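(* Let $A$ be a real $d\times d$ matrix all of whose eigenvalues have strictly negative real parts, let $B$ be a real $d\times m$ matrix such that $(A,B)$ is a controllable pair, and let $a\in\mathbb{R}^d$, $\gamma\in\mathbb{R}^m$. Let $\kappa>0$ and $\zeta_2>0$ with $\zeta_2<\kappa$, and put $\kappa_d=\sqrt{\kappa^2-\zeta_2^2}$. For $\varepsilon>0$ let $\lambda(\varepsilon)$ be the Lyapunov exponent of the system $$dv(t)=Av(t)\,dt+B\,dW(t),\qquad \ddot\varphi(t)+2\zeta_2\dot\varphi(t)+\bigl(\kappa^2-\varepsilon\langle a,v(t)\rangle\bigr)\varphi(t)=\sum_{\ell=1}^m\varepsilon\gamma_\ell\,\varphi(t)\,\dot W_\ell(t).$$ For $\omega>0$ define $$\lambda_2(\omega)=\frac{\pi}{\omega^2}\Bigl(\langle a,\widehat S_A(\omega)Ra\rangle+\langle a,\widehat S_A(\omega)B\gamma\rangle+\frac{\|\gamma\|^2}{2\pi}\Bigr).$$ (i) $\lambda(\varepsilon)=-\zeta_2+\varepsilon^2\lambda_2(2\kappa_d)+O(\varepsilon^4)$ as $\varepsilon\to0$. (ii) Given a real $d\times d$ matrix $A$ all of whose eigenvalues have strictly negative real parts, a real $d\times m$ matrix $B$ such that $(A,B)$ is a controllable pair, vectors $a\in\mathbb{R}^d$ and $\gamma\in\mathbb{R}^m$, and $0<c_1<c_2<\infty$, there exists a constant $K$ such that $$\bigl|\lambda(\varepsilon)+\zeta_2-\varepsilon^2\lambda_2(2\kappa_d)\bigr|\le K\varepsilon^4$$ whenever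 $0<\varepsilon\le1$ and $c_1\le\kappa_d\le c_2$.
   Context: $W=(W_1,\dots,W_m)$ is a standard $m$-dimensional Brownian motion. $(A,B)$ is a controllable pair if $\mathrm{rank}\{B,AB,\dots,A^{d-1}B\}=d$. $R=\int_0^\infty e^{tA}BB^*e^{tA^*}\,dt$ is the covariance matrix of the (mean-zero Gaussian) stationary probability measure of $v$. The matrix valued cosine transform of $A$ is $\widehat S_A(\omega)=\frac1\pi\int_0^\infty e^{tA}\cos\omega t\,dt$. The equation for $\varphi$ is understood as the It\^o system (identical to the Stratonovich one) $d\varphi=\dot\varphi\,dt$, $d\dot\varphi=\bigl[-2\zeta_2\dot\varphi-(\kappa^2-\varepsilon\langle a,v\rangle)\varphi\bigr]dt+\varepsilon\varphi\sum_{\ell}\gamma_\ell\,dW_\ell$. The Lyapunov exponent is the almost-sure limit $\lambda(\varepsilon)=\lim_{t\to\infty}\frac1t\log\|(\varphi(t),\dot\varphi(t))\|$, which exists and takes the same (nonrandom) value for all initial conditions $(v(0),\varphi(0),\dot\varphi(0))$ with $(\varphi(0),\dot\varphi(0))\ne(0,0)$. *)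

theory Defs
  imports "HOL-Probability.Probability" "HOL-Library.Landau_Symbols"
begin

section \<open>Linear algebra\<close>

text \<open>All complex eigenvalues of the real matrix \<open>A\<close> have negative real part.\<close>

definition stable_matrix :: "real^'d^'d \<Rightarrow> bool" where
  "stable_matrix A \<longleftrightarrow>
     (\<forall>(\<mu>::complex) (z::complex^'d).
        z \<noteq> 0 \<and> (\<chi> i j. complex_of_real (A $ i $ j)) *v z = \<mu> *s z \<longrightarrow> Re \<mu> < 0)"

text \<open>
  The dimension of the span of all columns of \<open>B, AB, \<dots>, A\<^sup>d\<^sup>-\<^sup>1B\<close> is the rank of the
  block matrix with these blocks. The library's \<open>(^)\<close> is not the matrix power, so powers are
  written as iterated left multiplication.
\<close>

definition controllable :: "real^'d^'d \<Rightarrow> real^'m^'d \<Rightarrow> bool" where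
  "controllable A B \<longleftrightarrow> dim (\<Union>k<CARD('d). columns (((**) A ^^ k) B)) = CARD('d)"

definition mat_exp :: "real^'d^'d \<Rightarrow> real^'d^'d" where
  "mat_exp A = (\<Sum>k. (1 / fact k) *\<^sub>R ((**) A ^^ k) (mat 1))"

definition stationary_cov :: "real^'d^'d \<Rightarrow> real^'m^'d \<Rightarrow> real^'d^'d" where
  "stationary_cov A B =
     integral {0..} (\<lambda>t. mat_exp (t *\<^sub>R A) ** B ** transpose B ** mat_exp (t *\<^sub>R transpose A))"

definition cos_transform :: "real^'d^'d \<Rightarrow> real \<Rightarrow> real^'d^'d" where
  "cos_transform A \<omega> = (1 / pi) *\<^sub>R integral {0..} (\<lambda>t. cos (\<omega> * t) *\<^sub>R mat_exp (t *\<^sub>R A))"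

definition lambda2 :: "real^'d^'d \<Rightarrow> real^'m^'d \<Rightarrow> real^'d \<Rightarrow> real^'m \<Rightarrow> real \<Rightarrow> real" where
  "lambda2 A B a \<gamma> \<omega> = pi / \<omega>\<^sup>2 *
     (a \<bullet> (cos_transform A \<omega> *v (stationary_cov A B *v a))
      + a \<bullet> (cos_transform A \<omega> *v (B *v \<gamma>))
      + (norm \<gamma>)\<^sup>2 / (2 * pi))"


section \<open>Brownian motion and Ito integrals\<close>

text \<open>
  Time is the half line \<open>t \<ge> 0\<close>; processes and filtrations are indexed by \<open>real\<close>, and their
  values at negative times play no role.
\<close>

definition brownian_motion ::
  "'w measure \<Rightarrow> (real \<Rightarrow> 'w measure) \<Rightarrow> (real \<Rightarrow> 'w \<Rightarrow> real^'m) \<Rightarrow> bool" where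
  "brownian_motion M F W \<longleftrightarrow>
     prob_space M \<and> filtration (space M) F \<and> (\<forall>t. sets (F t) \<subseteq> sets M) \<and>
     (\<forall>t\<ge>0. W t \<in> borel_measurable (F t)) \<and>
     (\<forall>\<omega>\<in>space M. W 0 \<omega> = 0 \<and> continuous_on {0..} (\<lambda>t. W t \<omega>)) \<and>
     (\<forall>s t. 0 \<le> s \<and> s < t \<longrightarrow>
        (\<forall>l. distributed M lborel (\<lambda>\<omega>. (W t \<omega> - W s \<omega>) $ l) (normal_density 0 (sqrt (t - s)))) \<and>
        prob_space.indep_vars M (\<lambda>_. borel) (\<lambda>l \<omega>. (W t \<omega> - W s \<omega>) $ l) UNIV \<and>
        prob_space.indep_set M (sets (F s))
          (sets (vimage_algebra (space M) (\<lambda>\<omega>. W t \<omega> - W s \<omega>) borel)))"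

definition progressive ::
  "(real \<Rightarrow> 'w measure) \<Rightarrow> (real \<Rightarrow> 'w \<Rightarrow> 'x::euclidean_space) \<Rightarrow> bool" where
  "progressive F H \<longleftrightarrow>
     (\<forall>t\<ge>0. (\<lambda>(s, \<omega>). H s \<omega>) \<in> borel_measurable (restrict_space borel {0..t} \<Otimes>\<^sub>M F t))"

text \<open>
  A simple integrand on \<open>[0,t]\<close> takes the value \<open>\<xi> i\<close>, which is bounded and known at time
  \<open>\<tau> i\<close>, on the interval \<open>(\<tau> i, \<tau> (i+1)]\<close>, for \<open>i < n\<close>.
\<close>

definition simple_integrand ::
  "(real \<Rightarrow> 'w measure) \<Rightarrow> real \<Rightarrow> nat \<Rightarrow> (nat \<Rightarrow> real) \<Rightarrow> (nat \<Rightarrow> 'w \<Rightarrow> 'x::euclidean_space) \<Rightarrow> bool"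
where
  "simple_integrand F t n \<tau> \<xi> \<longleftrightarrow>
     \<tau> 0 = 0 \<and> \<tau> n = t \<and>
     (\<forall>i<n. \<tau> i \<le> \<tau> (Suc i) \<and> \<xi> i \<in> borel_measurable (F (\<tau> i)) \<and>
            bounded (\<xi> i ` space (F (\<tau> i))))"

definition simple_value ::
  "nat \<Rightarrow> (nat \<Rightarrow> real) \<Rightarrow> (nat \<Rightarrow> 'w \<Rightarrow> 'x::euclidean_space) \<Rightarrow> real \<Rightarrow> 'w \<Rightarrow> 'x" where
  "simple_value n \<tau> \<xi> s \<omega> = (\<Sum>i<n. indicator {\<tau> i<..\<tau> (Suc i)} s *\<^sub>R \<xi> i \<omega>)"

definition simple_integral ::
  "(real \<Rightarrow> 'w \<Rightarrow> real) \<Rightarrow> nat \<Rightarrow> (nat \<Rightarrow> real) \<Rightarrow> (nat \<Rightarrow> 'w \<Rightarrow> 'x::euclidean_space) \<Rightarrow> 'w \<Rightarrow> 'x" where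
  "simple_integral w n \<tau> \<xi> \<omega> = (\<Sum>i<n. (w (\<tau> (Suc i)) \<omega> - w (\<tau> i) \<omega>) *\<^sub>R \<xi> i \<omega>)"

text \<open>
  \<open>I\<close> is (a version of) the Ito integral of \<open>H\<close> over \<open>[0,t]\<close> with respect to the real Brownian
  motion \<open>w\<close>: for simple integrands \<open>H\<^sub>k\<close> with \<open>\<integral>\<^sub>0\<^sup>t \<bar>H\<^sub>k - H\<bar>\<^sup>2 ds \<longlonglongrightarrow> 0\<close> in probability,
  the elementary integrals of \<open>H\<^sub>k\<close> converge to \<open>I\<close> in probability. By the Ito isometry the limit
  does not depend on the approximating sequence (up to null sets). Progressive measurability
  makes the events below measurable.
\<close>

definition has_ito_integral ::
  "'w measure \<Rightarrow> (real \<Rightarrow> 'w measure) \<Rightarrow> (real \<Rightarrow> 'w \<Rightarrow> real) \<Rightarrow> (real \<Rightarrow> 'w \<Rightarrow> 'x::euclidean_space) \<Rightarrow>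
   real \<Rightarrow> ('w \<Rightarrow> 'x) \<Rightarrow> bool" where
  "has_ito_integral M F w H t I \<longleftrightarrow>
     progressive F H \<and> I \<in> borel_measurable M \<and>
     (\<exists>n \<tau> \<xi>.
        (\<forall>k. simple_integrand F t (n k) (\<tau> k) (\<xi> k)) \<and>
        (\<forall>e>0. (\<lambda>k. measure M {\<omega>\<in>space M.
            (\<integral>\<^sup>+s\<in>{0..t}. ennreal ((norm (simple_value (n k) (\<tau> k) (\<xi> k) s \<omega> - H s \<omega>))\<^sup>2) \<partial>lborel)
              > ennreal e}) \<longlonglongrightarrow> 0) \<and>
        (\<forall>e>0. (\<lambda>k. measure M {\<omega>\<in>space M.
            norm (simple_integral w (n k) (\<tau> k) (\<xi> k) \<omega> - I \<omega>) > e}) \<longlonglongrightarrow> 0))"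

text \<open>
  Continuous adapted solutions of \<open>dX = b(X) dt + \<Sum>\<^sub>l \<sigma>\<^sub>l(X) dW\<^sub>l\<close> in the Ito sense. The initial
  value \<open>X 0\<close> may be any \<open>F 0\<close>-measurable random variable, in particular any constant.
\<close>

definition ito_solution ::
  "'w measure \<Rightarrow> (real \<Rightarrow> 'w measure) \<Rightarrow> (real \<Rightarrow> 'w \<Rightarrow> real^'m) \<Rightarrow>
   ('x::euclidean_space \<Rightarrow> 'x) \<Rightarrow> ('m \<Rightarrow> 'x \<Rightarrow> 'x) \<Rightarrow> (real \<Rightarrow> 'w \<Rightarrow> 'x) \<Rightarrow> bool" where
  "ito_solution M F W b \<sigma> X \<longleftrightarrow>
     (\<forall>t\<ge>0. X t \<in> borel_measurable (F t)) \<and>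
     (\<forall>\<omega>\<in>space M. continuous_on {0..} (\<lambda>t. X t \<omega>)) \<and>
     (\<forall>t\<ge>0. \<exists>I.
        (\<forall>l. has_ito_integral M F (\<lambda>s \<omega>. W s \<omega> $ l) (\<lambda>s \<omega>. \<sigma> l (X s \<omega>)) t (I l)) \<and>
        (AE \<omega> in M. X t \<omega> = X 0 \<omega> + integral {0..t} (\<lambda>s. b (X s \<omega>)) + (\<Sum>l\<in>UNIV. I l \<omega>)))"


section \<open>The randomly perturbed oscillator\<close>

text \<open>The state is \<open>(v, \<phi>, \<psi>)\<close> with \<open>\<psi> = \<phi>'\<close>.\<close>

definition osc_drift ::
  "real^'d^'d \<Rightarrow> real^'d \<Rightarrow> real \<Rightarrow> real \<Rightarrow> real \<Rightarrow> (real^'d) \<times> real \<times> real \<Rightarrow> (real^'d) \<times> real \<times> real"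
where
  "osc_drift A a \<kappa> \<zeta> \<epsilon> =
     (\<lambda>(v, \<phi>, \<psi>). (A *v v, \<psi>, - 2 * \<zeta> * \<psi> - (\<kappa>\<^sup>2 - \<epsilon> * (a \<bullet> v)) * \<phi>))"

definition osc_diffusion ::
  "real^'m^'d \<Rightarrow> real^'m \<Rightarrow> real \<Rightarrow> 'm \<Rightarrow> (real^'d) \<times> real \<times> real \<Rightarrow> (real^'d) \<times> real \<times> real"
where
  "osc_diffusion B \<gamma> \<epsilon> l = (\<lambda>(v, \<phi>, \<psi>). (column l B, 0, \<epsilon> * \<gamma> $ l * \<phi>))"

text \<open>
  \<open>L\<close> is the Lyapunov exponent of the system driven by \<open>W\<close>: the almost sure exponential growth
  rate of \<open>(\<phi>, \<phi>')\<close>, one constant for all solutions with \<open>(\<phi>(0), \<phi>'(0)) \<noteq> (0, 0)\<close>.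
\<close>

definition is_lyapunov_exponent ::
  "'w measure \<Rightarrow> (real \<Rightarrow> 'w measure) \<Rightarrow> (real \<Rightarrow> 'w \<Rightarrow> real^'m) \<Rightarrow>
   real^'d^'d \<Rightarrow> real^'m^'d \<Rightarrow> real^'d \<Rightarrow> real^'m \<Rightarrow> real \<Rightarrow> real \<Rightarrow> real \<Rightarrow> real \<Rightarrow> bool" where
  "is_lyapunov_exponent M F W A B a \<gamma> \<kappa> \<zeta> \<epsilon> L \<longleftrightarrow>
     (\<forall>X. ito_solution M F W (osc_drift A a \<kappa> \<zeta> \<epsilon>) (osc_diffusion B \<gamma> \<epsilon>) X \<and>
          (AE \<omega> in M. snd (X 0 \<omega>) \<noteq> (0, 0)) \<longrightarrow>
          (AE \<omega> in M. ((\<lambda>t. ln (norm (snd (X t \<omega>))) / t) \<longlongrightarrow> L) at_top))"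

end

theory Submission
  imports Defs "HOL-Computational_Algebra.Fundamental_Theorem_Algebra"
begin

text \<open>
  Started at \<open>v = 0\<close>, the equations can be solved path by path, since the noise can be absorbed into the
  momentum. Without damping, which only shifts the exponent by \<open>- \<zeta>\<^sub>2\<close>, let \<open>p + \<i> \<kappa> y\<close> be the complex phase at
  the frequency \<open>\<kappa> = \<kappa>\<^sub>d\<close> and \<open>w\<close> its complex conjugate divided by it, so that \<open>w\<close> has modulus one. The growth
  rate of the phase is the long-time average of an explicit function of \<open>v\<close> and \<open>w\<close>.

  In a generalized limit of time averages the drift of every process with bounded moments has mean
  zero. For \<open>w\<^sup>k\<close> times a product of linear functionals of \<open>v\<close> this is a linear equation between
  moments, in which \<open>A\<^sup>T\<close> acts on the functionals and \<open>w\<^sup>k\<close> contributes a rotation. It is solved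
  by integrating along the exponentially decaying flow of \<open>A\<^sup>T\<close>, with bounds uniform in the frequency. Hence
  moments with \<open>k \<ge> 1\<close> are of order \<open>\<epsilon>\<close>, those of an even number of functionals of order \<open>\<epsilon>\<^sup>2\<close>, and the
  moment of \<open>w\<close> with \<open>\<langle>a, v\<rangle>\<close> is known up to \<open>O(\<epsilon>\<^sup>3)\<close>: its leading term is a Fourier integral along
  the flow, which gives the cosine transform.
\<close>

section \<open>The matrix exponential\<close>

text \<open>Existence of the exponent is part of the hypothesis, and it is the same for all
  solutions; so its value can be read off from one explicit solution. Other time averages are not
  known to converge. A limit along one fixed filter assigns values to all of them linearly, as the
  moment equations require.

  The obstacle is that these equations do not close: with \<open>n\<close> functionals of
  \<open>v\<close> they contain, with a factor \<epsilon>, moments with \<open>n + 1\<close> and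
  \<open>n - 1\<close> functionals. Crude bounds from fourth moments of \<open>v\<close> cut off the
  hierarchy, and each solution of a transport equation gains a factor \<epsilon>. A second gain
  depends on neighbours with one or three functionals, because moments without \<open>w\<close>
  enter as well and vanish in these cases.

  Drifts are found from short steps. With the noise frozen, the phase moves differentiably during a
  step of length \<open>h\<close>; one jump at the end updates the momentum. Both are expanded up to
  errors of order \<open>h^(3/2)\<close>, which add up to order \<open>h^(1/2)\<close> per unit of
  time.\<close>

abbreviation mpow :: "real^'d^'d \<Rightarrow> nat \<Rightarrow> real^'d^'d" where
  "mpow A k \<equiv> ((**) A ^^ k) (mat 1)"

lemma mpow_commute: "mpow A k ** A = A ** mpow A k"
  by (induction k) (auto simp: matrix_mul_assoc[symmetric])

lemma mpow_scaleR: "mpow (t *\<^sub>R A) k = t ^ k *\<^sub>R mpow A k"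
  by (induction k) (auto simp: vec_eq_iff matrix_matrix_mult_def sum_distrib_left algebra_simps)

lemma mpow_transpose: "mpow (transpose A) k = transpose (mpow A k)"
proof (induction k)
  case (Suc k)
  then show ?case
    by (simp add: matrix_transpose_mul[symmetric] mpow_commute)
qed (simp add: transpose_mat)

definition entry_sum :: "real^'d^'d \<Rightarrow> real" where
  "entry_sum A = (\<Sum>i\<in>UNIV. \<Sum>j\<in>UNIV. \<bar>A $ i $ j\<bar>)"

text \<open>A row sum of absolute values is at most the sum over all entries, so each multiplication
  by \<open>A\<close> costs one factor \<open>entry_sum A\<close>. This dominates the exponential
  series entry by entry.\<close>

lemma mpow_entry_bound: "\<bar>mpow A k $ i $ j\<bar> \<le> entry_sum A ^ k"
proof (induction k arbitrary: i)
  case 0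
  then show ?case by (simp add: mat_def)
next
  case (Suc k)
  have "\<bar>mpow A (Suc k) $ i $ j\<bar> = \<bar>\<Sum>l\<in>UNIV. A $ i $ l * mpow A k $ l $ j\<bar>"
    by (simp add: matrix_matrix_mult_def)
  also have "\<dots> \<le> (\<Sum>l\<in>UNIV. \<bar>A $ i $ l\<bar> * entry_sum A ^ k)"
    by (rule order.trans[OF sum_abs]) (auto simp: abs_mult intro!: sum_mono mult_left_mono Suc)
  also have "\<dots> = (\<Sum>l\<in>UNIV. \<bar>A $ i $ l\<bar>) * entry_sum A ^ k"
    by (simp add: sum_distrib_right)
  also have "\<dots> \<le> entry_sum A * entry_sum A ^ k"
    unfolding entry_sum_def
    by (intro mult_right_mono member_le_sum zero_le_power sum_nonneg) (auto intro: sum_nonneg)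
  finally show ?case by simp
qed

lemma summable_mat_exp_entry:
  "summable (\<lambda>k. (mpow A k $ i $ j / fact k) * t ^ k)"
proof (rule summable_comparison_test)
  show "summable (\<lambda>k. (entry_sum A * \<bar>t\<bar>) ^ k /\<^sub>R fact k)"
    by (rule summable_exp_generic)
  show "\<exists>N. \<forall>n\<ge>N. norm (mpow A n $ i $ j / fact n * t ^ n) \<le> (entry_sum A * \<bar>t\<bar>) ^ n /\<^sub>R fact n"
    by (auto simp: abs_mult power_mult_distrib power_abs divide_simps intro!: exI[of _ 0]
        mult_right_mono mpow_entry_bound)
qed

text \<open>As a function of \<open>t\<close>, each entry is a scalar power series that converges
  everywhere. Differentiation, transposition and commutation of the exponential are all derived
  termwise from this form.\<close>

lemma mat_exp_entry: "mat_exp (t *\<^sub>R A) $ i $ j = (\<Sum>k. (mpow A k $ i $ j / fact k) * t ^ k)"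
proof -
  have "(\<lambda>k. (1 / fact k) *\<^sub>R mpow (t *\<^sub>R A) k) sums (\<chi> i j. \<Sum>k. (mpow A k $ i $ j / fact k) * t ^ k)"
    unfolding sums_def
  proof (intro vec_tendstoI)
    fix i j
    show "(\<lambda>n. (\<Sum>k<n. (1 / fact k) *\<^sub>R mpow (t *\<^sub>R A) k) $ i $ j) \<longlonglongrightarrow>
       (\<chi> i j. \<Sum>k. (mpow A k $ i $ j / fact k) * t ^ k) $ i $ j"
      using summable_LIMSEQ[OF summable_mat_exp_entry[of A i j t]]
      by (simp add: mpow_scaleR mult_ac)
  qed
  then show ?thesis
    unfolding mat_exp_def by (simp add: sums_iff)
qed

lemma mat_exp_0 [simp]: "mat_exp 0 = mat 1"
proof -
  have "mat_exp (0 *\<^sub>R A) $ i $ j = mat 1 $ i $ j" for A :: "real^'a^'a" and i j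
    unfolding mat_exp_entry powser_zero by simp
  then show ?thesis by (simp add: vec_eq_iff)
qed

lemma mat_exp_transpose: "mat_exp (t *\<^sub>R transpose A) = transpose (mat_exp (t *\<^sub>R A))"
  unfolding vec_eq_iff mat_exp_entry mpow_transpose by (simp add: transpose_def mat_exp_entry)

lemma mat_exp_entry_deriv:
  "((\<lambda>t. mat_exp (t *\<^sub>R A) $ i $ j) has_real_derivative (A ** mat_exp (t *\<^sub>R A)) $ i $ j) (at t)"
proof -
  let ?c = "\<lambda>i k. mpow A k $ i $ j / fact k"
  have "((\<lambda>t. \<Sum>k. ?c i k * t ^ k) has_real_derivative (\<Sum>k. diffs (?c i) k * t ^ k)) (at t)"
    by (rule termdiffs_strong_converges_everywhere) (rule summable_mat_exp_entry)
  also have "(\<Sum>k. diffs (?c i) k * t ^ k) = (\<Sum>k. \<Sum>l\<in>UNIV. A $ i $ l * (?c l k * t ^ k))"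
  proof (intro suminf_cong)
    fix k
    \<comment> \<open>\<open>diffs\<close> multiplies the coefficient with index
      \<open>k + 1\<close> by \<open>k + 1\<close>, which cancels against the factorial and leaves
      one extra factor \<open>A\<close>.\<close>
    have "diffs (?c i) k = mpow A (Suc k) $ i $ j / fact k"
      by (simp add: diffs_def field_simps del: funpow.simps of_nat_Suc)
    also have "\<dots> = (\<Sum>l\<in>UNIV. A $ i $ l * ?c l k)"
      by (simp add: matrix_matrix_mult_def sum_divide_distrib)
    finally show "diffs (?c i) k * t ^ k = (\<Sum>l\<in>UNIV. A $ i $ l * (?c l k * t ^ k))"
      by (simp only: sum_distrib_right mult.assoc)
  qed
  also have "\<dots> = (A ** mat_exp (t *\<^sub>R A)) $ i $ j"
    by (subst suminf_sum) (simp_all only: matrix_matrix_mult_def vec_lambda_beta mat_exp_entry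
        suminf_mult[OF summable_mat_exp_entry] summable_mult[OF summable_mat_exp_entry])
  finally show ?thesis by (simp add: mat_exp_entry)
qed

lemma mat_exp_commute: "mat_exp (t *\<^sub>R A) ** A = A ** mat_exp (t *\<^sub>R A)"
proof -
  have "(mat_exp (t *\<^sub>R A) ** A) $ i $ j = (A ** mat_exp (t *\<^sub>R A)) $ i $ j" for i j
  proof -
    have "(mat_exp (t *\<^sub>R A) ** A) $ i $ j = (\<Sum>l\<in>UNIV. \<Sum>k. mpow A k $ i $ l / fact k * t ^ k * A $ l $ j)"
      by (simp only: matrix_matrix_mult_def vec_lambda_beta mat_exp_entry
            suminf_mult2[OF summable_mat_exp_entry])
    also have "\<dots> = (\<Sum>k. \<Sum>l\<in>UNIV. mpow A k $ i $ l / fact k * t ^ k * A $ l $ j)"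
      by (subst suminf_sum) (simp_all only: summable_mult2[OF summable_mat_exp_entry])
    also have "\<dots> = (\<Sum>k. (mpow A k ** A) $ i $ j / fact k * t ^ k)"
      by (simp add: matrix_matrix_mult_def sum_divide_distrib sum_distrib_right sum_distrib_left mult_ac)
    also have "\<dots> = (\<Sum>k. (A ** mpow A k) $ i $ j / fact k * t ^ k)"
      by (simp add: mpow_commute)
    also have "\<dots> = (\<Sum>k. \<Sum>l\<in>UNIV. A $ i $ l * (mpow A k $ l $ j / fact k * t ^ k))"
      by (simp add: matrix_matrix_mult_def sum_divide_distrib sum_distrib_right sum_distrib_left mult_ac)
    also have "\<dots> = (A ** mat_exp (t *\<^sub>R A)) $ i $ j"
      by (subst suminf_sum) (simp_all only: matrix_matrix_mult_def vec_lambda_beta mat_exp_entry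
          suminf_mult[OF summable_mat_exp_entry] summable_mult[OF summable_mat_exp_entry])
    finally show ?thesis .
  qed
  then show ?thesis by (simp add: vec_eq_iff)
qed

lemma has_vector_derivative_vecI:
  fixes f :: "real \<Rightarrow> 'a::real_normed_vector ^ 'n"
  assumes "\<And>i. ((\<lambda>t. f t $ i) has_vector_derivative f' $ i) (at t within S)"
  shows "(f has_vector_derivative f') (at t within S)"
  using assms
  unfolding has_vector_derivative_def has_derivative_within
  by (auto intro!: vec_tendstoI bounded_linear_scaleR_left)

lemma mat_exp_deriv:
  "((\<lambda>t. mat_exp (t *\<^sub>R A)) has_vector_derivative (A ** mat_exp (t *\<^sub>R A))) (at t within S)"
  by (intro has_vector_derivative_vecI)
     (metis has_field_derivative_at_within has_real_derivative_iff_has_vector_derivative mat_exp_entry_deriv)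

lemma bounded_bilinear_matrix_vector_mult:
  "bounded_bilinear ((*v) :: real^'n^'m \<Rightarrow> real^'n \<Rightarrow> real^'m)"
  by (intro bilinear_conv_bounded_bilinear[THEN iffD1])
     (auto simp: bilinear_def intro!: linearI simp: matrix_vector_mult_add_rdistrib
       scaleR_matrix_vector_assoc algebra_simps)

lemma mat_exp_mv_deriv:
  "((\<lambda>t. mat_exp (t *\<^sub>R A) *v x) has_vector_derivative (A *v (mat_exp (t *\<^sub>R A) *v x))) (at t within S)"
  using bounded_linear.has_vector_derivative[OF
      bounded_bilinear.bounded_linear_left[OF bounded_bilinear_matrix_vector_mult] mat_exp_deriv]
  by (simp add: matrix_vector_mul_assoc)

lemma continuous_on_mat_exp: "continuous_on S (\<lambda>t. mat_exp (t *\<^sub>R A))"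
  by (rule continuous_on_vector_derivative[OF mat_exp_deriv])

section \<open>Exponential decay of stable linear flows\<close>

definition cmat :: "real^'n^'m \<Rightarrow> complex^'n^'m" where
  "cmat A = (\<chi> i j. complex_of_real (A $ i $ j))"

lemma cmat_mult: "cmat (A ** B) = cmat A ** cmat B"
  by (simp add: cmat_def matrix_matrix_mult_def vec_eq_iff)

lemma norm_vec_scale_complex: "norm (c *s (z::complex^'d)) = cmod c * norm z"
  unfolding norm_vec_def vector_smult_component norm_mult by (rule L2_set_right_distrib[symmetric]) simp

lemma bounded_linear_cmv: "bounded_linear ((*v) (M::complex^'d^'d))"
  by (simp add: linear_conv_bounded_linear[symmetric])

lemma cmv_deriv:
  "((\<lambda>t. cmat (mat_exp (t *\<^sub>R A)) *v z) has_vector_derivative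
      (cmat A *v (cmat (mat_exp (t *\<^sub>R A)) *v z))) (at t within S)"
proof (rule has_vector_derivative_vecI)
  fix i
  have "((\<lambda>t. \<Sum>j\<in>UNIV. complex_of_real (mat_exp (t *\<^sub>R A) $ i $ j) * z $ j) has_vector_derivative
     (\<Sum>j\<in>UNIV. complex_of_real ((A ** mat_exp (t *\<^sub>R A)) $ i $ j) * z $ j)) (at t within S)"
    by (intro has_vector_derivative_sum has_vector_derivative_mult_left has_vector_derivative_of_real)
       (rule has_field_derivative_at_within[OF mat_exp_entry_deriv])
  then show "((\<lambda>t. (cmat (mat_exp (t *\<^sub>R A)) *v z) $ i) has_vector_derivative
     (cmat A *v (cmat (mat_exp (t *\<^sub>R A)) *v z)) $ i) (at t within S)"
    unfolding matrix_vector_mul_assoc cmat_mult[symmetric]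
    by (simp only: matrix_vector_mult_def cmat_def vec_lambda_beta)
qed

text \<open>Eigenvectors are complex, hence the complexified flow. The rate may depend on the
  vector; this makes the set a complex subspace invariant under \<open>A\<close>, and stability will
  force it to be the whole space.\<close>

definition decay_space :: "real^'d^'d \<Rightarrow> (complex^'d) set" where
  "decay_space A = {z. \<exists>C \<delta>. \<delta> > 0 \<and> (\<forall>t\<ge>0. norm (cmat (mat_exp (t *\<^sub>R A)) *v z) \<le> C * exp (- \<delta> * t))}"

lemma decay_spaceI:
  assumes "\<delta> > 0" "\<And>t. t \<ge> 0 \<Longrightarrow> norm (cmat (mat_exp (t *\<^sub>R A)) *v z) \<le> C * exp (- \<delta> * t)"
  shows "z \<in> decay_space A"
  using assms unfolding decay_space_def by blast

lemma decay_space_add: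
  assumes "x \<in> decay_space A" "y \<in> decay_space A"
  shows "x + y \<in> decay_space A"
proof -
  obtain C d where d: "d > 0" "\<And>t. t \<ge> 0 \<Longrightarrow> norm (cmat (mat_exp (t *\<^sub>R A)) *v x) \<le> C * exp (- d * t)"
    using assms by (auto simp: decay_space_def)
  obtain C' d' where d': "d' > 0" "\<And>t. t \<ge> 0 \<Longrightarrow> norm (cmat (mat_exp (t *\<^sub>R A)) *v y) \<le> C' * exp (- d' * t)"
    using assms by (auto simp: decay_space_def)
  have C: "0 \<le> C" "0 \<le> C'"
    using order.trans[OF norm_ge_zero d(2)[of 0]] order.trans[OF norm_ge_zero d'(2)[of 0]] by auto
  have "norm (cmat (mat_exp (t *\<^sub>R A)) *v (x + y)) \<le> (C + C') * exp (- min d d' * t)" if "t \<ge> 0" for t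
  proof -
    have "norm (cmat (mat_exp (t *\<^sub>R A)) *v (x + y)) \<le> C * exp (- d * t) + C' * exp (- d' * t)"
      unfolding matrix_vector_right_distrib
      using d(2)[OF that] d'(2)[OF that] by (rule norm_triangle_mono)
    also have "\<dots> \<le> C * exp (- min d d' * t) + C' * exp (- min d d' * t)"
      using that C by (intro add_mono mult_left_mono) (auto intro!: mult_right_mono)
    finally show ?thesis by (simp add: algebra_simps)
  qed
  then show ?thesis by (rule decay_spaceI[rotated]) (use d(1) d'(1) in auto)
qed

lemma decay_space_scale:
  assumes "x \<in> decay_space A"
  shows "c *s x \<in> decay_space A"
proof -
  obtain C d where d: "d > 0" "\<And>t. t \<ge> 0 \<Longrightarrow> norm (cmat (mat_exp (t *\<^sub>R A)) *v x) \<le> C * exp (- d * t)"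
    using assms by (auto simp: decay_space_def)
  have "norm (cmat (mat_exp (t *\<^sub>R A)) *v (c *s x)) \<le> (cmod c * C) * exp (- d * t)" if "t \<ge> 0" for t
    unfolding vec.scale norm_vec_scale_complex mult.assoc using d(2)[OF that] by (intro mult_left_mono) auto
  then show ?thesis by (rule decay_spaceI[OF d(1)])
qed

lemma decay_space_mv:
  assumes "x \<in> decay_space A"
  shows "cmat A *v x \<in> decay_space A"
proof -
  obtain C d where d: "d > 0" "\<And>t. t \<ge> 0 \<Longrightarrow> norm (cmat (mat_exp (t *\<^sub>R A)) *v x) \<le> C * exp (- d * t)"
    using assms by (auto simp: decay_space_def)
  obtain K where K: "K > 0" "\<And>z. norm (cmat A *v z) \<le> norm z * K"
    using bounded_linear.pos_bounded[OF bounded_linear_cmv[of "cmat A"]] by auto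
  have "norm (cmat (mat_exp (t *\<^sub>R A)) *v (cmat A *v x)) \<le> (K * C) * exp (- d * t)" if "t \<ge> 0" for t
  proof -
    have "cmat (mat_exp (t *\<^sub>R A)) *v (cmat A *v x) = cmat A *v (cmat (mat_exp (t *\<^sub>R A)) *v x)"
      by (simp add: matrix_vector_mul_assoc cmat_mult[symmetric] mat_exp_commute)
    also have "norm \<dots> \<le> K * (C * exp (- d * t))"
      using order.trans[OF K(2) mult_right_mono[OF d(2)[OF that] less_imp_le[OF K(1)]]] by (simp add: mult.commute)
    finally show ?thesis by simp
  qed
  then show ?thesis unfolding decay_space_def using d(1) by blast
qed

lemma subspace_decay_space: "subspace (decay_space A)"
proof (rule subspaceI)
  show "0 \<in> decay_space A"
    by (auto simp: decay_space_def intro!: exI[of _ 0] exI[of _ 1])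
next
  fix x c assume "x \<in> decay_space A"
  then have "complex_of_real c *s x \<in> decay_space A" by (rule decay_space_scale)
  moreover have "complex_of_real c *s x = c *\<^sub>R x"
    by (simp add: vec_eq_iff scaleR_conv_of_real[where 'a=complex])
  ultimately show "c *\<^sub>R x \<in> decay_space A" by simp
qed (rule decay_space_add)

text \<open>Half of the rate is spent on the factor \<open>t\<close> that appears when a decaying
  inhomogeneity resonates with an eigenvalue.\<close>

lemma exp_linear_bound: "d > 0 \<Longrightarrow> t * exp (- (2 * d) * t) \<le> (1 / d) * exp (- d * (t::real))"
proof -
  assume d: "d > 0"
  have "d * t \<le> exp (d * t)" using exp_ge_add_one_self[of "d * t"] by linarith
  then have "t \<le> exp (d * t) / d" using d by (simp add: field_simps)
  then have "t * exp (- (2 * d) * t) \<le> exp (d * t) / d * exp (- (2 * d) * t)"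
    by (intro mult_right_mono) auto
  also have "\<dots> = (1 / d) * exp (- d * t)"
    by (simp add: mult_exp_exp)
  finally show ?thesis .
qed

text \<open>Variation of constants: if \<open>y = A x - l x\<close> decays, then
  \<open>exp (- t l)\<close> times the flow of \<open>x\<close> has as derivative
  \<open>exp (- t l)\<close> times the flow of \<open>y\<close>. The mean value inequality bounds
  its growth, and multiplying back by \<open>exp (t l)\<close> gives decay because
  \<open>Re l < 0\<close>.\<close>

lemma decay_space_eigen:
  assumes "cmat A *v x - l *s x \<in> decay_space A" "Re l < 0"
  shows "x \<in> decay_space A"
proof -
  let ?E = "\<lambda>t. cmat (mat_exp (t *\<^sub>R A))"
  define y where "y = cmat A *v x - l *s x"
  obtain C d0 where d0: "d0 > 0" "\<And>t. t \<ge> 0 \<Longrightarrow> norm (?E t *v y) \<le> C * exp (- d0 * t)"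
    using assms by (auto simp: decay_space_def y_def)
  \<comment> \<open>One half makes \<open>2 d\<close> at most \<open>d0\<close> and
    \<open>- Re l\<close>; the rate \<open>d\<close> survives after the factor \<open>t\<close> is
    absorbed.\<close>
  define d where "d = min d0 (- Re l) / 2"
  have d: "d > 0" "2 * d \<le> d0" "2 * d \<le> - Re l"
    using d0(1) assms(2) by (auto simp: d_def)
  have C: "0 \<le> C" using order.trans[OF norm_ge_zero d0(2)[of 0]] by simp
  let ?f = "\<lambda>t. exp (- (of_real t * l)) *s (?E t *v x)"
  have expd: "((\<lambda>t. exp (- (of_real t * l))) has_vector_derivative - l * exp (- (of_real t * l))) (at t within S)"
    for t S
    by (rule has_vector_derivative_eq_rhs, rule field_vector_diff_chain_at[where f="\<lambda>t. - (of_real t * l)" and g=exp, unfolded o_def, THEN has_vector_derivative_at_within])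
      (auto intro!: derivative_eq_intros)
  have Ay: "?E t *v y = cmat A *v (?E t *v x) - l *s (?E t *v x)" for t
    by (simp add: y_def matrix_vector_mult_diff_distrib vec.scale)
       (simp add: matrix_vector_mul_assoc cmat_mult[symmetric] mat_exp_commute)
  have f': "(?f has_vector_derivative (exp (- (of_real t * l)) *s (?E t *v y))) (at t within S)" for t S
  proof (rule has_vector_derivative_vecI)
    fix i
    have "((\<lambda>t. (?E t *v x) $ i) has_vector_derivative (cmat A *v (?E t *v x)) $ i) (at t within S)"
      using bounded_linear.has_vector_derivative[OF bounded_linear_vec_nth cmv_deriv] .
    from has_vector_derivative_mult[OF expd this]
    show "((\<lambda>t. ?f t $ i) has_vector_derivative (exp (- (of_real t * l)) *s (?E t *v y)) $ i) (at t within S)"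
      by (simp add: Ay algebra_simps)
  qed
  have nf': "norm (exp (- (of_real t * l)) *s (?E t *v y)) \<le> C * exp ((- Re l - d0) * t)" if "t \<ge> 0" for t
  proof -
    have "norm (exp (- (of_real t * l)) *s (?E t *v y)) = exp (- (t * Re l)) * norm (?E t *v y)"
      by (simp add: norm_vec_scale_complex)
    also have "\<dots> \<le> exp (- (t * Re l)) * (C * exp (- d0 * t))"
      by (intro mult_left_mono d0(2) that) auto
    also have "\<dots> = C * (exp (- (t * Re l)) * exp (- d0 * t))" by simp
    also have "exp (- (t * Re l)) * exp (- d0 * t) = exp ((- Re l - d0) * t)"
      unfolding exp_add[symmetric] by (rule arg_cong[where f=exp]) (simp add: algebra_simps)
    finally show ?thesis .
  qed
  \<comment> \<open>Positive part of the exponent in the derivative bound, which makes that bound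
    monotone in time. Then \<open>m + Re l\<close> is the larger of \<open>- d0\<close> and
    \<open>Re l\<close>, hence at most \<open>- 2 d\<close>.\<close>
  define m where "m = max (- Re l - d0) 0"
  have main: "norm (?E t *v x) \<le> (norm x + C / d) * exp (- d * t)" if t: "t \<ge> 0" for t
  proof -
    have "norm (?f t - ?f 0) \<le> C * exp (m * t) * norm (t - 0)"
    proof (rule differentiable_bound[where S="{0..t}" and f'="\<lambda>s h. h *\<^sub>R (exp (- (of_real s * l)) *s (?E s *v y))"])
      fix s assume s: "s \<in> {0..t}"
      show "(?f has_derivative (\<lambda>h. h *\<^sub>R (exp (- (of_real s * l)) *s (?E s *v y)))) (at s within {0..t})"
        using f' by (simp add: has_vector_derivative_def)
      have "norm (exp (- (of_real s * l)) *s (?E s *v y)) \<le> C * exp ((- Re l - d0) * s)"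
        using nf' s by auto
      also have "\<dots> \<le> C * exp (m * t)"
        using C s by (intro mult_left_mono) (auto simp: m_def intro!: mult_mono)
      finally show "onorm (\<lambda>h. h *\<^sub>R (exp (- (of_real s * l)) *s (?E s *v y))) \<le> C * exp (m * t)"
        by (intro onorm_le) (simp add: mult.commute mult_left_mono)
    qed (use t in auto)
    moreover have "?f 0 = x" by (simp add: cmat_def vec_eq_iff matrix_vector_mult_def mat_def if_distrib if_distribR cong: if_cong)
    ultimately have "norm (?f t) \<le> norm x + C * exp (m * t) * t"
      using norm_triangle_ineq2[of "?f t" x] t by simp
    then have "exp (- (t * Re l)) * norm (?E t *v x) \<le> norm x + C * exp (m * t) * t"
      by (simp add: norm_vec_scale_complex)
    then have "exp (t * Re l) * (exp (- (t * Re l)) * norm (?E t *v x)) \<le> exp (t * Re l) * (norm x + C * exp (m * t) * t)"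
      by (intro mult_left_mono) auto
    then have "norm (?E t *v x) \<le> exp (t * Re l) * norm x + C * (t * exp ((m + Re l) * t))"
      by (simp add: distrib_left distrib_right exp_add exp_minus mult_ac)
         (simp add: mult.assoc[symmetric])
    also have "\<dots> \<le> exp (- d * t) * norm x + C * (t * exp (- (2 * d) * t))"
    proof (intro add_mono mult_right_mono mult_left_mono)
      have "t * Re l \<le> t * (- d)" using d t by (intro mult_left_mono) auto
      then show "exp (t * Re l) \<le> exp (- d * t)" by (simp add: mult.commute)
      have "(m + Re l) * t \<le> - (2 * d) * t" using d t by (intro mult_right_mono) (auto simp: m_def)
      then show "exp ((m + Re l) * t) \<le> exp (- (2 * d) * t)" by simp
    qed (use C t in auto)
    also have "\<dots> \<le> exp (- d * t) * norm x + C * ((1 / d) * exp (- d * t))"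
      using exp_linear_bound[OF d(1)] C by (intro add_left_mono mult_left_mono) auto
    finally show ?thesis by (simp add: algebra_simps)
  qed
  then show ?thesis unfolding decay_space_def using d(1) by blast
qed

section \<open>Polynomials of a matrix applied to a vector, and decay on the whole space\<close>

definition poly_act :: "complex^'d^'d \<Rightarrow> complex poly \<Rightarrow> complex^'d \<Rightarrow> complex^'d" where
  "poly_act M p y = (\<Sum>i\<le>degree p. coeff p i *s (((*v) M) ^^ i) y)"

lemma poly_act_bound: "degree p \<le> n \<Longrightarrow> poly_act M p y = (\<Sum>i\<le>n. coeff p i *s (((*v) M) ^^ i) y)"
  unfolding poly_act_def by (rule sum.mono_neutral_left) (auto simp: coeff_eq_0)

lemma poly_act_linear_factor:
  "poly_act M ([:- l, 1:] * q) y = M *v poly_act M q y - l *s poly_act M q y"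
proof -
  define n where "n = Suc (degree q)"
  have dp: "degree ([:- l, 1:] * q) \<le> n"
    using degree_mult_le[of "[:- l, 1:]" q] by (simp add: n_def)
  have c: "coeff ([:- l, 1:] * q) i = (case i of 0 \<Rightarrow> 0 | Suc j \<Rightarrow> coeff q j) - l * coeff q i" for i
    by (simp add: coeff_pCons)
  have "poly_act M ([:- l, 1:] * q) y = (\<Sum>i\<le>n. (case i of 0 \<Rightarrow> 0 | Suc j \<Rightarrow> coeff q j) *s (((*v) M) ^^ i) y)
       - (\<Sum>i\<le>n. (l * coeff q i) *s (((*v) M) ^^ i) y)"
    unfolding poly_act_bound[OF dp] c by (simp add: vec.scale_left_diff_distrib sum_subtractf)
  also have "(\<Sum>i\<le>n. (l * coeff q i) *s (((*v) M) ^^ i) y) = l *s poly_act M q y"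
    by (subst poly_act_bound[of q n]) (auto simp: n_def vec.scale_sum_right)
  also have "(\<Sum>i\<le>n. (case i of 0 \<Rightarrow> 0 | Suc j \<Rightarrow> coeff q j) *s (((*v) M) ^^ i) y)
     = (\<Sum>i\<le>degree q. coeff q i *s (M *v (((*v) M) ^^ i) y))"
    unfolding n_def by (subst sum.atMost_Suc_shift) simp
  also have "\<dots> = M *v poly_act M q y"
    by (simp add: poly_act_def vec.sum vec.scale)
  finally show ?thesis .
qed

text \<open>In real dimension \<open>n\<close> the vectors \<open>M^i y\<close> with
  \<open>i \<le> n\<close> either repeat, which gives a difference of two monomials, or are
  \<open>n + 1\<close> distinct vectors, which are dependent over the reals.\<close>

lemma exists_annihilator: "\<exists>p. p \<noteq> 0 \<and> poly_act M p y = 0"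
proof -
  define n where "n = DIM(complex^'a)"
  let ?g = "\<lambda>i. (((*v) M) ^^ i) y"
  show ?thesis
  proof (cases "inj_on ?g {..n}")
    case False
    then obtain i j where ij: "i \<noteq> j" "?g i = ?g j" by (auto simp: inj_on_def)
    define p where "p = monom (1::complex) i - monom 1 j"
    have "coeff p i = 1" using ij by (simp add: p_def)
    then have "p \<noteq> 0" by auto
    have "degree p \<le> max i j" unfolding p_def
      by (rule degree_diff_le) (auto intro: order.trans[OF degree_monom_le])
    then have "poly_act M p y = (\<Sum>k\<le>max i j. (if k = i then ?g i else 0) - (if k = j then ?g j else 0))"
      by (subst poly_act_bound, assumption, intro sum.cong) (auto simp: p_def)
    also have "\<dots> = 0" using ij by (simp add: sum_subtractf)
    finally show ?thesis using \<open>p \<noteq> 0\<close> by blast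
  next
    case True
    have "dependent (?g ` {..n})"
    proof (rule ccontr)
      assume "independent (?g ` {..n})"
      then have "card (?g ` {..n}) \<le> n" unfolding n_def using independent_bound by blast
      with True show False by (simp add: card_image)
    qed
    then obtain u v where u: "(\<Sum>x\<in>?g ` {..n}. u x *\<^sub>R x) = 0" "v \<in> ?g ` {..n}" "u v \<noteq> 0"
      using dependent_finite[of "?g ` {..n}"] by auto
    obtain k where k: "k \<le> n" "v = ?g k" using u by auto
    have s: "(\<Sum>i\<le>n. u (?g i) *\<^sub>R ?g i) = 0" using u(1) True by (simp add: sum.reindex)
    define p where "p = (\<Sum>i\<le>n. monom (complex_of_real (u (?g i))) i)"
    have c: "coeff p i = (if i \<le> n then complex_of_real (u (?g i)) else 0)" for i
      by (simp add: p_def coeff_sum)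
    have "degree p \<le> n" by (rule degree_le) (simp add: c)
    then have "poly_act M p y = (\<Sum>i\<le>n. u (?g i) *\<^sub>R ?g i)"
      by (subst poly_act_bound, assumption, intro sum.cong) (auto simp: c vec_eq_iff scaleR_conv_of_real[where 'a=complex])
    with s have "poly_act M p y = 0" by simp
    moreover have "p \<noteq> 0" using c[of k] k u(3) by auto
    ultimately show ?thesis by blast
  qed
qed

text \<open>Given \<open>y\<close> outside, take \<open>p\<close> nonzero of minimal degree such
  that \<open>p(A) y\<close> decays, and split off a root, \<open>p = (X - l) q\<close>. By
  minimality \<open>x = q(A) y\<close> does not decay, while \<open>(A - l) x\<close> does. If
  \<open>l\<close> is an eigenvalue, then \<open>Re l < 0\<close> and variation of constants gives a
  contradiction. Otherwise \<open>A - l\<close> is injective and maps the finite-dimensional decay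
  space onto itself, so \<open>x\<close> would lie in it.\<close>

lemma decay_space_UNIV:
  assumes "stable_matrix A"
  shows "decay_space A = UNIV"
proof (rule ccontr)
  assume "decay_space A \<noteq> UNIV"
  then obtain y where y: "y \<notin> decay_space A" by auto
  define P where "P = (\<lambda>p. p \<noteq> 0 \<and> poly_act (cmat A) p y \<in> decay_space A)"
  obtain p0 where "p0 \<noteq> 0" "poly_act (cmat A) p0 y = 0" using exists_annihilator by blast
  then have "P p0" using subspace_0[OF subspace_decay_space] by (simp add: P_def)
  define p where "p = arg_min degree P"
  have Pp: "P p" and min: "\<And>q. P q \<Longrightarrow> degree p \<le> degree q"
    unfolding p_def using arg_min_nat_lemma[of P p0 degree] \<open>P p0\<close> by auto
  have "degree p \<noteq> 0"
  proof
    assume "degree p = 0"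
    then obtain c where c: "p = [:c:]" by (rule degree_eq_zeroE)
    with Pp have "c \<noteq> 0" and cy: "c *s y \<in> decay_space A" by (auto simp: P_def poly_act_def)
    have "(1 / c) *s (c *s y) \<in> decay_space A" by (rule decay_space_scale[OF cy])
    moreover have "(1 / c) *s (c *s y) = y" using \<open>c \<noteq> 0\<close> by (simp add: vec_eq_iff)
    ultimately show False using y by simp
  qed
  then have "\<not> constant (poly p)" by (simp add: constant_degree)
  then obtain l where "poly p l = 0" using fundamental_theorem_of_algebra by blast
  then obtain q where q: "p = [:- l, 1:] * q" by (auto simp: poly_eq_0_iff_dvd)
  with Pp have "q \<noteq> 0" by (auto simp: P_def)
  then have dq: "degree p = Suc (degree q)" unfolding q by (subst degree_mult_eq) auto
  define x where "x = poly_act (cmat A) q y"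
  have x: "x \<notin> decay_space A" using min[of q] dq \<open>q \<noteq> 0\<close> by (auto simp: P_def x_def)
  have Ax: "cmat A *v x - l *s x \<in> decay_space A"
    using Pp unfolding P_def q poly_act_linear_factor x_def by simp
  let ?L = "\<lambda>z. cmat A *v z - l *s z"
  have linL: "linear ?L"
    by (rule linearI) (auto simp: vec.scale vec_eq_iff algebra_simps matrix_vector_mult_def
        sum.distrib sum_distrib_left scaleR_conv_of_real[where 'a=complex])
  show False
  proof (cases "\<exists>z. z \<noteq> 0 \<and> ?L z = 0")
    case True
    then have "Re l < 0" using assms unfolding stable_matrix_def cmat_def by auto
    then show False using decay_space_eigen[OF Ax] x by blast
  next
    case False
    then have inj: "inj ?L" using linear_injective_0[OF linL] by blast
    have sub: "?L ` decay_space A \<subseteq> decay_space A"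
    proof safe
      fix z assume z: "z \<in> decay_space A"
      show "?L z \<in> decay_space A"
        using subspace_diff[OF subspace_decay_space decay_space_mv[OF z] decay_space_scale[OF z]] .
    qed
    have "?L ` decay_space A = decay_space A"
    proof (rule subspace_dim_equal[OF linear_subspace_image[OF linL subspace_decay_space] subspace_decay_space sub])
      show "dim (decay_space A) \<le> dim (?L ` decay_space A)"
        using dim_image_eq[OF linL inj_on_subset[OF inj]] by simp
    qed
    then obtain s where "s \<in> decay_space A" "?L x = ?L s" using Ax by blast
    with inj x show False by (auto dest: injD)
  qed
qed

text \<open>There are finitely many coordinate vectors, so the smallest of their rates and the sum
  of their constants serve all entries at once.\<close>

lemma stable_mat_exp_decay:
  fixes A :: "real^'d^'d"
  assumes "stable_matrix A"
  obtains C \<delta> where "C > 0" "\<delta> > 0" "\<And>t i j. t \<ge> 0 \<Longrightarrow> \<bar>mat_exp (t *\<^sub>R A) $ i $ j\<bar> \<le> C * exp (- \<delta> * t)"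
proof -
  have "\<exists>C \<delta>. \<delta> > 0 \<and> (\<forall>t\<ge>0. norm (cmat (mat_exp (t *\<^sub>R A)) *v axis j 1) \<le> C * exp (- \<delta> * t))" for j
    using decay_space_UNIV[OF assms] unfolding decay_space_def by blast
  then obtain C \<delta> where *: "\<And>j. \<delta> j > 0"
    "\<And>j t. t \<ge> 0 \<Longrightarrow> norm (cmat (mat_exp (t *\<^sub>R A)) *v axis j 1) \<le> C j * exp (- \<delta> j * t)"
    by metis
  define D where "D = Min (range \<delta>)"
  have D: "D > 0" "\<And>j. D \<le> \<delta> j" using *(1) by (auto simp: D_def)
  define K where "K = 1 + (\<Sum>j\<in>UNIV. \<bar>C j\<bar>)"
  have "K > 0" unfolding K_def by (intro add_pos_nonneg sum_nonneg) auto
  have "\<bar>mat_exp (t *\<^sub>R A) $ i $ j\<bar> \<le> K * exp (- D * t)" if t: "t \<ge> 0" for t i j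
  proof -
    have "\<bar>mat_exp (t *\<^sub>R A) $ i $ j\<bar> = norm ((cmat (mat_exp (t *\<^sub>R A)) *v axis j 1) $ i)"
      by (simp add: cmat_def matrix_vector_mult_def axis_def if_distrib cong: if_cong)
    also have "\<dots> \<le> C j * exp (- \<delta> j * t)"
      using order.trans[OF Finite_Cartesian_Product.norm_nth_le *(2)[OF t]] .
    also have "\<dots> \<le> \<bar>C j\<bar> * exp (- D * t)"
      using D t by (intro mult_mono) (auto intro!: mult_right_mono)
    also have "\<dots> \<le> K * exp (- D * t)"
      unfolding K_def by (intro mult_right_mono) (auto intro!: add_increasing member_le_sum[of j])
    finally show ?thesis .
  qed
  with \<open>K > 0\<close> D(1) show ?thesis using that by blast
qed

section \<open>Uniformly bounded moments\<close>

text \<open>Rounding the time down to a multiple of \<open>1 / (n + 1)\<close> leaves countably many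
  times, where measurability at fixed times applies; continuity of the paths gives the
  limit.\<close>

lemma borel_measurable_continuous_process:
  fixes Y :: "real \<Rightarrow> 'w \<Rightarrow> 'x::{metric_space}"
  assumes Y: "\<And>s. Y s \<in> borel_measurable N"
    and cont: "\<And>z. z \<in> space N \<Longrightarrow> continuous_on UNIV (\<lambda>s. Y s z)"
  shows "(\<lambda>(s, z). Y s z) \<in> borel_measurable (borel \<Otimes>\<^sub>M N)"
proof (rule borel_measurable_LIMSEQ_metric)
  let ?r = "\<lambda>n (s::real). real_of_int \<lfloor>real (Suc n) * s\<rfloor> / real (Suc n)"
  show "(\<lambda>x. Y (?r n (fst x)) (snd x)) \<in> borel_measurable (borel \<Otimes>\<^sub>M N)" for n
  proof (rule measurable_compose_countable[where f="\<lambda>(i::int) x. Y (real_of_int i / real (Suc n)) (snd x)"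
        and g="\<lambda>x. \<lfloor>real (Suc n) * fst x\<rfloor>"])
    show "(\<lambda>x. Y (real_of_int i / real (Suc n)) (snd x)) \<in> borel_measurable (borel \<Otimes>\<^sub>M N)" for i
      using Y by measurable
    show "(\<lambda>x. \<lfloor>real (Suc n) * fst x\<rfloor>) \<in> borel \<Otimes>\<^sub>M N \<rightarrow>\<^sub>M count_space UNIV"
      by measurable
  qed
  fix x :: "real \<times> 'w" assume "x \<in> space (borel \<Otimes>\<^sub>M N)"
  then have z: "snd x \<in> space N" by (auto simp: space_pair_measure)
  have "(\<lambda>n. ?r n s) \<longlonglongrightarrow> s" for s
  proof (rule LIMSEQ_I)
    fix e :: real assume "e > 0"
    then obtain k where k: "1 / e < real k" using reals_Archimedean2 by blast
    have "norm (?r n s - s) < e" if "n \<ge> k" for n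
    proof -
      have "1 / e < real (Suc n)" using k that by simp
      then have e: "1 < e * real (Suc n)" using \<open>e > 0\<close> by (simp add: field_simps)
      have "\<bar>real_of_int \<lfloor>real (Suc n) * s\<rfloor> - real (Suc n) * s\<bar> \<le> 1" by linarith
      also have "real_of_int \<lfloor>real (Suc n) * s\<rfloor> - real (Suc n) * s = real (Suc n) * (?r n s - s)"
        by (simp add: right_diff_distrib del: of_nat_Suc)
      finally have "real (Suc n) * \<bar>?r n s - s\<bar> \<le> 1" by (simp only: abs_mult abs_of_nat)
      with e have "real (Suc n) * \<bar>?r n s - s\<bar> < real (Suc n) * e" by (simp only: mult.commute[of _ e])
      then show ?thesis unfolding real_norm_def by (rule mult_left_less_imp_less) simp
    qed
    then show "\<exists>k. \<forall>n\<ge>k. norm (?r n s - s) < e" by blast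
  qed
  moreover have "isCont (\<lambda>s. Y s (snd x)) (fst x)"
    using cont[OF z] by (simp add: continuous_on_eq_continuous_at)
  ultimately show "(\<lambda>n. Y (?r n (fst x)) (snd x)) \<longlonglongrightarrow> (case x of (s, z) \<Rightarrow> Y s z)"
    by (auto simp: split_beta intro: isCont_tendsto_compose[where g="\<lambda>s. Y s (snd x)"])
qed

text \<open>Jensen's inequality for the exponents \<open>2^j\<close>, by repeated squaring and
  Cauchy-Schwarz. Each squaring brings in the mass of the measure once more, which is consistent
  with \<open>2 (2^j - 1) + 1 = 2^(j+1) - 1\<close>.\<close>

lemma nn_integral_power_bound:
  fixes f :: "'a \<Rightarrow> ennreal"
  assumes [measurable]: "f \<in> borel_measurable N" and m: "emeasure N (space N) \<le> m"
  shows "(\<integral>\<^sup>+s. f s \<partial>N) ^ (2 ^ j) \<le> m ^ (2 ^ j - 1) * (\<integral>\<^sup>+s. f s ^ (2 ^ j) \<partial>N)"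
proof (induction j)
  case (Suc j)
  let ?p = "2 ^ j :: nat"
  have cs: "(\<integral>\<^sup>+s. f s ^ ?p \<partial>N)\<^sup>2 \<le> m * (\<integral>\<^sup>+s. (f s ^ ?p)\<^sup>2 \<partial>N)"
  proof -
    have "(\<integral>\<^sup>+s. f s ^ ?p * 1 \<partial>N)\<^sup>2 \<le> (\<integral>\<^sup>+s. (f s ^ ?p)\<^sup>2 \<partial>N) * (\<integral>\<^sup>+s. 1\<^sup>2 \<partial>N)"
      by (rule Cauchy_Schwarz_nn_integral) auto
    also have "\<dots> \<le> (\<integral>\<^sup>+s. (f s ^ ?p)\<^sup>2 \<partial>N) * m"
      using m by (intro mult_left_mono) auto
    finally show ?thesis by (simp add: mult.commute)
  qed
  have e: "2 ^ Suc j - 1 = 2 * (2 ^ j - 1) + (1::nat)"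
  proof -
    have "2 * y - 1 = 2 * (y - 1) + 1" if "1 \<le> y" for y :: nat using that by arith
    from this[OF one_le_power[of "2::nat" j]] show ?thesis by simp
  qed
  have "(\<integral>\<^sup>+s. f s \<partial>N) ^ (2 ^ Suc j) = ((\<integral>\<^sup>+s. f s \<partial>N) ^ ?p)\<^sup>2"
    by (simp add: power_mult[symmetric] mult.commute)
  also have "\<dots> \<le> (m ^ (?p - 1) * (\<integral>\<^sup>+s. f s ^ ?p \<partial>N))\<^sup>2"
    by (intro power_mono Suc) auto
  also have "\<dots> = (m ^ (?p - 1))\<^sup>2 * (\<integral>\<^sup>+s. f s ^ ?p \<partial>N)\<^sup>2" by (simp add: power_mult_distrib)
  also have "\<dots> \<le> (m ^ (?p - 1))\<^sup>2 * (m * (\<integral>\<^sup>+s. (f s ^ ?p)\<^sup>2 \<partial>N))"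
    by (intro mult_left_mono cs) auto
  also have "\<dots> = m ^ (2 ^ Suc j - 1) * (\<integral>\<^sup>+s. f s ^ (2 ^ Suc j) \<partial>N)"
    unfolding e power_add by (simp add: power_mult[symmetric] mult.commute mult.assoc mult.left_commute)
  finally show ?case .
qed simp

text \<open>Fubini after Jensen: the moments of a time integral are bounded by those at fixed times,
  which is how time averages inherit uniform moment bounds.\<close>

lemma nn_integral_average_moment:
  fixes f :: "real \<Rightarrow> 'w \<Rightarrow> ennreal"
  assumes "sigma_finite_measure M" "sigma_finite_measure N"
    and [measurable]: "(\<lambda>(s, z). f s z) \<in> borel_measurable (N \<Otimes>\<^sub>M M)"
    and m: "emeasure N (space N) \<le> m"
    and C: "\<And>s. s \<in> space N \<Longrightarrow> (\<integral>\<^sup>+z. f s z ^ (2 ^ j) \<partial>M) \<le> C"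
  shows "(\<integral>\<^sup>+z. (\<integral>\<^sup>+s. f s z \<partial>N) ^ (2 ^ j) \<partial>M) \<le> m ^ (2 ^ j) * C"
proof -
  interpret N: sigma_finite_measure N by fact
  interpret pair_sigma_finite N M using assms by (simp add: pair_sigma_finite_def)
  have "(\<integral>\<^sup>+z. (\<integral>\<^sup>+s. f s z \<partial>N) ^ (2 ^ j) \<partial>M) \<le> (\<integral>\<^sup>+z. m ^ (2 ^ j - 1) * (\<integral>\<^sup>+s. f s z ^ (2 ^ j) \<partial>N) \<partial>M)"
    by (intro nn_integral_mono nn_integral_power_bound m) measurable
  also have "\<dots> = m ^ (2 ^ j - 1) * (\<integral>\<^sup>+z. \<integral>\<^sup>+s. f s z ^ (2 ^ j) \<partial>N \<partial>M)"
    by (rule nn_integral_cmult) measurable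
  also have "(\<integral>\<^sup>+z. \<integral>\<^sup>+s. f s z ^ (2 ^ j) \<partial>N \<partial>M) = (\<integral>\<^sup>+s. \<integral>\<^sup>+z. f s z ^ (2 ^ j) \<partial>M \<partial>N)"
    by (rule Fubini'[of "\<lambda>s z. f s z ^ (2 ^ j)"]) measurable
  also have "m ^ (2 ^ j - 1) * (\<integral>\<^sup>+s. \<integral>\<^sup>+z. f s z ^ (2 ^ j) \<partial>M \<partial>N) \<le> m ^ (2 ^ j - 1) * (\<integral>\<^sup>+s. C \<partial>N)"
    by (intro mult_left_mono nn_integral_mono C) auto
  also have "\<dots> \<le> m ^ (2 ^ j - 1) * (C * m)"
    using m by (intro mult_left_mono) (auto intro!: mult_left_mono)
  also have "\<dots> = m ^ (2 ^ j) * C"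
    using power_minus_mult[of "2 ^ j" m] by (simp add: mult_ac)
  finally show ?thesis .
qed

text \<open>All moments are bounded uniformly in the index. It suffices to control the powers that are
  powers of two, which iterating Cauchy-Schwarz produces.\<close>

definition mbdd :: "'w measure \<Rightarrow> 'i set \<Rightarrow> ('i \<Rightarrow> 'w \<Rightarrow> 'x::{second_countable_topology, real_normed_vector}) \<Rightarrow> bool"
  where "mbdd M I Z \<longleftrightarrow> (\<forall>i\<in>I. Z i \<in> borel_measurable M) \<and>
    (\<forall>j. \<exists>C. \<forall>i\<in>I. (\<integral>\<^sup>+z. ennreal (norm (Z i z)) ^ (2 ^ Suc j) \<partial>M) \<le> ennreal C)"

lemma mbdd_measurable: "mbdd M I Z \<Longrightarrow> i \<in> I \<Longrightarrow> Z i \<in> borel_measurable M"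
  by (simp add: mbdd_def)

lemma mbddD:
  assumes "mbdd M I Z"
  obtains C where "C \<ge> 0" "\<And>i. i \<in> I \<Longrightarrow> (\<integral>\<^sup>+z. ennreal (norm (Z i z)) ^ (2 ^ Suc j) \<partial>M) \<le> ennreal C"
proof -
  obtain C where C: "\<And>i. i \<in> I \<Longrightarrow> (\<integral>\<^sup>+z. ennreal (norm (Z i z)) ^ (2 ^ Suc j) \<partial>M) \<le> ennreal C"
    using assms unfolding mbdd_def by blast
  show ?thesis
    by (rule that[of "max 0 C"]) (use C in \<open>auto intro: order.trans[OF C] ennreal_leI\<close>)
qed

lemma mbdd_reindex: "mbdd M I Z \<Longrightarrow> (\<And>j. j \<in> J \<Longrightarrow> f j \<in> I) \<Longrightarrow> mbdd M J (\<lambda>j. Z (f j))"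
  unfolding mbdd_def by blast

lemma mbdd_dominated:
  fixes Z :: "'i \<Rightarrow> 'w \<Rightarrow> 'x::{second_countable_topology, real_normed_vector}"
  assumes Y: "mbdd M I Y" and Z: "\<And>i. i \<in> I \<Longrightarrow> Z i \<in> borel_measurable M"
    and le: "\<And>i z. i \<in> I \<Longrightarrow> z \<in> space M \<Longrightarrow> norm (Z i z) \<le> norm (Y i z)"
  shows "mbdd M I Z"
  unfolding mbdd_def
proof (intro conjI ballI allI Z)
  fix j
  obtain C where C: "C \<ge> 0" "\<And>i. i \<in> I \<Longrightarrow> (\<integral>\<^sup>+z. ennreal (norm (Y i z)) ^ (2 ^ Suc j) \<partial>M) \<le> ennreal C"
    using mbddD[OF Y] by metis
  have "(\<integral>\<^sup>+z. ennreal (norm (Z i z)) ^ (2 ^ Suc j) \<partial>M) \<le> ennreal C" if "i \<in> I" for i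
    by (rule order.trans[OF _ C(2)[OF that]], intro nn_integral_mono power_mono ennreal_leI le that) auto
  then show "\<exists>C. \<forall>i\<in>I. (\<integral>\<^sup>+z. ennreal (norm (Z i z)) ^ (2 ^ Suc j) \<partial>M) \<le> ennreal C" by blast
qed

lemma mbdd_norm: "mbdd M I Z \<Longrightarrow> mbdd M I (\<lambda>i z. norm (Z i z))"
  by (rule mbdd_dominated, assumption) (auto intro: borel_measurable_norm dest: mbdd_measurable)

lemma mbdd_cong:
  assumes "mbdd M I Y" "\<And>i z. i \<in> I \<Longrightarrow> z \<in> space M \<Longrightarrow> Z i z = Y i z"
  shows "mbdd M I Z"
proof (rule mbdd_dominated[OF assms(1)])
  fix i assume "i \<in> I"
  then show "Z i \<in> borel_measurable M"
    using measurable_cong[of M "Z i" "Y i" borel] assms(2) mbdd_measurable[OF assms(1)] by auto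
qed (use assms(2) in auto)

lemma mbdd_const:
  assumes "prob_space M"
  shows "mbdd M I (\<lambda>i z. c)"
proof -
  interpret prob_space M by fact
  show ?thesis unfolding mbdd_def
    by (auto simp: emeasure_space_1 ennreal_power simp del: power_Suc)
qed

lemma mbdd_add:
  fixes X Y :: "'i \<Rightarrow> 'w \<Rightarrow> 'x::{second_countable_topology, real_normed_vector}"
  assumes X: "mbdd M I X" and Y: "mbdd M I Y"
  shows "mbdd M I (\<lambda>i z. X i z + Y i z)"
  unfolding mbdd_def
proof (intro conjI ballI allI)
  fix i assume "i \<in> I" then show "(\<lambda>z. X i z + Y i z) \<in> borel_measurable M"
    by (intro borel_measurable_add mbdd_measurable[OF X] mbdd_measurable[OF Y])
next
  fix j
  let ?p = "2 ^ Suc j :: nat"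
  obtain C where C: "C \<ge> 0" "\<And>i. i \<in> I \<Longrightarrow> (\<integral>\<^sup>+z. ennreal (norm (X i z)) ^ ?p \<partial>M) \<le> ennreal C"
    using mbddD[OF X] by metis
  obtain D where D: "D \<ge> 0" "\<And>i. i \<in> I \<Longrightarrow> (\<integral>\<^sup>+z. ennreal (norm (Y i z)) ^ ?p \<partial>M) \<le> ennreal D"
    using mbddD[OF Y] by metis
  have ineq: "norm (x + y) ^ ?p \<le> 2 ^ ?p * (norm x ^ ?p + norm y ^ ?p)" for x y :: 'x
  proof -
    have "norm (x + y) \<le> 2 * max (norm x) (norm y)" using norm_triangle_ineq[of x y] by linarith
    then have "norm (x + y) ^ ?p \<le> (2 * max (norm x) (norm y)) ^ ?p" by (intro power_mono) auto
    also have "\<dots> \<le> 2 ^ ?p * (norm x ^ ?p + norm y ^ ?p)"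
      unfolding power_mult_distrib by (intro mult_left_mono) (auto simp: max_def)
    finally show ?thesis .
  qed
  have "(\<integral>\<^sup>+z. ennreal (norm (X i z + Y i z)) ^ ?p \<partial>M) \<le> ennreal (2 ^ ?p * (C + D))" if i: "i \<in> I" for i
  proof -
    have [measurable]: "X i \<in> borel_measurable M" "Y i \<in> borel_measurable M"
      using X Y i by (auto intro: mbdd_measurable)
    have "(\<integral>\<^sup>+z. ennreal (norm (X i z + Y i z)) ^ ?p \<partial>M) \<le>
      (\<integral>\<^sup>+z. ennreal (2 ^ ?p) * (ennreal (norm (X i z)) ^ ?p + ennreal (norm (Y i z)) ^ ?p) \<partial>M)"
      using ineq by (intro nn_integral_mono) (simp add: ennreal_power ennreal_mult[symmetric] flip: ennreal_plus)
    also have "\<dots> = ennreal (2 ^ ?p) * ((\<integral>\<^sup>+z. ennreal (norm (X i z)) ^ ?p \<partial>M) + (\<integral>\<^sup>+z. ennreal (norm (Y i z)) ^ ?p \<partial>M))"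
      by (simp add: nn_integral_cmult nn_integral_add)
    also have "\<dots> \<le> ennreal (2 ^ ?p) * (ennreal C + ennreal D)"
      using C(2)[OF i] D(2)[OF i] by (intro mult_left_mono add_mono) auto
    also have "\<dots> = ennreal (2 ^ ?p * (C + D))"
      using C(1) D(1) by (simp add: ennreal_mult ennreal_plus)
    finally show ?thesis .
  qed
  then show "\<exists>C. \<forall>i\<in>I. (\<integral>\<^sup>+z. ennreal (norm (X i z + Y i z)) ^ ?p \<partial>M) \<le> ennreal C" by blast
qed

text \<open>The moment of order \<open>p\<close> of a product is controlled by the moments of order
  \<open>2 p\<close> of the factors; doubling keeps the exponent a power of two.\<close>

lemma mbdd_mult_real:
  fixes X Y :: "'i \<Rightarrow> 'w \<Rightarrow> real"
  assumes X: "mbdd M I X" and Y: "mbdd M I Y"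
  shows "mbdd M I (\<lambda>i z. X i z * Y i z)"
  unfolding mbdd_def
proof (intro conjI ballI allI)
  fix i assume "i \<in> I" then show "(\<lambda>z. X i z * Y i z) \<in> borel_measurable M"
    by (intro borel_measurable_times mbdd_measurable[OF X] mbdd_measurable[OF Y])
next
  fix j
  let ?p = "2 ^ Suc j :: nat"
  obtain C where C: "C \<ge> 0" "\<And>i. i \<in> I \<Longrightarrow> (\<integral>\<^sup>+z. ennreal (norm (X i z)) ^ (2 ^ Suc (Suc j)) \<partial>M) \<le> ennreal C"
    using mbddD[OF X] by metis
  obtain D where D: "D \<ge> 0" "\<And>i. i \<in> I \<Longrightarrow> (\<integral>\<^sup>+z. ennreal (norm (Y i z)) ^ (2 ^ Suc (Suc j)) \<partial>M) \<le> ennreal D"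
    using mbddD[OF Y] by metis
  have ineq: "norm (x * y) ^ ?p \<le> norm x ^ (2 ^ Suc (Suc j)) + norm y ^ (2 ^ Suc (Suc j))" for x y :: real
  proof -
    have "norm (x * y) ^ ?p = norm x ^ ?p * norm y ^ ?p" by (simp add: norm_mult power_mult_distrib abs_mult)
    also have "\<dots> \<le> (norm x ^ ?p)\<^sup>2 + (norm y ^ ?p)\<^sup>2"
    proof -
      have "0 \<le> norm x ^ ?p * norm y ^ ?p" by simp
      with sum_squares_bound[of "norm x ^ ?p" "norm y ^ ?p"] show ?thesis unfolding mult.assoc by linarith
    qed
    finally show ?thesis by (simp add: power_mult[symmetric] mult.commute)
  qed
  have "(\<integral>\<^sup>+z. ennreal (norm (X i z * Y i z)) ^ ?p \<partial>M) \<le> ennreal (C + D)" if i: "i \<in> I" for i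
  proof -
    have [measurable]: "X i \<in> borel_measurable M" "Y i \<in> borel_measurable M"
      using X Y i by (auto intro: mbdd_measurable)
    have "(\<integral>\<^sup>+z. ennreal (norm (X i z * Y i z)) ^ ?p \<partial>M) \<le>
      (\<integral>\<^sup>+z. ennreal (norm (X i z)) ^ (2 ^ Suc (Suc j)) + ennreal (norm (Y i z)) ^ (2 ^ Suc (Suc j)) \<partial>M)"
      using ineq by (intro nn_integral_mono) (simp add: ennreal_power flip: ennreal_plus)
    also have "\<dots> = (\<integral>\<^sup>+z. ennreal (norm (X i z)) ^ (2 ^ Suc (Suc j)) \<partial>M) + (\<integral>\<^sup>+z. ennreal (norm (Y i z)) ^ (2 ^ Suc (Suc j)) \<partial>M)"
      by (rule nn_integral_add) measurable
    also have "\<dots> \<le> ennreal C + ennreal D"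
      using C(2)[OF i] D(2)[OF i] by (intro add_mono) auto
    also have "\<dots> = ennreal (C + D)" using C(1) D(1) by (simp add: ennreal_plus)
    finally show ?thesis .
  qed
  then show "\<exists>C. \<forall>i\<in>I. (\<integral>\<^sup>+z. ennreal (norm (X i z * Y i z)) ^ ?p \<partial>M) \<le> ennreal C" by blast
qed

lemma mbdd_mult:
  fixes X Y :: "'i \<Rightarrow> 'w \<Rightarrow> 'x::{second_countable_topology, real_normed_algebra}"
  assumes X: "mbdd M I X" and Y: "mbdd M I Y"
  shows "mbdd M I (\<lambda>i z. X i z * Y i z)"
  by (rule mbdd_dominated[OF mbdd_mult_real[OF mbdd_norm[OF X] mbdd_norm[OF Y]]])
     (auto intro!: borel_measurable_times mbdd_measurable[OF X] mbdd_measurable[OF Y] simp: norm_mult_ineq)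

lemma mbdd_bounded_linear:
  fixes X :: "'i \<Rightarrow> 'w \<Rightarrow> 'x::{second_countable_topology, real_normed_vector}"
    and f :: "'x \<Rightarrow> 'y::{second_countable_topology, real_normed_vector}"
  assumes f: "bounded_linear f" and X: "mbdd M I X" and M: "prob_space M"
  shows "mbdd M I (\<lambda>i z. f (X i z))"
proof -
  obtain K where K: "K \<ge> 0" "\<And>x. norm (f x) \<le> norm x * K"
    using bounded_linear.nonneg_bounded[OF f] by blast
  show ?thesis
  proof (rule mbdd_dominated[OF mbdd_mult_real[OF mbdd_norm[OF X] mbdd_const[OF M, of _ K]]])
    fix i assume "i \<in> I"
    then show "(\<lambda>z. f (X i z)) \<in> borel_measurable M"
      using mbdd_measurable[OF X] borel_measurable_continuous_onI[OF linear_continuous_on[OF f]]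
      by (auto intro: measurable_compose)
  qed (use K in \<open>auto simp: abs_mult\<close>)
qed

lemma mbdd_sum:
  fixes X :: "'k \<Rightarrow> 'i \<Rightarrow> 'w \<Rightarrow> 'x::{second_countable_topology, real_normed_vector}"
  assumes M: "prob_space M" and X: "\<And>k. k \<in> K \<Longrightarrow> mbdd M I (X k)"
  shows "mbdd M I (\<lambda>i z. \<Sum>k\<in>K. X k i z)"
  using X by (induction K rule: infinite_finite_induct) (auto intro: mbdd_const[OF M] mbdd_add)

lemma mbdd_diff:
  fixes X Y :: "'i \<Rightarrow> 'w \<Rightarrow> 'x::{second_countable_topology, real_normed_vector}"
  assumes M: "prob_space M" and X: "mbdd M I X" and Y: "mbdd M I Y"
  shows "mbdd M I (\<lambda>i z. X i z - Y i z)"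
  using mbdd_add[OF X mbdd_bounded_linear[OF bounded_linear_minus[OF bounded_linear_ident] Y M]] by simp

lemma mbdd_power:
  fixes X :: "'i \<Rightarrow> 'w \<Rightarrow> 'x::{second_countable_topology, real_normed_algebra_1}"
  assumes M: "prob_space M" and X: "mbdd M I X"
  shows "mbdd M I (\<lambda>i z. X i z ^ n)"
  by (induction n) (auto intro: mbdd_const[OF M] mbdd_mult X)

lemma mbdd_L1:
  fixes X :: "'i \<Rightarrow> 'w \<Rightarrow> 'x::{second_countable_topology, banach}"
  assumes M: "prob_space M" and X: "mbdd M I X"
  obtains C where "C \<ge> 0" "\<And>i. i \<in> I \<Longrightarrow> integrable M (X i)" "\<And>i. i \<in> I \<Longrightarrow> (\<integral>z. norm (X i z) \<partial>M) \<le> C"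
proof -
  interpret prob_space M by fact
  obtain C where C: "C \<ge> 0" "\<And>i. i \<in> I \<Longrightarrow> (\<integral>\<^sup>+z. ennreal (norm (X i z)) ^ (2 ^ Suc 0) \<partial>M) \<le> ennreal C"
    using mbddD[OF X] by metis
  have *: "(\<integral>\<^sup>+z. ennreal (norm (X i z)) \<partial>M) \<le> ennreal (1 + C)" if i: "i \<in> I" for i
  proof -
    have [measurable]: "X i \<in> borel_measurable M" using X i by (rule mbdd_measurable)
    \<comment> \<open>The exponents \<open>2^(j+1)\<close> start at two, so the first moment is
      obtained from the second.\<close>
    have "x \<le> 1 + x\<^sup>2" for x :: real
    proof -
      have "0 \<le> (x - 1 / 2)\<^sup>2" by simp
      also have "\<dots> = x\<^sup>2 - x + 1 / 4" by (simp add: power2_eq_square algebra_simps)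
      finally show ?thesis by simp
    qed
    then have "(\<integral>\<^sup>+z. ennreal (norm (X i z)) \<partial>M) \<le> (\<integral>\<^sup>+z. 1 + ennreal (norm (X i z)) ^ 2 \<partial>M)"
      by (intro nn_integral_mono) (auto simp: ennreal_power simp flip: ennreal_1 ennreal_plus)
    also have "\<dots> = 1 + (\<integral>\<^sup>+z. ennreal (norm (X i z)) ^ 2 \<partial>M)"
      by (subst nn_integral_add) (auto simp: emeasure_space_1)
    also have "\<dots> \<le> 1 + ennreal C" using C(2)[OF i] by (intro add_left_mono) simp
    finally show ?thesis using C(1) by (simp flip: ennreal_1 ennreal_plus)
  qed
  show ?thesis
  proof (rule that)
    show "0 \<le> 1 + C" using C(1) by simp
    fix i assume i: "i \<in> I"
    show int: "integrable M (X i)"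
      by (intro integrableI_bounded mbdd_measurable[OF X i] le_less_trans[OF *[OF i]]) (auto simp: less_top[symmetric] top_unique intro: le_less_trans)
    have "ennreal (\<integral>z. norm (X i z) \<partial>M) \<le> ennreal (1 + C)"
      using *[OF i] nn_integral_eq_integral[OF integrable_norm[OF int]] by simp
    then show "(\<integral>z. norm (X i z) \<partial>M) \<le> 1 + C" using C(1) ennreal_le_iff[of "1 + C"] by simp
  qed
qed

lemma mbdd_integrable:
  fixes X :: "'i \<Rightarrow> 'w \<Rightarrow> 'x::{second_countable_topology, banach}"
  shows "prob_space M \<Longrightarrow> mbdd M I X \<Longrightarrow> i \<in> I \<Longrightarrow> integrable M (X i)"
  using mbdd_L1 by metis

text \<open>The weight \<open>1 / h\<close> on \<open>[0, h]\<close> is a probability density, so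
  the mass in Jensen's inequality is one and the bound does not depend on the length of the
  interval.\<close>

lemma mbdd_average:
  fixes f :: "'i \<Rightarrow> real \<Rightarrow> 'w \<Rightarrow> real"
  assumes M: "prob_space M" and h: "\<And>i. i \<in> I \<Longrightarrow> 0 < h i"
    and f: "\<And>i. i \<in> I \<Longrightarrow> (\<lambda>(s, z). f i s z) \<in> borel_measurable (borel \<Otimes>\<^sub>M M)"
    and nonneg: "\<And>i s z. 0 \<le> f i s z"
    and b: "mbdd M {(i, s). i \<in> I \<and> 0 \<le> s \<and> s \<le> h i} (\<lambda>(i, s). f i s)"
    and Z: "\<And>i. i \<in> I \<Longrightarrow> Z i \<in> borel_measurable M"
    and le: "\<And>i z. i \<in> I \<Longrightarrow> z \<in> space M \<Longrightarrow>
      ennreal (norm (Z i z)) \<le> ennreal (1 / h i) * (\<integral>\<^sup>+s\<in>{0..h i}. ennreal (f i s z) \<partial>lborel)"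
  shows "mbdd M I (Z :: 'i \<Rightarrow> 'w \<Rightarrow> 'x::{second_countable_topology, real_normed_vector})"
  unfolding mbdd_def
proof (intro conjI ballI allI Z)
  fix j
  interpret prob_space M by fact
  let ?p = "2 ^ Suc j :: nat"
  obtain C where C0: "C \<ge> 0" "\<And>x. x \<in> {(i, s). i \<in> I \<and> 0 \<le> s \<and> s \<le> h i} \<Longrightarrow>
     (\<integral>\<^sup>+z. ennreal (norm ((case x of (i, s) \<Rightarrow> f i s) z)) ^ ?p \<partial>M) \<le> ennreal C"
    by (rule mbddD[OF b, of j]) blast
  have C: "C \<ge> 0" "\<And>i s. i \<in> I \<Longrightarrow> 0 \<le> s \<Longrightarrow> s \<le> h i \<Longrightarrow>
     (\<integral>\<^sup>+z. ennreal (norm (f i s z)) ^ ?p \<partial>M) \<le> ennreal C"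
    using C0(1) C0(2)[of "(i, s)" for i s] by auto
  have "(\<integral>\<^sup>+z. ennreal (norm (Z i z)) ^ ?p \<partial>M) \<le> ennreal C" if i: "i \<in> I" for i
  proof -
    have [measurable]: "(\<lambda>(s, z). f i s z) \<in> borel_measurable (borel \<Otimes>\<^sub>M M)" by (rule f[OF i])
    let ?k = "\<lambda>s. ennreal (1 / h i) * indicator {0..h i} s"
    let ?N = "density lborel ?k"
    have N1: "emeasure ?N (space ?N) = 1"
    proof -
      have "emeasure ?N (space ?N) = ennreal (1 / h i) * ennreal (h i)"
        using h[OF i] by (simp add: emeasure_density nn_integral_cmult)
      also have "\<dots> = 1" using h[OF i] by (subst ennreal_mult[symmetric]) auto
      finally show ?thesis .
    qed
    interpret N: prob_space ?N by (rule prob_spaceI) (rule N1)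
    have sets_N: "sets (?N \<Otimes>\<^sub>M M) = sets (borel \<Otimes>\<^sub>M M)" by (rule sets_pair_measure_cong) auto
    let ?f = "\<lambda>s z. indicator {0..h i} s * ennreal (f i s z)"
    have "(\<integral>\<^sup>+z. ennreal (norm (Z i z)) ^ ?p \<partial>M) \<le> (\<integral>\<^sup>+z. (\<integral>\<^sup>+s. ?f s z \<partial>?N) ^ ?p \<partial>M)"
    proof (intro nn_integral_mono power_mono)
      fix z assume z: "z \<in> space M"
      have "ennreal (norm (Z i z)) \<le> ennreal (1 / h i) * (\<integral>\<^sup>+s\<in>{0..h i}. ennreal (f i s z) \<partial>lborel)"
        by (rule le[OF i z])
      also have "\<dots> = (\<integral>\<^sup>+s. ?f s z \<partial>?N)"
      proof -
        have fm[measurable]: "(\<lambda>s. f i s z) \<in> borel_measurable borel"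
          using measurable_compose[OF measurable_Pair2'[OF z] f[OF i]] by simp
        have "(\<integral>\<^sup>+s. ?f s z \<partial>?N) = (\<integral>\<^sup>+s. ?k s * ?f s z \<partial>lborel)"
          by (rule nn_integral_density) measurable
        also have "\<dots> = (\<integral>\<^sup>+s. ennreal (1 / h i) * (ennreal (f i s z) * indicator {0..h i} s) \<partial>lborel)"
          by (intro nn_integral_cong) (simp add: indicator_def)
        also have "\<dots> = ennreal (1 / h i) * (\<integral>\<^sup>+s\<in>{0..h i}. ennreal (f i s z) \<partial>lborel)"
          by (rule nn_integral_cmult) measurable
        finally show ?thesis by simp
      qed
      finally show "ennreal (norm (Z i z)) \<le> (\<integral>\<^sup>+s. ?f s z \<partial>?N)" .
    qed auto
    also have "\<dots> \<le> 1 ^ ?p * ennreal C"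
    proof (rule nn_integral_average_moment)
      show "(\<lambda>(s, z). ?f s z) \<in> borel_measurable (?N \<Otimes>\<^sub>M M)"
        unfolding measurable_cong_sets[OF sets_N refl] by measurable
      fix s show "(\<integral>\<^sup>+z. ?f s z ^ ?p \<partial>M) \<le> ennreal C"
        using C(2)[OF i, of s] C(1) nonneg by (cases "s \<in> {0..h i}") (auto simp: power_0_left)
      show "emeasure ?N (space ?N) \<le> 1" using N1 by simp
    qed (rule sigma_finite_measure_axioms N.sigma_finite_measure_axioms)+
    finally show ?thesis by simp
  qed
  then show "\<exists>C. \<forall>i\<in>I. (\<integral>\<^sup>+z. ennreal (norm (Z i z)) ^ ?p \<partial>M) \<le> ennreal C" by blast
qed

section \<open>Increments of Brownian motion\<close>

text \<open>The moment of order \<open>2^(j+1)\<close> of a standard normal variable,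
  \<open>(2n)! / (2^n n!)\<close> with \<open>n = 2^j\<close>.\<close>

definition gauss_moment :: "nat \<Rightarrow> real" where
  "gauss_moment j = fact (2 ^ Suc j) / (2 ^ (2 ^ j) * fact (2 ^ j))"

locale brownian =
  fixes M :: "'w measure" and F :: "real \<Rightarrow> 'w measure" and W :: "real \<Rightarrow> 'w \<Rightarrow> real^'m"
  assumes bm: "brownian_motion M F W"
begin

lemma prob_space_M: "prob_space M"
  and filtration_F: "filtration (space M) F"
  and sets_F_M: "sets (F t) \<subseteq> sets M"
  and W_0: "z \<in> space M \<Longrightarrow> W 0 z = 0"
  and W_cont: "z \<in> space M \<Longrightarrow> continuous_on {0..} (\<lambda>t. W t z)"
  and W_adapted: "0 \<le> t \<Longrightarrow> W t \<in> borel_measurable (F t)"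
  using bm unfolding brownian_motion_def by auto

lemma W_incr:
  assumes "0 \<le> s" "s < t"
  shows W_incr_distributed:
      "distributed M lborel (\<lambda>z. (W t z - W s z) $ l) (normal_density 0 (sqrt (t - s)))"
    and W_incr_indep_vars: "prob_space.indep_vars M (\<lambda>_. borel) (\<lambda>l z. (W t z - W s z) $ l) UNIV"
    and W_incr_indep_set: "prob_space.indep_set M (sets (F s))
          (sets (vimage_algebra (space M) (\<lambda>z. W t z - W s z) borel))"
  using bm assms unfolding brownian_motion_def by blast+

sublocale prob_space M by (rule prob_space_M)

lemma space_F: "space (F t) = space M"
  using filtration.space_F[OF filtration_F] .

lemma sets_F_mono: "s \<le> t \<Longrightarrow> sets (F s) \<subseteq> sets (F t)"
  using filtration.sets_F_mono[OF filtration_F] .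

lemma measurable_F_mono: "f \<in> measurable (F s) N \<Longrightarrow> s \<le> t \<Longrightarrow> f \<in> measurable (F t) N"
  using measurable_mono[of N N "F s" "F t"] sets_F_mono[of s t] space_F by auto

lemma measurable_F_M: "f \<in> measurable (F s) N \<Longrightarrow> f \<in> measurable M N"
  using measurable_mono[of N N "F s" M] sets_F_M[of s] space_F by auto

lemma W_measurable: "0 \<le> t \<Longrightarrow> W t \<in> borel_measurable M"
  using measurable_F_M[OF W_adapted] .

lemma W_incr_moment:
  assumes st: "0 \<le> s" "s < t"
  shows "(\<integral>\<^sup>+z. ennreal \<bar>(W t z - W s z) $ l\<bar> ^ (2 ^ Suc j) \<partial>M) = ennreal (gauss_moment j * (t - s) ^ (2 ^ j))"
proof -
  let ?\<sigma> = "sqrt (t - s)" and ?X = "\<lambda>z. (W t z - W s z) $ l"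
  have \<sigma>: "0 < ?\<sigma>" using st by simp
  have *: "has_bochner_integral lborel (\<lambda>x. normal_density 0 ?\<sigma> x * x ^ (2 ^ Suc j)) (gauss_moment j * (t - s) ^ (2 ^ j))"
    using normal_moment_even[OF \<sigma>, of 0 "2 ^ j"] st
    by (simp add: gauss_moment_def power_divide field_simps)
  have "(\<integral>\<^sup>+z. ennreal \<bar>?X z\<bar> ^ (2 ^ Suc j) \<partial>M) = (\<integral>\<^sup>+x. normal_density 0 ?\<sigma> x * ennreal \<bar>x\<bar> ^ (2 ^ Suc j) \<partial>lborel)"
    by (rule distributed_nn_integral[OF W_incr_distributed[OF st], of "\<lambda>x. ennreal \<bar>x\<bar> ^ (2 ^ Suc j)", symmetric]) measurable
  also have "\<dots> = (\<integral>\<^sup>+x. ennreal (normal_density 0 ?\<sigma> x * x ^ (2 ^ Suc j)) \<partial>lborel)"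
    by (intro nn_integral_cong) (subst ennreal_mult', auto simp: ennreal_power power_even_abs simp del: power_Suc)
  also have "\<dots> = ennreal (gauss_moment j * (t - s) ^ (2 ^ j))"
    using * by (subst nn_integral_eq_integral) (auto simp: has_bochner_integral_iff)
  finally show ?thesis .
qed

text \<open>Brownian scaling: after division by \<open>sqrt (t - s)\<close> the law is standard
  normal. The degenerate case \<open>s = t\<close> is covered because division by zero yields
  zero.\<close>

lemma mbdd_W_incr_component:
  "mbdd M {(s, t). 0 \<le> s \<and> s \<le> t} (\<lambda>(s, t) z. (W t z - W s z) $ l / sqrt (t - s))"
  unfolding mbdd_def
proof (intro conjI ballI allI)
  fix i :: "real \<times> real" assume "i \<in> {(s, t). 0 \<le> s \<and> s \<le> t}"
  then show "(case i of (s, t) \<Rightarrow> \<lambda>z. (W t z - W s z) $ l / sqrt (t - s)) \<in> borel_measurable M"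
    using W_measurable[of "fst i"] W_measurable[of "snd i"] by (auto intro!: borel_measurable_divide borel_measurable_diff measurable_compose[OF _ borel_measurable_nth])
next
  fix j
  have "(\<integral>\<^sup>+z. ennreal (norm ((W t z - W s z) $ l / sqrt (t - s))) ^ 2 ^ Suc j \<partial>M) \<le> ennreal (gauss_moment j)"
    if "0 \<le> s" "s \<le> t" for s t
  proof (cases "s = t")
    case False
    then have st: "s < t" using that by simp
    have [measurable]: "W s \<in> borel_measurable M" "W t \<in> borel_measurable M" using that by (auto intro: W_measurable)
    have [measurable]: "(\<lambda>z. (W t z - W s z) $ l) \<in> borel_measurable M"
      by (rule measurable_compose[OF _ borel_measurable_nth]) measurable
    let ?c = "1 / (t - s) ^ (2 ^ j)"
    have p: "sqrt (t - s) ^ (2 ^ Suc j) = (t - s) ^ (2 ^ j)" using st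
      by (simp add: power_mult)
    have "(\<integral>\<^sup>+z. ennreal (norm ((W t z - W s z) $ l / sqrt (t - s))) ^ 2 ^ Suc j \<partial>M)
      = (\<integral>\<^sup>+z. ennreal ?c * ennreal \<bar>(W t z - W s z) $ l\<bar> ^ 2 ^ Suc j \<partial>M)"
      using st by (intro nn_integral_cong) (simp add: ennreal_power ennreal_mult'[symmetric] power_divide p del: power_Suc)
    also have "\<dots> = ennreal ?c * ennreal (gauss_moment j * (t - s) ^ (2 ^ j))"
      by (subst nn_integral_cmult, measurable) (simp only: W_incr_moment[OF that(1) st])
    also have "\<dots> = ennreal (gauss_moment j)"
      using st by (subst ennreal_mult'[symmetric]) auto
    finally show ?thesis by simp
  qed (simp add: power_0_left)
  then show "\<exists>C. \<forall>i\<in>{(s, t). 0 \<le> s \<and> s \<le> t}. (\<integral>\<^sup>+z. ennreal (norm ((case i of (s, t) \<Rightarrow>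
       \<lambda>z. (W t z - W s z) $ l / sqrt (t - s)) z)) ^ 2 ^ Suc j \<partial>M) \<le> ennreal C"
    by (intro exI[of _ "gauss_moment j"]) (auto simp del: power_Suc)
qed

lemma mbdd_W_incr:
  "mbdd M {(s, t). 0 \<le> s \<and> s \<le> t} (\<lambda>(s, t) z. norm (W t z - W s z) / sqrt (t - s))"
proof -
  let ?I = "{(s::real, t). 0 \<le> s \<and> s \<le> t}"
  have *: "mbdd M ?I (\<lambda>i z. \<Sum>l\<in>UNIV. \<bar>(W (snd i) z - W (fst i) z) $ l / sqrt (snd i - fst i)\<bar>)"
    using mbdd_norm[OF mbdd_W_incr_component]
    by (intro mbdd_sum prob_space_M) (simp add: split_beta)
  show ?thesis
  proof (rule mbdd_dominated[OF *])
    fix i :: "real \<times> real" and z assume i: "i \<in> ?I"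
    let ?d = "W (snd i) z - W (fst i) z"
    have "norm ?d / sqrt (snd i - fst i) \<le> (\<Sum>l\<in>UNIV. \<bar>?d $ l\<bar>) / sqrt (snd i - fst i)"
      by (intro divide_right_mono norm_le_l1_cart) (use i in auto)
    also have "\<dots> = (\<Sum>l\<in>UNIV. \<bar>?d $ l / sqrt (snd i - fst i)\<bar>)"
      unfolding sum_divide_distrib abs_divide using i by (intro sum.cong refl) auto
    finally show "norm ((case i of (s, t) \<Rightarrow> \<lambda>z. norm (W t z - W s z) / sqrt (t - s)) z)
      \<le> norm (\<Sum>l\<in>UNIV. \<bar>?d $ l / sqrt (snd i - fst i)\<bar>)"
      using i by (simp add: split_beta sum_nonneg)
  next
    fix i :: "real \<times> real" assume i: "i \<in> ?I"
    then have [measurable]: "W (fst i) \<in> borel_measurable M" "W (snd i) \<in> borel_measurable M"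
      by (auto intro: W_measurable)
    show "(case i of (s, t) \<Rightarrow> \<lambda>z. norm (W t z - W s z) / sqrt (t - s)) \<in> borel_measurable M"
      unfolding split_beta by measurable
  qed
qed

text \<open>Carries the independence of the sigma-algebra \<open>F s\<close> from that of the
  increment over to functions measurable with respect to them, in the complex-valued form to which
  the product rule for expectations is applied.\<close>

lemma W_incr_indep_var:
  fixes g :: "'w \<Rightarrow> complex" and k :: "real^'m \<Rightarrow> complex"
  assumes st: "0 \<le> s" "s < t" and g: "g \<in> borel_measurable (F s)" and k: "k \<in> borel_measurable borel"
  shows "indep_var borel g borel (\<lambda>z. k (W t z - W s z))"
  unfolding indep_var_eq
proof (intro conjI)
  have [measurable]: "W s \<in> borel_measurable M" "W t \<in> borel_measurable M"
    using st by (auto intro: W_measurable)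
  note [measurable] = k
  show "random_variable borel g" using g by (rule measurable_F_M)
  show "random_variable borel (\<lambda>z. k (W t z - W s z))" by measurable
  let ?V = "vimage_algebra (space M) (\<lambda>z. W t z - W s z) borel"
  have kV: "(\<lambda>z. k (W t z - W s z)) \<in> borel_measurable ?V"
    by (rule measurable_compose[OF measurable_vimage_algebra1 k]) auto
  have A: "sigma_sets (space M) {g -` A \<inter> space M |A. A \<in> sets borel} \<subseteq> sets (F s)"
    using measurable_sets[OF g] sets.sigma_sets_subset[of "{g -` A \<inter> space M |A. A \<in> sets borel}" "F s"]
    by (auto simp: space_F)
  have B: "sigma_sets (space M) {(\<lambda>z. k (W t z - W s z)) -` A \<inter> space M |A. A \<in> sets borel} \<subseteq> sets ?V"
    using measurable_sets[OF kV] sets.sigma_sets_subset[of "{(\<lambda>z. k (W t z - W s z)) -` A \<inter> space M |A. A \<in> sets borel}" ?V]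
    by auto
  show "indep_set (sigma_sets (space M) {g -` A \<inter> space M |A. A \<in> sets borel})
     (sigma_sets (space M) {(\<lambda>z. k (W t z - W s z)) -` A \<inter> space M |A. A \<in> sets borel})"
    using W_incr_indep_set[OF st] A B unfolding indep_sets2_eq by blast
qed

lemma W_incr_integrable:
  assumes st: "0 \<le> s" "s \<le> t"
  shows "integrable M (\<lambda>z. (W t z - W s z) $ l)"
    and "integrable M (\<lambda>z. (W t z - W s z) $ l * (W t z - W s z) $ l')"
proof -
  have *: "mbdd M {(s, t). 0 \<le> s \<and> s \<le> t} (\<lambda>(s, t) z. (W t z - W s z) $ l / sqrt (t - s))" for l
    by (rule mbdd_W_incr_component)
  have e: "sqrt (t - s) * ((W t z - W s z) $ l / sqrt (t - s)) = (W t z - W s z) $ l" for l z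
    using st by (cases "s = t") auto
  have "integrable M (\<lambda>z. sqrt (t - s) * ((W t z - W s z) $ l / sqrt (t - s)))"
    using mbdd_integrable[OF prob_space_M *[of l], of "(s, t)"] st by (intro integrable_mult_right) auto
  then show "integrable M (\<lambda>z. (W t z - W s z) $ l)" by (simp only: e)
  have "integrable M (\<lambda>z. (W t z - W s z) $ l / sqrt (t - s) * ((W t z - W s z) $ l' / sqrt (t - s)))"
    using mbdd_integrable[OF prob_space_M mbdd_mult[OF *[of l] *[of l']], of "(s, t)"] st by auto
  then have "integrable M (\<lambda>z. (t - s) * ((W t z - W s z) $ l / sqrt (t - s) * ((W t z - W s z) $ l' / sqrt (t - s))))"
    by (intro integrable_mult_right)
  also have "(\<lambda>z. (t - s) * ((W t z - W s z) $ l / sqrt (t - s) * ((W t z - W s z) $ l' / sqrt (t - s))))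
    = (\<lambda>z. (W t z - W s z) $ l * (W t z - W s z) $ l')"
    using st by (cases "s = t") (auto simp: fun_eq_iff)
  finally show "integrable M (\<lambda>z. (W t z - W s z) $ l * (W t z - W s z) $ l')" .
qed

lemma W_incr_mean:
  assumes st: "0 \<le> s" "s < t"
  shows "expectation (\<lambda>z. (W t z - W s z) $ l) = 0"
  using normal_distributed_expectation[OF _ W_incr_distributed[OF st]] st by simp

lemma W_incr_cov:
  assumes st: "0 \<le> s" "s < t"
  shows "expectation (\<lambda>z. (W t z - W s z) $ l * (W t z - W s z) $ l') = (if l = l' then t - s else 0)"
proof (cases "l = l'")
  case True
  have s0: "0 < sqrt (t - s)" using st by simp
  show ?thesis
    using normal_distributed_variance[OF s0 W_incr_distributed[OF st, of l]] st True
    by (simp add: W_incr_mean[OF st] power2_eq_square del: vector_minus_component)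
next
  case False
  let ?X = "\<lambda>l z. (W t z - W s z) $ l"
  have "indep_vars (\<lambda>_. borel) ?X {l, l'}"
    using indep_vars_subset[OF W_incr_indep_vars[OF st]] by auto
  then have "expectation (\<lambda>z. \<Prod>i\<in>{l, l'}. ?X i z) = (\<Prod>i\<in>{l, l'}. expectation (?X i))"
    using W_incr_integrable(1)[of s t] st by (intro indep_vars_lebesgue_integral) auto
  then show ?thesis using False by (simp add: W_incr_mean[OF st] del: vector_minus_component)
qed

text \<open>The martingale property: a weight known at time \<open>s\<close> is independent of the
  later increment, which is centred.\<close>

lemma expectation_incr:
  fixes g :: "'w \<Rightarrow> complex"
  assumes st: "0 \<le> s" "s \<le> t" and g: "g \<in> borel_measurable (F s)" "integrable M g"
  shows "integrable M (\<lambda>z. g z * complex_of_real ((W t z - W s z) $ l))"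
    and "expectation (\<lambda>z. g z * complex_of_real ((W t z - W s z) $ l)) = 0"
proof (atomize(full), cases "s = t")
  case False
  then have st': "s < t" using st by simp
  have iv: "indep_var borel g borel (\<lambda>z. complex_of_real ((W t z - W s z) $ l))"
    by (rule W_incr_indep_var[OF st(1) st' g(1)]) (auto intro: measurable_compose[OF borel_measurable_nth])
  have i: "integrable M (\<lambda>z. complex_of_real ((W t z - W s z) $ l))"
    using W_incr_integrable(1)[OF st] by (rule integrable_of_real)
  show "integrable M (\<lambda>z. g z * complex_of_real ((W t z - W s z) $ l)) \<and>
    expectation (\<lambda>z. g z * complex_of_real ((W t z - W s z) $ l)) = 0"
    using indep_var_integrable[OF iv g(2) i] indep_var_lebesgue_integral[OF iv g(2) i] W_incr_mean[OF st(1) st', of l]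
    by (simp only: integral_complex_of_real of_real_0 mult_zero_right simp_thms)
qed simp

text \<open>Subtracting \<open>t - s\<close> on the diagonal centres the product of two increments,
  so a weight known at time \<open>s\<close> again gives expectation zero. Such quadratic terms are
  left behind by the expansions over one step.\<close>

lemma expectation_incr2:
  fixes g :: "'w \<Rightarrow> complex" and l l' :: 'm
  assumes st: "0 \<le> s" "s \<le> t" and g: "g \<in> borel_measurable (F s)" "integrable M g"
  defines "Q \<equiv> \<lambda>z. (W t z - W s z) $ l * (W t z - W s z) $ l' - (if l = l' then t - s else 0)"
  shows "integrable M (\<lambda>z. g z * complex_of_real (Q z))"
    and "expectation (\<lambda>z. g z * complex_of_real (Q z)) = 0"
proof (atomize(full), cases "s = t")
  case False
  then have st': "s < t" using st by simp
  have iv: "indep_var borel g borel (\<lambda>z. complex_of_real (Q z))"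
    unfolding Q_def
    by (rule W_incr_indep_var[OF st(1) st' g(1), of "\<lambda>x. complex_of_real (x $ l * x $ l' - (if l = l' then t - s else 0))"])
      (auto intro!: borel_measurable_diff borel_measurable_times measurable_compose[OF borel_measurable_nth])
  have iQ: "integrable M Q" unfolding Q_def
    using W_incr_integrable(2)[OF st] by (intro Bochner_Integration.integrable_diff) auto
  have EQ: "expectation Q = 0" unfolding Q_def
    using W_incr_cov[OF st(1) st', of l l'] W_incr_integrable(2)[OF st, of l l']
    by (subst Bochner_Integration.integral_diff) (auto simp: prob_space simp del: vector_minus_component)
  show "integrable M (\<lambda>z. g z * complex_of_real (Q z)) \<and> expectation (\<lambda>z. g z * complex_of_real (Q z)) = 0"
    using indep_var_integrable[OF iv g(2) integrable_of_real[OF iQ]]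
      indep_var_lebesgue_integral[OF iv g(2) integrable_of_real[OF iQ]] EQ
    by (simp only: integral_complex_of_real of_real_0 mult_zero_right simp_thms)
qed (simp add: Q_def)

end

section \<open>A discrete Ito calculus\<close>

text \<open>A centred quadratic form in the increments is a product of two linear forms minus
  \<open>h\<close> times the product of their coefficients, summed over the diagonal; the subtracted
  term is the Ito correction.\<close>

lemma double_sum_diagonal:
  fixes u v x :: "'m::finite \<Rightarrow> 'a::comm_ring_1"
  shows "(\<Sum>l\<in>UNIV. \<Sum>k\<in>UNIV. u l * v k * (x l * x k - (if l = k then h else 0)))
    = (\<Sum>l\<in>UNIV. u l * x l) * (\<Sum>l\<in>UNIV. v l * x l) - h * (\<Sum>l\<in>UNIV. u l * v l)"
proof -
  have "(\<Sum>l\<in>UNIV. \<Sum>k\<in>UNIV. u l * v k * (x l * x k - (if l = k then h else 0)))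
    = (\<Sum>l\<in>UNIV. \<Sum>k\<in>UNIV. (u l * x l) * (v k * x k)) - (\<Sum>l\<in>UNIV. \<Sum>k\<in>UNIV. if l = k then h * (u l * v k) else 0)"
    unfolding sum_subtractf[symmetric] by (intro sum.cong refl) (auto simp: algebra_simps)
  also have "(\<Sum>l\<in>UNIV. \<Sum>k\<in>UNIV. if l = k then h * (u l * v k) else 0) = h * (\<Sum>l\<in>UNIV. u l * v l)"
    by (simp add: sum_distrib_left)
  finally show ?thesis unfolding sum_product .
qed

text \<open>Here \<open>s\<close> is the square root of the step length. Both factors are written as
  initial value, drift, diffusion, centred quadratic part and remainder. Removing the terms of the
  product rule, with Ito correction \<open>S\<close>, leaves a multiple of
  \<open>s^3\<close>.\<close>

lemma product_increment_identity:
  fixes s :: complex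
  assumes "s \<noteq> 0"
  shows "((y + s * s * a + s * K + s * s * C + s * s * s * P) * (z + s * s * b + s * L + s * s * D + s * s * s * Q)
      - y * z - s * s * (y * b + z * a + S) - s * (y * L + z * K)
      - s * s * (y * D + z * C + (K * L - S))) / (s * s * s)
    = y * Q + z * P + (a + C + s * P) * (L + s * (b + D + s * Q)) + K * (b + D + s * Q)" (is "?l / _ = ?r")
proof -
  have "?l = s * s * s * ?r" by algebra
  then show ?thesis using assms by simp
qed

section \<open>Adapted processes with bounded moments and their expansion over one step\<close>

definition steps :: "(real \<times> real) set" where
  "steps = {(t, h). 0 \<le> t \<and> 0 < h \<and> h \<le> 1}"

context brownian
begin

text \<open>Polynomials in such processes stay in the class. Together with real parts this covers
  all drifts and diffusion coefficients that occur; values are complex because the phase is.\<close>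

definition adm :: "(real \<Rightarrow> 'w \<Rightarrow> complex) \<Rightarrow> bool" where
  "adm Y \<longleftrightarrow> (\<forall>t\<ge>0. Y t \<in> borel_measurable (F t)) \<and> mbdd M {0..} Y"

lemma adm_measurable: "adm Y \<Longrightarrow> 0 \<le> t \<Longrightarrow> Y t \<in> borel_measurable (F t)"
  and adm_mbdd: "adm Y \<Longrightarrow> mbdd M {0..} Y"
  by (auto simp: adm_def)

lemma adm_integrable: "adm Y \<Longrightarrow> 0 \<le> t \<Longrightarrow> integrable M (Y t)"
  by (rule mbdd_integrable[OF prob_space_M adm_mbdd]) auto

lemma adm_const: "adm (\<lambda>t z. c)"
  by (auto simp: adm_def intro: mbdd_const prob_space_M)

lemma adm_add: "adm X \<Longrightarrow> adm Y \<Longrightarrow> adm (\<lambda>t z. X t z + Y t z)"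
  by (auto simp: adm_def intro: mbdd_add borel_measurable_add)

lemma adm_mult: "adm X \<Longrightarrow> adm Y \<Longrightarrow> adm (\<lambda>t z. X t z * Y t z)"
  by (auto simp: adm_def intro: mbdd_mult borel_measurable_times)

lemma adm_diff: "adm X \<Longrightarrow> adm Y \<Longrightarrow> adm (\<lambda>t z. X t z - Y t z)"
  by (auto simp: adm_def intro: mbdd_diff[OF prob_space_M] borel_measurable_diff)

lemma adm_minus: "adm X \<Longrightarrow> adm (\<lambda>t z. - X t z)"
  using adm_diff[OF adm_const[of 0]] by simp

lemma adm_power: "adm X \<Longrightarrow> adm (\<lambda>t z. X t z ^ n)"
  by (induction n) (auto intro: adm_const adm_mult)

lemma adm_sum: "(\<And>k. k \<in> K \<Longrightarrow> adm (X k)) \<Longrightarrow> adm (\<lambda>t z. \<Sum>k\<in>K. X k t z)"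
  by (induction K rule: infinite_finite_induct) (auto intro: adm_const adm_add)

lemmas adm_intros = adm_const adm_add adm_mult adm_diff adm_minus adm_power adm_sum

lemma adm_steps: "adm Y \<Longrightarrow> mbdd M steps (\<lambda>i. Y (fst i))"
  and adm_steps': "adm Y \<Longrightarrow> mbdd M steps (\<lambda>i. Y (fst i + snd i))"
  by (auto intro!: mbdd_reindex[OF adm_mbdd] simp: steps_def)

definition dW :: "'m \<Rightarrow> real \<Rightarrow> real \<Rightarrow> 'w \<Rightarrow> real" where
  "dW l t h z = (W (t + h) z - W t z) $ l"

definition dQ :: "'m \<Rightarrow> 'm \<Rightarrow> real \<Rightarrow> real \<Rightarrow> 'w \<Rightarrow> real" where
  "dQ l k t h z = dW l t h z * dW k t h z - (if l = k then h else 0)"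

lemma mbdd_of_real: "mbdd M I X \<Longrightarrow> mbdd M I (\<lambda>i z. complex_of_real (X i z))"
  by (rule mbdd_bounded_linear[OF bounded_linear_of_real _ prob_space_M])

lemma mbdd_dW: "mbdd M steps (\<lambda>i z. dW l (fst i) (snd i) z / sqrt (snd i))"
  by (rule mbdd_cong[OF mbdd_reindex[OF mbdd_W_incr_component[of l], of steps "\<lambda>i. (fst i, fst i + snd i)"]])
     (auto simp: steps_def dW_def)

lemma mbdd_dQ: "mbdd M steps (\<lambda>i z. dQ l k (fst i) (snd i) z / snd i)"
proof (rule mbdd_cong)
  show "mbdd M steps (\<lambda>i z. dW l (fst i) (snd i) z / sqrt (snd i) * (dW k (fst i) (snd i) z / sqrt (snd i))
     - (if l = k then 1 else 0))"
    by (intro mbdd_diff mbdd_mult mbdd_dW mbdd_const prob_space_M)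
  fix i z assume "i \<in> steps"
  then have "0 < snd i" by (auto simp: steps_def)
  then show "dQ l k (fst i) (snd i) z / snd i = dW l (fst i) (snd i) z / sqrt (snd i) *
     (dW k (fst i) (snd i) z / sqrt (snd i)) - (if l = k then 1 else 0)"
    by (simp add: dQ_def diff_divide_distrib)
qed

lemma mbdd_bounded_factor:
  assumes "\<And>i. i \<in> I \<Longrightarrow> norm (g i) \<le> K"
  shows "mbdd M I (\<lambda>i z. (g i :: complex))"
  by (rule mbdd_dominated[OF mbdd_const[OF prob_space_M, of I K]]) (use assms in \<open>auto intro: order.trans[OF _ abs_ge_self]\<close>)

lemma mbdd_sqrt_step: "mbdd M steps (\<lambda>i z. complex_of_real (sqrt (snd i)))"
  by (rule mbdd_bounded_factor[of _ _ 1]) (auto simp: steps_def)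

definition remainder ::
  "(real \<Rightarrow> 'w \<Rightarrow> complex) \<Rightarrow> (real \<Rightarrow> 'w \<Rightarrow> complex) \<Rightarrow> ('m \<Rightarrow> real \<Rightarrow> 'w \<Rightarrow> complex) \<Rightarrow>
   ('m \<Rightarrow> 'm \<Rightarrow> real \<Rightarrow> 'w \<Rightarrow> complex) \<Rightarrow> real \<times> real \<Rightarrow> 'w \<Rightarrow> complex" where
  "remainder Y a \<sigma> c i z =
    (Y (fst i + snd i) z - Y (fst i) z - of_real (snd i) * a (fst i) z
      - (\<Sum>l\<in>UNIV. \<sigma> l (fst i) z * of_real (dW l (fst i) (snd i) z))
      - (\<Sum>l\<in>UNIV. \<Sum>k\<in>UNIV. c l k (fst i) z * of_real (dQ l k (fst i) (snd i) z))) / complex_of_real (snd i * sqrt (snd i))"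

text \<open>A discrete substitute for semimartingales: over a step of length \<open>h\<close> the process has drift
  \<open>a\<close> and diffusion coefficients \<open>\<sigma>\<close>, up to a centred quadratic term in the increments of \<open>W\<close>
  and an error of order \<open>h\<^sup>3\<^sup>/\<^sup>2\<close>, which is negligible after summing over the steps.\<close>

definition ito :: "(real \<Rightarrow> 'w \<Rightarrow> complex) \<Rightarrow> (real \<Rightarrow> 'w \<Rightarrow> complex) \<Rightarrow> ('m \<Rightarrow> real \<Rightarrow> 'w \<Rightarrow> complex) \<Rightarrow> bool" where
  "ito Y a \<sigma> \<longleftrightarrow> adm a \<and> (\<forall>l. adm (\<sigma> l)) \<and>
    (\<exists>c. (\<forall>l k. adm (c l k)) \<and> mbdd M steps (remainder Y a \<sigma> c))"

lemma ito_adm: "ito Y a \<sigma> \<Longrightarrow> adm a" "ito Y a \<sigma> \<Longrightarrow> adm (\<sigma> l)"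
  by (auto simp: ito_def)

lemma ito_const: "ito (\<lambda>t z. k) (\<lambda>t z. 0) (\<lambda>l t z. 0)"
  unfolding ito_def
  by (auto intro!: adm_const exI[of _ "\<lambda>l k t z. 0"] mbdd_cong[OF mbdd_const[OF prob_space_M, of _ 0]] simp: remainder_def)

text \<open>Ito's product rule. The products of diffusion coefficients multiply products of
  increments; centring the latter moves the diagonal sum into the drift and leaves the rest among
  the quadratic coefficients \<open>d'\<close>.\<close>

lemma ito_mult:
  assumes Y: "ito Y a \<sigma>" and Z: "ito Z b \<rho>" and admY: "adm Y" and admZ: "adm Z"
  shows "ito (\<lambda>t z. Y t z * Z t z)
    (\<lambda>t z. Y t z * b t z + Z t z * a t z + (\<Sum>l\<in>UNIV. \<sigma> l t z * \<rho> l t z))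
    (\<lambda>l t z. Y t z * \<rho> l t z + Z t z * \<sigma> l t z)"
proof -
  obtain c d where c: "\<And>l k. adm (c l k)" "mbdd M steps (remainder Y a \<sigma> c)"
    and d: "\<And>l k. adm (d l k)" "mbdd M steps (remainder Z b \<rho> d)"
    using assms unfolding ito_def by blast
  note adm = ito_adm[OF Y] ito_adm[OF Z] c(1) d(1) admY admZ
  let ?s = "\<lambda>i. complex_of_real (sqrt (snd i))"
  define e where "e = (\<lambda>l i z. complex_of_real (dW l (fst i) (snd i) z / sqrt (snd i)))"
  define q where "q = (\<lambda>l k i z. complex_of_real (dQ l k (fst i) (snd i) z / snd i))"
  have e: "mbdd M steps (e l)" and q: "mbdd M steps (q l k)" for l k
    unfolding e_def q_def by (intro mbdd_of_real mbdd_dW mbdd_dQ)+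
  define K where "K = (\<lambda>\<sigma> i z. \<Sum>l\<in>UNIV. \<sigma> l (fst i) z * e l i z)"
  define C where "C = (\<lambda>c i z. \<Sum>l\<in>UNIV. \<Sum>k\<in>UNIV. c l k (fst i) z * q l k i z)"
  \<comment> \<open>With \<open>s\<close> the square root of the step length, the increment of the
    process is \<open>s K + s^2 G\<close>: everything beyond the diffusion part is collected in
    \<open>G\<close>.\<close>
  define G where "G = (\<lambda>Y a \<sigma> c i z. a (fst i) z + C c i z + ?s i * remainder Y a \<sigma> c i z)"
  have mK: "mbdd M steps (K \<sigma>)" if "\<And>l. adm (\<sigma> l)" for \<sigma>
    unfolding K_def by (intro mbdd_sum mbdd_mult e adm_steps that prob_space_M)
  have mC: "mbdd M steps (C c)" if "\<And>l k. adm (c l k)" for c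
    unfolding C_def by (intro mbdd_sum mbdd_mult q adm_steps that prob_space_M)
  have mG: "mbdd M steps (G Y a \<sigma> c)" "mbdd M steps (G Z b \<rho> d)"
    unfolding G_def by (intro mbdd_add mbdd_mult mbdd_sqrt_step mC adm adm_steps c d)+
  define d' where "d' = (\<lambda>l k t z. Y t z * d l k t z + Z t z * c l k t z + \<sigma> l t z * \<rho> k t z)"
  let ?a = "\<lambda>t z. Y t z * b t z + Z t z * a t z + (\<Sum>l\<in>UNIV. \<sigma> l t z * \<rho> l t z)"
  let ?\<sigma> = "\<lambda>l t z. Y t z * \<rho> l t z + Z t z * \<sigma> l t z"
  have "mbdd M steps (remainder (\<lambda>t z. Y t z * Z t z) ?a ?\<sigma> d')"
  proof (rule mbdd_cong)
    show "mbdd M steps (\<lambda>i z. Y (fst i) z * remainder Z b \<rho> d i z + Z (fst i) z * remainder Y a \<sigma> c i z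
       + G Y a \<sigma> c i z * (K \<rho> i z + ?s i * G Z b \<rho> d i z) + K \<sigma> i z * G Z b \<rho> d i z)"
      by (intro mbdd_add mbdd_mult mbdd_sqrt_step mG mK adm adm_steps c d)
    fix i z assume "i \<in> steps"
    then obtain t h where i: "i = (t, h)" "0 < h" by (auto simp: steps_def)
    define s where "s = complex_of_real (sqrt h)"
    have s: "s \<noteq> 0" "complex_of_real h = s * s" using i(2) by (auto simp: s_def simp flip: of_real_mult)
    have hs: "complex_of_real (h * sqrt h) = s * s * s" using s by (simp add: s_def)
    have dWe: "complex_of_real (dW l t h z) = s * e l i z" for l
      using i s by (simp add: e_def s_def)
    have dQq: "complex_of_real (dQ l k t h z) = s * s * q l k i z" for l k
      using i s by (simp add: q_def del: of_real_mult)
    have qe: "q l k i z = e l i z * e k i z - (if l = k then 1 else 0)" for l k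
      using i by (simp add: q_def e_def dQ_def diff_divide_distrib flip: of_real_mult)
    have KK: "(\<Sum>l\<in>UNIV. \<Sum>k\<in>UNIV. \<sigma> l t z * \<rho> k t z * q l k i z)
       = K \<sigma> i z * K \<rho> i z - (\<Sum>l\<in>UNIV. \<sigma> l t z * \<rho> l t z)"
      unfolding qe using double_sum_diagonal[of "\<lambda>l. \<sigma> l t z" "\<lambda>l. \<rho> l t z" "\<lambda>l. e l i z" 1]
      by (simp add: K_def i)
    have rem: "remainder Y a \<sigma> c i z = (Y (t + h) z - Y t z - s * s * a t z - s * K \<sigma> i z - s * s * C c i z) / (s * s * s)"
      for Y a \<sigma> c
      unfolding remainder_def i fst_conv snd_conv hs s(2) dWe[unfolded i] dQq[unfolded i] K_def C_def
      by (simp add: sum_distrib_left mult_ac)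
    have "C d' i z = Y t z * C d i z + Z t z * C c i z + (\<Sum>l\<in>UNIV. \<Sum>k\<in>UNIV. \<sigma> l t z * \<rho> k t z * q l k i z)"
      unfolding C_def d'_def i fst_conv by (simp add: distrib_right sum.distrib sum_distrib_left mult.assoc)
    then have Cd': "C d' i z = Y t z * C d i z + Z t z * C c i z + (K \<sigma> i z * K \<rho> i z - (\<Sum>l\<in>UNIV. \<sigma> l t z * \<rho> l t z))"
      unfolding KK .
    have K\<sigma>: "K ?\<sigma> i z = Y t z * K \<rho> i z + Z t z * K \<sigma> i z"
      unfolding K_def i fst_conv by (simp add: distrib_right sum.distrib sum_distrib_left mult.assoc)
    define RY where "RY = remainder Y a \<sigma> c i z"
    define RZ where "RZ = remainder Z b \<rho> d i z"
    have eqY: "Y (t + h) z = Y t z + s * s * a t z + s * K \<sigma> i z + s * s * C c i z + s * s * s * RY"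
      using s(1) unfolding RY_def rem by simp
    have eqZ: "Z (t + h) z = Z t z + s * s * b t z + s * K \<rho> i z + s * s * C d i z + s * s * s * RZ"
      using s(1) unfolding RZ_def rem by simp
    have si: "?s i = s" by (simp add: i s_def)
    show "remainder (\<lambda>t z. Y t z * Z t z) ?a ?\<sigma> d' i z =
       Y (fst i) z * remainder Z b \<rho> d i z + Z (fst i) z * remainder Y a \<sigma> c i z
       + G Y a \<sigma> c i z * (K \<rho> i z + ?s i * G Z b \<rho> d i z) + K \<sigma> i z * G Z b \<rho> d i z"
      unfolding rem[of "\<lambda>t z. Y t z * Z t z"] G_def RY_def[symmetric] RZ_def[symmetric] si K\<sigma> Cd' eqY eqZ
      unfolding i fst_conv by (rule product_increment_identity[OF s(1)])
  qed
  moreover have "adm ?a" "\<And>l. adm (?\<sigma> l)" "\<And>l k. adm (d' l k)"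
    unfolding d'_def by (intro adm_intros adm)+
  ultimately show ?thesis unfolding ito_def by blast
qed

text \<open>Meant for processes that grow in time, such as the logarithm of the phase: their
  increments over steps of length at most one still have uniformly bounded moments.\<close>

lemma ito_increment:
  assumes "ito Y a \<sigma>"
  shows "mbdd M steps (\<lambda>i z. Y (fst i + snd i) z - Y (fst i) z)"
proof -
  obtain c where c: "\<And>l k. adm (c l k)" "mbdd M steps (remainder Y a \<sigma> c)"
    using assms unfolding ito_def by blast
  note adm = ito_adm[OF assms] c(1)
  have h: "mbdd M steps (\<lambda>i z. complex_of_real (snd i))"
    by (rule mbdd_bounded_factor[of _ _ 1]) (auto simp: steps_def)
  show ?thesis
  proof (rule mbdd_cong)
    show "mbdd M steps (\<lambda>i z. complex_of_real (snd i) * a (fst i) z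
      + (\<Sum>l\<in>UNIV. \<sigma> l (fst i) z * (complex_of_real (sqrt (snd i)) * complex_of_real (dW l (fst i) (snd i) z / sqrt (snd i))))
      + (\<Sum>l\<in>UNIV. \<Sum>k\<in>UNIV. c l k (fst i) z * (complex_of_real (snd i) * complex_of_real (dQ l k (fst i) (snd i) z / snd i)))
      + complex_of_real (snd i) * complex_of_real (sqrt (snd i)) * remainder Y a \<sigma> c i z)"
      by (intro mbdd_add mbdd_mult mbdd_sum h mbdd_sqrt_step mbdd_of_real mbdd_dW mbdd_dQ adm_steps adm c prob_space_M)
  qed (auto simp: steps_def remainder_def)
qed

text \<open>The diffusion and quadratic parts have expectation zero, being weights known at time
  \<open>t\<close> against centred functions of a later increment. The drift and the remainder are
  left.\<close>

lemma ito_expectation: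
  assumes "ito Y a \<sigma>"
  obtains C where "C \<ge> 0"
    "\<And>t h. 0 \<le> t \<Longrightarrow> 0 < h \<Longrightarrow> h \<le> 1 \<Longrightarrow>
      norm (expectation (\<lambda>z. Y (t + h) z - Y t z) - of_real h * expectation (a t)) \<le> C * (h * sqrt h)"
proof -
  obtain c where c: "\<And>l k. adm (c l k)" "mbdd M steps (remainder Y a \<sigma> c)"
    using assms unfolding ito_def by blast
  note adm = ito_adm[OF assms] c(1)
  obtain C where C: "C \<ge> 0" "\<And>i. i \<in> steps \<Longrightarrow> integrable M (remainder Y a \<sigma> c i)"
     "\<And>i. i \<in> steps \<Longrightarrow> (\<integral>z. norm (remainder Y a \<sigma> c i z) \<partial>M) \<le> C"
    using mbdd_L1[OF prob_space_M c(2)] by blast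
  show ?thesis
  proof (rule that[OF C(1)])
    fix t h :: real assume th: "0 \<le> t" "0 < h" "h \<le> 1"
    let ?R = "remainder Y a \<sigma> c (t, h)"
    have i: "(t, h) \<in> steps" using th by (auto simp: steps_def)
    have s: "integrable M (\<lambda>z. \<sigma> l t z * of_real (dW l t h z))" "expectation (\<lambda>z. \<sigma> l t z * of_real (dW l t h z)) = 0" for l
      unfolding dW_def using th
      by (intro expectation_incr adm_measurable adm_integrable adm; simp)+
    have q: "integrable M (\<lambda>z. c l k t z * of_real (dQ l k t h z))" "expectation (\<lambda>z. c l k t z * of_real (dQ l k t h z)) = 0" for l k
      using expectation_incr2[of t "t + h" "c l k t" l k] th adm_measurable[OF adm(3), of t l k] adm_integrable[OF adm(3), of t l k]
      unfolding dQ_def dW_def by auto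
    have ia: "integrable M (a t)" using adm_integrable[OF adm(1)] th by simp
    have "(\<lambda>z. Y (t + h) z - Y t z) = (\<lambda>z. of_real h * a t z + (\<Sum>l\<in>UNIV. \<sigma> l t z * of_real (dW l t h z))
       + (\<Sum>l\<in>UNIV. \<Sum>k\<in>UNIV. c l k t z * of_real (dQ l k t h z)) + complex_of_real (h * sqrt h) * ?R z)"
      using th unfolding remainder_def by (auto simp: fun_eq_iff simp flip: of_real_mult)
    then have "expectation (\<lambda>z. Y (t + h) z - Y t z) = expectation (\<lambda>z. of_real h * a t z + (\<Sum>l\<in>UNIV. \<sigma> l t z * of_real (dW l t h z))
       + (\<Sum>l\<in>UNIV. \<Sum>k\<in>UNIV. c l k t z * of_real (dQ l k t h z)) + complex_of_real (h * sqrt h) * ?R z)" by simp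
    also have "\<dots> = of_real h * expectation (a t) + complex_of_real (h * sqrt h) * expectation ?R"
      using s q C(2)[OF i] ia
      by (simp add: Bochner_Integration.integral_add Bochner_Integration.integral_sum Bochner_Integration.integrable_sum
           del: of_real_mult)
    finally have "norm (expectation (\<lambda>z. Y (t + h) z - Y t z) - of_real h * expectation (a t)) = (h * sqrt h) * norm (expectation ?R)"
      using th by (simp add: norm_mult)
    also have "\<dots> \<le> (h * sqrt h) * C"
      using th by (intro mult_left_mono order.trans[OF integral_norm_bound C(3)[OF i]]) auto
    finally show "norm (expectation (\<lambda>z. Y (t + h) z - Y t z) - of_real h * expectation (a t)) \<le> C * (h * sqrt h)"
      by (simp add: mult.commute)
  qed
qed

end

section \<open>Ito integrals of differentiable integrands\<close>

text \<open>Dominated convergence for indicators. On a nonmeasurable set \<open>measure\<close> is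
  zero, so replacing such a set by the empty one changes nothing.\<close>

lemma (in finite_measure) measure_tendsto_0:
  assumes ev: "\<And>z. z \<in> space M \<Longrightarrow> eventually (\<lambda>k. z \<notin> S k) sequentially"
  shows "(\<lambda>k. measure M (S k)) \<longlonglongrightarrow> 0"
proof -
  define S' where "S' k = (if S k \<in> sets M then S k else {})" for k
  have [measurable]: "S' k \<in> sets M" for k by (simp add: S'_def)
  have eq: "measure M (S k) = (\<integral>z. indicator (S' k) z \<partial>M)" for k
    by (cases "S k \<in> sets M") (auto simp: S'_def measure_notin_sets sets.Int_space_eq2)
  have "(\<lambda>k. \<integral>z. indicator (S' k) z \<partial>M) \<longlonglongrightarrow> (\<integral>z. (0::real) \<partial>M)"
  proof (rule integral_dominated_convergence[where w="\<lambda>_. 1"])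
    show "AE z in M. (\<lambda>k. indicator (S' k) z :: real) \<longlonglongrightarrow> 0"
    proof (rule AE_I2)
      fix z assume "z \<in> space M"
      from ev[OF this] have "eventually (\<lambda>k. indicator (S' k) z = (0::real)) sequentially"
        by eventually_elim (auto simp: S'_def)
      then show "(\<lambda>k. indicator (S' k) z :: real) \<longlonglongrightarrow> 0" by (rule tendsto_eventually)
    qed
  qed (auto simp: indicator_def)
  then show ?thesis by (simp add: eq)
qed

lemma uniform_modulus:
  fixes f :: "real \<Rightarrow> 'a::real_normed_vector"
  assumes f: "continuous_on {0..t} f" and t: "0 \<le> t" and e: "0 < e"
  shows "eventually (\<lambda>k. \<forall>r\<in>{0..t}. \<forall>s\<in>{0..t}. \<bar>r - s\<bar> \<le> t / real (Suc k) \<longrightarrow> norm (f r - f s) \<le> e) sequentially"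
proof -
  have "uniformly_continuous_on {0..t} f" by (rule compact_uniformly_continuous[OF f]) simp
  then obtain d where d: "d > 0" "\<And>r s. r \<in> {0..t} \<Longrightarrow> s \<in> {0..t} \<Longrightarrow> dist r s < d \<Longrightarrow> dist (f r) (f s) < e"
    using e unfolding uniformly_continuous_on_def by metis
  obtain N where N: "t / d < real N" using reals_Archimedean2 by blast
  show ?thesis
  proof (rule eventually_sequentiallyI[of N], intro ballI impI)
    fix k r s assume k: "N \<le> k" and rs: "r \<in> {0..t}" "s \<in> {0..t}" "\<bar>r - s\<bar> \<le> t / real (Suc k)"
    have "t / d < real (Suc k)" using N k by simp
    then have "t / real (Suc k) < d" using d(1) by (simp add: field_simps)
    then show "norm (f r - f s) \<le> e" using d(2)[OF rs(1,2)] rs(3) by (simp add: dist_norm)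
  qed
qed

lemma simple_value_eq:
  assumes mono: "\<And>i j. i \<le> j \<Longrightarrow> j \<le> n \<Longrightarrow> \<tau> i \<le> \<tau> j" and i: "i < n" and s: "\<tau> i < s" "s \<le> \<tau> (Suc i)"
  shows "simple_value n \<tau> \<xi> s z = \<xi> i z"
proof -
  have "simple_value n \<tau> \<xi> s z = (\<Sum>j<n. if j = i then \<xi> i z else 0)"
    unfolding simple_value_def
  proof (intro sum.cong refl)
    fix j assume j: "j \<in> {..<n}"
    consider "j = i" | "j < i" | "i < j" by linarith
    then show "indicator {\<tau> j<..\<tau> (Suc j)} s *\<^sub>R \<xi> j z = (if j = i then \<xi> i z else 0)"
    proof cases
      case 2
      then have "\<tau> (Suc j) \<le> \<tau> i" using i by (intro mono) auto
      with 2 s show ?thesis by (auto simp: indicator_def)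
    next
      case 3
      then have "\<tau> (Suc i) \<le> \<tau> j" using j by (intro mono) auto
      with 3 s show ?thesis by (auto simp: indicator_def)
    qed (use s in auto)
  qed
  then show ?thesis using i by simp
qed

lemma partition_interval:
  fixes \<tau> :: "nat \<Rightarrow> real"
  assumes "\<tau> 0 < s" "s \<le> \<tau> n"
  obtains i where "i < n" "\<tau> i < s" "s \<le> \<tau> (Suc i)"
proof -
  define i where "i = (LEAST j. s \<le> \<tau> j)"
  have i: "s \<le> \<tau> i" unfolding i_def by (rule LeastI) (rule assms)
  have "i \<noteq> 0" using i assms(1) by (metis not_le)
  then obtain j where j: "i = Suc j" by (cases i) auto
  have "\<not> s \<le> \<tau> j" using not_less_Least[of j "\<lambda>j. s \<le> \<tau> j"] j i_def by simp
  moreover have "i \<le> n" unfolding i_def by (rule Least_le) (rule assms)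
  ultimately show ?thesis using that[of j] i j by auto
qed

text \<open>Summation by parts: against a \<open>C\<^sup>1\<close> path no stochastic integration theory is needed.\<close>

lemma riemann_stieltjes_bound:
  fixes H :: "real \<Rightarrow> 'x::euclidean_space" and w :: "real \<Rightarrow> real"
  assumes H: "\<And>s. s \<in> {0..t} \<Longrightarrow> (H has_vector_derivative H' s) (at s within {0..t})"
    and H': "continuous_on {0..t} H'" "\<And>s. s \<in> {0..t} \<Longrightarrow> norm (H' s) \<le> D"
    and w: "continuous_on {0..t} w" "w 0 = 0"
    and t: "0 \<le> t"
    and osc: "\<And>r s. r \<in> {0..t} \<Longrightarrow> s \<in> {0..t} \<Longrightarrow> \<bar>r - s\<bar> \<le> t / real n \<Longrightarrow> norm (w r - w s) \<le> e"
    and e: "0 \<le> e" and n: "n > 0"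
  defines "\<tau> \<equiv> \<lambda>i. real i * t / real n"
  shows "norm ((\<Sum>i<n. (w (\<tau> (Suc i)) - w (\<tau> i)) *\<^sub>R H (\<tau> i))
    - (w t *\<^sub>R H t - integral {0..t} (\<lambda>s. w s *\<^sub>R H' s))) \<le> e * D * t"
proof -
  have D: "0 \<le> D" using H'(2)[of 0] t order.trans[OF norm_ge_zero] by auto
  have \<tau>_le: "\<tau> j \<le> t" if "j \<le> n" for j
  proof -
    have "real j * t \<le> real n * t" using that t by (intro mult_right_mono) auto
    then show ?thesis using n unfolding \<tau>_def by (simp add: divide_le_eq mult.commute)
  qed
  have \<tau>_0: "0 \<le> \<tau> j" for j unfolding \<tau>_def using t by simp
  have step: "\<tau> (Suc j) = \<tau> j + t / real n" for j unfolding \<tau>_def by (simp add: add_divide_distrib algebra_simps)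
  let ?g = "\<lambda>s. w s *\<^sub>R H' s"
  have g: "continuous_on {0..t} ?g" using w(1) H'(1) by (intro continuous_intros)
  have "norm ((\<Sum>i<j. (w (\<tau> (Suc i)) - w (\<tau> i)) *\<^sub>R H (\<tau> i)) - (w (\<tau> j) *\<^sub>R H (\<tau> j) - integral {0..\<tau> j} ?g))
     \<le> e * D * \<tau> j" if "j \<le> n" for j
    using that
  proof (induction j)
    case 0
    then show ?case by (simp add: \<tau>_def w)
  next
    case (Suc j)
    have le: "\<tau> j \<le> \<tau> (Suc j)" using step t n by simp
    have sub: "{\<tau> j..\<tau> (Suc j)} \<subseteq> {0..t}" using \<tau>_0[of j] \<tau>_le[OF Suc.prems] by auto
    have FTC: "(H' has_integral (H (\<tau> (Suc j)) - H (\<tau> j))) {\<tau> j..\<tau> (Suc j)}"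
      by (rule fundamental_theorem_of_calculus[OF le], rule has_vector_derivative_within_subset[OF H sub])
         (use sub in auto)
    have gi: "?g integrable_on {\<tau> j..\<tau> (Suc j)}"
      by (rule integrable_continuous_real, rule continuous_on_subset[OF g sub])
    have ci: "integral {0..\<tau> j} ?g + integral {\<tau> j..\<tau> (Suc j)} ?g = integral {0..\<tau> (Suc j)} ?g"
      by (rule Henstock_Kurzweil_Integration.integral_combine[OF \<tau>_0 le])
         (rule integrable_continuous_real, rule continuous_on_subset[OF g], use \<tau>_le[OF Suc.prems] in auto)
    have hi: "((\<lambda>s. w (\<tau> (Suc j)) *\<^sub>R H' s - w s *\<^sub>R H' s) has_integral
       (w (\<tau> (Suc j)) *\<^sub>R (H (\<tau> (Suc j)) - H (\<tau> j)) - integral {\<tau> j..\<tau> (Suc j)} ?g)) {\<tau> j..\<tau> (Suc j)}"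
      by (intro has_integral_diff has_integral_cmul FTC integrable_integral gi)
    \<comment> \<open>On one interval of the partition, summation by parts leaves the integral of
      \<open>(w (\<tau> (Suc j)) - w s) H' s\<close>, which the bound on the oscillation of
      \<open>w\<close> makes small.\<close>
    have small: "norm (w (\<tau> (Suc j)) *\<^sub>R (H (\<tau> (Suc j)) - H (\<tau> j)) - integral {\<tau> j..\<tau> (Suc j)} ?g) \<le> (e * D) * (\<tau> (Suc j) - \<tau> j)"
    proof -
      have "norm (w (\<tau> (Suc j)) *\<^sub>R (H (\<tau> (Suc j)) - H (\<tau> j)) - integral {\<tau> j..\<tau> (Suc j)} ?g)
        \<le> (e * D) * measure lborel {\<tau> j..\<tau> (Suc j)}"
      proof (rule has_integral_bound_real[OF _ _ hi, of _ "{}"])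
      show "0 \<le> e * D" using e D by simp
      fix s assume "s \<in> {\<tau> j..\<tau> (Suc j)} - {}"
      then have s: "s \<in> {\<tau> j..\<tau> (Suc j)}" by simp
      have "w (\<tau> (Suc j)) *\<^sub>R H' s - w s *\<^sub>R H' s = (w (\<tau> (Suc j)) - w s) *\<^sub>R H' s" by (simp add: algebra_simps)
      moreover have "norm (w (\<tau> (Suc j)) - w s) \<le> e"
        using s sub le step[of j] by (intro osc) auto
      ultimately show "norm (w (\<tau> (Suc j)) *\<^sub>R H' s - w s *\<^sub>R H' s) \<le> e * D"
        using H'(2)[of s] s sub e by (auto intro!: mult_mono)
      qed simp
      then show ?thesis using le by simp
    qed
    have eq: "(\<Sum>i<Suc j. (w (\<tau> (Suc i)) - w (\<tau> i)) *\<^sub>R H (\<tau> i)) - (w (\<tau> (Suc j)) *\<^sub>R H (\<tau> (Suc j)) - integral {0..\<tau> (Suc j)} ?g)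
      = ((\<Sum>i<j. (w (\<tau> (Suc i)) - w (\<tau> i)) *\<^sub>R H (\<tau> i)) - (w (\<tau> j) *\<^sub>R H (\<tau> j) - integral {0..\<tau> j} ?g))
       - (w (\<tau> (Suc j)) *\<^sub>R (H (\<tau> (Suc j)) - H (\<tau> j)) - integral {\<tau> j..\<tau> (Suc j)} ?g)"
      unfolding ci[symmetric] by (simp add: algebra_simps)
    have "norm ((\<Sum>i<Suc j. (w (\<tau> (Suc i)) - w (\<tau> i)) *\<^sub>R H (\<tau> i)) - (w (\<tau> (Suc j)) *\<^sub>R H (\<tau> (Suc j)) - integral {0..\<tau> (Suc j)} ?g))
      \<le> e * D * \<tau> j + (e * D) * (\<tau> (Suc j) - \<tau> j)"
      unfolding eq by (rule norm_triangle_le_diff, rule add_mono[OF Suc.IH small]) (use Suc.prems in simp)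
    then show ?case by (simp add: algebra_simps)
  qed
  from this[of n] show ?thesis using n by (simp add: \<tau>_def)
qed

context brownian
begin

text \<open>Clamping the time to \<open>[0, t]\<close> extends the process to all real times by
  values known at time \<open>t\<close>, so that joint measurability of continuous processes
  applies.\<close>

lemma adapted_joint_measurable:
  fixes Y :: "real \<Rightarrow> 'w \<Rightarrow> 'x::euclidean_space"
  assumes Y: "\<And>s. 0 \<le> s \<Longrightarrow> Y s \<in> borel_measurable (F s)"
    and cont: "\<And>z. z \<in> space M \<Longrightarrow> continuous_on {0..} (\<lambda>s. Y s z)" and t: "0 \<le> t"
  shows "(\<lambda>(s, z). Y (max 0 (min t s)) z) \<in> borel_measurable (borel \<Otimes>\<^sub>M F t)"
proof (rule borel_measurable_continuous_process)
  fix s show "Y (max 0 (min t s)) \<in> borel_measurable (F t)"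
    using t by (intro measurable_F_mono[OF Y]) auto
next
  fix z assume "z \<in> space (F t)"
  then show "continuous_on UNIV (\<lambda>s. Y (max 0 (min t s)) z)"
    by (intro continuous_on_compose2[OF cont]) (auto simp: space_F intro!: continuous_intros)
qed

lemma progressive_continuous:
  fixes Y :: "real \<Rightarrow> 'w \<Rightarrow> 'x::euclidean_space"
  assumes "\<And>s. 0 \<le> s \<Longrightarrow> Y s \<in> borel_measurable (F s)"
    and "\<And>z. z \<in> space M \<Longrightarrow> continuous_on {0..} (\<lambda>s. Y s z)"
  shows "progressive F Y"
  unfolding progressive_def
proof (intro allI impI)
  fix t :: real assume t: "0 \<le> t"
  have "(\<lambda>(s, z). Y (max 0 (min t s)) z) \<in> borel_measurable (restrict_space borel {0..t} \<Otimes>\<^sub>M F t)"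
  proof -
    have "(\<lambda>x. (fst x, snd x)) \<in> (restrict_space borel {0..t} \<Otimes>\<^sub>M F t) \<rightarrow>\<^sub>M (borel \<Otimes>\<^sub>M F t)"
      by (intro measurable_Pair measurable_snd measurable_compose[OF measurable_fst] measurable_restrict_space1 measurable_ident_sets refl)
    from measurable_compose[OF this adapted_joint_measurable[OF assms t]] show ?thesis by (simp add: split_beta)
  qed
  then show "(\<lambda>(s, z). Y s z) \<in> borel_measurable (restrict_space borel {0..t} \<Otimes>\<^sub>M F t)"
    by (rule measurable_cong[THEN iffD1, rotated]) (auto simp: space_pair_measure space_restrict_space max_def min_def)
qed

lemma adapted_integral:
  fixes Y :: "real \<Rightarrow> 'w \<Rightarrow> 'x::euclidean_space"
  assumes Y: "\<And>s. 0 \<le> s \<Longrightarrow> Y s \<in> borel_measurable (F s)"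
    and cont: "\<And>z. z \<in> space M \<Longrightarrow> continuous_on {0..} (\<lambda>s. Y s z)" and t: "0 \<le> t"
  shows "(\<lambda>z. integral {0..t} (\<lambda>s. Y s z)) \<in> borel_measurable (F t)"
proof -
  have [measurable]: "(\<lambda>(s, z). Y (max 0 (min t s)) z) \<in> borel_measurable (borel \<Otimes>\<^sub>M F t)"
    by (rule adapted_joint_measurable[OF Y cont t])
  have sw: "(\<lambda>x. Y (max 0 (min t (snd x))) (fst x)) \<in> borel_measurable (F t \<Otimes>\<^sub>M lborel)"
    using measurable_compose[OF measurable_pair_swap', of _ "F t" lborel] adapted_joint_measurable[OF Y cont t]
    by (auto simp: split_beta measurable_lborel1 cong: measurable_cong_sets)
  have "(\<lambda>z. \<integral>s. indicator {0..t} s *\<^sub>R Y (max 0 (min t s)) z \<partial>lborel) \<in> borel_measurable (F t)"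
    by (rule lborel.borel_measurable_lebesgue_integral) (use sw in \<open>simp add: split_beta\<close>)
  then show ?thesis
  proof (rule measurable_cong[THEN iffD1, rotated])
    fix z assume "z \<in> space (F t)"
    then have c: "continuous_on {0..t} (\<lambda>s. Y s z)"
      by (intro continuous_on_subset[OF cont]) (auto simp: space_F)
    have "set_integrable lborel {0..t} (\<lambda>s. Y s z)"
      by (rule borel_integrable_compact[OF _ c, folded set_integrable_def]) simp
    from set_borel_integral_eq_integral(2)[OF this]
    show "(\<integral>s. indicator {0..t} s *\<^sub>R Y (max 0 (min t s)) z \<partial>lborel) = integral {0..t} (\<lambda>s. Y s z)"
      unfolding set_lebesgue_integral_def
      by (subst Bochner_Integration.integral_cong[OF refl, of _ _ "\<lambda>s. indicator {0..t} s *\<^sub>R Y s z"])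
         (auto simp: indicator_def max_def min_def)
  qed
qed

text \<open>For differentiable integrands the Ito integral is given by integration by parts.
  Left-point approximations on equidistant partitions converge on every path, for the integrand as
  well as for the integral, which implies convergence in probability.\<close>

lemma has_ito_integral_C1:
  fixes H H' :: "real \<Rightarrow> 'w \<Rightarrow> 'x::euclidean_space"
  assumes H: "\<And>s. 0 \<le> s \<Longrightarrow> H s \<in> borel_measurable (F s)"
    and H': "\<And>s. 0 \<le> s \<Longrightarrow> H' s \<in> borel_measurable (F s)"
    and deriv: "\<And>z s. z \<in> space M \<Longrightarrow> 0 \<le> s \<Longrightarrow> ((\<lambda>s. H s z) has_vector_derivative H' s z) (at s within {0..})"
    and cont': "\<And>z. z \<in> space M \<Longrightarrow> continuous_on {0..} (\<lambda>s. H' s z)"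
    and t: "0 \<le> t"
  shows "has_ito_integral M F (\<lambda>s z. W s z $ l) H t
    (\<lambda>z. (W t z $ l) *\<^sub>R H t z - integral {0..t} (\<lambda>s. (W s z $ l) *\<^sub>R H' s z))"
proof -
  have cont: "continuous_on {0..} (\<lambda>s. H s z)" if "z \<in> space M" for z
    by (rule continuous_on_vector_derivative) (use deriv[OF that] in auto)
  have Wl: "continuous_on {0..} (\<lambda>s. W s z $ l)" if "z \<in> space M" for z
    using W_cont[OF that] by (rule continuous_on_component)
  define \<tau> where "\<tau> = (\<lambda>k i. real i * t / real (Suc k))"
  \<comment> \<open>Simple integrands have to be bounded. On a fixed path over \<open>[0, t]\<close>
    the truncation at height \<open>k\<close> has no effect once \<open>k\<close> is large.\<close>
  define trunc where "trunc = (\<lambda>k (x::'x). if norm x \<le> real k then x else 0)"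
  define \<xi> where "\<xi> = (\<lambda>k i z. trunc k (H (\<tau> k i) z))"
  let ?I = "\<lambda>z. (W t z $ l) *\<^sub>R H t z - integral {0..t} (\<lambda>s. (W s z $ l) *\<^sub>R H' s z)"
  have \<tau>0: "0 \<le> \<tau> k i" for k i using t by (simp add: \<tau>_def)
  have \<tau>mono: "\<tau> k i \<le> \<tau> k j" if "i \<le> j" for k i j
    unfolding \<tau>_def using that t by (intro divide_right_mono mult_right_mono) auto
  have \<tau>n: "\<tau> k (Suc k) = t" for k by (simp add: \<tau>_def)
  have trunc_m: "trunc k \<in> borel_measurable borel" for k
    unfolding trunc_def by measurable
  have simple: "simple_integrand F t (Suc k) (\<tau> k) (\<xi> k)" for k
    unfolding simple_integrand_def
  proof (intro conjI allI impI)
    show "\<tau> k 0 = 0" "\<tau> k (Suc k) = t" by (auto simp: \<tau>_def)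
    fix i
    show "\<tau> k i \<le> \<tau> k (Suc i)" by (rule \<tau>mono) simp
    show "\<xi> k i \<in> borel_measurable (F (\<tau> k i))"
      unfolding \<xi>_def by (rule measurable_compose[OF H[OF \<tau>0] trunc_m])
    show "bounded (\<xi> k i ` space (F (\<tau> k i)))"
      by (rule boundedI[of _ "real k"]) (auto simp: \<xi>_def trunc_def)
  qed
  have trunc_id: "eventually (\<lambda>k. \<forall>s\<in>{0..t}. trunc k (H s z) = H s z) sequentially" if z: "z \<in> space M" for z
  proof -
    have "compact ((\<lambda>s. H s z) ` {0..t})"
      by (intro compact_continuous_image continuous_on_subset[OF cont[OF z]]) auto
    then have "bounded ((\<lambda>s. H s z) ` {0..t})" by (rule compact_imp_bounded)
    then obtain D where "\<forall>x\<in>(\<lambda>s. H s z) ` {0..t}. norm x \<le> D" unfolding bounded_iff by blast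
    then have D: "\<And>s. s \<in> {0..t} \<Longrightarrow> norm (H s z) \<le> D" by blast
    obtain N where "D \<le> real N" using real_arch_simple by blast
    then show ?thesis
      by (intro eventually_sequentiallyI[of N]) (auto simp: trunc_def intro: order.trans[OF D])
  qed
  show ?thesis
    unfolding has_ito_integral_def
  proof (intro conjI exI[of _ "\<lambda>k. Suc k"] exI[of _ \<tau>] exI[of _ \<xi>] allI impI simple)
    show "progressive F H" by (rule progressive_continuous[OF H cont])
    have [measurable]: "H t \<in> borel_measurable M" "W t \<in> borel_measurable M"
      using H[OF t] W_measurable[OF t] measurable_F_M by auto
    have [measurable]: "(\<lambda>z. integral {0..t} (\<lambda>s. (W s z $ l) *\<^sub>R H' s z)) \<in> borel_measurable M"
    proof (rule measurable_F_M, rule adapted_integral[OF _ _ t])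
      fix s :: real assume s: "0 \<le> s"
      have [measurable]: "W s \<in> borel_measurable (F s)" "H' s \<in> borel_measurable (F s)"
        using W_adapted H' s by auto
      have [measurable]: "(\<lambda>z. W s z $ l) \<in> borel_measurable (F s)"
        by (rule measurable_compose[OF _ borel_measurable_nth]) measurable
      show "(\<lambda>z. W s z $ l *\<^sub>R H' s z) \<in> borel_measurable (F s)" by measurable
    next
      fix z assume "z \<in> space M"
      then show "continuous_on {0..} (\<lambda>s. W s z $ l *\<^sub>R H' s z)"
        by (intro continuous_on_scaleR Wl cont')
    qed
    have [measurable]: "(\<lambda>z. W t z $ l) \<in> borel_measurable M"
      by (rule measurable_compose[OF _ borel_measurable_nth]) measurable
    show "?I \<in> borel_measurable M" by measurable
  next
    fix e :: real assume e: "0 < e"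
    show "(\<lambda>k. measure M {z\<in>space M. ennreal e < (\<integral>\<^sup>+s\<in>{0..t}. ennreal ((norm (simple_value (Suc k) (\<tau> k) (\<xi> k) s z - H s z))\<^sup>2) \<partial>lborel)}) \<longlonglongrightarrow> 0"
    proof (rule measure_tendsto_0)
      fix z assume z: "z \<in> space M"
      \<comment> \<open>Chosen such that \<open>d^2 t \<le> e\<close>; the denominator
        \<open>t + 1\<close> also covers \<open>t = 0\<close>.\<close>
      define d where "d = sqrt (e / (t + 1))"
      have d: "d > 0" "d\<^sup>2 * t \<le> e" using e t by (auto simp: d_def field_simps)
      have "eventually (\<lambda>k. (\<forall>s\<in>{0..t}. trunc k (H s z) = H s z) \<and>
          (\<forall>r\<in>{0..t}. \<forall>s\<in>{0..t}. \<bar>r - s\<bar> \<le> t / real (Suc k) \<longrightarrow> norm (H r z - H s z) \<le> d)) sequentially"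
        by (intro eventually_conj trunc_id[OF z] uniform_modulus continuous_on_subset[OF cont[OF z]] t d) auto
      then show "eventually (\<lambda>k. z \<notin> {z\<in>space M. ennreal e < (\<integral>\<^sup>+s\<in>{0..t}. ennreal ((norm (simple_value (Suc k) (\<tau> k) (\<xi> k) s z - H s z))\<^sup>2) \<partial>lborel)}) sequentially"
      proof eventually_elim
        case (elim k)
        have *: "norm (simple_value (Suc k) (\<tau> k) (\<xi> k) s z - H s z) \<le> d" if s: "0 < s" "s \<le> t" for s
        proof -
          obtain i where i: "i < Suc k" "\<tau> k i < s" "s \<le> \<tau> k (Suc i)"
            by (rule partition_interval[of "\<tau> k" s "Suc k"]) (use s in \<open>auto simp: \<tau>_def\<close>)
          have "\<tau> k (Suc i) = \<tau> k i + t / real (Suc k)" by (simp add: \<tau>_def add_divide_distrib distrib_right)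
          then have "\<bar>\<tau> k i - s\<bar> \<le> t / real (Suc k)" using i by simp
          moreover have "\<tau> k i \<in> {0..t}" using \<tau>0 i s by auto
          moreover have "simple_value (Suc k) (\<tau> k) (\<xi> k) s z = \<xi> k i z"
            by (rule simple_value_eq[OF _ i]) (rule \<tau>mono)
          ultimately show ?thesis using elim s by (simp add: \<xi>_def)
        qed
        have "(\<integral>\<^sup>+s\<in>{0..t}. ennreal ((norm (simple_value (Suc k) (\<tau> k) (\<xi> k) s z - H s z))\<^sup>2) \<partial>lborel)
          \<le> (\<integral>\<^sup>+s. ennreal (d\<^sup>2) * indicator {0..t} s \<partial>lborel)"
        proof (rule nn_integral_mono_AE)
          show "AE s in lborel. ennreal ((norm (simple_value (Suc k) (\<tau> k) (\<xi> k) s z - H s z))\<^sup>2) * indicator {0..t} s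
            \<le> ennreal (d\<^sup>2) * indicator {0..t} s"
            using AE_lborel_singleton[of 0]
            by eventually_elim (auto simp: indicator_def intro!: ennreal_leI power_mono *)
        qed
        also have "\<dots> = ennreal (d\<^sup>2 * t)" using t by (simp add: nn_integral_cmult ennreal_mult)
        also have "\<dots> \<le> ennreal e" using d(2) by (rule ennreal_leI)
        finally show ?case by (simp add: not_less)
      qed
    qed
    show "(\<lambda>k. measure M {z\<in>space M. e < norm (simple_integral (\<lambda>s z. W s z $ l) (Suc k) (\<tau> k) (\<xi> k) z - ?I z)}) \<longlonglongrightarrow> 0"
    proof (rule measure_tendsto_0)
      fix z assume z: "z \<in> space M"
      have c': "continuous_on {0..t} (\<lambda>s. H' s z)" by (rule continuous_on_subset[OF cont'[OF z]]) auto
      have cW: "continuous_on {0..t} (\<lambda>s. W s z $ l)" by (rule continuous_on_subset[OF Wl[OF z]]) auto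
      have "bounded ((\<lambda>s. H' s z) ` {0..t})"
        by (intro compact_imp_bounded compact_continuous_image c') auto
      then obtain D0 where "\<forall>x\<in>(\<lambda>s. H' s z) ` {0..t}. norm x \<le> D0" unfolding bounded_iff by blast
      then have D0: "\<And>s. s \<in> {0..t} \<Longrightarrow> norm (H' s z) \<le> D0" by blast
      define D where "D = \<bar>D0\<bar> + 1"
      have D: "\<And>s. s \<in> {0..t} \<Longrightarrow> norm (H' s z) \<le> D" "D > 0" using D0 by (fastforce simp: D_def)+
      define d where "d = e / (D * (t + 1))"
      have "d * D * t = e * (t / (t + 1))" using D(2) by (simp add: d_def)
      also have "\<dots> \<le> e * 1" using e t by (intro mult_left_mono) auto
      finally have d: "d * D * t \<le> e" "d > 0" using e t D(2) by (auto simp: d_def)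
      have "eventually (\<lambda>k. (\<forall>s\<in>{0..t}. trunc k (H s z) = H s z) \<and>
          (\<forall>r\<in>{0..t}. \<forall>s\<in>{0..t}. \<bar>r - s\<bar> \<le> t / real (Suc k) \<longrightarrow> norm (W r z $ l - W s z $ l) \<le> d)) sequentially"
        by (intro eventually_conj uniform_modulus trunc_id[OF z] cW t d)
      then show "eventually (\<lambda>k. z \<notin> {z\<in>space M. e < norm (simple_integral (\<lambda>s z. W s z $ l) (Suc k) (\<tau> k) (\<xi> k) z - ?I z)}) sequentially"
      proof eventually_elim
        case (elim k)
        have "\<tau> k i \<in> {0..t}" if "i < Suc k" for i
          using \<tau>0 \<tau>mono[of i "Suc k" k] \<tau>n[of k] that by auto
        then have "simple_integral (\<lambda>s z. W s z $ l) (Suc k) (\<tau> k) (\<xi> k) z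
          = (\<Sum>i<Suc k. (W (\<tau> k (Suc i)) z $ l - W (\<tau> k i) z $ l) *\<^sub>R H (\<tau> k i) z)"
          unfolding simple_integral_def \<xi>_def using elim by (intro sum.cong refl) auto
        also have "norm (\<dots> - ?I z) \<le> d * D * t"
          unfolding \<tau>_def
        proof (rule riemann_stieltjes_bound)
          fix s assume "s \<in> {0..t}"
          then show "((\<lambda>s. H s z) has_vector_derivative H' s z) (at s within {0..t})"
            by (intro has_vector_derivative_within_subset[OF deriv[OF z]]) auto
        qed (use c' D cW W_0[OF z] t elim d in auto)
        also have "\<dots> \<le> e" by (rule d(1))
        finally show ?case by simp
      qed
    qed
  qed
qed

end

section \<open>Pathwise solutions\<close>

text \<open>Integrates the bound for one Picard difference into the bound for the next.\<close>

lemma has_integral_power_fact: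
  assumes "0 \<le> (t::real)"
  shows "((\<lambda>s. K * (D * (K * s) ^ n / fact n)) has_integral D * (K * t) ^ Suc n / fact (Suc n)) {0..t}"
proof -
  have "((\<lambda>s. K * (D * (K * s) ^ n / fact n)) has_integral (D * (K * t) ^ Suc n / fact (Suc n) - D * (K * 0) ^ Suc n / fact (Suc n))) {0..t}"
  proof (rule fundamental_theorem_of_calculus[OF assms])
    fix s assume "s \<in> {0..t}"
    have "((\<lambda>s. D * (K * s) ^ Suc n / fact (Suc n)) has_real_derivative
        D * (real (Suc n) * (K * s) ^ n * K) / fact (Suc n)) (at s within {0..t})"
      by (auto intro!: derivative_eq_intros simp del: power_Suc fact_Suc of_nat_Suc)
    also have "D * (real (Suc n) * (K * s) ^ n * K) / fact (Suc n) = K * (D * (K * s) ^ n / fact n)"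
      by (simp add: field_simps del: of_nat_Suc)
    finally show "((\<lambda>s. D * (K * s) ^ Suc n / fact (Suc n)) has_vector_derivative K * (D * (K * s) ^ n / fact n)) (at s within {0..t})"
      by (simp add: has_real_derivative_iff_has_vector_derivative)
  qed
  then show ?thesis by simp
qed

lemma has_vector_derivative_within_halfline:
  assumes "(f has_vector_derivative f') (at s within {0..s + 1})" "0 \<le> s"
  shows "(f has_vector_derivative f') (at s within {0..})"
proof -
  have "at s within {0..} = at s within {0..s + 1}"
    by (rule at_within_nhd[of s "{..<s + 1}"]) (use assms(2) in auto)
  with assms show ?thesis by simp
qed

context brownian
begin

text \<open>Picard iteration path by path. All iterates are adapted, because integrals of adapted
  continuous processes are, and adaptedness passes to the pointwise limit. The Lipschitz constant
  may depend on the path and on the time horizon.\<close>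

lemma adapted_ode:
  fixes b :: "real \<Rightarrow> 'w \<Rightarrow> 'x::euclidean_space \<Rightarrow> 'x" and x0 :: 'x
  assumes lip: "\<And>z T. z \<in> space M \<Longrightarrow> 0 \<le> T \<Longrightarrow> \<exists>K\<ge>0. \<forall>s\<in>{0..T}. \<forall>x y. norm (b s z x - b s z y) \<le> K * norm (x - y)"
    and cont: "\<And>z x. z \<in> space M \<Longrightarrow> continuous_on {0..} x \<Longrightarrow> continuous_on {0..} (\<lambda>s. b s z (x s))"
    and meas: "\<And>s \<xi>. 0 \<le> s \<Longrightarrow> \<xi> \<in> borel_measurable (F s) \<Longrightarrow> (\<lambda>z. b s z (\<xi> z)) \<in> borel_measurable (F s)"
  shows "\<exists>X. (\<forall>t\<ge>0. X t \<in> borel_measurable (F t)) \<and> (\<forall>z\<in>space M. X 0 z = x0) \<and>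
    (\<forall>z\<in>space M. \<forall>t\<ge>0. ((\<lambda>t. X t z) has_vector_derivative b t z (X t z)) (at t within {0..}))"
proof -
  define P where "P = rec_nat (\<lambda>t z. x0) (\<lambda>_ X t z. x0 + integral {0..t} (\<lambda>s. b s z (X s z)))"
  have P0: "P 0 t z = x0" and PS: "P (Suc n) t z = x0 + integral {0..t} (\<lambda>s. b s z (P n s z))" for n t z
    by (simp_all add: P_def)
  have Pc: "continuous_on {0..} (\<lambda>t. P n t z)" if z: "z \<in> space M" for n z
  proof (induction n)
    case (Suc n)
    have "continuous_on {0..} (\<lambda>t. integral {0..t} (\<lambda>s. b s z (P n s z)))"
    proof (rule continuous_on_vector_derivative)
      fix t :: real assume t: "t \<in> {0..}"
      have "continuous_on {0..t + 1} (\<lambda>s. b s z (P n s z))"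
        by (rule continuous_on_subset[OF cont[OF z Suc]]) auto
      from integral_has_vector_derivative[OF this, of t] t
      show "((\<lambda>t. integral {0..t} (\<lambda>s. b s z (P n s z))) has_vector_derivative b t z (P n t z)) (at t within {0..})"
        by (intro has_vector_derivative_within_halfline) auto
    qed
    then show ?case unfolding PS by (intro continuous_intros)
  qed (simp add: P0)
  have Pm: "P n t \<in> borel_measurable (F t)" if "0 \<le> t" for n t
    using that
  proof (induction n arbitrary: t)
    case 0
    have "P 0 t = (\<lambda>z. x0)" by (simp add: P0 fun_eq_iff)
    then show ?case by simp
  next
    case (Suc n)
    have "P (Suc n) t = (\<lambda>z. x0 + integral {0..t} (\<lambda>s. b s z (P n s z)))" by (simp add: PS fun_eq_iff)
    moreover have "(\<lambda>z. integral {0..t} (\<lambda>s. b s z (P n s z))) \<in> borel_measurable (F t)"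
      by (rule adapted_integral[OF meas[OF _ Suc.IH] cont[OF _ Pc] Suc.prems])
    ultimately show ?case by simp
  qed
  have int: "(\<lambda>s. b s z (P n s z)) integrable_on {0..t}" if "z \<in> space M" for z n t
    by (intro integrable_continuous_real continuous_on_subset[OF cont[OF that Pc[OF that]]]) auto
  have ul: "\<exists>l. uniform_limit {0..T} (\<lambda>n t. P n t z) l sequentially" if z: "z \<in> space M" and T: "0 \<le> T" for z T
  proof -
    obtain K where K: "K \<ge> 0" "\<And>s x y. s \<in> {0..T} \<Longrightarrow> norm (b s z x - b s z y) \<le> K * norm (x - y)"
      using lip[OF z T] by blast
    have "bounded ((\<lambda>t. P 1 t z - P 0 t z) ` {0..T})"
      by (intro compact_imp_bounded compact_continuous_image continuous_on_diff continuous_on_subset[OF Pc[OF z]]) auto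
    then obtain D where "\<forall>x\<in>(\<lambda>t. P 1 t z - P 0 t z) ` {0..T}. norm x \<le> D" unfolding bounded_iff by blast
    then have D: "norm (P 1 t z - P 0 t z) \<le> D" if "t \<in> {0..T}" for t using that by blast
    have D0: "0 \<le> D" using D[of 0] T order.trans[OF norm_ge_zero] by auto
    have bound: "norm (P (Suc n) t z - P n t z) \<le> D * (K * t) ^ n / fact n" if "t \<in> {0..T}" for n t
      using that
    proof (induction n arbitrary: t)
      case (Suc n)
      have "P (Suc (Suc n)) t z - P (Suc n) t z
        = integral {0..t} (\<lambda>s. b s z (P (Suc n) s z) - b s z (P n s z))"
        unfolding PS[of "Suc n"] PS[of n t] using int[OF z, of "Suc n" t] int[OF z, of n t]
        by (simp add: Henstock_Kurzweil_Integration.integral_diff)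
      also have "norm \<dots> \<le> integral {0..t} (\<lambda>s. K * (D * (K * s) ^ n / fact n))"
      proof (rule integral_norm_bound_integral)
        show "(\<lambda>s. b s z (P (Suc n) s z) - b s z (P n s z)) integrable_on {0..t}"
          using int[OF z] by (intro Henstock_Kurzweil_Integration.integrable_diff)
        show "(\<lambda>s. K * (D * (K * s) ^ n / fact n)) integrable_on {0..t}"
          using has_integral_power_fact[of t] Suc.prems by (auto simp: integrable_on_def)
        fix s assume s: "s \<in> {0..t}"
        then have s': "s \<in> {0..T}" using Suc.prems by auto
        show "norm (b s z (P (Suc n) s z) - b s z (P n s z)) \<le> K * (D * (K * s) ^ n / fact n)"
          by (rule order.trans[OF K(2)[OF s'] mult_left_mono[OF Suc.IH[OF s'] K(1)]])
      qed
      also have "\<dots> = D * (K * t) ^ Suc n / fact (Suc n)"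
        using has_integral_power_fact[of t K D n] Suc.prems by (intro integral_unique) auto
      finally show ?case .
    qed (use D in simp)
    \<comment> \<open>The iterates are the partial sums of their differences, which are dominated by
      an exponential series in \<open>K T\<close>.\<close>
    have "uniform_limit {0..T} (\<lambda>n t. \<Sum>i<n. P (Suc i) t z - P i t z) (\<lambda>t. \<Sum>i. P (Suc i) t z - P i t z) sequentially"
    proof (rule Weierstrass_m_test)
      fix n t assume t: "t \<in> {0..T}"
      show "norm (P (Suc n) t z - P n t z) \<le> D * ((K * T) ^ n /\<^sub>R fact n)"
      proof (rule order.trans[OF bound[OF t]])
        have "(K * t) ^ n \<le> (K * T) ^ n" using t K(1) by (intro power_mono mult_left_mono) auto
        then show "D * (K * t) ^ n / fact n \<le> D * ((K * T) ^ n /\<^sub>R fact n)"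
          using D0 by (auto simp: field_simps intro!: mult_left_mono)
      qed
    next
      show "summable (\<lambda>n. D * ((K * T) ^ n /\<^sub>R fact n))"
        by (intro summable_mult summable_exp_generic)
    qed
    then have "uniform_limit {0..T} (\<lambda>n t. x0 + (\<Sum>i<n. P (Suc i) t z - P i t z)) (\<lambda>t. x0 + (\<Sum>i. P (Suc i) t z - P i t z)) sequentially"
      by (intro uniform_limit_intros)
    moreover have "x0 + (\<Sum>i<n. P (Suc i) t z - P i t z) = P n t z" for n t
      using sum_lessThan_telescope[of "\<lambda>i. P i t z" n] by (simp add: P0)
    ultimately show ?thesis by auto
  qed
  define X where "X t z = lim (\<lambda>n. P n t z)" for t z
  have ulX: "uniform_limit {0..T} (\<lambda>n t. P n t z) (\<lambda>t. X t z) sequentially" if z: "z \<in> space M" and T: "0 \<le> T" for z T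
  proof -
    obtain l where l: "uniform_limit {0..T} (\<lambda>n t. P n t z) l sequentially" using ul[OF z T] by blast
    have "l t = X t z" if "t \<in> {0..T}" for t
      using tendsto_uniform_limitI[OF l that] by (simp add: X_def limI)
    with l show ?thesis by (subst uniform_limit_cong'[of "{0..T}" _ "\<lambda>n t. P n t z" _ l]) auto
  qed
  have PX: "(\<lambda>n. P n t z) \<longlonglongrightarrow> X t z" if "z \<in> space M" "0 \<le> t" for t z
    using tendsto_uniform_limitI[OF ulX[OF that], of t] that by simp
  have Xm: "X t \<in> borel_measurable (F t)" if "0 \<le> t" for t
    by (rule borel_measurable_LIMSEQ_metric[OF Pm[OF that] PX[OF _ that]]) (simp add: space_F)
  have XcT: "continuous_on {0..T} (\<lambda>t. X t z)" if z: "z \<in> space M" and T: "0 \<le> T" for z T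
    by (rule uniform_limit_theorem[OF _ ulX[OF that]])
       (auto intro!: always_eventually continuous_on_subset[OF Pc[OF z]])
  have Xc: "continuous_on {0..} (\<lambda>t. X t z)" if z: "z \<in> space M" for z
    unfolding continuous_on_eq_continuous_within
  proof
    fix t :: real assume t: "t \<in> {0..}"
    have "at t within {0..} = at t within {0..t + 1}"
      by (rule at_within_nhd[of t "{..<t + 1}"]) (use t in auto)
    then show "continuous (at t within {0..}) (\<lambda>t. X t z)"
      using XcT[OF z, of "t + 1"] t by (simp add: continuous_on_eq_continuous_within)
  qed
  have intX: "X t z = x0 + integral {0..t} (\<lambda>s. b s z (X s z))" if z: "z \<in> space M" and t: "0 \<le> t" for z t
  proof -
    obtain K where K: "K \<ge> 0" "\<And>s x y. s \<in> {0..t} \<Longrightarrow> norm (b s z x - b s z y) \<le> K * norm (x - y)"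
      using lip[OF z t] by blast
    have iX: "(\<lambda>s. b s z (X s z)) integrable_on {0..t}"
      by (intro integrable_continuous_real continuous_on_subset[OF cont[OF z Xc[OF z]]]) auto
    have "(\<lambda>n. integral {0..t} (\<lambda>s. b s z (P n s z))) \<longlonglongrightarrow> integral {0..t} (\<lambda>s. b s z (X s z))"
    proof (rule LIMSEQ_I)
      fix e :: real assume e: "0 < e"
      define d where "d = e / ((K + 1) * (t + 1))"
      have d: "d > 0" using e K(1) t by (auto simp: d_def intro!: divide_pos_pos mult_pos_pos)
      from uniform_limitD[OF ulX[OF z t] d]
      obtain N where N: "\<And>n s. n \<ge> N \<Longrightarrow> s \<in> {0..t} \<Longrightarrow> dist (P n s z) (X s z) < d"
        unfolding eventually_sequentially by blast
      have "norm (integral {0..t} (\<lambda>s. b s z (P n s z)) - integral {0..t} (\<lambda>s. b s z (X s z))) < e" if n: "n \<ge> N" for n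
      proof -
        have "norm (integral {0..t} (\<lambda>s. b s z (P n s z) - b s z (X s z))) \<le> integral {0..t} (\<lambda>s. K * d)"
        proof (rule integral_norm_bound_integral)
          fix s assume s: "s \<in> {0..t}"
          show "norm (b s z (P n s z) - b s z (X s z)) \<le> K * d"
            using order.trans[OF K(2)[OF s] mult_left_mono[OF less_imp_le K(1)]] N[OF n s] by (simp add: dist_norm)
        qed (use int[OF z] iX in \<open>auto intro!: Henstock_Kurzweil_Integration.integrable_diff\<close>)
        also have "\<dots> = K * d * t" using t by simp
        also have "\<dots> < (K + 1) * d * (t + 1)"
        proof -
          have "(K + 1) * d * (t + 1) - K * d * t = K * d + d * t + d" by (simp add: algebra_simps)
          moreover have "0 \<le> K * d" "0 \<le> d * t" using K(1) d t by auto
          ultimately show ?thesis using d by linarith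
        qed
        also have "\<dots> = e" using K(1) t by (simp add: d_def)
        finally show ?thesis
          using int[OF z] iX by (simp add: Henstock_Kurzweil_Integration.integral_diff)
      qed
      then show "\<exists>no. \<forall>n\<ge>no. norm (integral {0..t} (\<lambda>s. b s z (P n s z)) - integral {0..t} (\<lambda>s. b s z (X s z))) < e"
        by blast
    qed
    then have "(\<lambda>n. P (Suc n) t z) \<longlonglongrightarrow> x0 + integral {0..t} (\<lambda>s. b s z (X s z))"
      unfolding PS by (intro tendsto_intros)
    with LIMSEQ_Suc[OF PX[OF z t]] show ?thesis by (rule LIMSEQ_unique)
  qed
  have Xd: "((\<lambda>t. X t z) has_vector_derivative b t z (X t z)) (at t within {0..})"
    if z: "z \<in> space M" and t: "0 \<le> t" for z t
  proof -
    have "continuous_on {0..t + 1} (\<lambda>s. b s z (X s z))"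
      by (rule continuous_on_subset[OF cont[OF z Xc[OF z]]]) auto
    from integral_has_vector_derivative[OF this, of t] t
    have "((\<lambda>t. x0 + integral {0..t} (\<lambda>s. b s z (X s z))) has_vector_derivative b t z (X t z)) (at t within {0..})"
      by (intro has_vector_derivative_within_halfline) (auto intro!: derivative_eq_intros)
    then show ?thesis
      by (rule has_vector_derivative_transform[rotated 2]) (use t intX[OF z] in auto)
  qed
  show ?thesis
    using Xm Xd intX[of _ 0] by (intro exI[of _ X]) auto
qed

end

text \<open>
  The undamped oscillator, with the noise \<open>\<epsilon> \<gamma> \<bullet> W\<close> absorbed into the momentum:
  \<open>p = r + \<epsilon> (\<gamma> \<bullet> W) y\<close>, so that \<open>v - B W\<close>, \<open>y\<close> and \<open>r\<close> solve ordinary differential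
  equations path by path.
\<close>

locale oscillator = brownian M F W
  for M :: "'w measure" and F :: "real \<Rightarrow> 'w measure" and W :: "real \<Rightarrow> 'w \<Rightarrow> real^'m" +
  fixes A :: "real^'d^'d" and B :: "real^'m^'d" and a :: "real^'d" and \<gamma> :: "real^'m"
    and \<kappa> :: real and \<epsilon> :: real
    and v :: "real \<Rightarrow> 'w \<Rightarrow> real^'d" and y r :: "real \<Rightarrow> 'w \<Rightarrow> real"
  assumes v_adapted: "\<And>t. 0 \<le> t \<Longrightarrow> v t \<in> borel_measurable (F t)"
    and y_adapted: "\<And>t. 0 \<le> t \<Longrightarrow> y t \<in> borel_measurable (F t)"
    and r_adapted: "\<And>t. 0 \<le> t \<Longrightarrow> r t \<in> borel_measurable (F t)"
    and v_0: "\<And>z. z \<in> space M \<Longrightarrow> v 0 z = 0"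
    and y_0: "\<And>z. z \<in> space M \<Longrightarrow> y 0 z = 0"
    and r_0: "\<And>z. z \<in> space M \<Longrightarrow> r 0 z = 1"
    and v_deriv: "\<And>z t. z \<in> space M \<Longrightarrow> 0 \<le> t \<Longrightarrow>
      ((\<lambda>t. v t z - B *v W t z) has_vector_derivative A *v v t z) (at t within {0..})"
    and y_deriv: "\<And>z t. z \<in> space M \<Longrightarrow> 0 \<le> t \<Longrightarrow>
      ((\<lambda>t. y t z) has_real_derivative r t z + \<epsilon> * (\<gamma> \<bullet> W t z) * y t z) (at t within {0..})"
    and r_deriv: "\<And>z t. z \<in> space M \<Longrightarrow> 0 \<le> t \<Longrightarrow>
      ((\<lambda>t. r t z) has_real_derivative - \<kappa>\<^sup>2 * y t z + \<epsilon> * (a \<bullet> v t z) * y t z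
        - \<epsilon> * (\<gamma> \<bullet> W t z) * (r t z + \<epsilon> * (\<gamma> \<bullet> W t z) * y t z)) (at t within {0..})"
    and \<kappa>_pos: "0 < \<kappa>"

text \<open>Two equations in succession: \<open>u = v - B W\<close>, then the pair
  \<open>(y, r)\<close>, with the \<open>v\<close> just constructed and \<open>W\<close> as
  continuous coefficients. Both are affine in the unknown, hence Lipschitz uniformly on bounded time
  intervals.\<close>

lemma (in brownian) exists_oscillator:
  fixes A :: "real^'d^'d" and B :: "real^'m^'d" and a :: "real^'d" and \<gamma> :: "real^'m"
  assumes "0 < \<kappa>"
  shows "\<exists>v y r. oscillator M F W A B a \<gamma> \<kappa> \<epsilon> v y r"
proof -
  obtain KA where KA: "KA \<ge> 0" "\<And>x. norm (A *v x) \<le> norm x * KA"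
    using bounded_linear.nonneg_bounded[OF matrix_vector_mul_bounded_linear[of A]] by blast
  have mA: "((*v) A) \<in> borel_measurable borel" and mB: "((*v) B) \<in> borel_measurable borel"
    by (intro borel_measurable_continuous_onI linear_continuous_on matrix_vector_mul_bounded_linear)+
  have cA: "continuous_on S (\<lambda>s. A *v x s)" if "continuous_on S x" for S :: "real set" and x
    by (rule bounded_linear.continuous_on[OF matrix_vector_mul_bounded_linear that])
  have cB: "continuous_on S (\<lambda>s. B *v x s)" if "continuous_on S x" for S :: "real set" and x
    by (rule bounded_linear.continuous_on[OF matrix_vector_mul_bounded_linear that])
  have "\<exists>u. (\<forall>t\<ge>0. u t \<in> borel_measurable (F t)) \<and> (\<forall>z\<in>space M. u 0 z = 0) \<and>
    (\<forall>z\<in>space M. \<forall>t\<ge>0. ((\<lambda>t. u t z) has_vector_derivative A *v (u t z + B *v W t z)) (at t within {0..}))"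
  proof (rule adapted_ode[of "\<lambda>s z x. A *v (x + B *v W s z)" 0])
    fix z and T :: real assume "z \<in> space M" "0 \<le> T"
    show "\<exists>K\<ge>0. \<forall>s\<in>{0..T}. \<forall>x y. norm (A *v (x + B *v W s z) - A *v (y + B *v W s z)) \<le> K * norm (x - y)"
      using KA by (intro exI[of _ KA]) (auto simp: matrix_vector_mult_diff_distrib[symmetric] mult.commute simp del: matrix_vector_mult_diff_distrib)
  next
    fix z and x :: "real \<Rightarrow> real^'d" assume "z \<in> space M" "continuous_on {0..} x"
    then show "continuous_on {0..} (\<lambda>s. A *v (x s + B *v W s z))"
      by (intro cA cB continuous_on_add W_cont)
  next
    fix s :: real and \<xi> :: "'w \<Rightarrow> real^'d" assume "0 \<le> s" and [measurable]: "\<xi> \<in> borel_measurable (F s)"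
    then have [measurable]: "W s \<in> borel_measurable (F s)" by (intro W_adapted)
    note [measurable] = mA mB
    show "(\<lambda>z. A *v (\<xi> z + B *v W s z)) \<in> borel_measurable (F s)" by measurable
  qed
  then obtain u where u: "\<And>t. 0 \<le> t \<Longrightarrow> u t \<in> borel_measurable (F t)" "\<And>z. z \<in> space M \<Longrightarrow> u 0 z = 0"
    "\<And>z t. z \<in> space M \<Longrightarrow> 0 \<le> t \<Longrightarrow> ((\<lambda>t. u t z) has_vector_derivative A *v (u t z + B *v W t z)) (at t within {0..})"
    by blast
  define v where "v t z = u t z + B *v W t z" for t z
  have v_m: "v t \<in> borel_measurable (F t)" if "0 \<le> t" for t
  proof -
    have [measurable]: "W t \<in> borel_measurable (F t)" "u t \<in> borel_measurable (F t)" using that u W_adapted by auto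
    note [measurable] = mB
    show ?thesis unfolding v_def by measurable
  qed
  have v_c: "continuous_on {0..} (\<lambda>t. v t z)" if "z \<in> space M" for z
    unfolding v_def
    by (intro continuous_on_add cB W_cont[OF that] continuous_on_vector_derivative[where f="\<lambda>t. u t z"])
      (use u(3)[OF that] in auto)
  define n where "n t z = \<epsilon> * (\<gamma> \<bullet> W t z)" for t z
  have n_m: "n t \<in> borel_measurable (F t)" if "0 \<le> t" for t
  proof -
    have [measurable]: "W t \<in> borel_measurable (F t)" using that W_adapted by auto
    show ?thesis unfolding n_def by measurable
  qed
  have n_c: "continuous_on {0..} (\<lambda>t. n t z)" if "z \<in> space M" for z
    unfolding n_def by (intro continuous_intros W_cont that)
  let ?b = "\<lambda>s z x. (snd x + n s z * fst x, - \<kappa>\<^sup>2 * fst x + \<epsilon> * (a \<bullet> v s z) * fst x - n s z * (snd x + n s z * fst x))"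
  have "\<exists>X :: real \<Rightarrow> 'w \<Rightarrow> real \<times> real. (\<forall>t\<ge>0. X t \<in> borel_measurable (F t)) \<and> (\<forall>z\<in>space M. X 0 z = (0, 1)) \<and>
    (\<forall>z\<in>space M. \<forall>t\<ge>0. ((\<lambda>t. X t z) has_vector_derivative ?b t z (X t z)) (at t within {0..}))"
  proof (rule adapted_ode[of ?b "(0, 1)"])
    fix z and T :: real assume z: "z \<in> space M" and T: "0 \<le> T"
    have "bounded ((\<lambda>s. n s z) ` {0..T})" "bounded ((\<lambda>s. \<epsilon> * (a \<bullet> v s z)) ` {0..T})"
      by (auto intro!: compact_imp_bounded compact_continuous_image continuous_intros
          continuous_on_subset[OF v_c[OF z]] continuous_on_subset[OF n_c[OF z]])
    then obtain N V where NV: "\<forall>x\<in>(\<lambda>s. n s z) ` {0..T}. norm x \<le> N" "\<forall>x\<in>(\<lambda>s. \<epsilon> * (a \<bullet> v s z)) ` {0..T}. norm x \<le> V"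
      unfolding bounded_iff by blast
    have N0: "0 \<le> N" and V0: "0 \<le> V" using NV T by (force intro: order.trans[OF norm_ge_zero])+
    show "\<exists>K\<ge>0. \<forall>s\<in>{0..T}. \<forall>x y. norm (?b s z x - ?b s z y) \<le> K * norm (x - y)"
    proof (intro exI[of _ "(1 + N) + (\<kappa>\<^sup>2 + V + N * (1 + N))"] conjI ballI allI)
      show "0 \<le> (1 + N) + (\<kappa>\<^sup>2 + V + N * (1 + N))" using N0 V0 by auto
      fix s and x y :: "real \<times> real" assume s: "s \<in> {0..T}"
      define p q where "p = fst (x - y)" and "q = snd (x - y)"
      have pq: "\<bar>p\<bar> \<le> norm (x - y)" "\<bar>q\<bar> \<le> norm (x - y)"
        unfolding p_def q_def by (metis norm_fst_le norm_snd_le real_norm_def prod.collapse)+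
      have Ns: "\<bar>n s z\<bar> \<le> N" and Vs: "\<bar>\<epsilon> * (a \<bullet> v s z)\<bar> \<le> V" using NV s by (force simp del: abs_mult)+
      have e: "?b s z x - ?b s z y = (q + n s z * p, - \<kappa>\<^sup>2 * p + \<epsilon> * (a \<bullet> v s z) * p - n s z * (q + n s z * p))"
        by (simp add: p_def q_def algebra_simps prod_eq_iff)
      have 1: "\<bar>q + n s z * p\<bar> \<le> (1 + N) * norm (x - y)"
        using mult_mono[OF Ns pq(1)] N0 pq(2) abs_triangle_ineq[of q "n s z * p"] by (simp add: abs_mult algebra_simps)
      have 2: "\<bar>n s z * (q + n s z * p)\<bar> \<le> N * ((1 + N) * norm (x - y))"
        using mult_mono[OF Ns 1] N0 by (simp add: abs_mult)
      have 3: "\<bar>\<epsilon> * (a \<bullet> v s z) * p\<bar> \<le> V * norm (x - y)"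
        using mult_mono[OF Vs pq(1)] V0 by (simp add: abs_mult)
      have 4: "\<bar>- \<kappa>\<^sup>2 * p\<bar> \<le> \<kappa>\<^sup>2 * norm (x - y)"
        using mult_left_mono[OF pq(1), of "\<kappa>\<^sup>2"] by (simp add: abs_mult)
      have "norm (?b s z x - ?b s z y) \<le> \<bar>q + n s z * p\<bar> + \<bar>- \<kappa>\<^sup>2 * p + \<epsilon> * (a \<bullet> v s z) * p - n s z * (q + n s z * p)\<bar>"
        unfolding e using norm_Pair_le by (metis real_norm_def)
      also have "\<dots> \<le> (1 + N) * norm (x - y) + (\<kappa>\<^sup>2 * norm (x - y) + V * norm (x - y) + N * ((1 + N) * norm (x - y)))"
        using 1 2 3 4 by linarith
      also have "\<dots> = ((1 + N) + (\<kappa>\<^sup>2 + V + N * (1 + N))) * norm (x - y)" by (simp add: algebra_simps)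
      finally show "norm (?b s z x - ?b s z y) \<le> ((1 + N) + (\<kappa>\<^sup>2 + V + N * (1 + N))) * norm (x - y)" .
    qed
  next
    fix z and x :: "real \<Rightarrow> real \<times> real" assume "z \<in> space M" "continuous_on {0..} x"
    then show "continuous_on {0..} (\<lambda>s. ?b s z (x s))"
      by (intro continuous_intros v_c n_c)
  next
    fix s :: real and \<xi> :: "'w \<Rightarrow> real \<times> real" assume s: "0 \<le> s" and [measurable]: "\<xi> \<in> borel_measurable (F s)"
    note [measurable] = v_m[OF s] n_m[OF s]
    have [measurable]: "(\<lambda>z. fst (\<xi> z)) \<in> borel_measurable (F s)" "(\<lambda>z. snd (\<xi> z)) \<in> borel_measurable (F s)"
      by (auto intro!: measurable_compose[OF \<open>\<xi> \<in> _\<close>] borel_measurable_continuous_onI continuous_intros)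
    show "(\<lambda>z. ?b s z (\<xi> z)) \<in> borel_measurable (F s)"
      by (rule borel_measurable_Pair) measurable
  qed
  then obtain X :: "real \<Rightarrow> 'w \<Rightarrow> real \<times> real" where X: "\<And>t. 0 \<le> t \<Longrightarrow> X t \<in> borel_measurable (F t)" "\<And>z. z \<in> space M \<Longrightarrow> X 0 z = (0, 1)"
    "\<And>z t. z \<in> space M \<Longrightarrow> 0 \<le> t \<Longrightarrow> ((\<lambda>t. X t z) has_vector_derivative ?b t z (X t z)) (at t within {0..})"
    by blast
  have "oscillator M F W A B a \<gamma> \<kappa> \<epsilon> v (\<lambda>t z. fst (X t z)) (\<lambda>t z. snd (X t z))"
  proof (unfold_locales)
    fix t :: real assume t: "0 \<le> t"
    show "(\<lambda>z. fst (X t z)) \<in> borel_measurable (F t)" "(\<lambda>z. snd (X t z)) \<in> borel_measurable (F t)"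
      by (auto intro!: measurable_compose[OF X(1)[OF t]] borel_measurable_continuous_onI continuous_intros)
  next
    fix z assume z: "z \<in> space M"
    show "v 0 z = 0" using u(2) W_0 z by (simp add: v_def)
    fix t :: real assume t: "0 \<le> t"
    show "((\<lambda>t. v t z - B *v W t z) has_vector_derivative A *v v t z) (at t within {0..})"
      using u(3)[OF z t] by (simp add: v_def)
    have "((\<lambda>t. fst (X t z)) has_vector_derivative fst (?b t z (X t z))) (at t within {0..})"
      "((\<lambda>t. snd (X t z)) has_vector_derivative snd (?b t z (X t z))) (at t within {0..})"
      by (intro bounded_linear.has_vector_derivative[OF bounded_linear_fst] bounded_linear.has_vector_derivative[OF bounded_linear_snd] X(3)[OF z t])+
    then show "((\<lambda>t. fst (X t z)) has_real_derivative snd (X t z) + \<epsilon> * (\<gamma> \<bullet> W t z) * fst (X t z)) (at t within {0..})"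
      "((\<lambda>t. snd (X t z)) has_real_derivative - \<kappa>\<^sup>2 * fst (X t z) + \<epsilon> * (a \<bullet> v t z) * fst (X t z)
        - \<epsilon> * (\<gamma> \<bullet> W t z) * (snd (X t z) + \<epsilon> * (\<gamma> \<bullet> W t z) * fst (X t z))) (at t within {0..})"
      by (simp_all add: has_real_derivative_iff_has_vector_derivative n_def)
  qed (use X(2) v_m assms in auto)
  then show ?thesis by blast
qed

section \<open>The damped oscillator\<close>

context oscillator
begin

definition noise :: "real \<Rightarrow> 'w \<Rightarrow> real" where "noise t z = \<epsilon> * (\<gamma> \<bullet> W t z)"

definition momentum :: "real \<Rightarrow> 'w \<Rightarrow> real" where "momentum t z = r t z + noise t z * y t z"

definition phase :: "real \<Rightarrow> 'w \<Rightarrow> complex" where "phase t z = Complex (momentum t z) (\<kappa> * y t z)"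

lemma noise_0: "z \<in> space M \<Longrightarrow> noise 0 z = 0"
  by (simp add: noise_def W_0)

lemma noise_cont: "z \<in> space M \<Longrightarrow> continuous_on {0..} (\<lambda>t. noise t z)"
  unfolding noise_def by (intro continuous_intros W_cont)

lemma y_cont: "z \<in> space M \<Longrightarrow> continuous_on {0..} (\<lambda>t. y t z)"
  and r_cont: "z \<in> space M \<Longrightarrow> continuous_on {0..} (\<lambda>t. r t z)"
  using y_deriv r_deriv by (auto intro!: DERIV_continuous_on)

lemma BW_cont: "z \<in> space M \<Longrightarrow> continuous_on {0..} (\<lambda>t. B *v W t z)"
  by (rule bounded_linear.continuous_on[OF matrix_vector_mul_bounded_linear W_cont])

lemma v_cont: 
  assumes "z \<in> space M"
  shows "continuous_on {0..} (\<lambda>t. v t z)"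
proof -
  have "continuous_on {0..} (\<lambda>t. v t z - B *v W t z)"
    by (rule continuous_on_vector_derivative) (use v_deriv[OF assms] in auto)
  from continuous_on_add[OF this BW_cont[OF assms]] show ?thesis by simp
qed

lemma momentum_cont: "z \<in> space M \<Longrightarrow> continuous_on {0..} (\<lambda>t. momentum t z)"
  unfolding momentum_def by (intro continuous_intros r_cont noise_cont y_cont)

lemma noise_adapted: "0 \<le> t \<Longrightarrow> noise t \<in> borel_measurable (F t)"
  unfolding noise_def using W_adapted[of t] by (intro borel_measurable_times borel_measurable_inner) auto

lemma momentum_adapted: "0 \<le> t \<Longrightarrow> momentum t \<in> borel_measurable (F t)"
  unfolding momentum_def using r_adapted[of t] noise_adapted[of t] y_adapted[of t]
  by (intro borel_measurable_add borel_measurable_times) auto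

lemma r_deriv':
  assumes "z \<in> space M" "0 \<le> t"
  shows "((\<lambda>t. r t z) has_real_derivative - \<kappa>\<^sup>2 * y t z + \<epsilon> * (a \<bullet> v t z) * y t z
    - noise t z * momentum t z) (at t within {0..})"
  and y_deriv': "((\<lambda>t. y t z) has_real_derivative momentum t z) (at t within {0..})"
  using r_deriv[OF assms] y_deriv[OF assms] by (simp_all add: noise_def momentum_def)

text \<open>Gronwall's argument for a lower bound: on \<open>[0, T]\<close> the energy satisfies
  \<open>E' \<ge> - K E\<close>, so \<open>exp (K s) E\<close> increases from its initial value one.
  The coordinate \<open>r\<close> is used because, unlike the momentum, it is differentiable by
  construction.\<close>

lemma energy_pos:
  assumes z: "z \<in> space M" and T: "0 \<le> T"
  shows "0 < (y T z)\<^sup>2 + (r T z)\<^sup>2"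
proof -
  let ?n = "\<lambda>s. noise s z" and ?V = "\<lambda>s. \<epsilon> * (a \<bullet> v s z)" and ?y = "\<lambda>s. y s z" and ?r = "\<lambda>s. r s z"
  have "bounded (?n ` {0..T})" "bounded (?V ` {0..T})"
    by (auto intro!: compact_imp_bounded compact_continuous_image continuous_intros
        continuous_on_subset[OF v_cont[OF z]] continuous_on_subset[OF noise_cont[OF z]])
  then obtain N V where "\<forall>x\<in>?n ` {0..T}. norm x \<le> N" "\<forall>x\<in>?V ` {0..T}. norm x \<le> V"
    unfolding bounded_iff by blast
  then have N: "\<bar>?n s\<bar> \<le> N" and V: "\<bar>?V s\<bar> \<le> V" if "s \<in> {0..T}" for s
    using that by (auto simp del: abs_mult)
  have N0: "0 \<le> N" using order.trans[OF abs_ge_zero N[of 0]] T by simp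
  define K where "K = 1 + 2 * N + (\<kappa>\<^sup>2 + V + 2 * N + N * N)"
  let ?E = "\<lambda>s. (?y s)\<^sup>2 + (?r s)\<^sup>2"
  let ?E' = "\<lambda>s. 2 * ?y s * momentum s z + 2 * ?r s * (- \<kappa>\<^sup>2 * ?y s + ?V s * ?y s - ?n s * momentum s z)"
  have Ed: "(?E has_real_derivative ?E' s) (at s within {0..})" if "0 \<le> s" for s
    by (auto intro!: derivative_eq_intros r_deriv'[OF z that] y_deriv'[OF z that])
  have E': "0 \<le> ?E' s + K * ?E s" if s: "s \<in> {0..T}" for s
  proof -
    let ?e = "?E s"
    have e0: "0 \<le> ?e" by simp
    have c: "\<bar>2 * ?y s * ?r s\<bar> \<le> ?e" "(?y s)\<^sup>2 \<le> ?e" "(?r s)\<^sup>2 \<le> ?e"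
      using sum_squares_bound[of "?y s" "?r s"] sum_squares_bound[of "- ?y s" "?r s"] by (auto simp: abs_le_iff)
    have b: "\<bar>u * x\<bar> \<le> U * ?e" if "\<bar>u\<bar> \<le> U" "\<bar>x\<bar> \<le> ?e" for u x U
      using mult_mono[OF that] e0 order.trans[OF abs_ge_zero that(1)] by (simp add: abs_mult)
    have nn: "\<bar>?n s * ?n s\<bar> \<le> N * N" using mult_mono[OF N[OF s] N[OF s]] N0 by (simp add: abs_mult)
    have "?E' s = 2 * ?y s * ?r s + 2 * (?n s * (?y s)\<^sup>2) + ((- \<kappa>\<^sup>2) * (2 * ?y s * ?r s) + ?V s * (2 * ?y s * ?r s)
        + - (2 * (?n s * (?r s)\<^sup>2)) - (?n s * ?n s) * (2 * ?y s * ?r s))"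
      by (simp add: momentum_def power2_eq_square algebra_simps)
    moreover have "\<bar>?n s * (?y s)\<^sup>2\<bar> \<le> N * ?e" "\<bar>?n s * (?r s)\<^sup>2\<bar> \<le> N * ?e"
      "\<bar>(- \<kappa>\<^sup>2) * (2 * ?y s * ?r s)\<bar> \<le> \<kappa>\<^sup>2 * ?e" "\<bar>?V s * (2 * ?y s * ?r s)\<bar> \<le> V * ?e"
      "\<bar>(?n s * ?n s) * (2 * ?y s * ?r s)\<bar> \<le> (N * N) * ?e"
      by (rule b; use N[OF s] V[OF s] nn c in simp)+
    moreover have "K * ?e = ?e + 2 * (N * ?e) + (\<kappa>\<^sup>2 * ?e + V * ?e + 2 * (N * ?e) + (N * N) * ?e)"
      by (simp add: K_def algebra_simps)
    ultimately show ?thesis using c(1) by linarith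
  qed
  have "exp (K * 0) * ?E 0 \<le> exp (K * T) * ?E T"
  proof (rule DERIV_nonneg_imp_increasing_open[OF T])
    fix s assume s: "0 < s" "s < T"
    have at: "at s within {0..} = at s" by (rule at_within_interior) (use s in simp)
    have "((\<lambda>s. exp (K * s) * ?E s) has_real_derivative exp (K * s) * (?E' s + K * ?E s)) (at s)"
    proof (rule DERIV_cong)
      have "((\<lambda>s. exp (K * s)) has_real_derivative K * exp (K * s)) (at s)"
        by (auto intro!: derivative_eq_intros)
      from DERIV_mult[OF this Ed[of s, unfolded at]] s
      show "((\<lambda>s. exp (K * s) * ?E s) has_real_derivative K * exp (K * s) * ?E s + ?E' s * exp (K * s)) (at s)"
        by simp
    qed (simp add: algebra_simps)
    then show "\<exists>d. ((\<lambda>s. exp (K * s) * ?E s) has_real_derivative d) (at s) \<and> 0 \<le> d"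
      using E'[of s] s by (intro exI[of _ "exp (K * s) * (?E' s + K * ?E s)"]) auto
  next
    show "continuous_on {0..T} (\<lambda>s. exp (K * s) * ?E s)"
      by (intro continuous_intros continuous_on_subset[OF y_cont[OF z]] continuous_on_subset[OF r_cont[OF z]]) auto
  qed
  then have "0 < exp (K * T) * ?E T" using y_0[OF z] r_0[OF z] by simp
  then show ?thesis by (simp add: zero_less_mult_iff)
qed

lemma phase_nonzero:
  assumes "z \<in> space M" "0 \<le> t"
  shows "phase t z \<noteq> 0"
  using energy_pos[OF assms] \<kappa>_pos by (auto simp: phase_def complex_eq_iff momentum_def)

text \<open>With \<open>\<phi> = exp (- \<zeta> t) y\<close> the damping disappears from the
  equation for \<open>y\<close> and the squared frequency drops by \<open>\<zeta>^2\<close>. The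
  last component is the derivative of \<open>\<phi>\<close>, since the momentum is the derivative of
  \<open>y\<close>.\<close>

definition damped :: "real \<Rightarrow> real \<Rightarrow> 'w \<Rightarrow> (real^'d) \<times> real \<times> real" where
  "damped \<zeta> t z = (v t z, exp (- \<zeta> * t) * y t z, exp (- \<zeta> * t) * (momentum t z - \<zeta> * y t z))"

text \<open>Along the path the diffusion coefficient is differentiable, because
  \<open>\<phi>\<close> is, so its Ito integral is explicit. Subtracting the boundary terms
  \<open>W H\<close> of that integral leaves a differentiable process \<open>G\<close>, for which
  the equation becomes the fundamental theorem of calculus.\<close>

lemma ito_solution_damped:
  assumes \<kappa>0: "\<kappa>0\<^sup>2 = \<kappa>\<^sup>2 + \<zeta>\<^sup>2"
  shows "ito_solution M F W (osc_drift A a \<kappa>0 \<zeta> \<epsilon>) (osc_diffusion B \<gamma> \<epsilon>) (damped \<zeta>)"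
proof -
  define \<phi> where "\<phi> t z = exp (- \<zeta> * t) * y t z" for t z
  define \<psi> where "\<psi> t z = exp (- \<zeta> * t) * (momentum t z - \<zeta> * y t z)" for t z
  have X: "damped \<zeta> t z = (v t z, \<phi> t z, \<psi> t z)" for t z
    by (simp add: damped_def \<phi>_def \<psi>_def)
  define H where "H l t z = (column l B, 0::real, \<epsilon> * \<gamma> $ l * \<phi> t z)" for l t z
  define H' where "H' l t z = (0 :: real^'d, 0::real, \<epsilon> * \<gamma> $ l * \<psi> t z)" for l t z
  have HX: "(\<lambda>s z. osc_diffusion B \<gamma> \<epsilon> l (damped \<zeta> s z)) = H l" for l
    by (simp add: osc_diffusion_def X H_def fun_eq_iff)
  have \<phi>_ad: "\<phi> t \<in> borel_measurable (F t)" and \<psi>_ad: "\<psi> t \<in> borel_measurable (F t)" if "0 \<le> t" for t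
    unfolding \<phi>_def \<psi>_def using y_adapted[OF that] momentum_adapted[OF that] by measurable
  have \<phi>_c: "continuous_on {0..} (\<lambda>t. \<phi> t z)" and \<psi>_c: "continuous_on {0..} (\<lambda>t. \<psi> t z)" if "z \<in> space M" for z
    unfolding \<phi>_def \<psi>_def using that by (intro continuous_intros y_cont momentum_cont; simp)+
  have \<phi>_d: "((\<lambda>t. \<phi> t z) has_real_derivative \<psi> t z) (at t within {0..})" if "z \<in> space M" "0 \<le> t" for z t
    unfolding \<phi>_def \<psi>_def
    by (auto intro!: derivative_eq_intros y_deriv'[OF that] simp: algebra_simps)
  have H_d: "((\<lambda>t. H l t z) has_vector_derivative H' l t z) (at t within {0..})" if "z \<in> space M" "0 \<le> t" for l z t
    unfolding H_def H'_def
    by (intro has_vector_derivative_Pair has_vector_derivative_const)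
       (auto simp flip: has_real_derivative_iff_has_vector_derivative intro!: derivative_eq_intros \<phi>_d[OF that])
  have H_ad: "H l t \<in> borel_measurable (F t)" and H'_ad: "H' l t \<in> borel_measurable (F t)" if "0 \<le> t" for l t
    unfolding H_def H'_def using \<phi>_ad[OF that] \<psi>_ad[OF that] by (intro borel_measurable_Pair; measurable)+
  have H'_c: "continuous_on {0..} (\<lambda>t. H' l t z)" if "z \<in> space M" for l z
    unfolding H'_def by (intro continuous_intros \<psi>_c that)
  define I where "I t l z = (W t z $ l) *\<^sub>R H l t z - integral {0..t} (\<lambda>s. (W s z $ l) *\<^sub>R H' l s z)" for t l z
  have hasI: "has_ito_integral M F (\<lambda>s z. W s z $ l) (H l) t (I t l)" if "0 \<le> t" for t l
    unfolding I_def by (rule has_ito_integral_C1[OF H_ad H'_ad H_d H'_c that])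
  have sumWH: "(\<Sum>l\<in>UNIV. (W t z $ l) *\<^sub>R H l t z) = (B *v W t z, 0, noise t z * \<phi> t z)" for t z
    unfolding H_def by (simp add: prod_eq_iff fst_sum snd_sum matrix_mult_sum scalar_mult_eq_scaleR noise_def
        inner_vec_def sum_distrib_left sum_distrib_right mult_ac)
  have sumWH': "(\<Sum>l\<in>UNIV. (W t z $ l) *\<^sub>R H' l t z) = (0, 0, noise t z * \<psi> t z)" for t z
    unfolding H'_def by (simp add: prod_eq_iff fst_sum snd_sum noise_def
        inner_vec_def sum_distrib_left sum_distrib_right mult_ac)
  have eq: "damped \<zeta> t z = damped \<zeta> 0 z + integral {0..t} (\<lambda>s. osc_drift A a \<kappa>0 \<zeta> \<epsilon> (damped \<zeta> s z)) + (\<Sum>l\<in>UNIV. I t l z)"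
    if z: "z \<in> space M" and t: "0 \<le> t" for t z
  proof -
    let ?b = "\<lambda>s. osc_drift A a \<kappa>0 \<zeta> \<epsilon> (damped \<zeta> s z)"
    define G where "G s = damped \<zeta> s z - (\<Sum>l\<in>UNIV. (W s z $ l) *\<^sub>R H l s z)" for s
    have G: "G s = (v s z - B *v W s z, \<phi> s z, exp (- \<zeta> * s) * (r s z - \<zeta> * y s z))" for s
      unfolding G_def sumWH X by (simp add: \<phi>_def \<psi>_def momentum_def algebra_simps)
    have Gd: "(G has_vector_derivative ?b s - (\<Sum>l\<in>UNIV. (W s z $ l) *\<^sub>R H' l s z)) (at s within {0..})" if s: "0 \<le> s" for s
    proof -
      have 3: "((\<lambda>s. exp (- \<zeta> * s) * (r s z - \<zeta> * y s z)) has_real_derivative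
          - 2 * \<zeta> * \<psi> s z - (\<kappa>0\<^sup>2 - \<epsilon> * (a \<bullet> v s z)) * \<phi> s z - noise s z * \<psi> s z) (at s within {0..})"
        unfolding \<kappa>0 \<psi>_def \<phi>_def
        by (auto intro!: derivative_eq_intros r_deriv'[OF z s] y_deriv'[OF z s])
           (simp add: momentum_def algebra_simps power2_eq_square)
      have "(G has_vector_derivative (A *v v s z, \<psi> s z, - 2 * \<zeta> * \<psi> s z - (\<kappa>0\<^sup>2 - \<epsilon> * (a \<bullet> v s z)) * \<phi> s z - noise s z * \<psi> s z)) (at s within {0..})"
        unfolding G
        by (intro has_vector_derivative_Pair v_deriv[OF z s] \<phi>_d[OF z s, unfolded has_real_derivative_iff_has_vector_derivative]
            3[unfolded has_real_derivative_iff_has_vector_derivative])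
      then show ?thesis unfolding sumWH' by (simp add: osc_drift_def X)
    qed
    have int: "((\<lambda>s. ?b s - (\<Sum>l\<in>UNIV. (W s z $ l) *\<^sub>R H' l s z)) has_integral (G t - G 0)) {0..t}"
      by (rule fundamental_theorem_of_calculus[OF t], rule has_vector_derivative_within_subset[OF Gd]) auto
    have WH'i: "(\<lambda>s. (W s z $ l) *\<^sub>R H' l s z) integrable_on {0..t}" for l
      by (intro integrable_continuous_real continuous_on_scaleR continuous_on_subset[OF H'_c[OF z]]
           continuous_on_component continuous_on_subset[OF W_cont[OF z]]) auto
    have "((\<lambda>s. (?b s - (\<Sum>l\<in>UNIV. (W s z $ l) *\<^sub>R H' l s z)) + (\<Sum>l\<in>UNIV. (W s z $ l) *\<^sub>R H' l s z)) has_integral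
       (G t - G 0 + (\<Sum>l\<in>UNIV. integral {0..t} (\<lambda>s. (W s z $ l) *\<^sub>R H' l s z)))) {0..t}"
      by (intro has_integral_add int has_integral_sum integrable_integral WH'i) auto
    then have "integral {0..t} ?b = G t - G 0 + (\<Sum>l\<in>UNIV. integral {0..t} (\<lambda>s. (W s z $ l) *\<^sub>R H' l s z))"
      by (simp add: integral_unique)
    moreover have "G 0 = damped \<zeta> 0 z" unfolding G_def using W_0[OF z] by simp
    ultimately show ?thesis
      unfolding I_def sum_subtractf by (simp add: G_def)
  qed
  show ?thesis
    unfolding ito_solution_def HX
  proof (intro conjI allI impI ballI)
    fix t :: real assume t: "0 \<le> t"
    have "(\<lambda>z. (v t z, \<phi> t z, \<psi> t z)) \<in> borel_measurable (F t)"
      using v_adapted[OF t] \<phi>_ad[OF t] \<psi>_ad[OF t] by (intro borel_measurable_Pair) auto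
    then show "damped \<zeta> t \<in> borel_measurable (F t)" by (simp add: X[abs_def])
    show "\<exists>I. (\<forall>l. has_ito_integral M F (\<lambda>s z. W s z $ l) (H l) t (I l)) \<and>
      (AE z in M. damped \<zeta> t z = damped \<zeta> 0 z + integral {0..t} (\<lambda>s. osc_drift A a \<kappa>0 \<zeta> \<epsilon> (damped \<zeta> s z)) + (\<Sum>l\<in>UNIV. I l z))"
      using hasI[OF t] eq[OF _ t] by (intro exI[of _ "I t"]) auto
  next
    fix z assume "z \<in> space M"
    then show "continuous_on {0..} (\<lambda>t. damped \<zeta> t z)"
      unfolding X by (intro continuous_intros v_cont \<phi>_c \<psi>_c)
  qed
qed

lemma damped_norm_bounds:
  assumes "0 < \<zeta>"
  shows "norm (snd (damped \<zeta> t z)) \<le> exp (- \<zeta> * t) * ((1 / \<kappa> + 1 + \<zeta> / \<kappa>) * cmod (phase t z))"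
    and "exp (- \<zeta> * t) * cmod (phase t z) \<le> (1 + \<zeta> + \<kappa>) * norm (snd (damped \<zeta> t z))"
proof -
  let ?y = "y t z" and ?p = "momentum t z" and ?z = "phase t z"
  have nrm: "norm (snd (damped \<zeta> t z)) = exp (- \<zeta> * t) * norm (?y, ?p - \<zeta> * ?y)"
  proof -
    have "snd (damped \<zeta> t z) = exp (- \<zeta> * t) *\<^sub>R (?y, ?p - \<zeta> * ?y)" by (simp add: damped_def)
    then show ?thesis by (simp only: norm_scaleR abs_exp_cancel)
  qed
  have y: "\<bar>?y\<bar> \<le> cmod ?z / \<kappa>" using abs_Im_le_cmod[of ?z] \<kappa>_pos by (simp add: phase_def abs_mult field_simps)
  have p: "\<bar>?p\<bar> \<le> cmod ?z" using abs_Re_le_cmod[of ?z] by (simp add: phase_def)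
  have "norm (?y, ?p - \<zeta> * ?y) \<le> \<bar>?y\<bar> + \<bar>?p - \<zeta> * ?y\<bar>" using norm_Pair_le[of ?y "?p - \<zeta> * ?y"] by simp
  also have "\<dots> \<le> \<bar>?y\<bar> + (\<bar>?p\<bar> + \<zeta> * \<bar>?y\<bar>)"
    using abs_triangle_ineq4[of ?p "\<zeta> * ?y"] assms by (simp add: abs_mult)
  also have "\<dots> \<le> cmod ?z / \<kappa> + (cmod ?z + \<zeta> * (cmod ?z / \<kappa>))"
    using y p assms by (intro add_mono mult_left_mono) auto
  also have "\<dots> = (1 / \<kappa> + 1 + \<zeta> / \<kappa>) * cmod ?z" by (simp add: algebra_simps)
  finally show "norm (snd (damped \<zeta> t z)) \<le> exp (- \<zeta> * t) * ((1 / \<kappa> + 1 + \<zeta> / \<kappa>) * cmod ?z)"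
    unfolding nrm by (rule mult_left_mono) simp
  let ?N = "norm (?y, ?p - \<zeta> * ?y)"
  have y': "\<bar>?y\<bar> \<le> ?N" and p': "\<bar>?p - \<zeta> * ?y\<bar> \<le> ?N"
    using norm_fst_le[of ?y "?p - \<zeta> * ?y"] norm_snd_le[of "?p - \<zeta> * ?y" ?y] by auto
  have "cmod ?z \<le> \<bar>?p\<bar> + \<bar>\<kappa> * ?y\<bar>" using cmod_le[of ?z] by (simp add: phase_def)
  also have "\<dots> \<le> (\<bar>?p - \<zeta> * ?y\<bar> + \<zeta> * \<bar>?y\<bar>) + \<kappa> * \<bar>?y\<bar>"
    using abs_triangle_ineq[of "?p - \<zeta> * ?y" "\<zeta> * ?y"] assms \<kappa>_pos by (simp add: abs_mult)
  also have "\<dots> \<le> (?N + \<zeta> * ?N) + \<kappa> * ?N"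
    using y' p' assms \<kappa>_pos by (intro add_mono mult_left_mono) auto
  also have "\<dots> = (1 + \<zeta> + \<kappa>) * ?N" by (simp add: algebra_simps)
  finally have "exp (- \<zeta> * t) * cmod ?z \<le> exp (- \<zeta> * t) * ((1 + \<zeta> + \<kappa>) * ?N)" by (rule mult_left_mono) simp
  then show "exp (- \<zeta> * t) * cmod ?z \<le> (1 + \<zeta> + \<kappa>) * norm (snd (damped \<zeta> t z))"
    unfolding nrm by (simp add: mult_ac)
qed

text \<open>Equivalent norms have the same growth rate, since the logarithms of the constants vanish
  after division by \<open>t\<close>; the factor \<open>exp (- \<zeta> t)\<close> accounts for the
  shift by \<zeta>.\<close>

lemma lyapunov_undamped:
  assumes L: "is_lyapunov_exponent M F W A B a \<gamma> \<kappa>0 \<zeta> \<epsilon> L"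
    and \<kappa>0: "\<kappa>0\<^sup>2 = \<kappa>\<^sup>2 + \<zeta>\<^sup>2" and \<zeta>: "0 < \<zeta>"
  shows "AE z in M. ((\<lambda>t. ln (cmod (phase t z)) / t) \<longlongrightarrow> L + \<zeta>) at_top"
proof -
  have "AE z in M. snd (damped \<zeta> 0 z) \<noteq> (0, 0)"
    by (rule AE_I2) (simp add: damped_def momentum_def noise_0 y_0 r_0)
  with L ito_solution_damped[OF \<kappa>0]
  have "AE z in M. ((\<lambda>t. ln (norm (snd (damped \<zeta> t z))) / t) \<longlongrightarrow> L) at_top"
    unfolding is_lyapunov_exponent_def by blast
  moreover have "AE z in M. ((\<lambda>t. ln (norm (snd (damped \<zeta> t z))) / t) \<longlongrightarrow> L) at_top \<longrightarrow>
    ((\<lambda>t. ln (cmod (phase t z)) / t) \<longlongrightarrow> L + \<zeta>) at_top"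
  proof (rule AE_I2, rule impI)
    fix z assume z: "z \<in> space M" and lim: "((\<lambda>t. ln (norm (snd (damped \<zeta> t z))) / t) \<longlongrightarrow> L) at_top"
    let ?N = "\<lambda>t. norm (snd (damped \<zeta> t z))" and ?Z = "\<lambda>t. cmod (phase t z)"
    define C1 where "C1 = 1 / \<kappa> + 1 + \<zeta> / \<kappa>"
    define C2 where "C2 = 1 + \<zeta> + \<kappa>"
    have C: "0 < C1" "0 < C2" using \<zeta> \<kappa>_pos by (auto simp: C1_def C2_def intro!: add_pos_pos)
    have bounds: "ln (?N t) / t + \<zeta> - ln C1 / t \<le> ln (?Z t) / t \<and> ln (?Z t) / t \<le> ln (?N t) / t + \<zeta> + ln C2 / t"
      if t: "0 < t" for t
    proof -
      have Z: "0 < ?Z t" using phase_nonzero[OF z, of t] t by simp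
      have 2: "exp (- \<zeta> * t) * ?Z t \<le> C2 * ?N t" unfolding C2_def by (rule damped_norm_bounds[OF \<zeta>])
      have "0 < exp (- \<zeta> * t) * ?Z t" using Z by simp
      with 2 have "0 < C2 * ?N t" by linarith
      then have N: "0 < ?N t" using C by (simp add: zero_less_mult_iff)
      have 1: "?N t \<le> exp (- \<zeta> * t) * (C1 * ?Z t)" unfolding C1_def by (rule damped_norm_bounds[OF \<zeta>])
      have "ln (?N t) \<le> ln (exp (- \<zeta> * t) * (C1 * ?Z t))" using 1 N by (intro ln_mono) auto
      also have "\<dots> = - \<zeta> * t + (ln C1 + ln (?Z t))" using C Z by (simp add: ln_mult)
      finally have l1: "ln (?N t) + \<zeta> * t - ln C1 \<le> ln (?Z t)" by simp
      have "ln (exp (- \<zeta> * t) * ?Z t) \<le> ln (C2 * ?N t)" using 2 Z by (intro ln_mono) auto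
      then have l2: "ln (?Z t) \<le> ln (?N t) + \<zeta> * t + ln C2" using C Z N by (simp add: ln_mult)
      from divide_right_mono[OF l1, of t] divide_right_mono[OF l2, of t] t
      show ?thesis by (simp add: add_divide_distrib diff_divide_distrib)
    qed
    have inv: "((\<lambda>t. c / t) \<longlongrightarrow> 0) at_top" for c :: real
      by (rule tendsto_divide_0[OF tendsto_const]) (simp add: filterlim_at_top_imp_at_infinity filterlim_ident)
    show "((\<lambda>t. ln (?Z t) / t) \<longlongrightarrow> L + \<zeta>) at_top"
    proof (rule tendsto_sandwich)
      show "eventually (\<lambda>t. ln (?N t) / t + \<zeta> - ln C1 / t \<le> ln (?Z t) / t) at_top"
        "eventually (\<lambda>t. ln (?Z t) / t \<le> ln (?N t) / t + \<zeta> + ln C2 / t) at_top"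
        using bounds by (auto intro: eventually_mono[OF eventually_gt_at_top[of 0]])
      show "((\<lambda>t. ln (?N t) / t + \<zeta> - ln C1 / t) \<longlongrightarrow> L + \<zeta>) at_top"
        using tendsto_diff[OF tendsto_add[OF lim tendsto_const] inv] by simp
      show "((\<lambda>t. ln (?N t) / t + \<zeta> + ln C2 / t) \<longlongrightarrow> L + \<zeta>) at_top"
        using tendsto_add[OF tendsto_add[OF lim tendsto_const] inv] by simp
    qed
  qed
  ultimately show ?thesis by (rule AE_mp)
qed

end

section \<open>Moments of the driving process\<close>

lemma nn_integral_Icc_continuous:
  fixes g :: "real \<Rightarrow> real"
  assumes g: "continuous_on {c..t} g" and pos: "\<And>s. s \<in> {c..t} \<Longrightarrow> 0 \<le> g s"
  shows "(\<integral>\<^sup>+s\<in>{c..t}. ennreal (g s) \<partial>lborel) = ennreal (integral {c..t} g)"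
proof -
  have int: "set_integrable lborel {c..t} g"
    by (rule borel_integrable_compact[OF _ g, folded set_integrable_def]) simp
  have "(\<integral>\<^sup>+s\<in>{c..t}. ennreal (g s) \<partial>lborel) = (\<integral>\<^sup>+s. ennreal (indicator {c..t} s *\<^sub>R g s) \<partial>lborel)"
    by (intro nn_integral_cong) (auto simp: indicator_def)
  also have "\<dots> = ennreal (\<integral>s. indicator {c..t} s *\<^sub>R g s \<partial>lborel)"
    using int pos by (intro nn_integral_eq_integral) (auto simp: set_integrable_def indicator_def)
  also have "(\<integral>s. indicator {c..t} s *\<^sub>R g s \<partial>lborel) = integral {c..t} g"
    using set_borel_integral_eq_integral(2)[OF int] by (simp add: set_lebesgue_integral_def)
  finally show ?thesis .
qed

lemma stable_decay_mv:
  fixes A :: "real^'d^'d"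
  assumes "stable_matrix A"
  obtains C \<delta> where "C > 0" "\<delta> > 0"
    "\<And>t x. t \<ge> 0 \<Longrightarrow> norm (mat_exp (t *\<^sub>R A) *v x) \<le> C * exp (- \<delta> * t) * norm x"
    "\<And>t x. t \<ge> 0 \<Longrightarrow> norm (transpose (mat_exp (t *\<^sub>R A)) *v x) \<le> C * exp (- \<delta> * t) * norm x"
proof -
  obtain C \<delta> where C: "C > 0" "\<delta> > 0" "\<And>t i j. t \<ge> 0 \<Longrightarrow> \<bar>mat_exp (t *\<^sub>R A) $ i $ j\<bar> \<le> C * exp (- \<delta> * t)"
    using stable_mat_exp_decay[OF assms] by blast
  define n where "n = real CARD('d)"
  have n: "n > 0" by (simp add: n_def)
  have *: "norm (M *v x) \<le> n * (n * (K * norm x))"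
    if M: "\<And>i j. \<bar>M $ i $ j\<bar> \<le> K" for M :: "real^'d^'d" and K x
  proof -
    have "norm (M *v x) \<le> (\<Sum>i\<in>UNIV. \<bar>(M *v x) $ i\<bar>)" by (rule norm_le_l1_cart)
    also have "\<dots> \<le> (\<Sum>i\<in>(UNIV::'d set). \<Sum>j\<in>(UNIV::'d set). K * norm x)"
    proof (intro sum_mono)
      fix i
      have "\<bar>(M *v x) $ i\<bar> \<le> (\<Sum>j\<in>UNIV. \<bar>M $ i $ j * x $ j\<bar>)"
        unfolding matrix_vector_mult_def vec_lambda_beta by (rule sum_abs)
      also have "\<dots> \<le> (\<Sum>j\<in>(UNIV::'d set). K * norm x)"
        unfolding abs_mult
        by (intro sum_mono mult_mono M order.trans[OF abs_ge_zero M] component_le_norm_cart abs_ge_zero)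
      finally show "\<bar>(M *v x) $ i\<bar> \<le> (\<Sum>j\<in>(UNIV::'d set). K * norm x)" .
    qed
    finally show ?thesis by (simp add: n_def)
  qed
  show ?thesis
  proof (rule that[of "n * n * C" \<delta>])
    show "n * n * C > 0" using n C(1) by simp
    show "\<delta> > 0" by (rule C(2))
    fix t :: real and x :: "real^'d" assume t: "t \<ge> 0"
    show "norm (mat_exp (t *\<^sub>R A) *v x) \<le> n * n * C * exp (- \<delta> * t) * norm x"
      using *[of "mat_exp (t *\<^sub>R A)", OF C(3)[OF t]] by (simp add: mult.assoc)
    have "\<bar>transpose (mat_exp (t *\<^sub>R A)) $ i $ j\<bar> \<le> C * exp (- \<delta> * t)" for i j
      using C(3)[OF t] by (simp add: transpose_def)
    from *[OF this] show "norm (transpose (mat_exp (t *\<^sub>R A)) *v x) \<le> n * n * C * exp (- \<delta> * t) * norm x"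
      by (simp add: mult.assoc del: transpose_matrix_vector)
  qed
qed

lemma power_sum_le:
  fixes f :: "'k \<Rightarrow> real"
  assumes "finite S" "\<And>k. k \<in> S \<Longrightarrow> 0 \<le> f k" "0 < p"
  shows "(\<Sum>k\<in>S. f k) ^ p \<le> real (card S) ^ p * (\<Sum>k\<in>S. f k ^ p)"
proof (cases "S = {}")
  case False
  define m where "m = Max (f ` S)"
  have m: "f k \<le> m" if "k \<in> S" for k using assms that by (auto simp: m_def)
  have "m \<in> f ` S" unfolding m_def by (rule Max_in) (use assms False in auto)
  then obtain k0 where k0: "k0 \<in> S" "m = f k0" by blast
  have "(\<Sum>k\<in>S. f k) \<le> real (card S) * m" using m sum_bounded_above[of S f m] by simp
  then have "(\<Sum>k\<in>S. f k) ^ p \<le> (real (card S) * m) ^ p" using assms by (intro power_mono sum_nonneg)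
  also have "\<dots> = real (card S) ^ p * f k0 ^ p" by (simp add: power_mult_distrib k0)
  also have "\<dots> \<le> real (card S) ^ p * (\<Sum>k\<in>S. f k ^ p)"
    using assms k0 by (intro mult_left_mono member_le_sum) auto
  finally show ?thesis .
qed (use assms in \<open>simp add: power_0_left\<close>)

lemma ennreal_power_add_le: "(x + y :: ennreal) ^ p \<le> 2 ^ p * (x ^ p + y ^ p)"
proof -
  have "(x + y) ^ p \<le> (2 * max x y) ^ p"
    by (intro power_mono) (auto simp: mult_2 intro: add_mono)
  also have "\<dots> = 2 ^ p * max x y ^ p" by (rule power_mult_distrib)
  also have "\<dots> \<le> 2 ^ p * (x ^ p + y ^ p)"
    by (intro mult_left_mono) (auto simp: max_def)
  finally show ?thesis .
qed

lemma time_exp_bound: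
  assumes "0 < \<delta>" "0 \<le> u"
  shows "u * exp (- \<delta> * u) \<le> 1 / (\<delta>::real)"
proof -
  have "\<delta> * u \<le> exp (\<delta> * u)" using exp_ge_add_one_self[of "\<delta> * u"] by linarith
  then show ?thesis using assms by (simp add: exp_minus field_simps)
qed

context brownian
begin

definition wmom :: "nat \<Rightarrow> real" where
  "wmom j = real CARD('m) ^ (2 ^ Suc j) * (real CARD('m) * gauss_moment j)"

lemma wmom_nonneg: "0 \<le> wmom j"
  by (simp add: wmom_def gauss_moment_def)

lemma W_norm_moment:
  assumes st: "0 \<le> s" "s \<le> t"
  shows "(\<integral>\<^sup>+z. ennreal (norm (W t z - W s z)) ^ (2 ^ Suc j) \<partial>M) \<le> ennreal (wmom j * (t - s) ^ (2 ^ j))"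
proof (cases "s = t")
  case False
  let ?p = "2 ^ Suc j :: nat"
  have st': "s < t" using st False by simp
  have [measurable]: "W s \<in> borel_measurable M" "W t \<in> borel_measurable M" using st by (auto intro: W_measurable)
  have [measurable]: "(\<lambda>z. (W t z - W s z) $ l) \<in> borel_measurable M" for l
    by (rule measurable_compose[OF _ borel_measurable_nth]) measurable
  have *: "norm x ^ ?p \<le> real CARD('m) ^ ?p * (\<Sum>l\<in>UNIV. \<bar>x $ l\<bar> ^ ?p)" for x :: "real^'m"
  proof -
    have "norm x ^ ?p \<le> (\<Sum>l\<in>UNIV. \<bar>x $ l\<bar>) ^ ?p" by (intro power_mono norm_le_l1_cart) simp
    also have "\<dots> \<le> real CARD('m) ^ ?p * (\<Sum>l\<in>UNIV. \<bar>x $ l\<bar> ^ ?p)" by (rule power_sum_le) auto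
    finally show ?thesis .
  qed
  have "(\<integral>\<^sup>+z. ennreal (norm (W t z - W s z)) ^ ?p \<partial>M)
    \<le> (\<integral>\<^sup>+z. ennreal (real CARD('m) ^ ?p) * (\<Sum>l\<in>UNIV. ennreal \<bar>(W t z - W s z) $ l\<bar> ^ ?p) \<partial>M)"
  proof (intro nn_integral_mono)
    fix z
    have "ennreal (norm (W t z - W s z)) ^ ?p = ennreal (norm (W t z - W s z) ^ ?p)" by (simp add: ennreal_power)
    also have "\<dots> \<le> ennreal (real CARD('m) ^ ?p * (\<Sum>l\<in>UNIV. \<bar>(W t z - W s z) $ l\<bar> ^ ?p))" by (rule ennreal_leI[OF *])
    also have "\<dots> = ennreal (real CARD('m) ^ ?p) * (\<Sum>l\<in>UNIV. ennreal \<bar>(W t z - W s z) $ l\<bar> ^ ?p)"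
      by (simp add: ennreal_mult sum_nonneg ennreal_power sum_ennreal del: power_Suc)
    finally show "ennreal (norm (W t z - W s z)) ^ ?p \<le> ennreal (real CARD('m) ^ ?p) * (\<Sum>l\<in>UNIV. ennreal \<bar>(W t z - W s z) $ l\<bar> ^ ?p)" .
  qed
  also have "\<dots> = ennreal (real CARD('m) ^ ?p) * (\<Sum>l\<in>(UNIV::'m set). ennreal (gauss_moment j * (t - s) ^ (2 ^ j)))"
    by (subst nn_integral_cmult, measurable, subst nn_integral_sum, measurable) (simp only: W_incr_moment[OF st(1) st'])
  also have "\<dots> = ennreal (wmom j * (t - s) ^ (2 ^ j))"
    using st by (subst sum_ennreal) (auto simp: wmom_def gauss_moment_def ennreal_mult'[symmetric] mult_ac simp del: power_Suc)
  finally show ?thesis .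
qed (simp add: power_0_left)

end

context oscillator
begin

text \<open>Variation of constants after an integration by parts that recentres \<open>W\<close> at
  its final value. The integrand involves \<open>W t - W s\<close>, whose moments grow with
  \<open>t - s\<close> and are compensated by the decay of the flow; this makes moment bounds
  uniform in \<open>t\<close> possible.\<close>

lemma v_formula:
  assumes z: "z \<in> space M" and t: "0 \<le> t"
  shows "((\<lambda>s. mat_exp ((t - s) *\<^sub>R A) *v (A *v (B *v (W t z - W s z)))) has_integral
     (mat_exp (t *\<^sub>R A) *v (B *v W t z) - v t z)) {0..t}"
proof -
  \<comment> \<open>Differentiable in \<open>s\<close>, and equal to \<open>v\<close> at the final
    time \<open>s = t\<close>.\<close>
  define u where "u s = v s z - B *v W s z + B *v W t z" for s
  let ?E = "\<lambda>s. mat_exp ((t - s) *\<^sub>R A)"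
  have Ed: "(?E has_vector_derivative - (?E s ** A)) (at s within {0..t})" for s
  proof -
    have "((\<lambda>s. t - s) has_vector_derivative - 1) (at s within {0..t})"
      by (auto intro!: derivative_eq_intros)
    from vector_diff_chain_within[OF this mat_exp_deriv[where t="t - s"]]
    show ?thesis by (simp add: o_def mat_exp_commute)
  qed
  have ud: "(u has_vector_derivative A *v v s z) (at s within {0..t})" if "s \<in> {0..t}" for s
  proof -
    have "((\<lambda>s. v s z - B *v W s z) has_vector_derivative A *v v s z) (at s within {0..t})"
      by (rule has_vector_derivative_within_subset[OF v_deriv[OF z]]) (use that in auto)
    from has_vector_derivative_add[OF this has_vector_derivative_const] show ?thesis
      by (simp add: u_def[abs_def])
  qed
  have "((\<lambda>s. - (mat_exp ((t - s) *\<^sub>R A) *v (A *v (B *v (W t z - W s z))))) has_integral (?E t *v u t - ?E 0 *v u 0)) {0..t}"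
  proof (rule fundamental_theorem_of_calculus[OF t])
    fix s assume s: "s \<in> {0..t}"
    have "((\<lambda>s. ?E s *v u s) has_vector_derivative (?E s *v (A *v v s z) + (- (?E s ** A)) *v u s)) (at s within {0..t})"
      by (rule bounded_bilinear.has_vector_derivative[OF bounded_bilinear_matrix_vector_mult Ed ud[OF s]])
    also have "?E s *v (A *v v s z) + (- (?E s ** A)) *v u s = ?E s *v (A *v (v s z - u s))"
    proof -
      have "(- M) *v x = - (M *v x)" for M :: "real^'d^'d" and x
        by (simp add: matrix_vector_mult_def vec_eq_iff sum_negf)
      then show ?thesis by (simp add: matrix_vector_mul_assoc matrix_vector_mult_diff_distrib)
    qed
    also have "v s z - u s = - (B *v (W t z - W s z))" by (simp add: u_def matrix_vector_mult_diff_distrib)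
    finally show "((\<lambda>s. ?E s *v u s) has_vector_derivative - (mat_exp ((t - s) *\<^sub>R A) *v (A *v (B *v (W t z - W s z))))) (at s within {0..t})"
      by (simp add: linear_neg[OF matrix_vector_mul_linear])
  qed
  from has_integral_neg[OF this] show ?thesis
    using v_0[OF z] W_0[OF z] by (simp add: u_def)
qed

lemma v_norm_bound:
  assumes decay: "\<And>t x. t \<ge> 0 \<Longrightarrow> norm (mat_exp (t *\<^sub>R A) *v x) \<le> C * exp (- \<delta> * t) * norm x"
    and K: "\<And>x. C * norm (B *v x) \<le> K * norm x" "\<And>x. C * norm (A *v (B *v x)) \<le> K * norm x"
    and K0: "0 \<le> K" and z: "z \<in> space M" and t: "0 \<le> t"
  shows "norm (v t z) \<le> K * (exp (- \<delta> * t) * norm (W t z) + integral {0..t} (\<lambda>s. exp (- \<delta> * (t - s)) * norm (W t z - W s z)))"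
proof -
  let ?f = "\<lambda>s. mat_exp ((t - s) *\<^sub>R A) *v (A *v (B *v (W t z - W s z)))"
  let ?g = "\<lambda>s. exp (- \<delta> * (t - s)) * norm (W t z - W s z)"
  have Ki: "norm (mat_exp (u *\<^sub>R A) *v x) \<le> exp (- \<delta> * u) * (C * norm x)" if "0 \<le> u" for u x
    using decay[OF that, of x] by (simp add: mult_ac)
  have gi: "?g integrable_on {0..t}"
    by (intro integrable_continuous_real continuous_intros continuous_on_subset[OF W_cont[OF z]]) auto
  have "norm (mat_exp (t *\<^sub>R A) *v (B *v W t z) - v t z) = norm (integral {0..t} ?f)"
    using v_formula[OF z t] by (simp add: integral_unique)
  also have "\<dots> \<le> integral {0..t} (\<lambda>s. K * ?g s)"
  proof (rule integral_norm_bound_integral)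
    show "?f integrable_on {0..t}" using v_formula[OF z t] by (auto simp: integrable_on_def)
    show "(\<lambda>s. K * ?g s) integrable_on {0..t}" using gi by (rule integrable_on_mult_right)
    fix s assume s: "s \<in> {0..t}"
    have "norm (?f s) \<le> exp (- \<delta> * (t - s)) * (C * norm (A *v (B *v (W t z - W s z))))" using s by (intro Ki) auto
    also have "\<dots> \<le> exp (- \<delta> * (t - s)) * (K * norm (W t z - W s z))" by (intro mult_left_mono K) auto
    finally show "norm (?f s) \<le> K * ?g s" by (simp only: mult_ac)
  qed
  also have "\<dots> = K * integral {0..t} ?g" by (rule integral_mult_right)
  finally have 1: "norm (mat_exp (t *\<^sub>R A) *v (B *v W t z) - v t z) \<le> K * integral {0..t} ?g" .
  have 2: "norm (mat_exp (t *\<^sub>R A) *v (B *v W t z)) \<le> K * (exp (- \<delta> * t) * norm (W t z))"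
    using order.trans[OF Ki[OF t] mult_left_mono[OF K(1)[of "W t z"], of "exp (- \<delta> * t)"]] by (simp add: mult_ac)
  show ?thesis
    using 1 2 norm_triangle_ineq4[of "mat_exp (t *\<^sub>R A) *v (B *v W t z)" "mat_exp (t *\<^sub>R A) *v (B *v W t z) - v t z"]
    by (simp add: distrib_left)
qed

text \<open>The kernel \<open>exp (- \<delta> (t - s))\<close> is split into two equal factors. One
  is the density of a measure of mass at most \<open>2 / \<delta>\<close>, to which Jensen's
  inequality is applied; the other keeps the moments of \<open>W t - W s\<close> bounded.\<close>

lemma v_moment:
  assumes decay: "\<And>t x. t \<ge> 0 \<Longrightarrow> norm (mat_exp (t *\<^sub>R A) *v x) \<le> C * exp (- \<delta> * t) * norm x"
    and K: "\<And>x. C * norm (B *v x) \<le> K * norm x" "\<And>x. C * norm (A *v (B *v x)) \<le> K * norm x"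
    and K0: "0 \<le> K" and \<delta>: "0 < \<delta>" and t: "0 \<le> t"
  shows "(\<integral>\<^sup>+z. ennreal (norm (v t z)) ^ (2 ^ Suc j) \<partial>M)
    \<le> ennreal (K ^ (2 ^ Suc j) * (2 ^ (2 ^ Suc j) * (wmom j * (1 / \<delta>) ^ (2 ^ j) + (2 / \<delta>) ^ (2 ^ Suc j) * (wmom j * (1 / \<delta>) ^ (2 ^ j)))))"
proof -
  let ?p = "2 ^ Suc j :: nat"
  have expp: "(exp (- (\<delta> / 2) * u)) ^ ?p * u ^ (2 ^ j) \<le> (1 / \<delta>) ^ (2 ^ j)" if u: "0 \<le> u" for u
  proof -
    have "(exp (- (\<delta> / 2) * u)) ^ ?p = (exp (- \<delta> * u)) ^ (2 ^ j)"
    proof -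
      have "(exp (- (\<delta> / 2) * u))\<^sup>2 = exp (- \<delta> * u)" by (simp add: power2_eq_square mult_exp_exp)
      then show ?thesis by (simp only: power_Suc power_mult)
    qed
    then have "(exp (- (\<delta> / 2) * u)) ^ ?p * u ^ (2 ^ j) = (u * exp (- \<delta> * u)) ^ (2 ^ j)"
      by (simp add: power_mult_distrib)
    also have "\<dots> \<le> (1 / \<delta>) ^ (2 ^ j)" using time_exp_bound[OF \<delta> u] u by (intro power_mono) auto
    finally show ?thesis .
  qed
  have mom: "(\<integral>\<^sup>+z. ennreal (exp (- (\<delta> / 2) * (t - s)) * norm (W t z - W s z)) ^ ?p \<partial>M) \<le> ennreal (wmom j * (1 / \<delta>) ^ (2 ^ j))"
    if s: "0 \<le> s" "s \<le> t" for s
  proof -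
    have [measurable]: "W s \<in> borel_measurable M" "W t \<in> borel_measurable M" using s by (auto intro: W_measurable)
    let ?e = "exp (- (\<delta> / 2) * (t - s))"
    have "(\<integral>\<^sup>+z. ennreal (?e * norm (W t z - W s z)) ^ ?p \<partial>M) = (\<integral>\<^sup>+z. ennreal (?e ^ ?p) * ennreal (norm (W t z - W s z)) ^ ?p \<partial>M)"
      by (intro nn_integral_cong) (simp add: ennreal_power ennreal_mult'[symmetric] power_mult_distrib del: power_Suc)
    also have "\<dots> = ennreal (?e ^ ?p) * (\<integral>\<^sup>+z. ennreal (norm (W t z - W s z)) ^ ?p \<partial>M)"
      by (rule nn_integral_cmult) measurable
    also have "\<dots> \<le> ennreal (?e ^ ?p) * ennreal (wmom j * (t - s) ^ (2 ^ j))"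
      by (intro mult_left_mono W_norm_moment s) auto
    also have "\<dots> = ennreal (wmom j * (?e ^ ?p * (t - s) ^ (2 ^ j)))"
      by (subst ennreal_mult'[symmetric]) (auto simp: mult_ac simp del: power_Suc)
    also have "\<dots> \<le> ennreal (wmom j * (1 / \<delta>) ^ (2 ^ j))"
      using s by (intro ennreal_leI mult_left_mono expp wmom_nonneg) auto
    finally show ?thesis .
  qed
  define X where "X z = ennreal (exp (- \<delta> * t) * norm (W t z))" for z
  define k where "k s = ennreal (exp (- (\<delta> / 2) * (t - s))) * indicator {0..t} s" for s
  define N where "N = density lborel k"
  define f where "f s z = indicator {0..t} s * ennreal (exp (- (\<delta> / 2) * (t - s)) * norm (W t z - W (max 0 (min t s)) z))" for s z
  have km[measurable]: "k \<in> borel_measurable borel" unfolding k_def by measurable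
  have [measurable]: "W t \<in> borel_measurable M" by (rule W_measurable[OF t])
  have jm[measurable]: "(\<lambda>(s, z). W (max 0 (min t s)) z) \<in> borel_measurable (borel \<Otimes>\<^sub>M M)"
  proof (rule borel_measurable_continuous_process)
    show "W (max 0 (min t s)) \<in> borel_measurable M" for s by (rule W_measurable) simp
    show "continuous_on UNIV (\<lambda>s. W (max 0 (min t s)) z)" if "z \<in> space M" for z
      by (intro continuous_on_compose2[OF W_cont[OF that]]) (auto intro!: continuous_intros)
  qed
  have fm: "(\<lambda>(s, z). f s z) \<in> borel_measurable (borel \<Otimes>\<^sub>M M)"
    unfolding f_def by measurable
  have bound: "ennreal (norm (v t z)) \<le> ennreal K * (X z + (\<integral>\<^sup>+s. f s z \<partial>N))" if z: "z \<in> space M" for z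
  proof -
    let ?g = "\<lambda>s. exp (- \<delta> * (t - s)) * norm (W t z - W s z)"
    have gc: "continuous_on {0..t} ?g"
      by (intro continuous_intros continuous_on_subset[OF W_cont[OF z]]) auto
    have fs: "(\<lambda>s. f s z) \<in> borel_measurable borel"
      using measurable_compose[OF measurable_Pair2'[OF z] fm] by simp
    have "(\<integral>\<^sup>+s. f s z \<partial>N) = (\<integral>\<^sup>+s. k s * f s z \<partial>lborel)"
      unfolding N_def using fs km by (intro nn_integral_density) auto
    also have "\<dots> = (\<integral>\<^sup>+s\<in>{0..t}. ennreal (?g s) \<partial>lborel)"
    proof (intro nn_integral_cong)
      fix s
      have "exp (- (\<delta> / 2) * (t - s)) * exp (- (\<delta> / 2) * (t - s)) = exp (- \<delta> * (t - s))"
        by (simp add: mult_exp_exp)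
      then show "k s * f s z = ennreal (?g s) * indicator {0..t} s"
        by (auto simp: k_def f_def indicator_def max_def min_def ennreal_mult'[symmetric] mult.assoc[symmetric])
    qed
    also have "\<dots> = ennreal (integral {0..t} ?g)"
      by (rule nn_integral_Icc_continuous[OF gc]) simp
    finally have 1: "(\<integral>\<^sup>+s. f s z \<partial>N) = ennreal (integral {0..t} ?g)" .
    have g0: "0 \<le> integral {0..t} ?g"
      by (intro Henstock_Kurzweil_Integration.integral_nonneg integrable_continuous_real gc) auto
    have "ennreal (norm (v t z)) \<le> ennreal (K * (exp (- \<delta> * t) * norm (W t z) + integral {0..t} ?g))"
      by (intro ennreal_leI v_norm_bound[OF decay K K0 z t])
    also have "\<dots> = ennreal K * (X z + (\<integral>\<^sup>+s. f s z \<partial>N))"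
      unfolding 1 X_def using K0 g0 by (simp add: ennreal_mult')
    finally show ?thesis .
  qed
  have sets_N: "sets (N \<Otimes>\<^sub>M M) = sets (borel \<Otimes>\<^sub>M M)" by (rule sets_pair_measure_cong) (auto simp: N_def)
  have massN: "emeasure N (space N) \<le> ennreal (2 / \<delta>)"
  proof -
    have "((\<lambda>s. exp (- (\<delta> / 2) * (t - s))) has_integral (2 / \<delta> * exp (- (\<delta> / 2) * (t - t)) - 2 / \<delta> * exp (- (\<delta> / 2) * (t - 0)))) {0..t}"
    proof (rule fundamental_theorem_of_calculus[OF t])
      fix s
      have "((\<lambda>s. 2 / \<delta> * exp (- (\<delta> / 2) * (t - s))) has_real_derivative exp (- (\<delta> / 2) * (t - s))) (at s within {0..t})"
        using \<delta> by (auto intro!: derivative_eq_intros)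
      then show "((\<lambda>s. 2 / \<delta> * exp (- (\<delta> / 2) * (t - s))) has_vector_derivative exp (- (\<delta> / 2) * (t - s))) (at s within {0..t})"
        by (simp add: has_real_derivative_iff_has_vector_derivative)
    qed
    then have I: "integral {0..t} (\<lambda>s. exp (- (\<delta> / 2) * (t - s))) = 2 / \<delta> - 2 / \<delta> * exp (- (\<delta> / 2) * t)"
      by (simp add: integral_unique)
    have "emeasure N (space N) = (\<integral>\<^sup>+s. k s \<partial>lborel)"
      by (simp add: N_def emeasure_density)
    also have "\<dots> = (\<integral>\<^sup>+s\<in>{0..t}. ennreal (exp (- (\<delta> / 2) * (t - s))) \<partial>lborel)" by (simp add: k_def)
    also have "\<dots> = ennreal (2 / \<delta> - 2 / \<delta> * exp (- (\<delta> / 2) * t))"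
      unfolding I[symmetric] by (rule nn_integral_Icc_continuous) (auto intro!: continuous_intros)
    also have "\<dots> \<le> ennreal (2 / \<delta>)" using \<delta> by (intro ennreal_leI) simp
    finally show ?thesis .
  qed
  have sfN: "sigma_finite_measure N"
    by (rule finite_measure.axioms, rule finite_measureI) (use massN in \<open>auto simp: top_unique\<close>)
  have Xm[measurable]: "X \<in> borel_measurable M" unfolding X_def by measurable
  interpret N: sigma_finite_measure N by (rule sfN)
  have fm': "(\<lambda>(s, z). f s z) \<in> borel_measurable (N \<Otimes>\<^sub>M M)"
    unfolding measurable_cong_sets[OF sets_N refl] by (rule fm)
  have Ym[measurable]: "(\<lambda>z. \<integral>\<^sup>+s. f s z \<partial>N) \<in> borel_measurable M"
  proof (rule N.borel_measurable_nn_integral)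
    from measurable_compose[OF measurable_pair_swap' fm']
    show "(\<lambda>(z, s). f s z) \<in> borel_measurable (M \<Otimes>\<^sub>M N)" by (simp add: split_beta)
  qed
  have X: "(\<integral>\<^sup>+z. X z ^ ?p \<partial>M) \<le> ennreal (wmom j * (1 / \<delta>) ^ (2 ^ j))"
  proof (rule order.trans[OF _ mom[of 0]])
    show "(\<integral>\<^sup>+z. X z ^ ?p \<partial>M) \<le> (\<integral>\<^sup>+z. ennreal (exp (- (\<delta> / 2) * (t - 0)) * norm (W t z - W 0 z)) ^ ?p \<partial>M)"
    proof (intro nn_integral_mono power_mono)
      fix z assume "z \<in> space M"
      then have "W 0 z = 0" by (rule W_0)
      moreover have "exp (- \<delta> * t) \<le> exp (- (\<delta> / 2) * t)" using \<delta> t by simp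
      ultimately show "X z \<le> ennreal (exp (- (\<delta> / 2) * (t - 0)) * norm (W t z - W 0 z))"
        unfolding X_def by (auto intro!: ennreal_leI mult_right_mono)
    qed simp
  qed (use t in auto)
  have Y: "(\<integral>\<^sup>+z. (\<integral>\<^sup>+s. f s z \<partial>N) ^ ?p \<partial>M) \<le> ennreal (2 / \<delta>) ^ ?p * ennreal (wmom j * (1 / \<delta>) ^ (2 ^ j))"
  proof (rule nn_integral_average_moment[OF sigma_finite_measure_axioms sfN fm' massN])
    fix s
    show "(\<integral>\<^sup>+z. f s z ^ ?p \<partial>M) \<le> ennreal (wmom j * (1 / \<delta>) ^ (2 ^ j))"
      using mom[of s] by (cases "s \<in> {0..t}") (auto simp: f_def power_0_left max_def min_def)
  qed
  have "(\<integral>\<^sup>+z. ennreal (norm (v t z)) ^ ?p \<partial>M) \<le> (\<integral>\<^sup>+z. (ennreal K * (X z + (\<integral>\<^sup>+s. f s z \<partial>N))) ^ ?p \<partial>M)"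
    by (intro nn_integral_mono power_mono bound) auto
  also have "\<dots> \<le> (\<integral>\<^sup>+z. ennreal K ^ ?p * (2 ^ ?p * (X z ^ ?p + (\<integral>\<^sup>+s. f s z \<partial>N) ^ ?p)) \<partial>M)"
    unfolding power_mult_distrib[of "ennreal K"] by (intro nn_integral_mono mult_left_mono ennreal_power_add_le) auto
  also have "\<dots> = ennreal K ^ ?p * (2 ^ ?p * ((\<integral>\<^sup>+z. X z ^ ?p \<partial>M) + (\<integral>\<^sup>+z. (\<integral>\<^sup>+s. f s z \<partial>N) ^ ?p \<partial>M)))"
    by (simp add: nn_integral_cmult nn_integral_add del: power_Suc)
  also have "\<dots> \<le> ennreal K ^ ?p * (2 ^ ?p * (ennreal (wmom j * (1 / \<delta>) ^ (2 ^ j)) + ennreal (2 / \<delta>) ^ ?p * ennreal (wmom j * (1 / \<delta>) ^ (2 ^ j))))"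
    by (intro mult_left_mono add_mono X Y) auto
  also have "\<dots> = ennreal (K ^ ?p * (2 ^ ?p * (wmom j * (1 / \<delta>) ^ (2 ^ j) + (2 / \<delta>) ^ ?p * (wmom j * (1 / \<delta>) ^ (2 ^ j)))))"
  proof -
    have 1: "ennreal a * (ennreal b * (ennreal q + ennreal c * ennreal q)) = ennreal (a * (b * (q + c * q)))"
      if "0 \<le> a" "0 \<le> b" "0 \<le> c" "0 \<le> q" for a b c q
      using that by (simp add: ennreal_mult ennreal_plus)
    have 2: "(2::ennreal) ^ ?p = ennreal (2 ^ ?p)" by (simp add: ennreal_power[symmetric] del: power_Suc)
    have 3: "ennreal K ^ ?p = ennreal (K ^ ?p)" "ennreal (2 / \<delta>) ^ ?p = ennreal ((2 / \<delta>) ^ ?p)"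
      using K0 \<delta> by (simp_all add: ennreal_power)
    show ?thesis unfolding 2 3 using K0 \<delta> wmom_nonneg[of j] by (intro 1) auto
  qed
  finally show ?thesis .
qed

end

section \<open>Expansion of the phase over one step\<close>

text \<open>For small \<open>x\<close> this is Taylor's formula for the complex logarithm. For large
  \<open>x\<close> the hypothesis \<open>low\<close> keeps \<open>1 + x\<close> away from zero, so
  that the logarithm of its modulus lies between \<open>- \<rho>\<close> and \<open>\<rho>\<close>;
  since \<open>\<rho> \<ge> 1/2\<close>, the cube absorbs all terms,
  \<open>2 \<rho> + \<rho>^2 / 2 \<le> 9 \<rho>^3\<close>.\<close>

lemma ln_jump:
  fixes x :: complex
  assumes x: "cmod x \<le> \<rho>" and low: "1 \<le> (1 + \<rho>) * cmod (1 + x)"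
  shows "\<bar>ln (cmod (1 + x)) - Re (x - x\<^sup>2 / 2)\<bar> \<le> 9 * \<rho> ^ 3"
proof (cases "cmod x \<le> 1 / 2")
  case True
  have \<rho>: "0 \<le> \<rho>" using x norm_ge_zero[of x] by linarith
  let ?f = "\<lambda>s. Ln (1 + of_real s * x) - of_real s * x + (of_real s * x)\<^sup>2 / 2"
  have Re: "0 < Re (1 + of_real s * x)" "1 / 2 \<le> cmod (1 + of_real s * x)" if "s \<in> {0..1}" for s
  proof -
    have "\<bar>Re (of_real s * x)\<bar> \<le> cmod (of_real s * x)" by (rule abs_Re_le_cmod)
    also have "\<dots> \<le> 1 * (1 / 2)" using that True unfolding norm_mult by (intro mult_mono) auto
    finally show R: "0 < Re (1 + of_real s * x)" by simp
    show "1 / 2 \<le> cmod (1 + of_real s * x)"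
      using \<open>\<bar>Re (of_real s * x)\<bar> \<le> cmod (of_real s * x)\<close> \<open>cmod (of_real s * x) \<le> 1 * (1 / 2)\<close>
        abs_Re_le_cmod[of "1 + of_real s * x"] by simp
  qed
  have "norm (?f 1 - ?f 0) \<le> (2 * cmod x ^ 3) * norm (1 - 0 :: real)"
  proof (rule differentiable_bound[where S="{0..1}" and f'="\<lambda>s h. h *\<^sub>R ((of_real s)\<^sup>2 * x ^ 3 / (1 + of_real s * x))"])
    fix s :: real assume s: "s \<in> {0..1}"
    have nz: "1 + of_real s * x \<noteq> 0" using Re(1)[OF s] by (auto simp: complex_eq_iff)
    have "(?f has_vector_derivative (x / (1 + of_real s * x) - x + of_real s * x * x)) (at s within {0..1})"
    proof -
      have lin: "((\<lambda>s. of_real s * x) has_vector_derivative x) (at s within {0..1})"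
        by (auto intro!: derivative_eq_intros)
      have "((\<lambda>s. 1 + of_real s * x) has_vector_derivative x) (at s within {0..1})"
        by (auto intro!: derivative_eq_intros)
      moreover have "(Ln has_field_derivative inverse (1 + of_real s * x)) (at (1 + of_real s * x) within T)" for T
        by (rule has_field_derivative_at_within[OF has_field_derivative_Ln])
           (use Re(1)[OF s] in \<open>auto simp: complex_nonpos_Reals_iff\<close>)
      ultimately have 1: "((\<lambda>s. Ln (1 + of_real s * x)) has_vector_derivative (x * inverse (1 + of_real s * x))) (at s within {0..1})"
        using field_vector_diff_chain_within[of "\<lambda>s. 1 + of_real s * x" x s "{0..1}" Ln] by (simp add: o_def)
      have 2: "((\<lambda>s. (1 / 2) * ((of_real s * x) * (of_real s * x))) has_vector_derivative
          (1 / 2) * ((of_real s * x) * x + x * (of_real s * x))) (at s within {0..1})"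
        by (intro has_vector_derivative_mult_right has_vector_derivative_mult lin)
      have "(?f has_vector_derivative (x * inverse (1 + of_real s * x) - x + (1 / 2) * ((of_real s * x) * x + x * (of_real s * x)))) (at s within {0..1})"
        using has_vector_derivative_add[OF has_vector_derivative_diff[OF 1 lin] 2] by (simp add: power2_eq_square)
      moreover have "(1 / 2) * ((of_real s * x) * x + x * (of_real s * x)) = of_real s * x * x"
        by (simp only: mult.commute[of x "of_real s * x"] mult_2[symmetric]) simp
      ultimately show ?thesis by (simp only: divide_inverse)
    qed
    also have "x / (1 + of_real s * x) - x + of_real s * x * x = (of_real s)\<^sup>2 * x ^ 3 / (1 + of_real s * x)"
    proof -
      have "x + (- x + of_real s * x * x) * (1 + of_real s * x) = (of_real s)\<^sup>2 * x ^ 3" by algebra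
      moreover have "(x + (- x + of_real s * x * x) * (1 + of_real s * x)) / (1 + of_real s * x)
        = x / (1 + of_real s * x) + (- x + of_real s * x * x)"
        unfolding add_divide_distrib using nz by simp
      ultimately show ?thesis by simp
    qed
    finally show "(?f has_derivative (\<lambda>h. h *\<^sub>R ((of_real s)\<^sup>2 * x ^ 3 / (1 + of_real s * x)))) (at s within {0..1})"
      by (simp add: has_vector_derivative_def)
    have "norm ((of_real s)\<^sup>2 * x ^ 3 / (1 + of_real s * x)) \<le> 2 * cmod x ^ 3"
    proof -
      have "norm ((of_real s)\<^sup>2 * x ^ 3 / (1 + of_real s * x)) = s\<^sup>2 * cmod x ^ 3 / cmod (1 + of_real s * x)"
        by (simp add: norm_mult norm_divide norm_power)
      also have "\<dots> \<le> 1 * cmod x ^ 3 / (1 / 2)"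
        using s Re(2)[OF s] by (intro frac_le mult_right_mono) (auto simp: power_le_one)
      finally show ?thesis by simp
    qed
    then show "onorm (\<lambda>h. h *\<^sub>R ((of_real s)\<^sup>2 * x ^ 3 / (1 + of_real s * x))) \<le> 2 * cmod x ^ 3"
      by (intro onorm_le) (simp add: mult.commute mult_left_mono)
  qed auto
  then have b: "cmod (Ln (1 + x) - x + x\<^sup>2 / 2) \<le> 2 * cmod x ^ 3" by simp
  have "ln (cmod (1 + x)) - Re (x - x\<^sup>2 / 2) = Re (Ln (1 + x) - x + x\<^sup>2 / 2)"
    using Re(1)[of 1] by (subst Re_Ln[symmetric]) (auto simp: complex_eq_iff)
  then have "\<bar>ln (cmod (1 + x)) - Re (x - x\<^sup>2 / 2)\<bar> \<le> 2 * cmod x ^ 3"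
    using order.trans[OF abs_Re_le_cmod b] by simp
  also have "\<dots> \<le> 9 * \<rho> ^ 3" using x \<rho> by (intro mult_mono power_mono) auto
  finally show ?thesis .
next
  case False
  then have \<rho>: "1 / 2 \<le> \<rho>" using x by simp
  have p: "0 < cmod (1 + x)" by (rule ccontr) (use low in auto)
  have u: "cmod (1 + x) \<le> 1 + \<rho>" using norm_triangle_ineq[of 1 x] x by simp
  have l1: "ln (1 + \<rho>) \<le> \<rho>" using \<rho> by (intro ln_add_one_self_le_self) auto
  have "ln (cmod (1 + x)) \<le> \<rho>" using ln_mono[OF u p] l1 by simp
  moreover have "0 \<le> ln ((1 + \<rho>) * cmod (1 + x))" using low by (rule ln_ge_zero)
  then have "- \<rho> \<le> ln (cmod (1 + x))" using p \<rho> l1 by (simp add: ln_mult)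
  ultimately have a: "\<bar>ln (cmod (1 + x))\<bar> \<le> \<rho>" by linarith
  have "\<bar>Re (x - x\<^sup>2 / 2)\<bar> \<le> cmod (x - x\<^sup>2 / 2)" by (rule abs_Re_le_cmod)
  also have "\<dots> \<le> cmod x + (cmod x)\<^sup>2 / 2"
    using norm_triangle_ineq4[of x "x\<^sup>2 / 2"] by (simp add: norm_power norm_divide)
  also have "\<dots> \<le> \<rho> + \<rho>\<^sup>2 / 2" using x \<rho> by (intro add_mono divide_right_mono power_mono) auto
  finally have "\<bar>ln (cmod (1 + x)) - Re (x - x\<^sup>2 / 2)\<bar> \<le> 2 * \<rho> + \<rho>\<^sup>2 / 2" using a by linarith
  also have "\<dots> \<le> 9 * \<rho> ^ 3"
  proof -
    have "(1 / 2) * \<rho>\<^sup>2 \<le> \<rho> * \<rho>\<^sup>2" using \<rho> by (intro mult_right_mono) auto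
    moreover have "(1 / 2) * \<rho> \<le> \<rho> * \<rho>" using \<rho> by (intro mult_right_mono) auto
    ultimately show ?thesis by (simp add: power2_eq_square power3_eq_cube)
  qed
  finally show ?thesis .
qed

text \<open>The quotient is the value of \<open>w\<close> after a jump. For small \<open>x\<close>
  the error is exactly \<open>(1 - u) x^3 / (1 + x)\<close>; for large \<open>x\<close> the quotient
  has modulus one, and \<open>2 + 2 \<rho> + 2 \<rho>^2 \<le> 28 \<rho>^3\<close>.\<close>

lemma ratio_jump:
  fixes x u :: complex
  assumes x: "cmod x \<le> \<rho>" and u: "cmod u = 1" and r: "cmod ((u + x) / (1 + x)) = 1"
  shows "cmod ((u + x) / (1 + x) - (u + x * (1 - u) - x\<^sup>2 * (1 - u))) \<le> 28 * \<rho> ^ 3"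
proof (cases "cmod x \<le> 1 / 2")
  case True
  have \<rho>: "0 \<le> \<rho>" using x norm_ge_zero[of x] by linarith
  have l: "1 / 2 \<le> cmod (1 + x)" using norm_triangle_ineq4[of "1 + x" x] True by simp
  then have nz: "1 + x \<noteq> 0" by auto
  have "(u + x) / (1 + x) - (u + x * (1 - u) - x\<^sup>2 * (1 - u)) = (1 - u) * x ^ 3 / (1 + x)"
  proof -
    have "(u + x) - (u + x * (1 - u) - x\<^sup>2 * (1 - u)) * (1 + x) = (1 - u) * x ^ 3" by algebra
    moreover have "((u + x) - (u + x * (1 - u) - x\<^sup>2 * (1 - u)) * (1 + x)) / (1 + x)
      = (u + x) / (1 + x) - (u + x * (1 - u) - x\<^sup>2 * (1 - u))"
      unfolding diff_divide_distrib using nz by simp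
    ultimately show ?thesis by simp
  qed
  also have "cmod \<dots> = cmod (1 - u) * cmod x ^ 3 / cmod (1 + x)" by (simp add: norm_mult norm_divide norm_power)
  also have "\<dots> \<le> 2 * \<rho> ^ 3 / (1 / 2)"
    using l x \<rho> norm_triangle_ineq4[of 1 u] u by (intro frac_le mult_mono power_mono) auto
  also have "\<dots> \<le> 28 * \<rho> ^ 3" using \<rho> by simp
  finally show ?thesis .
next
  case False
  then have \<rho>: "1 / 2 \<le> \<rho>" using x by simp
  have u1: "cmod (1 - u) \<le> 2" using norm_triangle_ineq4[of 1 u] u by simp
  have a: "cmod (x * (1 - u)) \<le> \<rho> * 2" "cmod (x\<^sup>2 * (1 - u)) \<le> \<rho>\<^sup>2 * 2"
    unfolding norm_mult norm_power using x u1 \<rho> by (intro mult_mono power_mono; simp)+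
  have "cmod ((u + x) / (1 + x) - (u + x * (1 - u) - x\<^sup>2 * (1 - u)))
    \<le> 1 + (1 + \<rho> * 2 + \<rho>\<^sup>2 * 2)"
    by (intro order.trans[OF norm_triangle_ineq4] add_mono order.trans[OF norm_triangle_ineq] a)
      (use r u in auto)
  also have "\<dots> \<le> 28 * \<rho> ^ 3"
  proof -
    have "(1 / 2) * \<rho>\<^sup>2 \<le> \<rho> * \<rho>\<^sup>2" using \<rho> by (intro mult_right_mono) auto
    moreover have "(1 / 2) * \<rho> \<le> \<rho> * \<rho>" using \<rho> by (intro mult_right_mono) auto
    ultimately show ?thesis using \<rho> unfolding power2_eq_square power3_eq_cube mult.assoc by linarith
  qed
  finally show ?thesis .
qed

lemma square_diff_bound:
  fixes u w :: complex
  assumes "cmod u = 1" "cmod w = 1"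
  shows "cmod ((1 - u)\<^sup>2 - (1 - w)\<^sup>2) \<le> 4 * cmod (u - w)"
    and "cmod ((1 - u) ^ 3 - (1 - w) ^ 3) \<le> 12 * cmod (u - w)"
    and "cmod (1 - u) \<le> 2" "cmod ((1 - u)\<^sup>2) \<le> 4"
proof -
  show u: "cmod (1 - u) \<le> 2" using norm_triangle_ineq4[of 1 u] assms by simp
  have w: "cmod (1 - w) \<le> 2" using norm_triangle_ineq4[of 1 w] assms by simp
  show u2: "cmod ((1 - u)\<^sup>2) \<le> 4" using power_mono[OF u, of 2] by (simp add: norm_power)
  have w2: "cmod ((1 - w)\<^sup>2) \<le> 4" using power_mono[OF w, of 2] by (simp add: norm_power)
  have "(1 - u)\<^sup>2 - (1 - w)\<^sup>2 = (w - u) * ((1 - u) + (1 - w))" by (simp add: power2_eq_square algebra_simps)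
  also have "cmod \<dots> \<le> cmod (w - u) * 4"
    unfolding norm_mult by (intro mult_left_mono order.trans[OF norm_triangle_ineq]) (use u w in auto)
  finally show "cmod ((1 - u)\<^sup>2 - (1 - w)\<^sup>2) \<le> 4 * cmod (u - w)" by (simp add: norm_minus_commute mult.commute)
  have uw: "cmod ((1 - u) * (1 - w)) \<le> 4" using mult_mono[OF u w] by (simp add: norm_mult)
  have "(1 - u) ^ 3 - (1 - w) ^ 3 = (w - u) * ((1 - u)\<^sup>2 + (1 - u) * (1 - w) + (1 - w)\<^sup>2)"
    by (simp add: power2_eq_square power3_eq_cube algebra_simps)
  also have "cmod \<dots> \<le> cmod (w - u) * 12"
    unfolding norm_mult
    using norm_triangle_ineq[of "(1 - u)\<^sup>2 + (1 - u) * (1 - w)" "(1 - w)\<^sup>2"]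
      norm_triangle_ineq[of "(1 - u)\<^sup>2" "(1 - u) * (1 - w)"] u2 w2 uw
    by (intro mult_left_mono) auto
  finally show "cmod ((1 - u) ^ 3 - (1 - w) ^ 3) \<le> 12 * cmod (u - w)" by (simp add: norm_minus_commute mult.commute)
qed

section \<open>Smooth motion of the phase with the noise frozen\<close>

lemma ln_hypot_deriv:
  fixes X Y :: "real \<Rightarrow> real"
  assumes X: "(X has_real_derivative X') (at s within S)" and Y: "(Y has_real_derivative Y') (at s within S)"
    and pos: "0 < (X s)\<^sup>2 + (Y s)\<^sup>2"
  shows "((\<lambda>s. ln ((X s)\<^sup>2 + (Y s)\<^sup>2) / 2) has_real_derivative
    ((2 * X s * X' + 2 * Y s * Y') / ((X s)\<^sup>2 + (Y s)\<^sup>2)) / 2) (at s within S)"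
proof -
  have 1: "((\<lambda>s. (X s)\<^sup>2 + (Y s)\<^sup>2) has_real_derivative (2 * X s * X' + 2 * Y s * Y')) (at s within S)"
    by (auto intro!: derivative_eq_intros X Y)
  from DERIV_cdivide[OF DERIV_chain2[OF DERIV_ln_divide[OF pos] 1], of 2]
  show ?thesis by simp
qed

text \<open>The factor that makes \<open>y\<close> divided by the phase equal to
  \<open>beta \<kappa>\<close> times \<open>1 - w\<close>: the phase minus its conjugate is
  \<open>2 \<i> \<kappa> y\<close>.\<close>

definition beta :: "real \<Rightarrow> complex" where "beta \<kappa> = 1 / (2 * \<i> * complex_of_real \<kappa>)"

lemma cnj_beta: "cnj (beta \<kappa>) = - beta \<kappa>"
  by (simp add: beta_def)

lemma norm_beta: "0 < \<kappa> \<Longrightarrow> cmod (beta \<kappa>) = 1 / (2 * \<kappa>)"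
  by (simp add: beta_def norm_divide norm_mult)

lemma beta_square: "(beta \<kappa>)\<^sup>2 = - complex_of_real (1 / (4 * \<kappa>\<^sup>2))"
  by (simp add: beta_def power_divide power_mult_distrib)

text \<open>The phase of the oscillator, in the momentum coordinate from which the noise accumulated
  since the start of the step has been removed, moves along a differentiable path.\<close>

locale smooth_step =
  fixes \<kappa> h :: real and q :: "real \<Rightarrow> complex" and n V :: "real \<Rightarrow> real"
  assumes \<kappa>: "0 < \<kappa>" and h: "0 \<le> h"
    and n_cont: "continuous_on {0..h} n" and V_cont: "continuous_on {0..h} V"
    and q_nz: "\<And>s. s \<in> {0..h} \<Longrightarrow> q s \<noteq> 0"
    and q_deriv: "\<And>s. s \<in> {0..h} \<Longrightarrow> (q has_vector_derivative
      Complex (- \<kappa> * Im (q s) + V s * (Im (q s) / \<kappa>) - n s * (Re (q s) + n s * (Im (q s) / \<kappa>)))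
        (\<kappa> * (Re (q s) + n s * (Im (q s) / \<kappa>)))) (at s within {0..h})"
begin

abbreviation "b \<equiv> beta \<kappa>"

definition u :: "real \<Rightarrow> complex" where "u s = cnj (q s) / q s"

text \<open>The logarithmic derivative of \<open>q\<close>, expressed through \<open>u\<close> and
  the coefficients.\<close>

definition P :: "real \<Rightarrow> complex" where
  "P s = \<i> * \<kappa> + (V s - (n s)\<^sup>2) * b * (1 - u s) - n s * u s"

lemma norm_u: "s \<in> {0..h} \<Longrightarrow> cmod (u s) = 1"
  using q_nz by (simp add: u_def norm_divide)

lemma q_deriv': "s \<in> {0..h} \<Longrightarrow> (q has_vector_derivative q s * P s) (at s within {0..h})"
proof -
  assume s: "s \<in> {0..h}"
  have b2: "b * (2 * \<i> * Im (q s)) = Im (q s) / \<kappa>" using \<kappa> by (simp add: beta_def)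
  have "q s * (1 - u s) = q s - cnj (q s)" using q_nz[OF s] by (simp add: u_def field_simps)
  also have "\<dots> = 2 * \<i> * Im (q s)" by (simp add: complex_eq_iff)
  finally have 1: "q s * (1 - u s) = 2 * \<i> * Im (q s)" .
  have 2: "q s * u s = cnj (q s)" using q_nz[OF s] by (simp add: u_def)
  have "q s * P s = \<i> * \<kappa> * q s + (V s - (n s)\<^sup>2) * (b * (q s * (1 - u s))) - n s * (q s * u s)"
    by (simp add: P_def algebra_simps)
  also have "\<dots> = \<i> * \<kappa> * q s + (V s - (n s)\<^sup>2) * (Im (q s) / \<kappa>) - n s * cnj (q s)"
    unfolding 1 2 b2 by simp
  also have "\<dots> = Complex (- \<kappa> * Im (q s) + V s * (Im (q s) / \<kappa>) - n s * (Re (q s) + n s * (Im (q s) / \<kappa>)))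
        (\<kappa> * (Re (q s) + n s * (Im (q s) / \<kappa>)))"
    using \<kappa> by (simp add: complex_eq_iff algebra_simps power2_eq_square diff_divide_distrib)
  finally show ?thesis using q_deriv[OF s] by simp
qed

text \<open>From \<open>q' = q P\<close> follows \<open>u' = u (cnj P - P)\<close>, and
  \<open>u cnj u = 1\<close> turns this into a polynomial in \<open>u\<close>.\<close>

lemma u_deriv:
  assumes s: "s \<in> {0..h}"
  shows "(u has_vector_derivative - 2 * \<i> * \<kappa> * u s + (V s - (n s)\<^sup>2) * b * (1 - u s)\<^sup>2 - n s * (1 - (u s)\<^sup>2)) (at s within {0..h})"
proof -
  have nz: "q s \<noteq> 0" by (rule q_nz[OF s])
  have c: "((\<lambda>s. cnj (q s)) has_vector_derivative cnj (q s * P s)) (at s within {0..h})"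
    using bounded_linear.has_vector_derivative[OF bounded_linear_cnj q_deriv'[OF s]] .
  have "((\<lambda>s. inverse (q s)) has_vector_derivative - (q s * P s * inverse (q s ^ 2))) (at s within {0..h})"
    using field_vector_diff_chain_within[OF q_deriv'[OF s] DERIV_inverse[OF nz]]
    by (simp add: o_def power2_eq_square)
  from has_vector_derivative_mult[OF c this]
  have "(u has_vector_derivative (cnj (q s) * - (q s * P s * inverse (q s ^ 2)) + cnj (q s * P s) * inverse (q s))) (at s within {0..h})"
    by (simp add: u_def[abs_def] divide_inverse)
  also have "cnj (q s) * - (q s * P s * inverse (q s ^ 2)) + cnj (q s * P s) * inverse (q s) = u s * (cnj (P s) - P s)"
    using nz by (simp add: u_def field_simps power2_eq_square)
  also have "\<dots> = - 2 * \<i> * \<kappa> * u s + (V s - (n s)\<^sup>2) * b * (1 - u s)\<^sup>2 - n s * (1 - (u s)\<^sup>2)"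
  proof -
    have uu: "u s * cnj (u s) = 1" using norm_u[OF s] by (simp add: complex_norm_square[symmetric])
    have "u s * cnj (P s) = - \<i> * \<kappa> * u s - (V s - (n s)\<^sup>2) * b * (u s - u s * cnj (u s)) - n s * (u s * cnj (u s))"
      by (simp add: P_def cnj_beta algebra_simps)
    also have "\<dots> = - \<i> * \<kappa> * u s - (V s - (n s)\<^sup>2) * b * (u s - 1) - n s" unfolding uu by simp
    finally show ?thesis unfolding right_diff_distrib by (simp add: P_def power2_eq_square algebra_simps)
  qed
  finally show ?thesis .
qed

text \<open>The modulus is differentiated through real and imaginary parts: the complex logarithm
  has a branch cut, and \<open>q\<close> rotates about zero.\<close>

lemma ln_q_deriv:
  assumes s: "s \<in> {0..h}"
  shows "((\<lambda>s. ln (cmod (q s))) has_vector_derivative Re (P s)) (at s within {0..h})"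
proof -
  have nz: "q s \<noteq> 0" by (rule q_nz[OF s])
  then have pos: "0 < (Re (q s))\<^sup>2 + (Im (q s))\<^sup>2" using complex_neq_0[of "q s"] by simp
  let ?X = "Re (q s * P s)" and ?Y = "Im (q s * P s)"
  have d: "((\<lambda>s. Re (q s)) has_real_derivative ?X) (at s within {0..h})" "((\<lambda>s. Im (q s)) has_real_derivative ?Y) (at s within {0..h})"
    using bounded_linear.has_vector_derivative[OF bounded_linear_Re q_deriv'[OF s]]
      bounded_linear.has_vector_derivative[OF bounded_linear_Im q_deriv'[OF s]]
    by (simp_all add: has_real_derivative_iff_has_vector_derivative)
  have "((\<lambda>s. ln ((Re (q s))\<^sup>2 + (Im (q s))\<^sup>2) / 2) has_real_derivative
    ((2 * Re (q s) * ?X + 2 * Im (q s) * ?Y) / ((Re (q s))\<^sup>2 + (Im (q s))\<^sup>2)) / 2) (at s within {0..h})"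
    using ln_hypot_deriv[OF d pos] by simp
  also have "((2 * Re (q s) * ?X + 2 * Im (q s) * ?Y) / ((Re (q s))\<^sup>2 + (Im (q s))\<^sup>2)) / 2 = Re (P s)"
    using pos by (simp add: field_simps power2_eq_square)
  finally have "((\<lambda>s. ln ((Re (q s))\<^sup>2 + (Im (q s))\<^sup>2) / 2) has_vector_derivative Re (P s)) (at s within {0..h})"
    by (simp add: has_real_derivative_iff_has_vector_derivative)
  then show ?thesis
  proof (rule has_vector_derivative_transform[OF s, rotated])
    fix s assume "s \<in> {0..h}"
    then have "0 < (Re (q s))\<^sup>2 + (Im (q s))\<^sup>2" using complex_neq_0[of "q s"] q_nz by simp
    then show "ln (cmod (q s)) = ln ((Re (q s))\<^sup>2 + (Im (q s))\<^sup>2) / 2"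
      by (simp add: cmod_def ln_sqrt)
  qed
qed

text \<open>In the application to a step of length \<open>h\<close>, \<open>S1\<close> and
  \<open>S4\<close> are of order \<open>h^(3/2)\<close>, \<open>S2\<close> of order
  \<open>h^2\<close> and \<open>S3\<close> of order \<open>h\<close>.\<close>

definition "S1 = integral {0..h} (\<lambda>s. \<bar>n s\<bar>)"
definition "S2 = integral {0..h} (\<lambda>s. (n s)\<^sup>2)"
definition "S3 = integral {0..h} (\<lambda>s. \<bar>V s\<bar>)"
definition "S4 = integral {0..h} (\<lambda>s. \<bar>V s - V 0\<bar>)"

lemma S_integrals:
  "((\<lambda>s. \<bar>n s\<bar>) has_integral S1) {0..h}" "((\<lambda>s. (n s)\<^sup>2) has_integral S2) {0..h}"
  "((\<lambda>s. \<bar>V s\<bar>) has_integral S3) {0..h}" "((\<lambda>s. \<bar>V s - V 0\<bar>) has_integral S4) {0..h}"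
  unfolding S1_def S2_def S3_def S4_def
  by (intro integrable_integral integrable_continuous_real continuous_intros n_cont V_cont)+

text \<open>Bounds the movement of \<open>u\<close> during the step, which is of order
  \<open>h\<close>.\<close>

definition "U = 2 * \<kappa> * h + 4 * cmod b * (S3 + S2) + 2 * S1"

lemma norm_le_of_has_integral:
  assumes "(f has_integral I) {0..h}" "(g has_integral J) {0..h}" "\<And>s. s \<in> {0..h} \<Longrightarrow> norm (f s) \<le> g s"
  shows "norm (I :: 'z::euclidean_space) \<le> J"
  using integral_norm_bound_integral[of f "{0..h}" g] assms by (auto simp: integral_unique has_integral_integrable)

lemma u_close:
  assumes s: "s \<in> {0..h}"
  shows "cmod (u s - u 0) \<le> U"
proof -
  let ?f = "\<lambda>s. - 2 * \<i> * \<kappa> * u s + (V s - (n s)\<^sup>2) * b * (1 - u s)\<^sup>2 - n s * (1 - (u s)\<^sup>2)"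
  let ?g = "\<lambda>s. 2 * \<kappa> + 4 * cmod b * (\<bar>V s\<bar> + (n s)\<^sup>2) + 2 * \<bar>n s\<bar>"
  have fg: "norm (?f r) \<le> ?g r" if r: "r \<in> {0..h}" for r
  proof -
    have u1: "cmod (u r) = 1" by (rule norm_u[OF r])
    have 1: "cmod (- 2 * \<i> * \<kappa> * u r) = 2 * \<kappa>" using \<kappa> u1 by (simp add: norm_mult)
    have 2: "cmod ((V r - (n r)\<^sup>2) * b * (1 - u r)\<^sup>2) \<le> (\<bar>V r\<bar> + (n r)\<^sup>2) * cmod b * 4"
      unfolding norm_mult norm_of_real using square_diff_bound(4)[OF u1 u1] abs_triangle_ineq4[of "V r" "(n r)\<^sup>2"]
      by (intro mult_mono) auto
    have "cmod (1 - (u r)\<^sup>2) \<le> 2" using norm_triangle_ineq4[of 1 "(u r)\<^sup>2"] u1 by (simp add: norm_power)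
    then have 3: "cmod (n r * (1 - (u r)\<^sup>2)) \<le> \<bar>n r\<bar> * 2" by (simp add: norm_mult mult_left_mono)
    show ?thesis
      using 1 2 3 norm_triangle_ineq4[of "- 2 * \<i> * \<kappa> * u r + (V r - (n r)\<^sup>2) * b * (1 - u r)\<^sup>2" "n r * (1 - (u r)\<^sup>2)"]
        norm_triangle_ineq[of "- 2 * \<i> * \<kappa> * u r" "(V r - (n r)\<^sup>2) * b * (1 - u r)\<^sup>2"]
      by (simp add: mult_ac)
  qed
  have sub: "{0..s} \<subseteq> {0..h}" using s by auto
  have 1: "(?f has_integral (u s - u 0)) {0..s}"
    by (rule fundamental_theorem_of_calculus, use s in simp, rule has_vector_derivative_within_subset[OF u_deriv sub])
       (use s in auto)
  have gh: "(?g has_integral U) {0..h}"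
    unfolding U_def using has_integral_const_real[of "2 * \<kappa>" 0 h] h
    by (intro has_integral_add has_integral_mult_right S_integrals) (auto simp: mult.commute)
  have gi: "?g integrable_on {0..s}"
    by (rule integrable_on_subinterval[OF has_integral_integrable[OF gh] sub])
  have "norm (u s - u 0) \<le> integral {0..s} ?g"
    using integral_norm_bound_integral[OF has_integral_integrable[OF 1] gi] fg sub integral_unique[OF 1] by auto
  also have "\<dots> \<le> integral {0..h} ?g"
    using \<kappa> by (intro integral_subset_le sub gi has_integral_integrable[OF gh]) (auto intro!: add_nonneg_nonneg mult_nonneg_nonneg)
  also have "\<dots> = U" using gh by (rule integral_unique)
  finally show ?thesis .
qed

lemma U_nonneg: "0 \<le> U"
  using order.trans[OF norm_ge_zero u_close[of 0]] h by auto

lemma drift_diff: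
  assumes s: "s \<in> {0..h}"
  shows "cmod (V s * (1 - u s) - V 0 * (1 - u 0)) \<le> U * \<bar>V s\<bar> + 2 * \<bar>V s - V 0\<bar>"
    and "cmod (V s * (1 - u s)\<^sup>2 - V 0 * (1 - u 0)\<^sup>2) \<le> 4 * U * \<bar>V s\<bar> + 4 * \<bar>V s - V 0\<bar>"
proof -
  have us: "cmod (u s) = 1" and u0: "cmod (u 0) = 1" using s h by (auto intro: norm_u)
  have "V s * (1 - u s) - V 0 * (1 - u 0) = V s * (u 0 - u s) + (V s - V 0) * (1 - u 0)" by (simp add: algebra_simps)
  also have "cmod \<dots> \<le> \<bar>V s\<bar> * U + \<bar>V s - V 0\<bar> * 2"
    unfolding of_real_diff[symmetric]
    by (intro order.trans[OF norm_triangle_ineq] add_mono; unfold norm_mult norm_of_real; intro mult_left_mono)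
      (use u_close[OF s] square_diff_bound(3)[OF u0 u0] in \<open>auto simp: norm_minus_commute\<close>)
  finally show "cmod (V s * (1 - u s) - V 0 * (1 - u 0)) \<le> U * \<bar>V s\<bar> + 2 * \<bar>V s - V 0\<bar>" by (simp add: mult.commute)
  have "V s * (1 - u s)\<^sup>2 - V 0 * (1 - u 0)\<^sup>2 = V s * ((1 - u s)\<^sup>2 - (1 - u 0)\<^sup>2) + (V s - V 0) * (1 - u 0)\<^sup>2" by (simp add: algebra_simps)
  also have "cmod \<dots> \<le> \<bar>V s\<bar> * (4 * U) + \<bar>V s - V 0\<bar> * 4"
    unfolding of_real_diff[symmetric]
    by (intro order.trans[OF norm_triangle_ineq] add_mono; unfold norm_mult norm_of_real; intro mult_left_mono)
      (use u_close[OF s] square_diff_bound(1)[OF us u0] square_diff_bound(4)[OF u0 u0] in auto)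
  finally show "cmod (V s * (1 - u s)\<^sup>2 - V 0 * (1 - u 0)\<^sup>2) \<le> 4 * U * \<bar>V s\<bar> + 4 * \<bar>V s - V 0\<bar>" by (simp add: mult_ac)
qed

text \<open>The coefficients are frozen at the start of the step. Terms with \<open>n\<close> count
  as errors, because their time integrals are of order \<open>h^(3/2)\<close> or smaller; to leading
  order the noise acts through the jump at the end of the step.\<close>

lemma u_expansion:
  "cmod (u h - u 0 - h * (- 2 * \<i> * \<kappa> * u 0 + V 0 * b * (1 - u 0)\<^sup>2))
    \<le> 2 * \<kappa> * U * h + cmod b * (4 * U * S3 + 4 * S4 + 4 * S2) + 2 * S1"
proof -
  let ?f = "\<lambda>s. - 2 * \<i> * \<kappa> * u s + (V s - (n s)\<^sup>2) * b * (1 - u s)\<^sup>2 - n s * (1 - (u s)\<^sup>2)"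
  let ?c = "- 2 * \<i> * \<kappa> * u 0 + V 0 * b * (1 - u 0)\<^sup>2"
  have 1: "(?f has_integral (u h - u 0)) {0..h}"
    by (rule fundamental_theorem_of_calculus[OF h]) (rule u_deriv)
  have 2: "((\<lambda>s. ?f s - ?c) has_integral (u h - u 0 - h * ?c)) {0..h}"
    using has_integral_diff[OF 1 has_integral_const_real[of ?c 0 h]] h by (simp add: scaleR_conv_of_real)
  show ?thesis
  proof (rule norm_le_of_has_integral[OF 2])
    show "((\<lambda>s. 2 * \<kappa> * U + cmod b * (4 * U * \<bar>V s\<bar> + 4 * \<bar>V s - V 0\<bar> + 4 * (n s)\<^sup>2) + 2 * \<bar>n s\<bar>) has_integral
       (2 * \<kappa> * U * h + cmod b * (4 * U * S3 + 4 * S4 + 4 * S2) + 2 * S1)) {0..h}"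
      using has_integral_const_real[of "2 * \<kappa> * U" 0 h] h
      by (intro has_integral_add has_integral_mult_right S_integrals) (auto simp: mult.commute)
    fix s assume s: "s \<in> {0..h}"
    have u1: "cmod (u s) = 1" by (rule norm_u[OF s])
    have "?f s - ?c = - 2 * \<i> * \<kappa> * (u s - u 0) + b * ((V s * (1 - u s)\<^sup>2 - V 0 * (1 - u 0)\<^sup>2) - (n s)\<^sup>2 * (1 - u s)\<^sup>2) - n s * (1 - (u s)\<^sup>2)"
      by (simp add: algebra_simps)
    also have "cmod \<dots> \<le> 2 * \<kappa> * U + cmod b * ((4 * U * \<bar>V s\<bar> + 4 * \<bar>V s - V 0\<bar>) + (n s)\<^sup>2 * 4) + \<bar>n s\<bar> * 2"
    proof (intro order.trans[OF norm_triangle_ineq4] add_mono order.trans[OF norm_triangle_ineq])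
      show "cmod (- 2 * \<i> * \<kappa> * (u s - u 0)) \<le> 2 * \<kappa> * U"
        using u_close[OF s] \<kappa> by (simp add: norm_mult)
      have "cmod (complex_of_real ((n s)\<^sup>2) * (1 - u s)\<^sup>2) \<le> (n s)\<^sup>2 * 4"
        unfolding norm_mult norm_of_real using square_diff_bound(4)[OF u1 u1] by (intro mult_mono) auto
      then show "cmod (b * ((V s * (1 - u s)\<^sup>2 - V 0 * (1 - u 0)\<^sup>2) - (n s)\<^sup>2 * (1 - u s)\<^sup>2)) \<le> cmod b * ((4 * U * \<bar>V s\<bar> + 4 * \<bar>V s - V 0\<bar>) + (n s)\<^sup>2 * 4)"
        unfolding norm_mult[of b]
        by (intro mult_left_mono order.trans[OF norm_triangle_ineq4] add_mono drift_diff(2)[OF s]) auto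
      have "cmod (1 - (u s)\<^sup>2) \<le> 2" using norm_triangle_ineq4[of 1 "(u s)\<^sup>2"] u1 by (simp add: norm_power)
      then show "cmod (n s * (1 - (u s)\<^sup>2)) \<le> \<bar>n s\<bar> * 2" by (simp add: norm_mult mult_left_mono)
    qed
    finally show "cmod (?f s - ?c) \<le> 2 * \<kappa> * U + cmod b * (4 * U * \<bar>V s\<bar> + 4 * \<bar>V s - V 0\<bar> + 4 * (n s)\<^sup>2) + 2 * \<bar>n s\<bar>"
      by (simp add: mult_ac)
  qed
qed

lemma ln_expansion:
  "\<bar>ln (cmod (q h)) - ln (cmod (q 0)) - h * Re (V 0 * b * (1 - u 0))\<bar>
    \<le> cmod b * (U * S3 + 2 * S4 + 2 * S2) + S1"
proof -
  have 1: "((\<lambda>s. Re (P s)) has_integral (ln (cmod (q h)) - ln (cmod (q 0)))) {0..h}"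
    by (rule fundamental_theorem_of_calculus[OF h]) (rule ln_q_deriv)
  let ?c = "Re (V 0 * b * (1 - u 0))"
  have 2: "((\<lambda>s. Re (P s) - ?c) has_integral (ln (cmod (q h)) - ln (cmod (q 0)) - h * ?c)) {0..h}"
    using has_integral_diff[OF 1 has_integral_const_real[of ?c 0 h]] h by simp
  have "norm (ln (cmod (q h)) - ln (cmod (q 0)) - h * ?c) \<le> cmod b * (U * S3 + 2 * S4 + 2 * S2) + S1"
  proof (rule norm_le_of_has_integral[OF 2])
    show "((\<lambda>s. cmod b * (U * \<bar>V s\<bar> + 2 * \<bar>V s - V 0\<bar> + 2 * (n s)\<^sup>2) + \<bar>n s\<bar>) has_integral
       (cmod b * (U * S3 + 2 * S4 + 2 * S2) + S1)) {0..h}"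
      by (intro has_integral_add has_integral_mult_right S_integrals)
    fix s assume s: "s \<in> {0..h}"
    have u1: "cmod (u s) = 1" by (rule norm_u[OF s])
    have "Re (P s) - ?c = Re (b * ((V s * (1 - u s) - V 0 * (1 - u 0)) - (n s)\<^sup>2 * (1 - u s)) - n s * u s)"
      unfolding P_def by (simp add: algebra_simps)
    also have "\<bar>\<dots>\<bar> \<le> cmod (b * ((V s * (1 - u s) - V 0 * (1 - u 0)) - (n s)\<^sup>2 * (1 - u s)) - n s * u s)"
      by (rule abs_Re_le_cmod)
    also have "\<dots> \<le> cmod b * ((U * \<bar>V s\<bar> + 2 * \<bar>V s - V 0\<bar>) + (n s)\<^sup>2 * 2) + \<bar>n s\<bar>"
    proof (intro order.trans[OF norm_triangle_ineq4] add_mono)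
      have "cmod (complex_of_real ((n s)\<^sup>2) * (1 - u s)) \<le> (n s)\<^sup>2 * 2"
        unfolding norm_mult norm_of_real using square_diff_bound(3)[OF u1 u1] by (intro mult_mono) auto
      then show "cmod (b * ((V s * (1 - u s) - V 0 * (1 - u 0)) - (n s)\<^sup>2 * (1 - u s))) \<le> cmod b * ((U * \<bar>V s\<bar> + 2 * \<bar>V s - V 0\<bar>) + (n s)\<^sup>2 * 2)"
        unfolding norm_mult[of b]
        by (intro mult_left_mono order.trans[OF norm_triangle_ineq4] add_mono drift_diff(1)[OF s]) auto
      show "cmod (n s * u s) \<le> \<bar>n s\<bar>" using u1 by (simp add: norm_mult)
    qed
    finally show "norm (Re (P s) - ?c) \<le> cmod b * (U * \<bar>V s\<bar> + 2 * \<bar>V s - V 0\<bar> + 2 * (n s)\<^sup>2) + \<bar>n s\<bar>"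
      by (simp add: mult_ac)
  qed
  then show ?thesis by simp
qed

end

section \<open>Size of the error terms over one step\<close>

lemma norm_Cauchy_inner: "\<bar>c * (x \<bullet> z)\<bar> \<le> \<bar>c\<bar> * norm x * norm (z::'a::real_inner)"
  using Cauchy_Schwarz_ineq2[of x z] by (simp add: abs_mult mult.assoc mult_left_mono)

lemma has_vector_derivative_shift:
  assumes f: "(f has_vector_derivative D) (at (t + s) within {0..})" and t: "0 \<le> t" and s: "s \<in> {0..h}"
  shows "((\<lambda>s. f (t + s)) has_vector_derivative D) (at s within {0..h})"
proof -
  have 1: "((\<lambda>s. t + s) has_vector_derivative 1) (at s within {0..h})" by (auto intro!: derivative_eq_intros)
  have 2: "(f has_vector_derivative D) (at (t + s) within (\<lambda>s. t + s) ` {0..h})"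
    by (rule has_vector_derivative_within_subset[OF f]) (use t in auto)
  from vector_diff_chain_within[OF 1 2] show ?thesis by (simp add: o_def)
qed

text \<open>The movement is of order \<open>h\<close>, the jump of order \<open>sqrt h\<close>, and
  \<open>h \<le> sqrt h\<close>; so each of these products is an error of order
  \<open>h^(3/2)\<close>.\<close>

lemma step_error_bound:
  fixes h g e U S1 S2 S3 S4 n :: real
  assumes h: "0 < h" "h \<le> 1"
  defines "g \<equiv> sqrt h" and "e \<equiv> h * sqrt h"
  assumes k: "0 \<le> k" "0 \<le> b"
    and S: "S1 \<le> e * A1" "S2 \<le> e * A2" "S3 \<le> h * A3" "S4 \<le> e * A4" "0 \<le> S3" "0 \<le> A3"
    and U: "0 \<le> U" "U \<le> h * B" "0 \<le> B" and n: "0 \<le> n" "n \<le> g * N" "0 \<le> N"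
  shows "k * U * h \<le> e * (k * B)" and "U * S3 \<le> e * (B * A3)"
    and "n * U \<le> e * (N * B)" and "n\<^sup>2 * U \<le> e * (N\<^sup>2 * B)" and "n ^ 3 \<le> e * N ^ 3"
proof -
  have g: "0 < g" "g \<le> 1" "g * g = h" and e: "e = h * g" using h by (auto simp: g_def e_def)
  have "h \<le> g" using mult_left_mono[OF g(2), of g] g by simp
  then have hh: "h * h \<le> e" unfolding e using h by (intro mult_left_mono) auto
  have g2: "g\<^sup>2 = h" using g(3) by (simp add: power2_eq_square)
  have e0: "0 \<le> e" unfolding e using g h by simp
  have "U * h \<le> h * B * h" using U(2) h by (intro mult_right_mono) auto
  also have "\<dots> = (h * h) * B" by simp
  also have "\<dots> \<le> e * B" by (intro mult_right_mono hh U)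
  finally have Uh: "U * h \<le> e * B" .
  show "k * U * h \<le> e * (k * B)" using mult_left_mono[OF Uh k(1)] by (simp add: mult_ac)
  have "U * S3 \<le> (h * B) * (h * A3)" using U S h by (intro mult_mono) auto
  also have "\<dots> = (h * h) * (B * A3)" by simp
  also have "\<dots> \<le> e * (B * A3)" using U S by (intro mult_right_mono hh) auto
  finally show "U * S3 \<le> e * (B * A3)" .
  have "n * U \<le> (g * N) * (h * B)" using n U g by (intro mult_mono) auto
  then show "n * U \<le> e * (N * B)" by (simp add: e mult_ac)
  have n2: "n\<^sup>2 \<le> h * N\<^sup>2" using power_mono[OF n(2,1), of 2] unfolding power_mult_distrib g2 .
  have "n\<^sup>2 * U \<le> (h * N\<^sup>2) * (h * B)" using n2 U h by (intro mult_mono) auto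
  also have "\<dots> = (h * h) * (N\<^sup>2 * B)" by simp
  also have "\<dots> \<le> e * (N\<^sup>2 * B)" using U by (intro mult_right_mono hh) auto
  finally show "n\<^sup>2 * U \<le> e * (N\<^sup>2 * B)" .
  have "n ^ 3 \<le> (g * N) ^ 3" using n by (intro power_mono) auto
  also have "\<dots> = e * N ^ 3" unfolding power_mult_distrib e using g(3) by (simp add: power3_eq_cube mult_ac)
  finally show "n ^ 3 \<le> e * N ^ 3" .
qed

context brownian
begin

text \<open>The form in which expansions are verified: a pathwise bound of the error by
  \<open>h^(3/2)\<close> times a variable with uniformly bounded moments.\<close>

lemma ito_I:
  assumes Y: "\<And>t. 0 \<le> t \<Longrightarrow> Y t \<in> borel_measurable (F t)"
    and a: "adm a" and \<sigma>: "\<And>l. adm (\<sigma> l)" and c: "\<And>l k. adm (c l k)"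
    and R: "mbdd M steps (R :: real \<times> real \<Rightarrow> 'w \<Rightarrow> real)"
    and le: "\<And>t h z. z \<in> space M \<Longrightarrow> 0 \<le> t \<Longrightarrow> 0 < h \<Longrightarrow> h \<le> 1 \<Longrightarrow>
      norm (Y (t + h) z - Y t z - of_real h * a t z - (\<Sum>l\<in>UNIV. \<sigma> l t z * of_real (dW l t h z))
        - (\<Sum>l\<in>UNIV. \<Sum>k\<in>UNIV. c l k t z * of_real (dQ l k t h z))) \<le> (h * sqrt h) * R (t, h) z"
  shows "ito Y a \<sigma>"
proof -
  have "mbdd M steps (remainder Y a \<sigma> c)"
  proof (rule mbdd_dominated[OF R])
    fix i assume "i \<in> steps"
    then obtain t h where i: "i = (t, h)" "0 \<le> t" "0 < h" "h \<le> 1" by (auto simp: steps_def)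
    have [measurable]: "W t \<in> borel_measurable M" "W (t + h) \<in> borel_measurable M"
      using i by (auto intro!: W_measurable)
    have [measurable]: "dW l t h \<in> borel_measurable M" for l
      unfolding dW_def by (rule measurable_compose[OF _ borel_measurable_nth]) measurable
    have [measurable]: "dQ l k t h \<in> borel_measurable M" for l k
      unfolding dQ_def by measurable
    have [measurable]: "Y t \<in> borel_measurable M" "Y (t + h) \<in> borel_measurable M"
      using i by (auto intro!: measurable_F_M[OF Y])
    have [measurable]: "a t \<in> borel_measurable M" "\<sigma> l t \<in> borel_measurable M" "c l k t \<in> borel_measurable M" for l k
      using i by (auto intro!: measurable_F_M[OF adm_measurable] a \<sigma> c)
    show "remainder Y a \<sigma> c i \<in> borel_measurable M"
      unfolding remainder_def i fst_conv snd_conv by measurable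
    fix z assume z: "z \<in> space M"
    have hs: "0 < h * sqrt h" using i by simp
    then have "norm (remainder Y a \<sigma> c i z) = norm (Y (t + h) z - Y t z - of_real h * a t z - (\<Sum>l\<in>UNIV. \<sigma> l t z * of_real (dW l t h z))
        - (\<Sum>l\<in>UNIV. \<Sum>k\<in>UNIV. c l k t z * of_real (dQ l k t h z))) / (h * sqrt h)"
      unfolding remainder_def i fst_conv snd_conv norm_divide norm_of_real by simp
    also have "\<dots> \<le> R (t, h) z"
      using le[OF z i(2-4)] hs by (simp add: pos_divide_le_eq mult.commute)
    finally show "norm (remainder Y a \<sigma> c i z) \<le> norm (R i z)" by (simp add: i)
  qed
  with a \<sigma> c show ?thesis unfolding ito_def by blast
qed

lemma mbdd_time_average:
  fixes g :: "real \<times> real \<Rightarrow> real \<Rightarrow> 'w \<Rightarrow> real"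
  assumes m: "\<And>i s. i \<in> steps \<Longrightarrow> 0 \<le> s \<Longrightarrow> g i s \<in> borel_measurable M"
    and c: "\<And>i z. i \<in> steps \<Longrightarrow> z \<in> space M \<Longrightarrow> continuous_on {0..} (\<lambda>s. g i s z)"
    and pos: "\<And>i s z. i \<in> steps \<Longrightarrow> 0 \<le> g i s z"
    and b: "mbdd M {(i, s). i \<in> steps \<and> 0 \<le> s \<and> s \<le> snd i} (\<lambda>(i, s). g i s)"
  shows "mbdd M steps (\<lambda>i z. integral {0..snd i} (\<lambda>s. g i s z) / snd i)"
proof -
  define f where "f i s z = \<bar>g i (max 0 s) z\<bar>" for i s z
  have fm: "(\<lambda>(s, z). f i s z) \<in> borel_measurable (borel \<Otimes>\<^sub>M M)" if i: "i \<in> steps" for i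
    unfolding f_def
  proof (rule borel_measurable_continuous_process)
    show "(\<lambda>z. \<bar>g i (max 0 s) z\<bar>) \<in> borel_measurable M" for s
      by (rule borel_measurable_abs, rule m[OF i]) simp
    show "continuous_on UNIV (\<lambda>s. \<bar>g i (max 0 s) z\<bar>)" if "z \<in> space M" for z
      by (intro continuous_on_rabs continuous_on_compose2[OF c[OF i that]]) (auto intro!: continuous_intros)
  qed
  have int: "(\<integral>\<^sup>+s\<in>{0..snd i}. ennreal (f i s z) \<partial>lborel) = ennreal (integral {0..snd i} (\<lambda>s. g i s z))"
    if "i \<in> steps" "z \<in> space M" for i z
  proof -
    have "(\<integral>\<^sup>+s\<in>{0..snd i}. ennreal (f i s z) \<partial>lborel) = (\<integral>\<^sup>+s\<in>{0..snd i}. ennreal (g i s z) \<partial>lborel)"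
      using pos that by (intro nn_integral_cong) (auto simp: f_def indicator_def)
    also have "\<dots> = ennreal (integral {0..snd i} (\<lambda>s. g i s z))"
      by (rule nn_integral_Icc_continuous) (use pos that in \<open>auto intro: continuous_on_subset[OF c[OF that]]\<close>)
    finally show ?thesis .
  qed
  have nn: "0 \<le> integral {0..snd i} (\<lambda>s. g i s z)" if "i \<in> steps" "z \<in> space M" for i z
    by (rule Henstock_Kurzweil_Integration.integral_nonneg)
       (use pos that in \<open>auto intro!: integrable_continuous_real intro: continuous_on_subset[OF c[OF that]]\<close>)
  show ?thesis
  proof (rule mbdd_average[OF prob_space_M, where f=f])
    show "0 < snd i" if "i \<in> steps" for i using that by (auto simp: steps_def)
    show "mbdd M {(i, s). i \<in> steps \<and> 0 \<le> s \<and> s \<le> snd i} (\<lambda>(i, s). f i s)"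
      by (rule mbdd_cong[OF b]) (use pos in \<open>auto simp: f_def\<close>)
    show "0 \<le> f i s z" for i s z by (simp add: f_def)
    fix i assume i: "i \<in> steps"
    show "(\<lambda>(s, z). f i s z) \<in> borel_measurable (borel \<Otimes>\<^sub>M M)" by (rule fm[OF i])
    have [measurable]: "(\<lambda>x. f i (snd x) (fst x)) \<in> borel_measurable (M \<Otimes>\<^sub>M borel)"
      using measurable_compose[OF measurable_pair_swap' fm[OF i]] by (simp add: split_beta)
    have sl: "sets (M \<Otimes>\<^sub>M lborel) = sets (M \<Otimes>\<^sub>M borel)" by (rule sets_pair_measure_cong) auto
    have "(\<lambda>z. enn2real (\<integral>\<^sup>+s\<in>{0..snd i}. ennreal (f i s z) \<partial>lborel) / snd i) \<in> borel_measurable M"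
    proof -
      have "(\<lambda>(z, s). ennreal (f i s z) * indicator {0..snd i} s) \<in> borel_measurable (M \<Otimes>\<^sub>M lborel)"
        unfolding measurable_cong_sets[OF sl refl] split_beta by measurable
      from lborel.borel_measurable_nn_integral[OF this]
      have [measurable]: "(\<lambda>z. \<integral>\<^sup>+s\<in>{0..snd i}. ennreal (f i s z) \<partial>lborel) \<in> borel_measurable M" .
      show ?thesis by measurable
    qed
    then show "(\<lambda>z. integral {0..snd i} (\<lambda>s. g i s z) / snd i) \<in> borel_measurable M"
      by (rule measurable_cong[THEN iffD1, rotated]) (use int[OF i] nn[OF i] in simp)
    fix z assume z: "z \<in> space M"
    have "0 < snd i" using i by (auto simp: steps_def)
    then show "ennreal (norm (integral {0..snd i} (\<lambda>s. g i s z) / snd i)) \<le> ennreal (1 / snd i) * (\<integral>\<^sup>+s\<in>{0..snd i}. ennreal (f i s z) \<partial>lborel)"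
      unfolding int[OF i z] using nn[OF i z] by (subst ennreal_mult'[symmetric]) auto
  qed
qed

text \<open>Scaling by the square root of the whole step instead of \<open>s\<close> keeps the path
  continuous at \<open>s = 0\<close>, as the time averages require, and only makes the quotient
  smaller.\<close>

lemma mbdd_W_scaled: "mbdd M {(i, s). i \<in> steps \<and> 0 \<le> s \<and> s \<le> snd i}
   (\<lambda>(i, s) z. norm (W (fst i + s) z - W (fst i) z) / sqrt (snd i))"
proof (rule mbdd_dominated)
  show "mbdd M {(i, s). i \<in> steps \<and> 0 \<le> s \<and> s \<le> snd i}
     (\<lambda>x z. norm (W (fst (fst x) + snd x) z - W (fst (fst x)) z) / sqrt (fst (fst x) + snd x - fst (fst x)))"
    using mbdd_reindex[OF mbdd_W_incr, of "{(i, s). i \<in> steps \<and> 0 \<le> s \<and> s \<le> snd i}" "\<lambda>x. (fst (fst x), fst (fst x) + snd x)"]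
    by (auto simp: steps_def)
  fix x :: "(real \<times> real) \<times> real" assume "x \<in> {(i, s). i \<in> steps \<and> 0 \<le> s \<and> s \<le> snd i}"
  then obtain t h s where x: "x = ((t, h), s)" "0 \<le> t" "0 < h" "h \<le> 1" "0 \<le> s" "s \<le> h"
    by (auto simp: steps_def)
  have [measurable]: "W t \<in> borel_measurable M" "W (t + s) \<in> borel_measurable M"
    using x by (auto intro!: W_measurable)
  show "(case x of (i, s) \<Rightarrow> \<lambda>z. norm (W (fst i + s) z - W (fst i) z) / sqrt (snd i)) \<in> borel_measurable M"
    unfolding x by simp
  fix z
  show "norm ((case x of (i, s) \<Rightarrow> \<lambda>z. norm (W (fst i + s) z - W (fst i) z) / sqrt (snd i)) z)
     \<le> norm (norm (W (fst (fst x) + snd x) z - W (fst (fst x)) z) / sqrt (fst (fst x) + snd x - fst (fst x)))"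
    using x by (cases "s = 0") (auto intro!: divide_left_mono)
qed

definition avgW :: "real \<times> real \<Rightarrow> 'w \<Rightarrow> real" where
  "avgW i z = integral {0..snd i} (\<lambda>s. norm (W (fst i + s) z - W (fst i) z) / sqrt (snd i)) / snd i"

definition avgW2 :: "real \<times> real \<Rightarrow> 'w \<Rightarrow> real" where
  "avgW2 i z = integral {0..snd i} (\<lambda>s. (norm (W (fst i + s) z - W (fst i) z) / sqrt (snd i))\<^sup>2) / snd i"

lemma W_shift_cont:
  assumes "z \<in> space M" "0 \<le> t"
  shows "continuous_on {0..} (\<lambda>s. W (t + s) z)"
  by (rule continuous_on_compose2[OF W_cont[OF assms(1)]]) (use assms(2) in \<open>auto intro!: continuous_intros\<close>)

lemma mbdd_avgW: "mbdd M steps avgW" and mbdd_avgW2: "mbdd M steps avgW2"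
proof -
  have m: "(\<lambda>z. norm (W (fst i + s) z - W (fst i) z) / sqrt (snd i)) \<in> borel_measurable M"
    if "i \<in> steps" "0 \<le> s" for i :: "real \<times> real" and s
  proof -
    have [measurable]: "W (fst i) \<in> borel_measurable M" "W (fst i + s) \<in> borel_measurable M"
      using that by (auto intro!: W_measurable simp: steps_def)
    show ?thesis by measurable
  qed
  have c: "continuous_on {0..} (\<lambda>s. norm (W (fst i + s) z - W (fst i) z) / sqrt (snd i))"
    if "i \<in> steps" "z \<in> space M" for i z
    using that by (intro continuous_intros W_shift_cont) (auto simp: steps_def)
  show "mbdd M steps avgW"
    unfolding avgW_def[abs_def]
    by (intro mbdd_time_average m c) (use mbdd_W_scaled in \<open>auto simp: steps_def intro!: divide_nonneg_nonneg\<close>)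
  show "mbdd M steps avgW2"
    unfolding avgW2_def[abs_def]
  proof (rule mbdd_time_average[where g="\<lambda>i s z. (norm (W (fst i + s) z - W (fst i) z) / sqrt (snd i))\<^sup>2"])
    show "mbdd M {(i, s). i \<in> steps \<and> 0 \<le> s \<and> s \<le> snd i} (\<lambda>(i, s) z. (norm (W (fst i + s) z - W (fst i) z) / sqrt (snd i))\<^sup>2)"
      by (rule mbdd_cong[OF mbdd_power[OF prob_space_M mbdd_W_scaled, of 2]]) auto
  qed (use m c in \<open>auto intro!: continuous_on_power borel_measurable_power\<close>)
qed

end

section \<open>The driving process in the discrete calculus\<close>

text \<open>The probability space and all parameters of the oscillator are quantified after the
  constant, which thus depends on \<open>A\<close>, \<open>B\<close> and the exponent alone. The
  uniform estimate rests on this.\<close>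

lemma v_moment_uniform:
  fixes A :: "real^'d^'d" and B :: "real^'m^'d"
  assumes "stable_matrix A"
  shows "\<exists>C\<ge>0. \<forall>(M::'w measure) F W a \<gamma> \<kappa> \<epsilon> v y r t. oscillator M F W A B a \<gamma> \<kappa> \<epsilon> v y r \<longrightarrow> 0 \<le> t \<longrightarrow>
    (\<integral>\<^sup>+z. ennreal (norm (v t z)) ^ (2 ^ Suc j) \<partial>M) \<le> ennreal C"
proof -
  obtain C \<delta> where C: "C > 0" "\<delta> > 0"
    "\<And>t x. t \<ge> 0 \<Longrightarrow> norm (mat_exp (t *\<^sub>R A) *v x) \<le> C * exp (- \<delta> * t) * norm x"
    using stable_decay_mv[OF assms] by metis
  obtain KB where KB: "KB \<ge> 0" "\<And>x. norm (B *v x) \<le> norm x * KB"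
    using bounded_linear.nonneg_bounded[OF matrix_vector_mul_bounded_linear[of B]] by blast
  obtain KA where KA: "KA \<ge> 0" "\<And>x. norm (A *v x) \<le> norm x * KA"
    using bounded_linear.nonneg_bounded[OF matrix_vector_mul_bounded_linear[of A]] by blast
  define K where "K = C * KB + C * (KB * KA)"
  have K0: "0 \<le> K" using C KB KA by (simp add: K_def)
  have K1: "C * norm (B *v x) \<le> K * norm x" for x
  proof -
    have "C * norm (B *v x) \<le> C * (norm x * KB)" using C KB by (intro mult_left_mono) auto
    moreover have "0 \<le> C * (KB * KA) * norm x" using C KB KA by simp
    ultimately show ?thesis by (simp add: K_def algebra_simps)
  qed
  have K2: "C * norm (A *v (B *v x)) \<le> K * norm x" for x
  proof -
    have "norm (A *v (B *v x)) \<le> (norm x * KB) * KA"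
      using order.trans[OF KA(2) mult_right_mono[OF KB(2) KA(1)]] .
    then have "C * norm (A *v (B *v x)) \<le> C * ((norm x * KB) * KA)" using C by (intro mult_left_mono) auto
    moreover have "0 \<le> C * KB * norm x" using C KB by simp
    ultimately show ?thesis by (simp add: K_def algebra_simps)
  qed
  define wm where "wm = real CARD('m) ^ (2 ^ Suc j) * (real CARD('m) * gauss_moment j)"
  let ?C = "K ^ (2 ^ Suc j) * (2 ^ (2 ^ Suc j) * (wm * (1 / \<delta>) ^ (2 ^ j) + (2 / \<delta>) ^ (2 ^ Suc j) * (wm * (1 / \<delta>) ^ (2 ^ j))))"
  have "(\<integral>\<^sup>+z. ennreal (norm (v t z)) ^ (2 ^ Suc j) \<partial>M) \<le> ennreal (max 0 ?C)"
    if "oscillator M F W A B a \<gamma> \<kappa> \<epsilon> v y r" "0 \<le> t" for M :: "'w measure" and F W a \<gamma> \<kappa> \<epsilon> v y r t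
  proof -
    interpret oscillator M F W A B a \<gamma> \<kappa> \<epsilon> v y r by fact
    have "wmom j = wm" by (simp add: wmom_def wm_def)
    with v_moment[OF C(3) K1 K2 K0 C(2) that(2), of j]
    have "(\<integral>\<^sup>+z. ennreal (norm (v t z)) ^ (2 ^ Suc j) \<partial>M) \<le> ennreal ?C" by simp
    also have "\<dots> \<le> ennreal (max 0 ?C)" by (intro ennreal_leI) simp
    finally show ?thesis .
  qed
  then show ?thesis by (intro exI[of _ "max 0 ?C"]) auto
qed

locale stable_oscillator = oscillator M F W A B a \<gamma> \<kappa> \<epsilon> v y r
  for M :: "'w measure" and F and W :: "real \<Rightarrow> 'w \<Rightarrow> real^'m" and A :: "real^'d^'d" and B a \<gamma> \<kappa> \<epsilon> v y r +
  assumes stable: "stable_matrix A"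
begin

lemma mbdd_v: "mbdd M {0..} v"
  unfolding mbdd_def
proof (intro conjI ballI allI)
  show "v t \<in> borel_measurable M" if "t \<in> {0..}" for t
    using that by (auto intro!: measurable_F_M[OF v_adapted])
  show "\<exists>C. \<forall>t\<in>{0..}. (\<integral>\<^sup>+z. ennreal (norm (v t z)) ^ (2 ^ Suc j) \<partial>M) \<le> ennreal C" for j
    using v_moment_uniform[OF stable, of B j, where 'w='w] oscillator_axioms by (meson atLeast_iff)
qed

definition avgV :: "real \<times> real \<Rightarrow> 'w \<Rightarrow> real" where
  "avgV i z = integral {0..snd i} (\<lambda>s. norm (v (fst i + s) z)) / snd i"

lemma v_shift_cont:
  assumes "z \<in> space M" "0 \<le> t"
  shows "continuous_on {0..} (\<lambda>s. v (t + s) z)"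
  by (rule continuous_on_compose2[OF v_cont[OF assms(1)]]) (use assms(2) in \<open>auto intro!: continuous_intros\<close>)

lemma mbdd_avgV: "mbdd M steps avgV"
  unfolding avgV_def[abs_def]
proof (rule mbdd_time_average[where g="\<lambda>i s z. norm (v (fst i + s) z)"])
  show "mbdd M {(i, s). i \<in> steps \<and> 0 \<le> s \<and> s \<le> snd i} (\<lambda>(i, s) z. norm (v (fst i + s) z))"
    by (rule mbdd_cong[OF mbdd_reindex[OF mbdd_norm[OF mbdd_v], where f="\<lambda>x. fst (fst x) + snd x"]])
       (auto simp: steps_def)
  show "(\<lambda>z. norm (v (fst i + s) z)) \<in> borel_measurable M" if "i \<in> steps" "0 \<le> s" for i s
  proof -
    have [measurable]: "v (fst i + s) \<in> borel_measurable M"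
      using that by (auto intro!: measurable_F_M[OF v_adapted] simp: steps_def)
    show ?thesis by measurable
  qed
  show "continuous_on {0..} (\<lambda>s. norm (v (fst i + s) z))" if "i \<in> steps" "z \<in> space M" for i z
    using that by (intro continuous_intros v_shift_cont) (auto simp: steps_def)
qed simp

definition dist_W :: "real \<times> real \<Rightarrow> 'w \<Rightarrow> real" where
  "dist_W i z = norm (W (fst i + snd i) z - W (fst i) z) / sqrt (snd i)"

lemma mbdd_dist_W: "mbdd M steps dist_W"
  by (rule mbdd_cong[OF mbdd_reindex[OF mbdd_W_incr, of steps "\<lambda>i. (fst i, fst i + snd i)"]])
     (auto simp: steps_def dist_W_def)

definition normB :: real where "normB = onorm ((*v) B)"
definition normA :: real where "normA = onorm ((*v) A)"

lemma normB: "norm (B *v x) \<le> normB * norm x" and normA: "norm (A *v z) \<le> normA * norm z"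
  unfolding normB_def normA_def by (rule onorm[OF matrix_vector_mul_bounded_linear])+

lemma norm_nonneg: "0 \<le> normB" "0 \<le> normA"
  unfolding normB_def normA_def by (rule onorm_pos_le[OF matrix_vector_mul_bounded_linear])+

lemma step_integrals:
  assumes z: "z \<in> space M" and th: "0 \<le> t" "0 < h" "h \<le> 1"
  shows "((\<lambda>s. norm (W (t + s) z - W t z)) has_integral (h * sqrt h) * avgW (t, h) z) {0..h}"
    and "((\<lambda>s. (norm (W (t + s) z - W t z))\<^sup>2) has_integral (h * h) * avgW2 (t, h) z) {0..h}"
    and "((\<lambda>s. norm (v (t + s) z)) has_integral h * avgV (t, h) z) {0..h}"
proof -
  have cW: "continuous_on {0..h} (\<lambda>s. W (t + s) z)" and cv: "continuous_on {0..h} (\<lambda>s. v (t + s) z)"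
    by (rule continuous_on_subset[OF W_shift_cont[OF z th(1)]], force) (rule continuous_on_subset[OF v_shift_cont[OF z th(1)]], force)
  have "(h * sqrt h) * avgW (t, h) z = integral {0..h} (\<lambda>s. norm (W (t + s) z - W t z))"
    using th by (simp add: avgW_def)
  then show "((\<lambda>s. norm (W (t + s) z - W t z)) has_integral (h * sqrt h) * avgW (t, h) z) {0..h}"
    by (simp only:) (intro integrable_integral integrable_continuous_real continuous_intros cW)
  have "(h * h) * avgW2 (t, h) z = integral {0..h} (\<lambda>s. (norm (W (t + s) z - W t z))\<^sup>2)"
    using th by (simp add: avgW2_def power_divide)
  then show "((\<lambda>s. (norm (W (t + s) z - W t z))\<^sup>2) has_integral (h * h) * avgW2 (t, h) z) {0..h}"
    by (simp only:) (intro integrable_integral integrable_continuous_real continuous_intros cW)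
  have "h * avgV (t, h) z = integral {0..h} (\<lambda>s. norm (v (t + s) z))"
    using th by (simp add: avgV_def)
  then show "((\<lambda>s. norm (v (t + s) z)) has_integral h * avgV (t, h) z) {0..h}"
    by (simp only:) (intro integrable_integral integrable_continuous_real continuous_intros cv)
qed

lemma avg_nonneg:
  assumes z: "z \<in> space M" and th: "0 \<le> t" "0 < h" "h \<le> 1"
  shows "0 \<le> avgW (t, h) z" "0 \<le> avgW2 (t, h) z" "0 \<le> avgV (t, h) z" "0 \<le> dist_W (t, h) z"
proof -
  note i = step_integrals[OF assms]
  have pos: "0 \<le> x" if "0 < c" "0 \<le> c * x" for c x :: real
    using that by (simp add: zero_le_mult_iff)
  have "0 \<le> (h * sqrt h) * avgW (t, h) z" by (rule has_integral_nonneg[OF i(1)]) simp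
  then show "0 \<le> avgW (t, h) z" by (rule pos[rotated]) (use th in simp)
  have "0 \<le> (h * h) * avgW2 (t, h) z" by (rule has_integral_nonneg[OF i(2)]) simp
  then show "0 \<le> avgW2 (t, h) z" by (rule pos[rotated]) (use th in simp)
  have "0 \<le> h * avgV (t, h) z" by (rule has_integral_nonneg[OF i(3)]) simp
  then show "0 \<le> avgV (t, h) z" by (rule pos[rotated]) (use th in simp)
qed (use th in \<open>simp add: dist_W_def\<close>)

lemma v_increment:
  assumes z: "z \<in> space M" and t: "0 \<le> t" and s: "0 \<le> s"
  shows "((\<lambda>s. A *v v (t + s) z) has_integral (v (t + s) z - v t z - B *v (W (t + s) z - W t z))) {0..s}"
proof -
  have "((\<lambda>s. A *v v (t + s) z) has_integral ((v (t + s) z - B *v W (t + s) z) - (v (t + 0) z - B *v W (t + 0) z))) {0..s}"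
    by (rule fundamental_theorem_of_calculus[OF s])
       (rule has_vector_derivative_shift[OF v_deriv[OF z]], use t in auto)
  then show ?thesis by (simp add: matrix_vector_mult_diff_distrib algebra_simps)
qed

lemma v_close:
  assumes z: "z \<in> space M" and th: "0 \<le> t" "0 < h" "h \<le> 1" and s: "s \<in> {0..h}"
  shows "norm (v (t + s) z - v t z) \<le> normB * norm (W (t + s) z - W t z) + normA * (h * avgV (t, h) z)"
proof -
  note i = step_integrals(3)[OF z th]
  have s': "0 \<le> s" using s by simp
  have sub: "{0..s} \<subseteq> {0..h}" using s by auto
  have int: "(\<lambda>s. normA * norm (v (t + s) z)) integrable_on {0..h}"
    using has_integral_integrable[OF has_integral_mult_right[OF i]] .
  have ints: "(\<lambda>s. normA * norm (v (t + s) z)) integrable_on {0..s}"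
    by (rule integrable_on_subinterval[OF int sub])
  have "norm (v (t + s) z - v t z - B *v (W (t + s) z - W t z)) = norm (integral {0..s} (\<lambda>s. A *v v (t + s) z))"
    using v_increment[OF z th(1) s'] by (simp add: integral_unique)
  also have "\<dots> \<le> integral {0..s} (\<lambda>s. normA * norm (v (t + s) z))"
    by (rule integral_norm_bound_integral[OF has_integral_integrable[OF v_increment[OF z th(1) s']] ints]) (rule normA)
  also have "\<dots> \<le> integral {0..h} (\<lambda>s. normA * norm (v (t + s) z))"
    using norm_nonneg by (intro integral_subset_le sub ints int) auto
  also have "\<dots> = normA * (h * avgV (t, h) z)"
    using has_integral_mult_right[OF i] by (rule integral_unique)
  finally have 1: "norm (v (t + s) z - v t z - B *v (W (t + s) z - W t z)) \<le> normA * (h * avgV (t, h) z)" .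
  have "norm (v (t + s) z - v t z) \<le> norm (v (t + s) z - v t z - B *v (W (t + s) z - W t z)) + norm (B *v (W (t + s) z - W t z))"
    using norm_triangle_ineq[of "v (t + s) z - v t z - B *v (W (t + s) z - W t z)" "B *v (W (t + s) z - W t z)"] by simp
  then show ?thesis using 1 normB[of "W (t + s) z - W t z"] by linarith
qed

lemma v_close_integral:
  assumes z: "z \<in> space M" and th: "0 \<le> t" "0 < h" "h \<le> 1"
  obtains I where "((\<lambda>s. norm (v (t + s) z - v t z)) has_integral I) {0..h}"
    "I \<le> (h * sqrt h) * (normB * avgW (t, h) z + normA * avgV (t, h) z)"
proof -
  have cv: "continuous_on {0..h} (\<lambda>s. v (t + s) z)"
    by (rule continuous_on_subset[OF v_shift_cont[OF z th(1)]]) auto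
  have int: "(\<lambda>s. norm (v (t + s) z - v t z)) integrable_on {0..h}"
    by (intro integrable_continuous_real continuous_intros cv)
  have g: "((\<lambda>s. normB * norm (W (t + s) z - W t z) + normA * (h * avgV (t, h) z)) has_integral
     (normB * ((h * sqrt h) * avgW (t, h) z) + (normA * (h * avgV (t, h) z)) * h)) {0..h}"
    using has_integral_const_real[of "normA * (h * avgV (t, h) z)" 0 h] th
    by (intro has_integral_add has_integral_mult_right step_integrals[OF z th]) (simp add: mult.commute)
  have "integral {0..h} (\<lambda>s. norm (v (t + s) z - v t z)) \<le> normB * ((h * sqrt h) * avgW (t, h) z) + (normA * (h * avgV (t, h) z)) * h"
    using integral_le[OF int has_integral_integrable[OF g] v_close[OF z th]] integral_unique[OF g] by simp
  also have "(normA * (h * avgV (t, h) z)) * h = (h * h) * (normA * avgV (t, h) z)" by simp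
  also have "\<dots> \<le> (h * sqrt h) * (normA * avgV (t, h) z)"
  proof (intro mult_right_mono mult_left_mono)
    have "sqrt h * sqrt h \<le> sqrt h * 1" using th by (intro mult_left_mono) auto
    then show "h \<le> sqrt h" using th by simp
  qed (use th norm_nonneg avg_nonneg[OF z th] in auto)
  finally have "integral {0..h} (\<lambda>s. norm (v (t + s) z - v t z)) \<le> (h * sqrt h) * (normB * avgW (t, h) z + normA * avgV (t, h) z)"
    by (simp add: algebra_simps)
  then show ?thesis using that[OF integrable_integral[OF int]] by simp
qed

definition lin :: "real^'d \<Rightarrow> real \<Rightarrow> 'w \<Rightarrow> complex" where
  "lin b t z = complex_of_real (b \<bullet> v t z)"

lemma adm_lin: "adm (lin b)"
  unfolding adm_def lin_def
proof (intro conjI allI impI)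
  show "mbdd M {0..} (\<lambda>t z. complex_of_real (b \<bullet> v t z))"
    by (rule mbdd_bounded_linear[OF _ mbdd_v prob_space_M])
       (intro bounded_linear_of_real bounded_linear_compose[OF bounded_linear_of_real] bounded_linear_inner_right)
  show "(\<lambda>z. complex_of_real (b \<bullet> v t z)) \<in> borel_measurable (F t)" if "0 \<le> t" for t
    using v_adapted[OF that] by measurable
qed

lemma inner_mv: "b \<bullet> (C *v x) = (transpose C *v b) \<bullet> (x :: real^'e)" for C :: "real^'e^'d"
  by (simp add: dot_lmul_matrix)

text \<open>The equation for \<open>v\<close> is linear with constant diffusion, so quadratic terms
  are absent, and the remainder comes from the integral of \<open>A (v (t + s) - v t)\<close>, which
  is of order \<open>h^(3/2)\<close>.\<close>

lemma ito_lin: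
  "ito (lin b) (lin (transpose A *v b)) (\<lambda>l t z. complex_of_real ((transpose B *v b) $ l))"
proof (rule ito_I[where c="\<lambda>l k t z. 0"])
  let ?R = "\<lambda>i z. (norm b * normA) * (normB * avgW i z + normA * avgV i z)"
  show "mbdd M steps ?R"
    by (intro mbdd_mult mbdd_add mbdd_const mbdd_avgW mbdd_avgV prob_space_M)
  show "lin b t \<in> borel_measurable (F t)" if "0 \<le> t" for t by (rule adm_measurable[OF adm_lin that])
  fix t h :: real and z assume z: "z \<in> space M" and th: "0 \<le> t" "0 < h" "h \<le> 1"
  let ?\<Delta> = "W (t + h) z - W t z"
  have "b \<bullet> (B *v ?\<Delta>) = (\<Sum>l\<in>UNIV. (transpose B *v b) $ l * dW l t h z)"
    unfolding inner_mv by (simp add: inner_vec_def dW_def)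
  then have "(lin b (t + h) z - lin b t z - of_real h * lin (transpose A *v b) t z - (\<Sum>l\<in>UNIV. complex_of_real ((transpose B *v b) $ l) * of_real (dW l t h z))
        - (\<Sum>l\<in>(UNIV::'m set). \<Sum>k\<in>(UNIV::'m set). 0 * of_real (dQ l k t h z)))
     = complex_of_real (b \<bullet> (v (t + h) z - v t z - B *v ?\<Delta> - h *\<^sub>R (A *v v t z)))"
    unfolding lin_def inner_diff_right inner_scaleR_right inner_mv[of b A] by simp
  also have "norm \<dots> \<le> norm b * norm (v (t + h) z - v t z - B *v ?\<Delta> - h *\<^sub>R (A *v v t z))"
    using Cauchy_Schwarz_ineq2 by simp
  also have "norm (v (t + h) z - v t z - B *v ?\<Delta> - h *\<^sub>R (A *v v t z)) \<le> normA * ((h * sqrt h) * (normB * avgW (t, h) z + normA * avgV (t, h) z))"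
  proof -
    obtain I where I: "((\<lambda>s. norm (v (t + s) z - v t z)) has_integral I) {0..h}"
      "I \<le> (h * sqrt h) * (normB * avgW (t, h) z + normA * avgV (t, h) z)"
      using v_close_integral[OF z th] by blast
    have h0: "0 \<le> h" using th by simp
    have 1: "((\<lambda>s. A *v v (t + s) z - A *v v t z) has_integral (v (t + h) z - v t z - B *v ?\<Delta> - h *\<^sub>R (A *v v t z))) {0..h}"
      using has_integral_diff[OF v_increment[OF z th(1) h0] has_integral_const_real[of "A *v v t z" 0 h]] th by simp
    have "norm (v (t + h) z - v t z - B *v ?\<Delta> - h *\<^sub>R (A *v v t z)) \<le> integral {0..h} (\<lambda>s. normA * norm (v (t + s) z - v t z))"
      unfolding integral_unique[OF 1, symmetric]
      by (rule integral_norm_bound_integral[OF has_integral_integrable[OF 1] has_integral_integrable[OF has_integral_mult_right[OF I(1)]]])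
         (metis normA matrix_vector_mult_diff_distrib)
    also have "\<dots> = normA * I" by (rule integral_unique[OF has_integral_mult_right[OF I(1)]])
    also have "\<dots> \<le> normA * ((h * sqrt h) * (normB * avgW (t, h) z + normA * avgV (t, h) z))"
      by (rule mult_left_mono[OF I(2) norm_nonneg(2)])
    finally show ?thesis .
  qed
  then have "norm b * norm (v (t + h) z - v t z - B *v ?\<Delta> - h *\<^sub>R (A *v v t z)) \<le> (h * sqrt h) * ?R (t, h) z"
    using mult_left_mono[of _ _ "norm b"] by (fastforce simp: mult_ac)
  finally show "norm (lin b (t + h) z - lin b t z - of_real h * lin (transpose A *v b) t z - (\<Sum>l\<in>UNIV. complex_of_real ((transpose B *v b) $ l) * of_real (dW l t h z))
        - (\<Sum>l\<in>(UNIV::'m set). \<Sum>k\<in>(UNIV::'m set). 0 * of_real (dQ l k t h z))) \<le> (h * sqrt h) * ?R (t, h) z" .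
qed (intro adm_lin adm_const)+

end

section \<open>The phase in the discrete calculus\<close>

lemma has_vector_derivative_Complex:
  assumes "(f has_real_derivative f') (at s within S)" "(g has_real_derivative g') (at s within S)"
  shows "((\<lambda>s. Complex (f s) (g s)) has_vector_derivative Complex f' g') (at s within S)"
  unfolding Complex_eq
  by (intro has_vector_derivative_add has_vector_derivative_mult_right has_vector_derivative_of_real assms)

lemma norm_add3_diff: "norm (p + q + c - d) \<le> norm p + norm q + norm c + norm (d :: 'a::real_normed_vector)"
  using norm_triangle_ineq4[of "p + q + c" d] norm_triangle_ineq[of "p + q" c] norm_triangle_ineq[of p q] by linarith

context stable_oscillator
begin

abbreviation "bt \<equiv> beta \<kappa>"

definition w :: "real \<Rightarrow> 'w \<Rightarrow> complex" where "w t z = cnj (phase t z) / phase t z"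

lemma norm_w: "z \<in> space M \<Longrightarrow> 0 \<le> t \<Longrightarrow> cmod (w t z) = 1"
  using phase_nonzero by (simp add: w_def norm_divide)

lemma phase_adapted: "0 \<le> t \<Longrightarrow> phase t \<in> borel_measurable (F t)"
proof -
  assume t: "0 \<le> t"
  note [measurable] = momentum_adapted[OF t] y_adapted[OF t]
  have "(\<lambda>z. complex_of_real (momentum t z) + \<i> * complex_of_real (\<kappa> * y t z)) \<in> borel_measurable (F t)"
    by measurable
  then show ?thesis by (simp add: phase_def[abs_def] Complex_eq)
qed

lemma adm_w: "adm w"
  unfolding adm_def
proof (intro conjI allI impI)
  have cnj_m: "cnj \<in> borel_measurable borel" by (intro borel_measurable_continuous_onI continuous_intros)
  show m: "w t \<in> borel_measurable (F t)" if "0 \<le> t" for t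
    unfolding w_def[abs_def]
    by (intro borel_measurable_divide measurable_compose[OF _ cnj_m] phase_adapted that)
  show "mbdd M {0..} w"
    by (rule mbdd_dominated[OF mbdd_const[OF prob_space_M, of _ "1::real"]])
       (auto intro!: measurable_F_M[OF m] simp: norm_w)
qed

text \<open>With the noise frozen at its value at time \<open>t\<close>, the path starts in the
  phase at time \<open>t\<close>; the noise accumulated since then plays the part of
  \<open>n\<close>.\<close>

lemma step_smooth:
  assumes z: "z \<in> space M" and th: "0 \<le> t" "0 < h"
  shows "smooth_step \<kappa> h (\<lambda>s. Complex (r (t + s) z + noise t z * y (t + s) z) (\<kappa> * y (t + s) z))
    (\<lambda>s. noise (t + s) z - noise t z) (\<lambda>s. \<epsilon> * (a \<bullet> v (t + s) z))"
proof (unfold_locales)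
  show "0 < \<kappa>" by (rule \<kappa>_pos)
  show "0 \<le> h" using th by simp
  show "continuous_on {0..h} (\<lambda>s. noise (t + s) z - noise t z)"
    unfolding noise_def by (intro continuous_intros continuous_on_subset[OF W_shift_cont[OF z th(1)]]) auto
  show "continuous_on {0..h} (\<lambda>s. \<epsilon> * (a \<bullet> v (t + s) z))"
    by (intro continuous_intros continuous_on_subset[OF v_shift_cont[OF z th(1)]]) auto
  fix s assume s: "s \<in> {0..h}"
  have ts: "0 \<le> t + s" using s th by simp
  show "Complex (r (t + s) z + noise t z * y (t + s) z) (\<kappa> * y (t + s) z) \<noteq> 0"
    using energy_pos[OF z ts] \<kappa>_pos by (auto simp: complex_eq_iff)
  let ?q = "Complex (r (t + s) z + noise t z * y (t + s) z) (\<kappa> * y (t + s) z)"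
  let ?n = "noise (t + s) z - noise t z" and ?V = "\<epsilon> * (a \<bullet> v (t + s) z)"
  have yd: "((\<lambda>s. y (t + s) z) has_real_derivative momentum (t + s) z) (at s within {0..h})"
    using has_vector_derivative_shift[OF y_deriv'[OF z ts, unfolded has_real_derivative_iff_has_vector_derivative] th(1) s]
    by (simp add: has_real_derivative_iff_has_vector_derivative)
  have rd: "((\<lambda>s. r (t + s) z) has_real_derivative - \<kappa>\<^sup>2 * y (t + s) z + ?V * y (t + s) z - noise (t + s) z * momentum (t + s) z) (at s within {0..h})"
    using has_vector_derivative_shift[OF r_deriv'(1)[OF z ts, unfolded has_real_derivative_iff_has_vector_derivative] th(1) s]
    by (simp add: has_real_derivative_iff_has_vector_derivative)
  have "((\<lambda>s. Complex (r (t + s) z + noise t z * y (t + s) z) (\<kappa> * y (t + s) z)) has_vector_derivative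
    Complex ((- \<kappa>\<^sup>2 * y (t + s) z + ?V * y (t + s) z - noise (t + s) z * momentum (t + s) z) + noise t z * momentum (t + s) z)
      (\<kappa> * momentum (t + s) z)) (at s within {0..h})"
    by (intro has_vector_derivative_Complex DERIV_add DERIV_cmult rd yd)
  also have "Complex ((- \<kappa>\<^sup>2 * y (t + s) z + ?V * y (t + s) z - noise (t + s) z * momentum (t + s) z) + noise t z * momentum (t + s) z)
      (\<kappa> * momentum (t + s) z)
    = Complex (- \<kappa> * Im ?q + ?V * (Im ?q / \<kappa>) - ?n * (Re ?q + ?n * (Im ?q / \<kappa>))) (\<kappa> * (Re ?q + ?n * (Im ?q / \<kappa>)))"
    using \<kappa>_pos by (simp add: momentum_def power2_eq_square algebra_simps)
  finally show "((\<lambda>s. Complex (r (t + s) z + noise t z * y (t + s) z) (\<kappa> * y (t + s) z)) has_vector_derivative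
    Complex (- \<kappa> * Im ?q + ?V * (Im ?q / \<kappa>) - ?n * (Re ?q + ?n * (Im ?q / \<kappa>))) (\<kappa> * (Re ?q + ?n * (Im ?q / \<kappa>)))) (at s within {0..h})" .
qed

definition "c1 = \<bar>\<epsilon>\<bar> * norm \<gamma>"
definition "c3 = \<bar>\<epsilon>\<bar> * norm a"
definition "A1 i z = c1 * avgW i z"
definition "A2 i z = c1\<^sup>2 * avgW2 i z"
definition "A3 i z = c3 * avgV i z"
definition "A4 i z = c3 * (normB * avgW i z + normA * avgV i z)"
definition "Ub i z = 2 * \<kappa> + 4 * cmod bt * (A3 i z + A2 i z) + 2 * A1 i z"
definition "Nn i z = c1 * dist_W i z"
text \<open>Random factors of \<open>h^(3/2)\<close> in the two expansions over one step. They are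
  polynomials in quantities with uniformly bounded moments, hence have bounded moments
  themselves.\<close>

definition "errW i z = 2 * \<kappa> * Ub i z + cmod bt * (4 * (Ub i z * A3 i z) + 4 * A4 i z + 4 * A2 i z) + 2 * A1 i z
  + 4 * cmod bt * (Nn i z * Ub i z) + 12 * (cmod bt)\<^sup>2 * ((Nn i z)\<^sup>2 * Ub i z) + 28 / \<kappa> ^ 3 * Nn i z ^ 3"
definition "errL i z = cmod bt * (Ub i z * A3 i z + 2 * A4 i z + 2 * A2 i z) + A1 i z
  + cmod bt * (Nn i z * Ub i z) + 2 * (cmod bt)\<^sup>2 * ((Nn i z)\<^sup>2 * Ub i z) + 9 / \<kappa> ^ 3 * Nn i z ^ 3"

lemma mbdd_err: "mbdd M steps errW" "mbdd M steps errL"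
  unfolding errW_def[abs_def] errL_def[abs_def] Nn_def Ub_def A4_def A3_def A2_def A1_def
  by (intro mbdd_add mbdd_mult mbdd_power mbdd_const mbdd_avgW mbdd_avgW2 mbdd_avgV mbdd_dist_W prob_space_M)+

lemma noise_diff: "noise (t + h) z - noise t z = \<epsilon> * (\<gamma> \<bullet> (W (t + h) z - W t z))"
  by (simp only: noise_def inner_diff_right right_diff_distrib)

text \<open>A step is a smooth motion from the phase at time \<open>t\<close> to \<open>q\<close>,
  followed by a multiplication by \<open>1 + j\<close> that puts the accumulated noise
  \<open>n\<close> into the momentum. The motion contributes the drift with frozen coefficients; the
  jump is expanded to second order in \<open>n\<close>, because \<open>n\<close> has size
  \<open>sqrt h\<close>.\<close>

lemma step_expansion:
  assumes z: "z \<in> space M" and th: "0 \<le> t" "0 < h" "h \<le> 1"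
  defines "n \<equiv> complex_of_real (noise (t + h) z - noise t z)" and "V \<equiv> complex_of_real (\<epsilon> * (a \<bullet> v t z))"
    and "x \<equiv> w t z"
  shows "cmod (w (t + h) z - x - of_real h * (- 2 * \<i> * \<kappa> * x + V * bt * (1 - x)\<^sup>2)
      - bt * n * (1 - x)\<^sup>2 + bt\<^sup>2 * n\<^sup>2 * (1 - x) ^ 3) \<le> (h * sqrt h) * errW (t, h) z"
    and "\<bar>ln (cmod (phase (t + h) z)) - ln (cmod (phase t z)) - h * Re (V * bt * (1 - x))
      - Re (bt * n * (1 - x) - bt\<^sup>2 * n\<^sup>2 * (1 - x)\<^sup>2 / 2)\<bar> \<le> (h * sqrt h) * errL (t, h) z"
proof -
  let ?q = "\<lambda>s. Complex (r (t + s) z + noise t z * y (t + s) z) (\<kappa> * y (t + s) z)"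
  let ?n = "\<lambda>s. noise (t + s) z - noise t z" and ?V = "\<lambda>s. \<epsilon> * (a \<bullet> v (t + s) z)"
  interpret S: smooth_step \<kappa> h ?q ?n ?V by (rule step_smooth[OF z th(1,2)])
  let ?i = "(t, h)" and ?e = "h * sqrt h"
  have h0: "0 \<le> h" and hI: "h \<in> {0..h}" "0 \<in> {0..h}" using th by auto
  have c13: "0 \<le> c1" "0 \<le> c3" by (auto simp: c1_def c3_def)
  note an = avg_nonneg[OF z th]
  have q0: "?q 0 = phase t z" by (simp add: phase_def momentum_def)
  have u0: "S.u 0 = x" unfolding S.u_def x_def w_def using q0 by simp
  have V0: "complex_of_real (?V 0) = V" by (simp add: V_def)
  have nb: "\<bar>?n s\<bar> \<le> c1 * norm (W (t + s) z - W t z)" for s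
    unfolding noise_diff c1_def by (rule norm_Cauchy_inner)
  have S1: "S.S1 \<le> ?e * A1 ?i z"
  proof -
    have "norm S.S1 \<le> c1 * (?e * avgW ?i z)"
      by (rule S.norm_le_of_has_integral[OF S.S_integrals(1) has_integral_mult_right[OF step_integrals(1)[OF z th]]]) (use nb in auto)
    then show ?thesis by (simp add: A1_def mult_ac)
  qed
  have S2: "S.S2 \<le> (h * h) * A2 ?i z"
  proof -
    have "norm S.S2 \<le> c1\<^sup>2 * ((h * h) * avgW2 ?i z)"
      by (rule S.norm_le_of_has_integral[OF S.S_integrals(2) has_integral_mult_right[OF step_integrals(2)[OF z th]]])
         (use power_mono[OF nb abs_ge_zero, of _ 2] in \<open>simp add: power_mult_distrib\<close>)
    then show ?thesis by (simp add: A2_def mult_ac)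
  qed
  have S3: "S.S3 \<le> h * A3 ?i z"
  proof -
    have "norm S.S3 \<le> c3 * (h * avgV ?i z)"
      by (rule S.norm_le_of_has_integral[OF S.S_integrals(3) has_integral_mult_right[OF step_integrals(3)[OF z th]]])
         (use norm_Cauchy_inner[of \<epsilon> a] in \<open>simp add: c3_def\<close>)
    then show ?thesis by (simp add: A3_def mult_ac)
  qed
  have S4: "S.S4 \<le> ?e * A4 ?i z"
  proof -
    obtain I where I: "((\<lambda>s. norm (v (t + s) z - v t z)) has_integral I) {0..h}"
      "I \<le> ?e * (normB * avgW (t, h) z + normA * avgV (t, h) z)"
      using v_close_integral[OF z th] by blast
    have "norm S.S4 \<le> c3 * I"
    proof (rule S.norm_le_of_has_integral[OF S.S_integrals(4) has_integral_mult_right[OF I(1)]])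
      fix s
      have "?V s - ?V 0 = \<epsilon> * (a \<bullet> (v (t + s) z - v t z))" by (simp add: inner_diff_right algebra_simps)
      then show "norm \<bar>?V s - ?V 0\<bar> \<le> c3 * norm (v (t + s) z - v t z)"
        using norm_Cauchy_inner[of \<epsilon> a "v (t + s) z - v t z"] by (simp add: c3_def)
    qed
    also have "\<dots> \<le> c3 * (?e * (normB * avgW (t, h) z + normA * avgV (t, h) z))"
      by (rule mult_left_mono[OF I(2) c13(2)])
    finally show ?thesis by (simp add: A4_def mult_ac)
  qed
  have Apos: "0 \<le> A1 ?i z" "0 \<le> A2 ?i z" "0 \<le> A3 ?i z" "0 \<le> A4 ?i z" "0 \<le> Nn ?i z"
    using an c13 norm_nonneg by (auto simp: A1_def A2_def A3_def A4_def Nn_def)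
  have Ubpos: "0 \<le> Ub ?i z" using Apos \<kappa>_pos by (simp add: Ub_def)
  have hsq: "h \<le> sqrt h"
  proof -
    have "sqrt h * sqrt h \<le> sqrt h * 1" using th by (intro mult_left_mono) auto
    then show ?thesis using th by simp
  qed
  have hhe: "h * h \<le> ?e" using hsq th by (intro mult_left_mono) auto
  have eh: "?e \<le> h" using mult_left_mono[of "sqrt h" 1 h] th by simp
  have hhh: "h * h \<le> h" using mult_left_mono[of h 1 h] th by simp
  have S2e: "S.S2 \<le> ?e * A2 ?i z" using S2 mult_right_mono[OF hhe Apos(2)] by linarith
  have UU: "S.U \<le> h * Ub ?i z"
  proof -
    have a: "S.S1 \<le> h * A1 ?i z" using S1 mult_right_mono[OF eh Apos(1)] by linarith
    have b: "S.S2 \<le> h * A2 ?i z" using S2 mult_right_mono[OF hhh Apos(2)] by linarith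
    have "S.U \<le> 2 * \<kappa> * h + 4 * cmod bt * (h * A3 ?i z + h * A2 ?i z) + 2 * (h * A1 ?i z)"
      unfolding S.U_def using a b S3 by (intro add_mono mult_left_mono order_refl) auto
    also have "\<dots> = h * Ub ?i z" by (simp add: Ub_def algebra_simps)
    finally show ?thesis .
  qed
  have S30: "0 \<le> S.S3" using S.S_integrals(3) by (rule has_integral_nonneg) simp
  have nN: "\<bar>?n h\<bar> \<le> sqrt h * Nn ?i z"
    using nb[of h] th by (simp add: Nn_def dist_W_def)
  have k2: "0 \<le> 2 * \<kappa>" using \<kappa>_pos by simp
  note SB = step_error_bound[OF th(2,3) k2 norm_ge_zero S1 S2e S3 S4 S30 Apos(3) S.U_nonneg UU Ubpos abs_ge_zero nN Apos(5)]
  define u where "u = S.u h"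
  \<comment> \<open>Relative jump of the phase: the momentum increases by \<open>n y\<close>, and
    \<open>y / q = bt (1 - u)\<close>.\<close>
  define j where "j = n * bt * (1 - u)"
  have nu: "cmod u = 1" unfolding u_def by (rule S.norm_u[OF hI(1)])
  have nx: "cmod x = 1" unfolding x_def by (rule norm_w[OF z th(1)])
  have ux: "cmod (u - x) \<le> S.U" unfolding u_def u0[symmetric] by (rule S.u_close[OF hI(1)])
  have qh: "?q h \<noteq> 0" by (rule S.q_nz[OF hI(1)])
  have uq: "u = cnj (?q h) / ?q h" unfolding u_def S.u_def ..
  have nr: "n = complex_of_real (?n h)" by (simp add: n_def)
  have nn: "cmod n = \<bar>?n h\<bar>" unfolding nr norm_of_real ..
  have ph: "phase (t + h) z = ?q h + n * y (t + h) z"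
    by (simp add: phase_def momentum_def nr complex_eq_iff algebra_simps)
  have zq: "j * ?q h = n * y (t + h) z"
  proof -
    have "(1 - u) * ?q h = ?q h - cnj (?q h)" unfolding uq left_diff_distrib using qh by simp
    also have "\<dots> = 2 * \<i> * complex_of_real (\<kappa> * y (t + h) z)" by (simp add: complex_eq_iff)
    finally have "j * ?q h = n * (bt * (2 * \<i> * complex_of_real (\<kappa> * y (t + h) z)))" by (simp add: j_def mult_ac)
    then show ?thesis using \<kappa>_pos by (simp add: beta_def)
  qed
  have phz: "phase (t + h) z = ?q h * (1 + j)" unfolding ph zq[symmetric] by (simp add: algebra_simps)
  have th0: "0 \<le> t + h" using th by simp
  have pnz: "phase (t + h) z \<noteq> 0" by (rule phase_nonzero[OF z th0])
  then have z1: "1 + j \<noteq> 0" unfolding phz by auto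
  have "cnj (phase (t + h) z) = cnj (?q h) + n * y (t + h) z" unfolding ph by (simp add: nr)
  also have "\<dots> = ?q h * (u + j)" unfolding zq[symmetric] uq distrib_left using qh by (simp add: mult.commute)
  finally have wh: "w (t + h) z = (u + j) / (1 + j)"
    unfolding w_def phz using qh by simp
  \<comment> \<open>Bounds the modulus of \<open>j\<close>, by \<open>cmod (1 - u) \<le> 2\<close>
    and the modulus \<open>1 / (2 \<kappa>)\<close> of \<open>bt\<close>.\<close>
  define \<rho> where "\<rho> = \<bar>?n h\<bar> / \<kappa>"
  have j\<rho>: "cmod j \<le> \<rho>"
  proof -
    have "cmod j = \<bar>?n h\<bar> * (1 / (2 * \<kappa>)) * cmod (1 - u)"
      unfolding j_def norm_mult nr norm_of_real norm_beta[OF \<kappa>_pos] ..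
    also have "\<dots> \<le> \<bar>?n h\<bar> * (1 / (2 * \<kappa>)) * 2"
      using square_diff_bound(3)[OF nu nu] \<kappa>_pos by (intro mult_left_mono) auto
    finally show ?thesis by (simp add: \<rho>_def)
  qed
  \<comment> \<open>The jump is read backwards: undoing it subtracts \<open>n y\<close>, whose
    modulus is at most \<open>\<rho>\<close> times that of the phase after the jump. So the jump
    cannot bring the phase too close to zero.\<close>
  have low: "1 \<le> (1 + \<rho>) * cmod (1 + j)"
  proof -
    have "cmod (n * y (t + h) z) \<le> \<rho> * cmod (phase (t + h) z)"
    proof -
      have "\<bar>\<kappa> * y (t + h) z\<bar> \<le> cmod (phase (t + h) z)"
        using abs_Im_le_cmod[of "phase (t + h) z"] by (simp add: phase_def)
      then have "\<rho> * (\<kappa> * \<bar>y (t + h) z\<bar>) \<le> \<rho> * cmod (phase (t + h) z)"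
        using \<kappa>_pos by (intro mult_left_mono) (auto simp: abs_mult \<rho>_def)
      moreover have "cmod (n * y (t + h) z) = \<rho> * (\<kappa> * \<bar>y (t + h) z\<bar>)"
        using \<kappa>_pos by (simp only: norm_mult nn norm_of_real \<rho>_def) simp
      ultimately show ?thesis by simp
    qed
    then have "cmod (?q h) \<le> (1 + \<rho>) * cmod (phase (t + h) z)"
      using norm_triangle_ineq4[of "phase (t + h) z" "n * y (t + h) z"] unfolding ph by (simp add: algebra_simps)
    then have "cmod (?q h) * 1 \<le> cmod (?q h) * ((1 + \<rho>) * cmod (1 + j))"
      unfolding phz norm_mult by (simp add: mult_ac)
    then show ?thesis using qh by (subst (asm) mult_le_cancel_left_pos) auto
  qed
  have \<rho>3: "\<rho> ^ 3 \<le> ?e * (1 / \<kappa> ^ 3 * Nn ?i z ^ 3)"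
    using SB(5) \<kappa>_pos unfolding \<rho>_def power_divide by (simp add: divide_right_mono)
  have n2: "cmod (n\<^sup>2) = \<bar>?n h\<bar>\<^sup>2" unfolding nr norm_power norm_of_real ..
  show "cmod (w (t + h) z - x - of_real h * (- 2 * \<i> * \<kappa> * x + V * bt * (1 - x)\<^sup>2)
      - bt * n * (1 - x)\<^sup>2 + bt\<^sup>2 * n\<^sup>2 * (1 - x) ^ 3) \<le> (h * sqrt h) * errW (t, h) z" (is "cmod ?L \<le> _")
  proof -
    \<comment> \<open>\<open>T1\<close> is the error of the smooth motion and \<open>T2\<close> that
      of the jump formula; \<open>T3\<close> and \<open>T4\<close> come from replacing
      \<open>u\<close> by the initial value \<open>x\<close> in the terms of first and second order
      in \<open>n\<close>.\<close>
    define T1 where "T1 = u - x - of_real h * (- 2 * \<i> * \<kappa> * x + V * bt * (1 - x)\<^sup>2)"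
    define T2 where "T2 = (u + j) / (1 + j) - (u + j * (1 - u) - j\<^sup>2 * (1 - u))"
    define T3 where "T3 = bt * n * ((1 - u)\<^sup>2 - (1 - x)\<^sup>2)"
    define T4 where "T4 = bt\<^sup>2 * n\<^sup>2 * ((1 - u) ^ 3 - (1 - x) ^ 3)"
    have eq: "?L = T1 + T2 + T3 - T4"
      unfolding wh T1_def T2_def T3_def T4_def by (simp add: j_def algebra_simps power2_eq_square power3_eq_cube)
    have "cmod ?L \<le> (2 * \<kappa> * S.U * h + cmod bt * (4 * S.U * S.S3 + 4 * S.S4 + 4 * S.S2) + 2 * S.S1)
      + 28 * \<rho> ^ 3 + cmod bt * \<bar>?n h\<bar> * (4 * S.U) + (cmod bt)\<^sup>2 * \<bar>?n h\<bar>\<^sup>2 * (12 * S.U)"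
      unfolding eq
    proof (rule order.trans[OF norm_add3_diff], rule add_mono[OF add_mono[OF add_mono]])
      show "cmod T1 \<le>
         2 * \<kappa> * S.U * h + cmod bt * (4 * S.U * S.S3 + 4 * S.S4 + 4 * S.S2) + 2 * S.S1"
        using S.u_expansion unfolding T1_def u0 V0 u_def .
      show "cmod T2 \<le> 28 * \<rho> ^ 3"
        unfolding T2_def by (rule ratio_jump[OF j\<rho> nu]) (use norm_w[OF z th0] wh in simp)
      show "cmod T3 \<le> cmod bt * \<bar>?n h\<bar> * (4 * S.U)"
        unfolding T3_def norm_mult nr norm_of_real
        using square_diff_bound(1)[OF nu nx] ux by (intro mult_left_mono) auto
      show "cmod T4 \<le> (cmod bt)\<^sup>2 * \<bar>?n h\<bar>\<^sup>2 * (12 * S.U)"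
        unfolding T4_def norm_mult[of "bt\<^sup>2 * n\<^sup>2"] norm_mult[of "bt\<^sup>2"] n2 norm_power[of bt]
        using square_diff_bound(2)[OF nu nx] ux by (intro mult_left_mono) auto
    qed
    also have "\<dots> = 2 * \<kappa> * S.U * h + cmod bt * (4 * (S.U * S.S3) + 4 * S.S4 + 4 * S.S2) + 2 * S.S1
      + 28 * \<rho> ^ 3 + 4 * cmod bt * (\<bar>?n h\<bar> * S.U) + 12 * (cmod bt)\<^sup>2 * (\<bar>?n h\<bar>\<^sup>2 * S.U)"
      by (simp add: mult_ac)
    also have "\<dots> \<le> ?e * (2 * \<kappa> * Ub ?i z) + cmod bt * (4 * (?e * (Ub ?i z * A3 ?i z)) + 4 * (?e * A4 ?i z) + 4 * (?e * A2 ?i z)) + 2 * (?e * A1 ?i z)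
      + 28 * (?e * (1 / \<kappa> ^ 3 * Nn ?i z ^ 3)) + 4 * cmod bt * (?e * (Nn ?i z * Ub ?i z)) + 12 * (cmod bt)\<^sup>2 * (?e * ((Nn ?i z)\<^sup>2 * Ub ?i z))"
      using SB S1 S2e S4 \<rho>3 by (intro add_mono mult_left_mono) auto
    also have "\<dots> = ?e * errW ?i z" by (simp add: errW_def algebra_simps)
    finally show ?thesis .
  qed
  show "\<bar>ln (cmod (phase (t + h) z)) - ln (cmod (phase t z)) - h * Re (V * bt * (1 - x))
      - Re (bt * n * (1 - x) - bt\<^sup>2 * n\<^sup>2 * (1 - x)\<^sup>2 / 2)\<bar> \<le> (h * sqrt h) * errL (t, h) z" (is "\<bar>?L2\<bar> \<le> _")
  proof -
    have lnp: "ln (cmod (phase (t + h) z)) = ln (cmod (?q h)) + ln (cmod (1 + j))"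
      unfolding phz norm_mult using qh z1 by (subst ln_mult) auto
    have Rez: "Re (j - j\<^sup>2 / 2) - Re (bt * n * (1 - x) - bt\<^sup>2 * n\<^sup>2 * (1 - x)\<^sup>2 / 2)
      = Re (bt * n * (x - u) - bt\<^sup>2 * n\<^sup>2 * ((1 - u)\<^sup>2 - (1 - x)\<^sup>2) / 2)"
      unfolding minus_complex.sel(1)[symmetric] by (rule arg_cong[where f=Re]) (simp add: j_def field_simps power2_eq_square)
    define T1 where "T1 = ln (cmod (?q h)) - ln (cmod (?q 0)) - h * Re (V * bt * (1 - x))"
    define T2 where "T2 = ln (cmod (1 + j)) - Re (j - j\<^sup>2 / 2)"
    define T3 where "T3 = Re (bt * n * (x - u) - bt\<^sup>2 * n\<^sup>2 * ((1 - u)\<^sup>2 - (1 - x)\<^sup>2) / 2)"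
    have eq: "?L2 = T1 + T2 + T3"
      unfolding T1_def T2_def T3_def lnp q0 Rez[symmetric] by simp
    have "\<bar>?L2\<bar> \<le> (cmod bt * (S.U * S.S3 + 2 * S.S4 + 2 * S.S2) + S.S1) + 9 * \<rho> ^ 3
      + (cmod bt * \<bar>?n h\<bar> * S.U + (cmod bt)\<^sup>2 * \<bar>?n h\<bar>\<^sup>2 * (4 * S.U) / 2)"
      unfolding eq
    proof (rule order.trans[OF abs_triangle_ineq], rule add_mono, rule order.trans[OF abs_triangle_ineq], rule add_mono)
      show "\<bar>T1\<bar> \<le> cmod bt * (S.U * S.S3 + 2 * S.S4 + 2 * S.S2) + S.S1"
        using S.ln_expansion unfolding u0 V0 T1_def .
      show "\<bar>T2\<bar> \<le> 9 * \<rho> ^ 3" unfolding T2_def by (rule ln_jump[OF j\<rho> low])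
      have "cmod (bt * n * (x - u)) \<le> cmod bt * \<bar>?n h\<bar> * S.U"
        unfolding norm_mult nr norm_of_real using ux by (intro mult_left_mono) (auto simp: norm_minus_commute)
      moreover have "cmod (bt\<^sup>2 * n\<^sup>2 * ((1 - u)\<^sup>2 - (1 - x)\<^sup>2) / 2) \<le> (cmod bt)\<^sup>2 * \<bar>?n h\<bar>\<^sup>2 * (4 * S.U) / 2"
        unfolding norm_divide norm_mult[of "bt\<^sup>2 * n\<^sup>2"] norm_mult[of "bt\<^sup>2"] n2 norm_power[of bt] norm_numeral
        using square_diff_bound(1)[OF nu nx] ux by (intro divide_right_mono mult_left_mono) auto
      ultimately show "\<bar>T3\<bar> \<le> cmod bt * \<bar>?n h\<bar> * S.U + (cmod bt)\<^sup>2 * \<bar>?n h\<bar>\<^sup>2 * (4 * S.U) / 2"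
        unfolding T3_def by (intro order.trans[OF abs_Re_le_cmod] order.trans[OF norm_triangle_ineq4]) (rule add_mono)
    qed
    also have "\<dots> = cmod bt * ((S.U * S.S3) + 2 * S.S4 + 2 * S.S2) + S.S1 + 9 * \<rho> ^ 3
      + (cmod bt * (\<bar>?n h\<bar> * S.U) + 2 * (cmod bt)\<^sup>2 * (\<bar>?n h\<bar>\<^sup>2 * S.U))"
      by (simp add: mult_ac)
    also have "\<dots> \<le> cmod bt * ((?e * (Ub ?i z * A3 ?i z)) + 2 * (?e * A4 ?i z) + 2 * (?e * A2 ?i z)) + ?e * A1 ?i z
      + 9 * (?e * (1 / \<kappa> ^ 3 * Nn ?i z ^ 3)) + (cmod bt * (?e * (Nn ?i z * Ub ?i z)) + 2 * (cmod bt)\<^sup>2 * (?e * ((Nn ?i z)\<^sup>2 * Ub ?i z)))"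
      using SB S1 S2e S4 \<rho>3 by (intro add_mono mult_left_mono) auto
    also have "\<dots> = ?e * errL ?i z" by (simp add: errL_def algebra_simps)
    finally show ?thesis .
  qed
qed

lemma noise_sum: "complex_of_real (noise (t + h) z - noise t z) = (\<Sum>l\<in>UNIV. of_real (\<epsilon> * \<gamma> $ l) * of_real (dW l t h z))"
  unfolding noise_diff inner_vec_def dW_def by (simp add: sum_distrib_left mult.assoc)

text \<open>Splits the squared noise increment into a centred part and its mean; the mean is the
  source of the second-order terms in the drifts of \<open>w\<close> and of the logarithm.\<close>

lemma noise_square: "(complex_of_real (noise (t + h) z - noise t z))\<^sup>2
  = (\<Sum>l\<in>UNIV. \<Sum>k\<in>UNIV. of_real (\<epsilon>\<^sup>2 * \<gamma> $ l * \<gamma> $ k) * of_real (dQ l k t h z)) + of_real h * of_real (\<epsilon>\<^sup>2 * (norm \<gamma>)\<^sup>2)"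
proof -
  have "(\<Sum>l\<in>UNIV. \<Sum>k\<in>UNIV. (\<epsilon> * \<gamma> $ l) * (\<epsilon> * \<gamma> $ k) * (dW l t h z * dW k t h z - (if l = k then h else 0)))
    = (\<Sum>l\<in>UNIV. \<epsilon> * \<gamma> $ l * dW l t h z) * (\<Sum>l\<in>UNIV. \<epsilon> * \<gamma> $ l * dW l t h z) - h * (\<Sum>l\<in>UNIV. (\<epsilon> * \<gamma> $ l) * (\<epsilon> * \<gamma> $ l))"
    by (rule double_sum_diagonal)
  moreover have "noise (t + h) z - noise t z = (\<Sum>l\<in>UNIV. \<epsilon> * \<gamma> $ l * dW l t h z)"
    unfolding noise_diff inner_vec_def dW_def by (simp add: sum_distrib_left mult.assoc)
  moreover have "(\<Sum>l\<in>UNIV. (\<epsilon> * \<gamma> $ l) * (\<epsilon> * \<gamma> $ l)) = \<epsilon>\<^sup>2 * (norm \<gamma>)\<^sup>2"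
  proof -
    have "(norm \<gamma>)\<^sup>2 = (\<Sum>l\<in>UNIV. \<gamma> $ l * \<gamma> $ l)" by (simp add: power2_norm_eq_inner inner_vec_def)
    then show ?thesis by (simp only: sum_distrib_left) (intro sum.cong refl, simp add: power2_eq_square)
  qed
  ultimately have "(noise (t + h) z - noise t z)\<^sup>2 = (\<Sum>l\<in>UNIV. \<Sum>k\<in>UNIV. (\<epsilon> * \<gamma> $ l) * (\<epsilon> * \<gamma> $ k) * dQ l k t h z) + h * (\<epsilon>\<^sup>2 * (norm \<gamma>)\<^sup>2)"
    unfolding dQ_def power2_eq_square by simp
  then have "complex_of_real ((noise (t + h) z - noise t z)\<^sup>2) = complex_of_real ((\<Sum>l\<in>UNIV. \<Sum>k\<in>UNIV. (\<epsilon> * \<gamma> $ l) * (\<epsilon> * \<gamma> $ k) * dQ l k t h z) + h * (\<epsilon>\<^sup>2 * (norm \<gamma>)\<^sup>2))"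
    by simp
  then show ?thesis by (simp add: power2_eq_square mult_ac)
qed

lemma adm_w_drift: "adm (\<lambda>t z. - 2 * \<i> * \<kappa> * w t z + bt * \<epsilon> * lin a t z * (1 - w t z)\<^sup>2
        - bt\<^sup>2 * (of_real (\<epsilon>\<^sup>2 * (norm \<gamma>)\<^sup>2)) * (1 - w t z) ^ 3)"
  by (intro adm_intros adm_w adm_lin)

text \<open>The rotation comes from the free oscillation and the term with \<open>lin a\<close> from
  the driving process; the cubic term is the Ito correction.\<close>

lemma ito_w:
  "ito w (\<lambda>t z. - 2 * \<i> * \<kappa> * w t z + bt * \<epsilon> * lin a t z * (1 - w t z)\<^sup>2
        - bt\<^sup>2 * (of_real (\<epsilon>\<^sup>2 * (norm \<gamma>)\<^sup>2)) * (1 - w t z) ^ 3)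
     (\<lambda>l t z. bt * of_real (\<epsilon> * \<gamma> $ l) * (1 - w t z)\<^sup>2)"
proof (rule ito_I[where R=errW and c="\<lambda>l k t z. - bt\<^sup>2 * of_real (\<epsilon>\<^sup>2 * \<gamma> $ l * \<gamma> $ k) * (1 - w t z) ^ 3"])
  fix t h :: real and z assume z: "z \<in> space M" and th: "0 \<le> t" "0 < h" "h \<le> 1"
  let ?x = "w t z" and ?n = "complex_of_real (noise (t + h) z - noise t z)"
  let ?D = "\<Sum>l\<in>UNIV. \<Sum>k\<in>UNIV. of_real (\<epsilon>\<^sup>2 * \<gamma> $ l * \<gamma> $ k) * complex_of_real (dQ l k t h z)"
  have 1: "(\<Sum>l\<in>UNIV. bt * of_real (\<epsilon> * \<gamma> $ l) * (1 - ?x)\<^sup>2 * of_real (dW l t h z)) = bt * ?n * (1 - ?x)\<^sup>2"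
    unfolding noise_sum sum_distrib_left sum_distrib_right by (intro sum.cong) (auto simp: mult_ac)
  have 2: "(\<Sum>l\<in>UNIV. \<Sum>k\<in>UNIV. - bt\<^sup>2 * of_real (\<epsilon>\<^sup>2 * \<gamma> $ l * \<gamma> $ k) * (1 - ?x) ^ 3 * of_real (dQ l k t h z))
    = - bt\<^sup>2 * (1 - ?x) ^ 3 * ?D"
    unfolding sum_distrib_left by (intro sum.cong) (auto simp: mult_ac)
  have 3: "w (t + h) z - ?x - of_real h * (- 2 * \<i> * \<kappa> * ?x + bt * \<epsilon> * lin a t z * (1 - ?x)\<^sup>2
        - bt\<^sup>2 * (of_real (\<epsilon>\<^sup>2 * (norm \<gamma>)\<^sup>2)) * (1 - ?x) ^ 3)
        - bt * ?n * (1 - ?x)\<^sup>2 - (- bt\<^sup>2 * (1 - ?x) ^ 3 * ?D)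
     = w (t + h) z - ?x - of_real h * (- 2 * \<i> * \<kappa> * ?x + of_real (\<epsilon> * (a \<bullet> v t z)) * bt * (1 - ?x)\<^sup>2)
        - bt * ?n * (1 - ?x)\<^sup>2 + bt\<^sup>2 * ?n\<^sup>2 * (1 - ?x) ^ 3"
    unfolding noise_square by (simp add: lin_def algebra_simps)
  show "norm (w (t + h) z - ?x - of_real h * (- 2 * \<i> * \<kappa> * ?x + bt * \<epsilon> * lin a t z * (1 - ?x)\<^sup>2
        - bt\<^sup>2 * (of_real (\<epsilon>\<^sup>2 * (norm \<gamma>)\<^sup>2)) * (1 - ?x) ^ 3)
        - (\<Sum>l\<in>UNIV. bt * of_real (\<epsilon> * \<gamma> $ l) * (1 - ?x)\<^sup>2 * of_real (dW l t h z))
        - (\<Sum>l\<in>UNIV. \<Sum>k\<in>UNIV. - bt\<^sup>2 * of_real (\<epsilon>\<^sup>2 * \<gamma> $ l * \<gamma> $ k) * (1 - ?x) ^ 3 * of_real (dQ l k t h z)))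
     \<le> (h * sqrt h) * errW (t, h) z"
    unfolding 1 2 3 by (rule step_expansion(1)[OF z th])
next
  show "w t \<in> borel_measurable (F t)" if "0 \<le> t" for t by (rule adm_measurable[OF adm_w that])
  show "adm (\<lambda>t z. - 2 * \<i> * \<kappa> * w t z + bt * \<epsilon> * lin a t z * (1 - w t z)\<^sup>2
        - bt\<^sup>2 * (of_real (\<epsilon>\<^sup>2 * (norm \<gamma>)\<^sup>2)) * (1 - w t z) ^ 3)"
    by (rule adm_w_drift)
  show "adm (\<lambda>t z. bt * of_real (\<epsilon> * \<gamma> $ l) * (1 - w t z)\<^sup>2)" for l
    by (intro adm_intros adm_w)
  show "adm (\<lambda>t z. - bt\<^sup>2 * of_real (\<epsilon>\<^sup>2 * \<gamma> $ l * \<gamma> $ k) * (1 - w t z) ^ 3)" for l k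
    by (intro adm_intros adm_w)
qed (rule mbdd_err)

definition lnphase :: "real \<Rightarrow> 'w \<Rightarrow> complex" where
  "lnphase t z = complex_of_real (ln (cmod (phase t z)))"

lemma adm_Re: assumes "adm X" shows "adm (\<lambda>t z. complex_of_real (Re (X t z)))"
  unfolding adm_def
proof (intro conjI allI impI)
  show "(\<lambda>z. complex_of_real (Re (X t z))) \<in> borel_measurable (F t)" if "0 \<le> t" for t
    using adm_measurable[OF assms that] by measurable
  have "bounded_linear (\<lambda>z. complex_of_real (Re z))"
    by (rule bounded_linear_compose[OF bounded_linear_of_real bounded_linear_Re])
  from mbdd_bounded_linear[OF this adm_mbdd[OF assms] prob_space_M]
  show "mbdd M {0..} (\<lambda>t z. complex_of_real (Re (X t z)))" .
qed

lemma adm_halve: "adm X \<Longrightarrow> adm (\<lambda>t z. X t z / 2)"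
  unfolding divide_inverse by (intro adm_mult adm_const)

text \<open>The growth rate will be the time average of this drift, which is a polynomial in the
  bounded process \<open>w\<close> and linear in the one functional \<open>lin a\<close>.\<close>

lemma ito_lnphase:
  "ito lnphase (\<lambda>t z. of_real (Re (bt * \<epsilon> * lin a t z * (1 - w t z)
        - bt\<^sup>2 * (of_real (\<epsilon>\<^sup>2 * (norm \<gamma>)\<^sup>2)) * (1 - w t z)\<^sup>2 / 2)))
     (\<lambda>l t z. of_real (Re (bt * of_real (\<epsilon> * \<gamma> $ l) * (1 - w t z))))"
proof (rule ito_I[where R=errL and c="\<lambda>l k t z. of_real (Re (- bt\<^sup>2 * of_real (\<epsilon>\<^sup>2 * \<gamma> $ l * \<gamma> $ k) * (1 - w t z)\<^sup>2 / 2))"])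
  fix t h :: real and z assume z: "z \<in> space M" and th: "0 \<le> t" "0 < h" "h \<le> 1"
  let ?x = "w t z" and ?n = "complex_of_real (noise (t + h) z - noise t z)"
  let ?D = "\<Sum>l\<in>UNIV. \<Sum>k\<in>UNIV. of_real (\<epsilon>\<^sup>2 * \<gamma> $ l * \<gamma> $ k) * complex_of_real (dQ l k t h z)"
  have Rem: "complex_of_real (Re z) * complex_of_real s = complex_of_real (Re (z * of_real s))" for z s by simp
  have 1: "(\<Sum>l\<in>UNIV. of_real (Re (bt * of_real (\<epsilon> * \<gamma> $ l) * (1 - ?x))) * complex_of_real (dW l t h z)) = of_real (Re (bt * ?n * (1 - ?x)))"
    unfolding noise_sum sum_distrib_left sum_distrib_right Re_sum of_real_sum Rem by (intro sum.cong) (auto simp: mult_ac)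
  have 2: "(\<Sum>l\<in>UNIV. \<Sum>k\<in>UNIV. of_real (Re (- bt\<^sup>2 * of_real (\<epsilon>\<^sup>2 * \<gamma> $ l * \<gamma> $ k) * (1 - ?x)\<^sup>2 / 2)) * complex_of_real (dQ l k t h z))
    = of_real (Re (- bt\<^sup>2 * (1 - ?x)\<^sup>2 / 2 * ?D))"
    unfolding sum_distrib_left Re_sum of_real_sum Rem
    by (intro sum.cong refl arg_cong[where f=complex_of_real] arg_cong[where f=Re]) (simp add: mult_ac)
  have "lnphase (t + h) z - lnphase t z - of_real h * of_real (Re (bt * \<epsilon> * lin a t z * (1 - ?x)
        - bt\<^sup>2 * (of_real (\<epsilon>\<^sup>2 * (norm \<gamma>)\<^sup>2)) * (1 - ?x)\<^sup>2 / 2))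
        - of_real (Re (bt * ?n * (1 - ?x))) - of_real (Re (- bt\<^sup>2 * (1 - ?x)\<^sup>2 / 2 * ?D))
     = complex_of_real (ln (cmod (phase (t + h) z)) - ln (cmod (phase t z)) - h * Re (of_real (\<epsilon> * (a \<bullet> v t z)) * bt * (1 - ?x))
      - Re (bt * ?n * (1 - ?x) - bt\<^sup>2 * ?n\<^sup>2 * (1 - ?x)\<^sup>2 / 2))"
  proof -
    let ?X = "bt * \<epsilon> * lin a t z * (1 - ?x) - bt\<^sup>2 * (of_real (\<epsilon>\<^sup>2 * (norm \<gamma>)\<^sup>2)) * (1 - ?x)\<^sup>2 / 2"
    let ?Y = "bt * ?n * (1 - ?x)" and ?Z = "- bt\<^sup>2 * (1 - ?x)\<^sup>2 / 2 * ?D"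
    let ?X' = "of_real (\<epsilon> * (a \<bullet> v t z)) * bt * (1 - ?x)"
      and ?Y' = "bt * ?n * (1 - ?x) - bt\<^sup>2 * ?n\<^sup>2 * (1 - ?x)\<^sup>2 / 2"
    have C: "of_real h * ?X + ?Y + ?Z = of_real h * ?X' + ?Y'"
      unfolding noise_square by (simp add: lin_def field_simps)
    have ReM: "Re (complex_of_real c * z') = c * Re z'" for c z' by simp
    have R: "h * Re ?X + Re ?Y + Re ?Z = h * Re ?X' + Re ?Y'"
      using arg_cong[where f=Re, OF C] by (simp only: plus_complex.sel ReM)
    have "lnphase (t + h) z - lnphase t z - of_real h * of_real (Re ?X) - of_real (Re ?Y) - of_real (Re ?Z)
      = complex_of_real (ln (cmod (phase (t + h) z)) - ln (cmod (phase t z)) - h * Re ?X - Re ?Y - Re ?Z)"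
      by (simp only: lnphase_def of_real_diff of_real_mult)
    also have "ln (cmod (phase (t + h) z)) - ln (cmod (phase t z)) - h * Re ?X - Re ?Y - Re ?Z
      = ln (cmod (phase (t + h) z)) - ln (cmod (phase t z)) - h * Re ?X' - Re ?Y'"
      using R by linarith
    finally show ?thesis .
  qed
  then show "norm (lnphase (t + h) z - lnphase t z - of_real h * of_real (Re (bt * \<epsilon> * lin a t z * (1 - ?x)
        - bt\<^sup>2 * (of_real (\<epsilon>\<^sup>2 * (norm \<gamma>)\<^sup>2)) * (1 - ?x)\<^sup>2 / 2))
        - (\<Sum>l\<in>UNIV. of_real (Re (bt * of_real (\<epsilon> * \<gamma> $ l) * (1 - ?x))) * complex_of_real (dW l t h z))
        - (\<Sum>l\<in>UNIV. \<Sum>k\<in>UNIV. of_real (Re (- bt\<^sup>2 * of_real (\<epsilon>\<^sup>2 * \<gamma> $ l * \<gamma> $ k) * (1 - ?x)\<^sup>2 / 2)) * complex_of_real (dQ l k t h z)))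
     \<le> (h * sqrt h) * errL (t, h) z"
    unfolding 1 2 using step_expansion(2)[OF z th] by (simp only: norm_of_real)
next
  show "lnphase t \<in> borel_measurable (F t)" if "0 \<le> t" for t
    unfolding lnphase_def[abs_def] using phase_adapted[OF that] by measurable
  show "adm (\<lambda>t z. of_real (Re (bt * \<epsilon> * lin a t z * (1 - w t z)
        - bt\<^sup>2 * (of_real (\<epsilon>\<^sup>2 * (norm \<gamma>)\<^sup>2)) * (1 - w t z)\<^sup>2 / 2)))"
    by (intro adm_Re adm_diff adm_halve adm_intros adm_w adm_lin)
  show "adm (\<lambda>t z. of_real (Re (bt * of_real (\<epsilon> * \<gamma> $ l) * (1 - w t z))))" for l
    by (intro adm_Re adm_intros adm_w)
  show "adm (\<lambda>t z. of_real (Re (- bt\<^sup>2 * of_real (\<epsilon>\<^sup>2 * \<gamma> $ l * \<gamma> $ k) * (1 - w t z)\<^sup>2 / 2)))" for l k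
    by (intro adm_Re adm_halve adm_intros adm_w)
qed (rule mbdd_err)

end

section \<open>Generalized limits of time averages\<close>

text \<open>By Tychonoff's theorem the points \<open>f \<mapsto> f n\<close> of a product of discs have a cluster point, so some
  filter below \<open>sequentially\<close> makes all bounded sequences converge.\<close>

lemma generalized_limit:
  "\<exists>G. G \<noteq> bot \<and> G \<le> sequentially \<and> (\<forall>f :: nat \<Rightarrow> complex. Bseq f \<longrightarrow> (\<exists>l. (f \<longlongrightarrow> l) G))"
proof -
  define b where "b = (\<lambda>f :: nat \<Rightarrow> complex. SOME K. \<forall>n. cmod (f n) \<le> K)"
  have b: "cmod (f n) \<le> b f" if "Bseq f" for f n
  proof -
    have "\<exists>K. \<forall>n. cmod (f n) \<le> K" using that unfolding Bseq_def by blast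
    then have "\<forall>n. cmod (f n) \<le> b f" unfolding b_def by (rule someI_ex)
    then show ?thesis ..
  qed
  \<comment> \<open>Coordinates that belong to unbounded sequences are set to zero, so that every
    \<open>e n\<close> lies in one compact product of discs.\<close>
  define e where "e = (\<lambda>n f. if Bseq f then f n else (0 :: complex))"
  let ?K = "PiE UNIV (\<lambda>f. cball (0 :: complex) \<bar>b f\<bar>)"
  have "compactin (product_topology (\<lambda>i. euclidean) UNIV) ?K"
    by (simp add: compactin_PiE)
  then have K: "compact ?K" by (simp add: euclidean_product_topology)
  have eK: "e n \<in> ?K" for n
    by (auto simp: e_def intro: order.trans[OF b abs_ge_self])
  have "eventually (\<lambda>x. x \<in> ?K) (filtermap e sequentially)"
    unfolding eventually_filtermap by (rule always_eventually) (use eK in blast)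
  moreover have "filtermap e sequentially \<noteq> bot" by (simp add: filtermap_bot_iff)
  ultimately obtain c where c: "inf (nhds c) (filtermap e sequentially) \<noteq> bot"
    using K unfolding compact_filter by blast
  \<comment> \<open>The neighbourhoods of the cluster point, pulled back to the natural numbers and
    combined with \<open>sequentially\<close>. That the point is a cluster point makes this filter
    proper.\<close>
  let ?G = "inf (filtercomap e (nhds c)) sequentially"
  show ?thesis
  proof (intro exI[of _ ?G] conjI allI impI)
    show "?G \<noteq> bot"
    proof
      assume "?G = bot"
      then have "eventually (\<lambda>n. False) ?G" by simp
      then obtain P Q where P: "eventually P (filtercomap e (nhds c))" and Q: "eventually Q sequentially"
        and PQ: "\<And>n. P n \<and> Q n \<Longrightarrow> False" unfolding eventually_inf by blast
      obtain R where R: "eventually R (nhds c)" "\<And>n. R (e n) \<Longrightarrow> P n"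
        using P unfolding eventually_filtercomap by blast
      have "eventually (\<lambda>n. \<not> R (e n)) sequentially"
        using Q by eventually_elim (use R(2) PQ in blast)
      then have "eventually (\<lambda>x. \<not> R x) (filtermap e sequentially)" unfolding eventually_filtermap .
      then have "eventually (\<lambda>x. False) (inf (nhds c) (filtermap e sequentially))"
        unfolding eventually_inf using R(1) by blast
      with c show False by simp
    qed
    show "?G \<le> sequentially" by simp
    fix f :: "nat \<Rightarrow> complex" assume f: "Bseq f"
    have "filterlim (\<lambda>x. x f) (nhds (c f)) (nhds c)"
    proof (rule topological_tendstoI)
      fix S assume "open S" "c f \<in> S"
      then show "eventually (\<lambda>x. x f \<in> S) (nhds c)"
        using eventually_nhds_in_open[OF open_vimage[OF _ continuous_on_product_coordinates[of f]], of S c] by simp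
    qed
    then have "filterlim (\<lambda>n. e n f) (nhds (c f)) (filtercomap e (nhds c))"
      by (rule filterlim_compose) (rule filterlim_filtercomap)
    then have "((\<lambda>n. e n f) \<longlongrightarrow> c f) ?G" by (rule filterlim_mono) auto
    then show "\<exists>l. (f \<longlongrightarrow> l) ?G" using f by (auto simp: e_def)
  qed
qed

text \<open>One filter is fixed for all sequences, so that generalized limits are genuine limits and
  inherit linearity, bounds and compatibility with real parts.\<close>

definition gfilter :: "nat filter" where
  "gfilter = (SOME G. G \<noteq> bot \<and> G \<le> sequentially \<and> (\<forall>f :: nat \<Rightarrow> complex. Bseq f \<longrightarrow> (\<exists>l. (f \<longlongrightarrow> l) G)))"

definition glim :: "(nat \<Rightarrow> complex) \<Rightarrow> complex" where "glim f = Lim gfilter f"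

lemma gfilter: "gfilter \<noteq> bot" "gfilter \<le> sequentially"
  and glim: "Bseq f \<Longrightarrow> (f \<longlongrightarrow> glim f) gfilter"
proof -
  have *: "gfilter \<noteq> bot \<and> gfilter \<le> sequentially \<and> (\<forall>f :: nat \<Rightarrow> complex. Bseq f \<longrightarrow> (\<exists>l. (f \<longlongrightarrow> l) gfilter))"
    unfolding gfilter_def by (rule someI_ex[OF generalized_limit])
  then show "gfilter \<noteq> bot" "gfilter \<le> sequentially" by auto
  show "(f \<longlongrightarrow> glim f) gfilter" if "Bseq f"
    using * that unfolding glim_def by (metis tendsto_Lim)
qed

lemma glim_eqI: "(f \<longlongrightarrow> l) gfilter \<Longrightarrow> glim f = l"
  unfolding glim_def by (rule tendsto_Lim[OF gfilter(1)])

lemma glim_sequentially: "f \<longlonglongrightarrow> l \<Longrightarrow> glim f = l"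
  by (rule glim_eqI) (rule tendsto_mono[OF gfilter(2)])

text \<open>Bounded second moments give uniform integrability. The deviation is truncated at height
  \<open>R\<close>, where dominated convergence applies; what exceeds \<open>R\<close> is at most
  the squared deviation divided by \<open>R\<close>.\<close>

lemma (in prob_space) expectation_limit:
  fixes X :: "nat \<Rightarrow> 'a \<Rightarrow> real"
  assumes meas: "\<And>n. X n \<in> borel_measurable M" and sq: "\<And>n. integrable M (\<lambda>z. (X n z)\<^sup>2)"
    and C: "\<And>n. expectation (\<lambda>z. (X n z)\<^sup>2) \<le> C" and lim: "AE z in M. (\<lambda>n. X n z) \<longlonglongrightarrow> c"
  shows "(\<lambda>n. expectation (X n)) \<longlonglongrightarrow> c"
proof -
  have C0: "0 \<le> C" using C[of 0] by (rule order.trans[rotated]) simp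
  have int: "integrable M (X n)" for n
    by (rule square_integrable_imp_integrable[OF meas sq])
  let ?D = "\<lambda>n z. \<bar>X n z - c\<bar>"
  define K where "K = 2 * C + 2 * c\<^sup>2"
  have K0: "0 \<le> K" using C0 by (simp add: K_def)
  have le: "\<bar>expectation (X n) - c\<bar> \<le> expectation (\<lambda>z. min (?D n z) R) + K / R" if R: "0 < R" for n R
  proof -
    have sqD: "(X n z - c)\<^sup>2 \<le> 2 * (X n z)\<^sup>2 + 2 * c\<^sup>2" for z
      using zero_le_power2[of "X n z + c"] by (simp add: power2_eq_square algebra_simps)
    have int1: "integrable M (\<lambda>z. min (?D n z) R)"
      by (rule integrable_const_bound[of _ R]) (use R meas[of n] in \<open>auto intro!: AE_I2\<close>)
    have int2: "integrable M (\<lambda>z. (2 * (X n z)\<^sup>2 + 2 * c\<^sup>2) / R)"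
      using sq by (intro integrable_divide Bochner_Integration.integrable_add integrable_mult_right) auto
    have "\<bar>expectation (X n) - c\<bar> = \<bar>expectation (\<lambda>z. X n z - c)\<bar>"
      using int by (simp add: prob_space)
    also have "\<dots> \<le> expectation (?D n)" by (rule integral_abs_bound)
    also have "\<dots> \<le> expectation (\<lambda>z. min (?D n z) R + (2 * (X n z)\<^sup>2 + 2 * c\<^sup>2) / R)"
    proof (rule integral_mono)
      show "integrable M (?D n)" using int by simp
      show "integrable M (\<lambda>z. min (?D n z) R + (2 * (X n z)\<^sup>2 + 2 * c\<^sup>2) / R)"
        by (intro Bochner_Integration.integrable_add int1 int2)
      fix z
      have "?D n z \<le> (?D n z)\<^sup>2 / R" if "R < ?D n z"
        using mult_right_mono[of R "?D n z" "?D n z"] that R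
        by (simp add: pos_le_divide_eq power2_eq_square mult.commute)
      moreover have "(?D n z)\<^sup>2 / R \<le> (2 * (X n z)\<^sup>2 + 2 * c\<^sup>2) / R"
        using sqD[of z] R by (intro divide_right_mono) auto
      moreover have "0 \<le> (2 * (X n z)\<^sup>2 + 2 * c\<^sup>2) / R" using R by simp
      ultimately show "?D n z \<le> min (?D n z) R + (2 * (X n z)\<^sup>2 + 2 * c\<^sup>2) / R"
        using R by (cases "?D n z \<le> R") (auto simp: min_def)
    qed
    also have "\<dots> = expectation (\<lambda>z. min (?D n z) R) + (2 * expectation (\<lambda>z. (X n z)\<^sup>2) + 2 * c\<^sup>2) / R"
      using int1 int2 sq[of n] by (simp add: prob_space)
    also have "\<dots> \<le> expectation (\<lambda>z. min (?D n z) R) + K / R"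
      using C[of n] R unfolding K_def by (intro add_left_mono divide_right_mono) auto
    finally show ?thesis .
  qed
  have tr: "(\<lambda>n. expectation (\<lambda>z. min (?D n z) R)) \<longlonglongrightarrow> 0" if R: "0 < R" for R
  proof -
    have "(\<lambda>n. expectation (\<lambda>z. min (?D n z) R)) \<longlonglongrightarrow> expectation (\<lambda>z. 0)"
    proof (rule integral_dominated_convergence[where w="\<lambda>_. R"])
      show "AE z in M. (\<lambda>n. min (?D n z) R) \<longlonglongrightarrow> 0" using lim
      proof eventually_elim
        case (elim z)
        have "(\<lambda>n. min (?D n z) R) \<longlonglongrightarrow> min \<bar>c - c\<bar> R" by (intro tendsto_intros elim)
        then show ?case using R by simp
      qed
    qed (use R meas in auto)
    then show ?thesis by simp
  qed
  show ?thesis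
  proof (rule LIMSEQ_I)
    fix e :: real assume e: "0 < e"
    define R where "R = 2 * (K + 1) / e"
    have R: "0 < R" using e K0 by (simp add: R_def add_nonneg_pos)
    have CR: "K / R < e / 2"
    proof -
      have "K < K + 1" by simp
      then have "K * (e / 2) / (K + 1) < e / 2" using e K0 by (simp add: pos_divide_less_eq add_nonneg_pos)
      moreover have "K / R = K * (e / 2) / (K + 1)" using e K0 by (simp add: R_def field_simps)
      ultimately show ?thesis by linarith
    qed
    obtain N where N: "\<And>n. n \<ge> N \<Longrightarrow> \<bar>expectation (\<lambda>z. min (?D n z) R)\<bar> < e / 2"
      using LIMSEQ_D[OF tr[OF R], of "e / 2"] e by auto
    show "\<exists>N. \<forall>n\<ge>N. norm (expectation (X n) - c) < e"
    proof (intro exI[of _ N] allI impI)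
      fix n assume "N \<le> n"
      then show "norm (expectation (X n) - c) < e" using le[OF R, of n] N[of n] CR abs_ge_self[of "expectation (\<lambda>z. min (?D n z) R)"]
        unfolding real_norm_def by linarith
    qed
  qed
qed

section \<open>Generalized time averages as a linear functional on processes\<close>

context brownian
begin

text \<open>Mesh \<open>1 / (n + 1)\<close> and horizon \<open>(n + 1)^2\<close>, hence
  \<open>(n + 1)^3\<close> points: the mesh tends to zero and the horizon to infinity along the same
  sequence.\<close>

definition avg :: "(real \<Rightarrow> 'w \<Rightarrow> complex) \<Rightarrow> nat \<Rightarrow> complex" where
  "avg Y n = (\<Sum>j<Suc n ^ 3. expectation (Y (real j / real (Suc n)))) / of_nat (Suc n ^ 3)"

definition mean :: "(real \<Rightarrow> 'w \<Rightarrow> complex) \<Rightarrow> complex" where "mean Y = glim (avg Y)"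

lemma norm_avg: "(\<And>t. 0 \<le> t \<Longrightarrow> cmod (expectation (Y t)) \<le> C) \<Longrightarrow> cmod (avg Y n) \<le> C"
proof -
  assume C: "\<And>t. 0 \<le> t \<Longrightarrow> cmod (expectation (Y t)) \<le> C"
  have "cmod (\<Sum>j<Suc n ^ 3. expectation (Y (real j / real (Suc n)))) \<le> (\<Sum>j<Suc n ^ 3. C)"
    by (rule order.trans[OF norm_sum sum_mono]) (rule C, simp)
  then have "cmod (\<Sum>j<Suc n ^ 3. expectation (Y (real j / real (Suc n)))) \<le> C * real (Suc n ^ 3)"
    by (simp add: mult.commute)
  moreover have "0 < real (Suc n ^ 3)" by simp
  ultimately show ?thesis unfolding avg_def norm_divide norm_of_nat by (subst pos_divide_le_eq)
qed

lemma adm_expectation_bound: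
  assumes "adm Y" obtains C where "\<And>t. 0 \<le> t \<Longrightarrow> cmod (expectation (Y t)) \<le> C"
proof -
  obtain C where "\<And>t. t \<in> {0..} \<Longrightarrow> expectation (\<lambda>z. norm (Y t z)) \<le> C"
    using mbdd_L1[OF prob_space_M adm_mbdd[OF assms]] by metis
  then show ?thesis by (intro that[of C] order.trans[OF integral_norm_bound]) auto
qed

lemma mean_limit: "adm Y \<Longrightarrow> (avg Y \<longlongrightarrow> mean Y) gfilter"
proof -
  assume "adm Y"
  then obtain C where "\<And>t. 0 \<le> t \<Longrightarrow> cmod (expectation (Y t)) \<le> C" by (rule adm_expectation_bound) blast
  then have "cmod (avg Y n) \<le> C" for n by (rule norm_avg)
  then have "Bseq (avg Y)" by (rule BseqI')
  then show ?thesis unfolding mean_def by (rule glim)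
qed

lemma norm_mean:
  assumes "adm Y" "\<And>t. 0 \<le> t \<Longrightarrow> cmod (expectation (Y t)) \<le> C"
  shows "cmod (mean Y) \<le> C"
  by (rule tendsto_upperbound[OF tendsto_norm[OF mean_limit[OF assms(1)]] _ gfilter(1)])
     (rule always_eventually, rule allI, rule norm_avg[OF assms(2)])

lemma mean_add:
  assumes "adm X" "adm Y" shows "mean (\<lambda>t z. X t z + Y t z) = mean X + mean Y"
proof -
  have "avg (\<lambda>t z. X t z + Y t z) = (\<lambda>n. avg X n + avg Y n)"
  proof
    fix n
    have "expectation (\<lambda>z. X (real j / real (Suc n)) z + Y (real j / real (Suc n)) z)
      = expectation (X (real j / real (Suc n))) + expectation (Y (real j / real (Suc n)))" for j
      by (intro Bochner_Integration.integral_add adm_integrable assms) auto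
    then show "avg (\<lambda>t z. X t z + Y t z) n = avg X n + avg Y n"
      by (simp only: avg_def sum.distrib add_divide_distrib)
  qed
  then show ?thesis
    unfolding mean_def[of "\<lambda>t z. X t z + Y t z"] by (auto intro!: glim_eqI tendsto_add mean_limit assms)
qed

lemma mean_cmult: assumes "adm X" shows "mean (\<lambda>t z. c * X t z) = c * mean X"
proof -
  have "avg (\<lambda>t z. c * X t z) = (\<lambda>n. c * avg X n)"
    by (rule ext) (simp add: avg_def sum_distrib_left)
  then show ?thesis
    unfolding mean_def[of "\<lambda>t z. c * X t z"] by (auto intro!: glim_eqI tendsto_mult_left mean_limit assms)
qed

lemma mean_const: "mean (\<lambda>t z. c) = c"
proof -
  have "avg (\<lambda>t z. c) n = c" for n
    unfolding avg_def by (simp add: prob_space del: of_nat_Suc of_nat_power)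
  then have "avg (\<lambda>t z. c) = (\<lambda>n. c)" by blast
  then show ?thesis unfolding mean_def by (intro glim_sequentially) simp
qed

lemma mean_diff: "adm X \<Longrightarrow> adm Y \<Longrightarrow> mean (\<lambda>t z. X t z - Y t z) = mean X - mean Y"
  using mean_add[of X "\<lambda>t z. (-1) * Y t z"] mean_cmult[of Y "-1"] adm_minus[of Y] by simp

lemma mean_sum:
  assumes "finite K" "\<And>k. k \<in> K \<Longrightarrow> adm (X k)"
  shows "mean (\<lambda>t z. \<Sum>k\<in>K. X k t z) = (\<Sum>k\<in>K. mean (X k))"
  using assms
proof (induction K rule: finite_induct)
  case empty show ?case by (simp add: mean_const)
next
  case (insert k K)
  then show ?case by (simp add: mean_add adm_sum)
qed

lemma mean_Re: assumes "adm X" shows "mean (\<lambda>t z. of_real (Re (X t z))) = of_real (Re (mean X))"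
proof -
  have "avg (\<lambda>t z. of_real (Re (X t z))) = (\<lambda>n. of_real (Re (avg X n)))"
  proof
    fix n
    have E: "expectation (\<lambda>z. complex_of_real (Re (X (real j / real (Suc n)) z))) = of_real (Re (expectation (X (real j / real (Suc n)))))" for j
      unfolding integral_complex_of_real by (subst integral_Re) (auto intro: adm_integrable assms)
    have Rd: "Re (z / of_nat k) = Re z / of_nat k" for z k
      by (metis Re_divide_of_real of_real_of_nat_eq)
    show "avg (\<lambda>t z. of_real (Re (X t z))) n = of_real (Re (avg X n))"
      unfolding avg_def E Rd Re_sum by simp
  qed
  then show ?thesis
    unfolding mean_def[of "\<lambda>t z. of_real (Re (X t z))"]
    by (auto intro!: glim_eqI tendsto_of_real tendsto_Re mean_limit assms)
qed

text \<open>Expected increments over the grid telescope. The errors, of order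
  \<open>h sqrt h\<close> for each of \<open>N\<close> steps, are of order \<open>sqrt h\<close>
  after division by the horizon \<open>h N\<close>, and the mesh \<open>h\<close> tends to
  zero.\<close>

lemma mean_drift:
  assumes Y: "ito Y a \<sigma>"
    and lim: "(\<lambda>n. expectation (\<lambda>z. Y (real (Suc n ^ 2)) z - Y 0 z) / of_nat (Suc n ^ 2)) \<longlonglongrightarrow> l"
  shows "mean a = l"
proof -
  obtain C where C: "C \<ge> 0" "\<And>t h. 0 \<le> t \<Longrightarrow> 0 < h \<Longrightarrow> h \<le> 1 \<Longrightarrow>
      norm (expectation (\<lambda>z. Y (t + h) z - Y t z) - of_real h * expectation (a t)) \<le> C * (h * sqrt h)"
    by (rule ito_expectation[OF Y]) blast
  let ?E = "\<lambda>n. expectation (\<lambda>z. Y (real (Suc n ^ 2)) z - Y 0 z) / of_nat (Suc n ^ 2)"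
  have bd: "cmod (avg a n - ?E n) \<le> C * sqrt (1 / real (Suc n))" for n
  proof -
    define h N where "h = 1 / real (Suc n)" and "N = Suc n ^ 3"
    have h: "0 < h" "h \<le> 1" by (auto simp: h_def)
    have T: "h * real N = real (Suc n ^ 2)"
      unfolding h_def N_def power3_eq_cube power2_eq_square of_nat_mult by (simp del: of_nat_Suc)
    have N: "0 < real N" by (simp add: N_def)
    let ?t = "\<lambda>j. real j * h"
    have int: "integrable M (\<lambda>z. Y (?t (Suc j)) z - Y (?t j) z)" for j
    proof -
      have "(?t j, h) \<in> steps" using h by (simp add: steps_def)
      from mbdd_integrable[OF prob_space_M ito_increment[OF Y] this]
      show ?thesis by (simp add: algebra_simps)
    qed
    have "(\<lambda>z. Y (real (Suc n ^ 2)) z - Y 0 z) = (\<lambda>z. \<Sum>j<N. Y (?t (Suc j)) z - Y (?t j) z)"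
    proof
      fix z
      have "?t N = real (Suc n ^ 2)" using T by (simp only: mult.commute)
      then show "Y (real (Suc n ^ 2)) z - Y 0 z = (\<Sum>j<N. Y (?t (Suc j)) z - Y (?t j) z)"
        using sum_lessThan_telescope[of "\<lambda>j. Y (?t j) z" N] by (simp only: of_nat_0 mult_zero_left)
    qed
    then have sum: "expectation (\<lambda>z. Y (real (Suc n ^ 2)) z - Y 0 z)
      = (\<Sum>j<N. expectation (\<lambda>z. Y (?t (Suc j)) z - Y (?t j) z))"
      by (simp only: Bochner_Integration.integral_sum[OF int])
    define e where "e = (\<lambda>j. expectation (\<lambda>z. Y (?t (Suc j)) z - Y (?t j) z))"
    define \<alpha> where "\<alpha> = (\<lambda>j. expectation (a (?t j)))"
    have "complex_of_nat (Suc n ^ 2) = of_real (h * real N)" unfolding T of_real_of_nat_eq ..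
    then have E: "?E n = (\<Sum>j<N. e j) / complex_of_real (h * real N)" unfolding sum e_def by (rule arg_cong)
    have tj: "real j / real (Suc n) = ?t j" for j by (simp add: h_def)
    have "avg a n = (\<Sum>j<N. \<alpha> j) / of_nat N" unfolding avg_def N_def[symmetric] tj \<alpha>_def ..
    then have a: "avg a n = (\<Sum>j<N. of_real h * \<alpha> j) / complex_of_real (h * real N)"
      using h by (simp add: sum_distrib_left[symmetric])
    have step: "cmod (e j - of_real h * \<alpha> j) \<le> C * (h * sqrt h)" for j
    proof -
      have "?t (Suc j) = ?t j + h" by (simp add: algebra_simps)
      moreover have "0 \<le> ?t j" using h by simp
      ultimately show ?thesis using C(2)[of "?t j" h] h unfolding e_def \<alpha>_def by simp
    qed
    have "cmod (\<Sum>j<N. e j - of_real h * \<alpha> j) \<le> (\<Sum>j<N. C * (h * sqrt h))"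
      by (rule order.trans[OF norm_sum sum_mono]) (rule step)
    also have "\<dots> = C * sqrt h * (h * real N)" by (simp only: sum_constant card_lessThan mult_ac)
    finally have S: "cmod (\<Sum>j<N. e j - of_real h * \<alpha> j) \<le> C * sqrt h * (h * real N)" .
    have hN: "0 < h * real N" using h N by simp
    have "avg a n - ?E n = - ((\<Sum>j<N. e j - of_real h * \<alpha> j) / complex_of_real (h * real N))"
      unfolding E a sum_subtractf by (simp only: diff_divide_distrib minus_diff_eq)
    then have "cmod (avg a n - ?E n) = cmod (\<Sum>j<N. e j - of_real h * \<alpha> j) / (h * real N)"
      using hN by (simp only: norm_minus_cancel norm_divide norm_of_real abs_of_pos)
    also have "\<dots> \<le> C * sqrt h" using S by (simp only: pos_divide_le_eq[OF hN])
    finally show ?thesis unfolding h_def .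
  qed
  have "(\<lambda>n. C * sqrt (1 / real (Suc n))) \<longlonglongrightarrow> C * sqrt 0"
    by (intro tendsto_intros LIMSEQ_inverse_real_of_nat[unfolded inverse_eq_divide])
  then have "(\<lambda>n. avg a n - ?E n) \<longlonglongrightarrow> 0"
    by (intro Lim_null_comparison[of "\<lambda>n. avg a n - ?E n", OF always_eventually[OF allI[OF bd]]]) simp
  from tendsto_add[OF this lim] show ?thesis
    unfolding mean_def by (intro glim_sequentially) simp
qed

text \<open>Bounded expectations vanish after division by the horizon. The result plays the role of
  the identity by which an invariant measure annihilates the image of the generator.\<close>

lemma mean_drift_adm: assumes "ito Y a \<sigma>" "adm Y" shows "mean a = 0"
proof (rule mean_drift[OF assms(1)])
  obtain C where C: "\<And>t. 0 \<le> t \<Longrightarrow> cmod (expectation (Y t)) \<le> C" by (rule adm_expectation_bound[OF assms(2)]) blast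
  have C0: "0 \<le> C" using order.trans[OF norm_ge_zero C[of 0]] by simp
  have "cmod (expectation (\<lambda>z. Y (real (Suc n ^ 2)) z - Y 0 z) / of_nat (Suc n ^ 2)) \<le> 2 * C * (1 / real (Suc n))" for n
  proof -
    have "expectation (\<lambda>z. Y (real (Suc n ^ 2)) z - Y 0 z) = expectation (Y (real (Suc n ^ 2))) - expectation (Y 0)"
      by (rule Bochner_Integration.integral_diff) (intro adm_integrable assms(2), simp)+
    also have "cmod \<dots> \<le> C + C"
      by (rule order.trans[OF norm_triangle_ineq4 add_mono]) (rule C, simp)+
    finally have "cmod (expectation (\<lambda>z. Y (real (Suc n ^ 2)) z - Y 0 z)) \<le> C + C" .
    moreover have "real (Suc n) \<le> real (Suc n ^ 2)" unfolding of_nat_le_iff by (rule self_le_power) auto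
    then have "1 / real (Suc n ^ 2) \<le> 1 / real (Suc n)" by (rule frac_le[OF zero_le_one order_refl of_nat_0_less_iff[THEN iffD2, OF zero_less_Suc]])
    ultimately have "cmod (expectation (\<lambda>z. Y (real (Suc n ^ 2)) z - Y 0 z)) * (1 / real (Suc n ^ 2)) \<le> (C + C) * (1 / real (Suc n))"
      using C0 by (intro mult_mono) auto
    then show ?thesis by (simp only: norm_divide norm_of_nat times_divide_eq_right mult_1_right mult_2)
  qed
  moreover have "(\<lambda>n. 2 * C * (1 / real (Suc n))) \<longlonglongrightarrow> 2 * C * 0"
    by (intro tendsto_intros LIMSEQ_inverse_real_of_nat[unfolded inverse_eq_divide])
  ultimately show "(\<lambda>n. expectation (\<lambda>z. Y (real (Suc n ^ 2)) z - Y 0 z) / of_nat (Suc n ^ 2)) \<longlonglongrightarrow> 0"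
    unfolding mult_zero_right by (rule Lim_null_comparison[OF always_eventually[OF allI]])
qed

end

text \<open>The exponent is an almost sure limit, while the drift formula concerns expectations.
  Second moments justify the passage: by Cauchy-Schwarz the square of an average of increments over
  unit intervals is at most the average of their squares, whose expectations are bounded.\<close>

lemma (in stable_oscillator) mean_lnphase:
  assumes L: "is_lyapunov_exponent M F W A B a \<gamma> \<kappa>0 \<zeta> \<epsilon> L"
    and \<kappa>0: "\<kappa>0\<^sup>2 = \<kappa>\<^sup>2 + \<zeta>\<^sup>2" and \<zeta>: "0 < \<zeta>"
  shows "mean (\<lambda>t z. of_real (Re (bt * \<epsilon> * lin a t z * (1 - w t z)
        - bt\<^sup>2 * (of_real (\<epsilon>\<^sup>2 * (norm \<gamma>)\<^sup>2)) * (1 - w t z)\<^sup>2 / 2))) = of_real (L + \<zeta>)"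
proof (rule mean_drift[OF ito_lnphase])
  let ?l = "\<lambda>t z. ln (cmod (phase t z))"
  let ?D = "\<lambda>k z. ?l (real (Suc k)) z - ?l (real k) z"
  let ?X = "\<lambda>n z. (?l (real (Suc n ^ 2)) z - ?l 0 z) / real (Suc n ^ 2)"
  have m: "?l t \<in> borel_measurable M" if "0 \<le> t" for t
    using measurable_F_M[OF phase_adapted[OF that]] that by measurable
  have "mbdd M (UNIV :: nat set) (\<lambda>k z. lnphase (real k + 1) z - lnphase (real k) z)"
    using mbdd_reindex[OF ito_increment[OF ito_lnphase], of UNIV "\<lambda>k::nat. (real k, 1)"] by (simp add: steps_def)
  from mbdd_power[OF prob_space_M mbdd_norm[OF this], of 2]
  have "mbdd M (UNIV :: nat set) (\<lambda>k z. (cmod (lnphase (real k + 1) z - lnphase (real k) z))\<^sup>2)" .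
  moreover have "(cmod (lnphase (real k + 1) z - lnphase (real k) z))\<^sup>2 = (?D k z)\<^sup>2" for k :: nat and z
    unfolding lnphase_def of_real_diff[symmetric] norm_of_real power2_abs by (simp add: add.commute)
  ultimately have "mbdd M UNIV (\<lambda>k z. (?D k z)\<^sup>2)" by (simp only:)
  then obtain C where C': "0 \<le> C" "\<And>k. k \<in> UNIV \<Longrightarrow> integrable M (\<lambda>z. (?D k z)\<^sup>2)"
    "\<And>k. k \<in> UNIV \<Longrightarrow> expectation (\<lambda>z. norm ((?D k z)\<^sup>2)) \<le> C" by (rule mbdd_L1[OF prob_space_M]) blast
  have C: "integrable M (\<lambda>z. (?D k z)\<^sup>2)" "expectation (\<lambda>z. (?D k z)\<^sup>2) \<le> C" for k
    using C'(2)[of k] C'(3)[of k] by simp_all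
  have Xsq: "(?X n z)\<^sup>2 \<le> (\<Sum>k<Suc n ^ 2. (?D k z)\<^sup>2) / real (Suc n ^ 2)" for n z
  proof -
    have tel: "?l (real (Suc n ^ 2)) z - ?l 0 z = (\<Sum>k<Suc n ^ 2. ?D k z)"
      using sum_lessThan_telescope[of "\<lambda>k. ?l (real k) z" "Suc n ^ 2"] by simp
    have "(\<Sum>k<Suc n ^ 2. ?D k z)\<^sup>2 \<le> (\<Sum>k<Suc n ^ 2. (?D k z)\<^sup>2) * real (Suc n ^ 2)"
      using sum_squared_le_sum_of_squares[of "\<lambda>k. ?D k z" "{..<Suc n ^ 2}"] by simp
    moreover have T: "0 < real (Suc n ^ 2)" by simp
    ultimately have "(?X n z)\<^sup>2 \<le> ((\<Sum>k<Suc n ^ 2. (?D k z)\<^sup>2) * real (Suc n ^ 2)) / (real (Suc n ^ 2))\<^sup>2"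
      unfolding tel power_divide by (intro divide_right_mono) auto
    also have "\<dots> = (\<Sum>k<Suc n ^ 2. (?D k z)\<^sup>2) / real (Suc n ^ 2)"
      using T by (simp only: power2_eq_square[of "real (Suc n ^ 2)"]) (simp del: of_nat_Suc of_nat_power)
    finally show ?thesis .
  qed
  have Xm: "?X n \<in> borel_measurable M" for n
    using m[of "real (Suc n ^ 2)"] m[of 0] by (simp del: of_nat_Suc of_nat_power)
  have intS: "integrable M (\<lambda>z. (\<Sum>k<Suc n ^ 2. (?D k z)\<^sup>2) / real (Suc n ^ 2))" for n
    by (intro integrable_divide Bochner_Integration.integrable_sum C(1))
  have intX: "integrable M (\<lambda>z. (?X n z)\<^sup>2)" for n
  proof (rule Bochner_Integration.integrable_bound[OF intS[of n]])
    show "(\<lambda>z. (?X n z)\<^sup>2) \<in> borel_measurable M" using Xm[of n] by (rule borel_measurable_power)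
    show "AE z in M. norm ((?X n z)\<^sup>2) \<le> norm ((\<Sum>k<Suc n ^ 2. (?D k z)\<^sup>2) / real (Suc n ^ 2))"
      unfolding real_norm_def abs_power2 by (intro AE_I2 order.trans[OF Xsq abs_ge_self])
  qed
  have "(\<lambda>n. expectation (?X n)) \<longlonglongrightarrow> L + \<zeta>"
  proof (rule expectation_limit[OF Xm intX])
    show "expectation (\<lambda>z. (?X n z)\<^sup>2) \<le> C" for n
    proof -
      have "expectation (\<lambda>z. (?X n z)\<^sup>2) \<le> expectation (\<lambda>z. (\<Sum>k<Suc n ^ 2. (?D k z)\<^sup>2) / real (Suc n ^ 2))"
        by (rule integral_mono[OF intX intS Xsq])
      also have "\<dots> = (\<Sum>k<Suc n ^ 2. expectation (\<lambda>z. (?D k z)\<^sup>2)) / real (Suc n ^ 2)"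
        using C(1) by (simp del: of_nat_Suc of_nat_power)
      also have "\<dots> \<le> (\<Sum>k<Suc n ^ 2. C) / real (Suc n ^ 2)"
        by (intro divide_right_mono sum_mono C(2)) simp
      also have "\<dots> = C" by (simp del: of_nat_Suc of_nat_power)
      finally show ?thesis .
    qed
    have T: "filterlim (\<lambda>n. real (Suc n ^ 2)) at_top sequentially"
      by (rule filterlim_at_top_mono[OF filterlim_real_sequentially]) (auto intro!: always_eventually simp: power2_eq_square)
    have inv: "(\<lambda>n. 1 / real (Suc n ^ 2)) \<longlonglongrightarrow> 0"
      using tendsto_inverse_0_at_top[OF T] by (simp add: inverse_eq_divide)
    from lyapunov_undamped[OF L \<kappa>0 \<zeta>] show "AE z in M. (\<lambda>n. ?X n z) \<longlonglongrightarrow> L + \<zeta>"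
    proof eventually_elim
      case (elim z)
      have "(\<lambda>n. ?l (real (Suc n ^ 2)) z / real (Suc n ^ 2) - ?l 0 z * (1 / real (Suc n ^ 2))) \<longlonglongrightarrow> (L + \<zeta>) - ?l 0 z * 0"
        by (intro tendsto_diff tendsto_mult_left inv filterlim_compose[OF elim T])
      then show ?case by (simp add: diff_divide_distrib)
    qed
  qed
  from tendsto_of_real[OF this, where 'a=complex]
  show "(\<lambda>n. expectation (\<lambda>z. lnphase (real (Suc n ^ 2)) z - lnphase 0 z) / of_nat (Suc n ^ 2)) \<longlonglongrightarrow> of_real (L + \<zeta>)"
    by (simp add: lnphase_def integral_complex_of_real flip: of_real_diff del: of_nat_Suc of_nat_power)
qed

section \<open>Multilinear functionals transported by a stable flow\<close>

text \<open>The fundamental theorem on \<open>[0, n]\<close> followed by dominated convergence; the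
  limit of \<open>f\<close> is taken along the integers.\<close>

lemma has_integral_half_line:
  fixes f :: "real \<Rightarrow> 'a::euclidean_space"
  assumes deriv: "\<And>t. 0 \<le> t \<Longrightarrow> (f has_vector_derivative g t) (at t within {0..})"
    and bound: "\<And>t. 0 \<le> t \<Longrightarrow> norm (g t) \<le> K * exp (- \<delta> * t)" and \<delta>: "0 < \<delta>"
    and lim: "(\<lambda>n. f (real n)) \<longlonglongrightarrow> 0"
  shows "(g has_integral - f 0) {0..}"
proof (rule has_integral_dominated_convergence)
  show "((\<lambda>t. if t \<in> {0..real n} then g t else 0) has_integral f (real n) - f 0) {0..}" for n
  proof -
    have "(g has_integral f (real n) - f 0) {0..real n}"
      by (rule fundamental_theorem_of_calculus)
         (auto intro: has_vector_derivative_within_subset[OF deriv])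
    then show ?thesis by (subst has_integral_restrict) auto
  qed
  show "(\<lambda>t. K * exp (- \<delta> * t)) integrable_on {0..}"
    by (intro integrable_on_mult_right integrable_on_exp_minus_to_infinity \<delta>)
  have "0 \<le> K * exp (- \<delta> * t)" if "0 \<le> t" for t
    by (rule order.trans[OF norm_ge_zero bound[OF that]])
  then show "\<forall>t\<in>{0..}. norm (if t \<in> {0..real n} then g t else 0) \<le> K * exp (- \<delta> * t)" for n
    using bound by auto
  show "\<forall>t\<in>{0..}. (\<lambda>n. if t \<in> {0..real n} then g t else 0) \<longlonglongrightarrow> g t"
  proof
    fix t :: real assume t: "t \<in> {0..}"
    obtain N where "t \<le> real N" using real_arch_simple by blast
    then have "eventually (\<lambda>n. (if t \<in> {0..real n} then g t else 0) = g t) sequentially"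
      using t by (intro eventually_sequentiallyI[of N]) auto
    then show "(\<lambda>n. if t \<in> {0..real n} then g t else 0) \<longlonglongrightarrow> g t" by (rule tendsto_eventually)
  qed
  have "(\<lambda>n. f (real n) - f 0) \<longlonglongrightarrow> 0 - f 0" by (intro tendsto_diff lim tendsto_const)
  then show "(\<lambda>n. f (real n) - f 0) \<longlonglongrightarrow> - f 0" by simp
qed

text \<open>Multilinear functionals are written as functions of a list of vectors. For the list
  \<open>[b\<^sub>1, \<dots>, b\<^sub>n]\<close>, \<open>subst1 T m\<close> sums \<open>m\<close> over the lists with one \<open>b\<^sub>i\<close> replaced by \<open>T b\<^sub>i\<close>;
  \<open>contract r m\<close> sums \<open>r b\<^sub>i\<close> times \<open>m\<close> of the list without \<open>b\<^sub>i\<close>; \<open>contract2 q m\<close> sums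
  \<open>q b\<^sub>i b\<^sub>j\<close> times \<open>m\<close> of the list without \<open>b\<^sub>i, b\<^sub>j\<close>, over \<open>i < j\<close>.\<close>

fun subst1 :: "('b \<Rightarrow> 'b) \<Rightarrow> ('b list \<Rightarrow> complex) \<Rightarrow> 'b list \<Rightarrow> complex" where
  "subst1 T m [] = 0"
| "subst1 T m (b # bs) = m (T b # bs) + subst1 T (\<lambda>cs. m (b # cs)) bs"

fun contract :: "('b \<Rightarrow> real) \<Rightarrow> ('b list \<Rightarrow> complex) \<Rightarrow> 'b list \<Rightarrow> complex" where
  "contract r m [] = 0"
| "contract r m (b # bs) = of_real (r b) * m bs + contract r (\<lambda>cs. m (b # cs)) bs"

fun contract2 :: "('b \<Rightarrow> 'b \<Rightarrow> real) \<Rightarrow> ('b list \<Rightarrow> complex) \<Rightarrow> 'b list \<Rightarrow> complex" where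
  "contract2 q m [] = 0"
| "contract2 q m (b # bs) = contract (q b) m bs + contract2 q (\<lambda>cs. m (b # cs)) bs"

fun multilinear :: "nat \<Rightarrow> ('b::real_vector list \<Rightarrow> complex) \<Rightarrow> bool" where
  "multilinear 0 m \<longleftrightarrow> True"
| "multilinear (Suc n) m \<longleftrightarrow> (\<forall>bs. length bs = n \<longrightarrow> linear (\<lambda>b. m (b # bs))) \<and> (\<forall>b. multilinear n (\<lambda>bs. m (b # bs)))"

definition nprod :: "'b::real_normed_vector list \<Rightarrow> real" where "nprod bs = prod_list (map norm bs)"

lemma nprod_simps [simp]: "nprod [] = 1" "nprod (b # bs) = norm b * nprod bs"
  by (simp_all add: nprod_def)

lemma nprod_nonneg [simp]: "0 \<le> nprod bs"
  by (induction bs) auto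

lemma contract_add: "contract r (\<lambda>bs. m bs + m' bs) bs = contract r m bs + contract r m' bs"
  by (induction bs arbitrary: m m') (auto simp: algebra_simps)

lemma contract_cmult: "contract r (\<lambda>bs. c * m bs) bs = c * contract r m bs"
  by (induction bs arbitrary: m) (auto simp: algebra_simps)

lemma contract_sum_left:
  "finite K \<Longrightarrow> (\<Sum>l\<in>K. of_real (s l) * contract (r l) m bs) = contract (\<lambda>b. \<Sum>l\<in>K. s l * r l b) m bs"
  by (induction bs arbitrary: m) (auto simp: sum.distrib distrib_left sum_distrib_right mult.assoc simp flip: sum_distrib_left)

lemma contract_bound:
  fixes m :: "'b::real_normed_vector list \<Rightarrow> complex"
  assumes "\<And>b. \<bar>r b\<bar> \<le> \<rho> * norm b" "0 \<le> \<rho>" "0 \<le> e" "length bs = Suc n"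
    "\<And>cs. length cs = n \<Longrightarrow> cmod (m cs) \<le> e * nprod cs"
  shows "cmod (contract r m bs) \<le> real (Suc n) * (\<rho> * e) * nprod bs"
  using assms(3-5)
proof (induction bs arbitrary: n m e)
  case Nil
  then show ?case by simp
next
  case (Cons b bs)
  have 1: "cmod (of_real (r b) * m bs) \<le> (\<rho> * norm b) * (e * nprod bs)"
    unfolding norm_mult norm_of_real using Cons.prems assms(1)[of b] assms(2) by (intro mult_mono) auto
  have 2: "cmod (contract r (\<lambda>cs. m (b # cs)) bs) \<le> real n * (\<rho> * (e * norm b)) * nprod bs"
  proof (cases n)
    case 0
    then show ?thesis using Cons.prems by simp
  next
    case (Suc k)
    show ?thesis unfolding Suc
    proof (rule Cons.IH)
      show "cmod (m (b # cs)) \<le> (e * norm b) * nprod cs" if "length cs = k" for cs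
        using Cons.prems(3)[of "b # cs"] that Suc by (simp add: mult.assoc)
    qed (use Cons.prems Suc in auto)
  qed
  have "cmod (contract r m (b # bs)) \<le> (\<rho> * norm b) * (e * nprod bs) + real n * (\<rho> * (e * norm b)) * nprod bs"
    unfolding contract.simps by (rule norm_triangle_le[OF add_mono[OF 1 2]])
  also have "\<dots> = real (Suc n) * (\<rho> * e) * nprod (b # bs)" by (simp add: algebra_simps)
  finally show ?case .
qed

lemma norm_map_bound:
  assumes "\<And>b. norm (T b) \<le> C * norm b" "0 \<le> C"
  shows "nprod (map T bs) \<le> C ^ length bs * nprod bs"
proof (induction bs)
  case (Cons b bs)
  have "norm (T b) * nprod (map T bs) \<le> (C * norm b) * (C ^ length bs * nprod bs)"
    by (intro mult_mono assms Cons.IH) (use assms in auto)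
  then show ?case by (simp add: mult_ac)
qed simp

text \<open>Leibniz rule along the flow. Expanding the head of the list in a basis turns its slot
  into scalar factors, and the induction hypothesis applies to the functionals with a fixed basis
  vector in the first slot.\<close>

lemma multilinear_deriv:
  fixes m :: "'b::euclidean_space list \<Rightarrow> complex"
  assumes "\<And>b. ((\<lambda>t. E t b) has_vector_derivative T (E t b)) (at t within S)"
    and "multilinear (length bs) m"
  shows "((\<lambda>t. m (map (E t) bs)) has_vector_derivative subst1 T m (map (E t) bs)) (at t within S)"
  using assms(2)
proof (induction bs arbitrary: m)
  case Nil
  then show ?case by simp
next
  case (Cons b bs)
  define x where "x = E t b"
  have lin: "linear (\<lambda>c. m (c # cs))" if "length cs = length bs" for cs
    using Cons.prems that by simp
  have expand: "m (c # cs) = (\<Sum>e\<in>Basis. (c \<bullet> e) *\<^sub>R m (e # cs))" if "length cs = length bs" for c cs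
  proof -
    have "m (c # cs) = m ((\<Sum>e\<in>Basis. (c \<bullet> e) *\<^sub>R e) # cs)" by (simp add: euclidean_representation)
    also have "\<dots> = (\<Sum>e\<in>Basis. (c \<bullet> e) *\<^sub>R m (e # cs))"
      by (simp only: linear_sum[OF lin[OF that]] linear_scale[OF lin[OF that]])
    finally show ?thesis .
  qed
  have mult: "multilinear (length bs) (\<lambda>cs. m (c # cs))" for c using Cons.prems by simp
  have "((\<lambda>t. \<Sum>e\<in>Basis. (E t b \<bullet> e) *\<^sub>R m (e # map (E t) bs)) has_vector_derivative
     (\<Sum>e\<in>Basis. (E t b \<bullet> e) *\<^sub>R subst1 T (\<lambda>cs. m (e # cs)) (map (E t) bs) + (T (E t b) \<bullet> e) *\<^sub>R m (e # map (E t) bs))) (at t within S)"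
  proof (intro has_vector_derivative_sum has_vector_derivative_scaleR Cons.IH[OF mult])
    fix e
    have "((\<lambda>t. E t b \<bullet> e) has_vector_derivative T (E t b) \<bullet> e) (at t within S)"
      by (rule bounded_linear.has_vector_derivative[OF bounded_linear_inner_left assms(1)])
    then show "((\<lambda>t. E t b \<bullet> e) has_real_derivative T (E t b) \<bullet> e) (at t within S)"
      by (simp add: has_real_derivative_iff_has_vector_derivative)
  qed
  moreover have "(\<Sum>e\<in>Basis. (E t b \<bullet> e) *\<^sub>R subst1 T (\<lambda>cs. m (e # cs)) ds) = subst1 T (\<lambda>cs. m (E t b # cs)) ds"
    if "length ds = length bs" for ds
  proof -
    \<comment> \<open>Stated for an arbitrary family \<open>f\<close>, so that the induction on the
      list can fix further arguments.\<close>
    have "(\<Sum>e\<in>Basis. (c \<bullet> e) *\<^sub>R subst1 T (\<lambda>cs. f e cs) ds) = subst1 T (f c) ds"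
      if "\<And>c cs. length cs = length ds \<Longrightarrow> f c cs = (\<Sum>e\<in>Basis. (c \<bullet> e) *\<^sub>R f e cs)" for f :: "'b \<Rightarrow> 'b list \<Rightarrow> complex" and c
      using that
    proof (induction ds arbitrary: f)
      case Nil
      then show ?case by simp
    next
      case (Cons d ds)
      have "(\<Sum>e\<in>Basis. (c \<bullet> e) *\<^sub>R subst1 T (\<lambda>cs. f e (d # cs)) ds) = subst1 T (\<lambda>cs. f c (d # cs)) ds"
        by (rule Cons.IH[where f="\<lambda>e cs. f e (d # cs)"]) (rule Cons.prems, simp)
      moreover have "f c (T d # ds) = (\<Sum>e\<in>Basis. (c \<bullet> e) *\<^sub>R f e (T d # ds))" by (rule Cons.prems) simp
      ultimately show ?case by (simp only: subst1.simps scaleR_add_right sum.distrib)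
    qed
    from this[of "\<lambda>c cs. m (c # cs)" "E t b"] that expand show ?thesis by simp
  qed
  ultimately have "((\<lambda>t. \<Sum>e\<in>Basis. (E t b \<bullet> e) *\<^sub>R m (e # map (E t) bs)) has_vector_derivative
     (subst1 T (\<lambda>cs. m (E t b # cs)) (map (E t) bs) + m (T (E t b) # map (E t) bs))) (at t within S)"
    using expand[of "map (E t) bs" "T (E t b)"] by (simp add: sum.distrib)
  then show ?case
    using expand[of "map (E s) bs" "E s b" for s] by (simp add: add.commute)
qed

section \<open>The transport equation and its solution\<close>

definition Ev :: "real^'d^'d \<Rightarrow> real \<Rightarrow> real^'d \<Rightarrow> real^'d" where
  "Ev A t b = transpose (mat_exp (t *\<^sub>R A)) *v b"

lemma Ev_deriv: "((\<lambda>t. Ev A t b) has_vector_derivative transpose A *v Ev A t b) (at t within S)"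
  unfolding Ev_def mat_exp_transpose[symmetric] by (rule mat_exp_mv_deriv)

lemma Ev_0 [simp]: "Ev A 0 b = b"
  by (simp add: Ev_def transpose_mat)

text \<open>Method of characteristics: along \<open>cs = map (Ev A t) bs\<close> the equation says
  that \<open>exp (- \<i> \<mu> t) m cs\<close> has derivative
  \<open>- exp (- \<i> \<mu> t) g cs\<close>. The a priori bound \<open>K\<close> shows that this
  quantity tends to zero, and the resulting bound contains neither \<open>K\<close> nor the
  frequency \<mu>. Uniformity in the frequency and the gain of orders both come from here.\<close>

lemma transport_integral:
  fixes m g :: "(real^'d) list \<Rightarrow> complex"
  assumes m: "multilinear n m" and n: "0 < n" and len: "length bs = n" and \<delta>: "0 < \<delta>"
    and decay: "\<And>t b. 0 \<le> t \<Longrightarrow> norm (Ev A t b) \<le> C * exp (- \<delta> * t) * norm b"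
    and eq: "\<And>cs. length cs = n \<Longrightarrow> subst1 ((*v) (transpose A)) m cs - \<i> * of_real \<mu> * m cs + g cs = 0"
    and mb: "\<And>cs. length cs = n \<Longrightarrow> cmod (m cs) \<le> K * nprod cs"
    and gb: "\<And>cs. length cs = n \<Longrightarrow> cmod (g cs) \<le> G * nprod cs"
  shows "((\<lambda>t. exp (- \<i> * of_real (\<mu> * t)) * g (map (Ev A t) bs)) has_integral m bs) {0..}"
    and "cmod (m bs) \<le> G * (C ^ n / \<delta>) * nprod bs"
proof -
  have C0: "0 \<le> C"
  proof -
    have "norm (axis undefined 1 :: real^'d) = 1" by simp
    then show ?thesis using decay[of 0 "axis undefined 1"] by simp
  qed
  have nn: "nprod (map (Ev A t) bs) \<le> (C ^ n * nprod bs) * exp (- \<delta> * t)" if t: "0 \<le> t" for t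
  proof -
    have "nprod (map (Ev A t) bs) \<le> (C * exp (- \<delta> * t)) ^ n * nprod bs"
      using norm_map_bound[of "Ev A t" "C * exp (- \<delta> * t)" bs] decay[OF t] C0 len by simp
    also have "\<dots> = (C ^ n * nprod bs) * exp (- \<delta> * t) ^ n" by (simp add: power_mult_distrib)
    \<comment> \<open>Each functional contributes one decaying factor. One of them is kept, and
      \<open>n > 0\<close> guarantees that there is one.\<close>
    also have "exp (- \<delta> * t) ^ n \<le> exp (- \<delta> * t) ^ 1"
      using n t \<delta> by (intro power_decreasing) auto
    finally show ?thesis using C0 by (simp add: mult_left_mono)
  qed
  have bound: "cmod (h (map (Ev A t) bs)) \<le> (max 0 K' * (C ^ n * nprod bs)) * exp (- \<delta> * t)"
    if "0 \<le> t" "\<And>cs. length cs = n \<Longrightarrow> cmod (h cs) \<le> K' * nprod cs" for h :: "(real^'d) list \<Rightarrow> complex" and K' t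
  proof -
    have "cmod (h (map (Ev A t) bs)) \<le> max 0 K' * nprod (map (Ev A t) bs)"
      by (rule order.trans[OF that(2)]) (use len in \<open>auto intro: mult_right_mono\<close>)
    also have "\<dots> \<le> max 0 K' * ((C ^ n * nprod bs) * exp (- \<delta> * t))"
      by (intro mult_left_mono nn that) simp
    finally show ?thesis by (simp add: mult_ac)
  qed
  let ?e = "\<lambda>t. exp (- \<i> * of_real (\<mu> * t))"
  let ?f = "\<lambda>t. ?e t * m (map (Ev A t) bs)" and ?g = "\<lambda>t. ?e t * g (map (Ev A t) bs)"
  have ne: "cmod (?e t) = 1" for t by (simp add: norm_exp_eq_Re)
  have de: "(?e has_vector_derivative (- \<i> * of_real \<mu> * ?e t)) (at t within S)" for t S
  proof -
    have "((\<lambda>t. exp (t *\<^sub>R (- \<i> * of_real \<mu>))) has_vector_derivative exp (t *\<^sub>R (- \<i> * of_real \<mu>)) * (- \<i> * of_real \<mu>)) (at t within S)"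
      by (rule exp_scaleR_has_vector_derivative_right)
    then show ?thesis by (simp add: scaleR_conv_of_real mult_ac)
  qed
  have "((\<lambda>t. - ?g t) has_integral - ?f 0) {0..}"
  proof (rule has_integral_half_line)
    fix t :: real assume t: "0 \<le> t"
    have "(?f has_vector_derivative (?e t * subst1 ((*v) (transpose A)) m (map (Ev A t) bs)
       + (- \<i> * of_real \<mu> * ?e t) * m (map (Ev A t) bs))) (at t within {0..})"
      by (intro has_vector_derivative_mult de multilinear_deriv Ev_deriv) (use m len in simp)
    moreover have "subst1 ((*v) (transpose A)) m (map (Ev A t) bs) = \<i> * of_real \<mu> * m (map (Ev A t) bs) - g (map (Ev A t) bs)"
      using eq[of "map (Ev A t) bs"] len by (simp add: algebra_simps eq_neg_iff_add_eq_0)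
    ultimately show "(?f has_vector_derivative - ?g t) (at t within {0..})"
      by (simp add: algebra_simps)
    show "norm (- ?g t) \<le> (max 0 G * (C ^ n * nprod bs)) * exp (- \<delta> * t)"
      using bound[OF t gb] ne[of t] by (simp add: norm_mult)
  next
    have lim0: "(\<lambda>k. exp (- \<delta> * real k)) \<longlonglongrightarrow> 0"
      using LIMSEQ_power_zero[of "exp (- \<delta>)"] \<delta> by (simp add: exp_of_nat_mult[symmetric] mult.commute)
    have "(\<lambda>k. (max 0 K * (C ^ n * nprod bs)) * exp (- \<delta> * real k)) \<longlonglongrightarrow> (max 0 K * (C ^ n * nprod bs)) * 0"
      by (intro tendsto_mult_left lim0)
    moreover have "cmod (?f (real k)) \<le> (max 0 K * (C ^ n * nprod bs)) * exp (- \<delta> * real k)" for k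
      using bound[OF _ mb, of "real k"] ne[of "real k"] by (simp add: norm_mult)
    ultimately show "(\<lambda>k. ?f (real k)) \<longlonglongrightarrow> 0"
      unfolding mult_zero_right by (rule Lim_null_comparison[OF always_eventually[OF allI], rotated])
  qed (rule \<delta>)
  from has_integral_neg[OF this] show int: "(?g has_integral m bs) {0..}"
    by (simp add: map_idI)
  have G0: "0 \<le> G * nprod bs" by (rule order.trans[OF norm_ge_zero gb[OF len]])
  have h: "((\<lambda>t. (G * (C ^ n * nprod bs)) * exp (- \<delta> * t)) has_integral (G * (C ^ n * nprod bs)) * (exp (- \<delta> * 0) / \<delta>)) {0..}"
    by (intro has_integral_mult_right has_integral_exp_minus_to_infinity \<delta>)
  have "norm (integral {0..} ?g) \<le> integral {0..} (\<lambda>t. (G * (C ^ n * nprod bs)) * exp (- \<delta> * t))"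
  proof (rule integral_norm_bound_integral)
    show "?g integrable_on {0..}" using int by blast
    show "(\<lambda>t. (G * (C ^ n * nprod bs)) * exp (- \<delta> * t)) integrable_on {0..}" using h by blast
    fix t :: real assume "t \<in> {0..}"
    then have t: "0 \<le> t" by simp
    show "norm (?g t) \<le> (G * (C ^ n * nprod bs)) * exp (- \<delta> * t)"
    proof (cases "0 \<le> G")
      case True
      then show ?thesis using bound[OF t gb] ne[of t] by (simp add: norm_mult)
    next
      case False
      then have "nprod bs = 0" using G0 nprod_nonneg[of bs] by (simp add: zero_le_mult_iff)
      then show ?thesis using bound[OF t gb] ne[of t] by (simp add: norm_mult)
    qed
  qed
  then show "cmod (m bs) \<le> G * (C ^ n / \<delta>) * nprod bs"
    unfolding integral_unique[OF int] integral_unique[OF h] by (simp add: mult_ac)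
qed

section \<open>Moment equations\<close>

text \<open>The Ito correction in the drift of \<open>w^(k+1)\<close>, divided by
  \<open>bt^2 \<epsilon>^2 (norm \<gamma>)^2\<close>; the index is shifted by one. The recursion is
  the product rule for \<open>w^(k+1)\<close> times \<open>w\<close>, and its last summand is the
  product of the diffusion coefficients.\<close>

fun rpoly :: "nat \<Rightarrow> complex \<Rightarrow> complex" where
  "rpoly 0 x = - ((1 - x) ^ 3)"
| "rpoly (Suc k) x = x ^ Suc k * rpoly 0 x + x * rpoly k x + of_nat (Suc k) * (x ^ k * (1 - x) ^ 4)"

lemma norm_one_minus_power: "cmod x = 1 \<Longrightarrow> cmod ((1 - x) ^ n) \<le> 2 ^ n"
  using norm_triangle_ineq4[of 1 x] by (simp add: norm_power power_mono)

lemma norm_rpoly: "cmod x = 1 \<Longrightarrow> cmod (rpoly k x) \<le> 8 + real k * 8 + 8 * real k * (real k + 1)"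
proof (induction k)
  case 0
  then show ?case using norm_one_minus_power[of x 3] by simp
next
  case (Suc k)
  have 1: "cmod (x ^ Suc k * rpoly 0 x) \<le> 8"
    using norm_one_minus_power[OF Suc.prems, of 3] Suc.prems by (simp add: norm_mult norm_power)
  have 2: "cmod (x * rpoly k x) \<le> 8 + real k * 8 + 8 * real k * (real k + 1)"
    using Suc by (simp add: norm_mult)
  have "cmod (of_nat (Suc k) * (x ^ k * (1 - x) ^ 4)) = real (Suc k) * cmod ((1 - x) ^ 4)"
    unfolding norm_mult norm_of_nat norm_power Suc.prems by simp
  also have "\<dots> \<le> real (Suc k) * 16"
    using norm_one_minus_power[OF Suc.prems, of 4] by (intro mult_left_mono) auto
  finally have 3: "cmod (of_nat (Suc k) * (x ^ k * (1 - x) ^ 4)) \<le> real (Suc k) * 16" .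
  have "cmod (rpoly (Suc k) x) \<le> 8 + (8 + real k * 8 + 8 * real k * (real k + 1)) + real (Suc k) * 16"
    unfolding rpoly.simps(2) by (intro norm_triangle_le add_mono 1 2 3)
  also have "\<dots> = 8 + real (Suc k) * 8 + 8 * real (Suc k) * (real (Suc k) + 1)" by (simp add: algebra_simps)
  finally show ?case .
qed

lemma (in brownian) ito_cong:
  assumes "ito Y a \<sigma>" "\<And>t z. Y t z = Y' t z" "\<And>t z. a t z = a' t z" "\<And>l t z. \<sigma> l t z = \<sigma>' l t z"
  shows "ito Y' a' \<sigma>'"
proof -
  have "Y = Y'" "a = a'" "\<sigma> = \<sigma>'" using assms(2-4) by blast+
  then show ?thesis using assms(1) by (simp only:)
qed

context stable_oscillator
begin

definition plin :: "(real^'d) list \<Rightarrow> real \<Rightarrow> 'w \<Rightarrow> complex" where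
  "plin bs t z = (\<Prod>b\<leftarrow>bs. lin b t z)"

text \<open>The weight \<open>q\<close> is a parameter, so that a functional can be moved from the
  list into the weight; inductions on the list proceed in this way.\<close>

definition moment :: "(real \<Rightarrow> 'w \<Rightarrow> complex) \<Rightarrow> (real^'d) list \<Rightarrow> complex" where
  "moment q bs = mean (\<lambda>t z. q t z * plin bs t z)"

lemma adm_plin: "adm (plin bs)"
proof (induction bs)
  case Nil
  show ?case unfolding plin_def[abs_def] list.map prod_list.Nil by (rule adm_const)
next
  case (Cons b bs)
  then show ?case unfolding plin_def[abs_def] list.map prod_list.Cons by (intro adm_mult adm_lin)
qed

lemma moment_Nil: "moment q [] = mean q"
  by (simp add: moment_def plin_def)

lemma moment_Cons: "moment q (b # bs) = moment (\<lambda>t z. q t z * lin b t z) bs"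
  by (simp add: moment_def plin_def mult.assoc)

lemma moment_add:
  "adm p \<Longrightarrow> adm q \<Longrightarrow> moment (\<lambda>t z. p t z + q t z) bs = moment p bs + moment q bs"
  unfolding moment_def distrib_right by (intro mean_add adm_mult adm_plin)

lemma moment_diff:
  "adm p \<Longrightarrow> adm q \<Longrightarrow> moment (\<lambda>t z. p t z - q t z) bs = moment p bs - moment q bs"
  unfolding moment_def left_diff_distrib by (intro mean_diff adm_mult adm_plin)

lemma moment_cmult: "adm q \<Longrightarrow> moment (\<lambda>t z. c * q t z) bs = c * moment q bs"
  unfolding moment_def mult.assoc by (intro mean_cmult adm_mult adm_plin)

lemma moment_sum:
  "finite K \<Longrightarrow> (\<And>k. k \<in> K \<Longrightarrow> adm (q k)) \<Longrightarrow> moment (\<lambda>t z. \<Sum>k\<in>K. q k t z) bs = (\<Sum>k\<in>K. moment (q k) bs)"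
  unfolding moment_def sum_distrib_right by (intro mean_sum adm_mult adm_plin) auto

lemma moment_linear: assumes "adm q" shows "linear (\<lambda>b. moment q (b # bs))"
proof (rule linearI)
  show "moment q ((x + y) # bs) = moment q (x # bs) + moment q (y # bs)" for x y
    unfolding moment_Cons lin_def inner_add_left of_real_add distrib_left
    by (intro moment_add adm_mult assms adm_lin[unfolded lin_def[abs_def]])
  have *: "q t z * complex_of_real (c * (x \<bullet> v t z)) = of_real c * (q t z * complex_of_real (x \<bullet> v t z))" for c x t z
    by simp
  show "moment q ((c *\<^sub>R x) # bs) = c *\<^sub>R moment q (x # bs)" for c x
    unfolding moment_Cons lin_def inner_scaleR_left *
    by (subst scaleR_conv_of_real) (intro moment_cmult adm_mult assms adm_lin[unfolded lin_def[abs_def]])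
qed

lemma moment_multilinear: "adm q \<Longrightarrow> multilinear n (moment q)"
proof (induction n arbitrary: q)
  case (Suc n)
  show ?case unfolding multilinear.simps
  proof (intro conjI allI impI moment_linear Suc.prems)
    show "multilinear n (\<lambda>bs. moment q (b # bs))" for b
      unfolding moment_Cons by (intro Suc.IH adm_mult Suc.prems adm_lin)
  qed
qed simp

abbreviation "TA \<equiv> (*v) (transpose A)"
abbreviation "TB \<equiv> (*v) (transpose B)"

text \<open>The time average of the drift of \<open>q\<close> times a product of linear functionals of \<open>v\<close> vanishes.\<close>

lemma moment_equation:
  assumes "ito q D \<sigma>" "adm q"
  shows "subst1 TA (moment q) bs + contract2 (\<lambda>b c. TB b \<bullet> TB c) (moment q) bs + moment D bs
    + (\<Sum>l\<in>UNIV. contract (\<lambda>c. TB c $ l) (moment (\<sigma> l)) bs) = 0"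
  using assms
proof (induction bs arbitrary: q D \<sigma>)
  case Nil
  then show ?case using mean_drift_adm[of q D \<sigma>] by (simp add: moment_Nil)
next
  case (Cons b bs)
  note q = Cons.prems(2) and admD = ito_adm[OF Cons.prems(1)]
  let ?B = "\<lambda>l. complex_of_real (TB b $ l)"
  \<comment> \<open>The product rule absorbs the head functional into the process; the induction
    hypothesis then applies to the new process, with drift \<open>?D\<close> and diffusion
    \<open>?\<sigma>\<close>.\<close>
  let ?q = "\<lambda>t z. q t z * lin b t z"
  let ?D = "\<lambda>t z. q t z * lin (TA b) t z + lin b t z * D t z + (\<Sum>l\<in>UNIV. \<sigma> l t z * ?B l)"
  let ?\<sigma> = "\<lambda>l t z. q t z * ?B l + lin b t z * \<sigma> l t z"
  have IH: "subst1 TA (moment ?q) bs + contract2 (\<lambda>b c. TB b \<bullet> TB c) (moment ?q) bs + moment ?D bs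
    + (\<Sum>l\<in>UNIV. contract (\<lambda>c. TB c $ l) (moment (?\<sigma> l)) bs) = 0"
    by (rule Cons.IH[OF ito_mult[OF Cons.prems(1) ito_lin q adm_lin]]) (intro adm_mult q adm_lin)
  have mq: "moment ?q = (\<lambda>cs. moment q (b # cs))" by (rule ext) (simp only: moment_Cons)
  have "moment ?D bs = moment (\<lambda>t z. q t z * lin (TA b) t z) bs + moment (\<lambda>t z. lin b t z * D t z) bs
     + moment (\<lambda>t z. \<Sum>l\<in>UNIV. \<sigma> l t z * ?B l) bs"
    by (simp only: moment_add adm_add adm_mult adm_sum adm_const q admD adm_lin)
  also have "moment (\<lambda>t z. \<Sum>l\<in>UNIV. \<sigma> l t z * ?B l) bs = (\<Sum>l\<in>UNIV. ?B l * moment (\<sigma> l) bs)"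
    unfolding mult.commute[of _ "?B _"]
    by (subst moment_sum) (auto intro!: adm_mult adm_const admD simp: moment_cmult admD)
  also have "moment (\<lambda>t z. lin b t z * D t z) bs = moment D (b # bs)"
    unfolding moment_Cons by (simp only: mult.commute)
  finally have mD: "moment ?D bs = moment q (TA b # bs) + moment D (b # bs) + (\<Sum>l\<in>UNIV. ?B l * moment (\<sigma> l) bs)"
    by (simp only: moment_Cons)
  have "moment (?\<sigma> l) cs = ?B l * moment q cs + moment (\<sigma> l) (b # cs)" for l cs
  proof -
    have "moment (?\<sigma> l) cs = moment (\<lambda>t z. ?B l * q t z) cs + moment (\<lambda>t z. \<sigma> l t z * lin b t z) cs"
      unfolding mult.commute[of "?B l"] mult.commute[of "\<sigma> l _ _"]
      by (intro moment_add adm_mult adm_const q admD adm_lin)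
    then show ?thesis by (simp only: moment_cmult[OF q] moment_Cons)
  qed
  then have m\<sigma>: "moment (?\<sigma> l) = (\<lambda>cs. ?B l * moment q cs + moment (\<sigma> l) (b # cs))" for l by blast
  have cs: "(\<Sum>l\<in>UNIV. ?B l * contract (\<lambda>c. TB c $ l) (moment q) bs) = contract (\<lambda>c. TB b \<bullet> TB c) (moment q) bs"
    by (subst contract_sum_left) (simp_all add: inner_vec_def)
  show ?case
    using IH unfolding mq mD m\<sigma> contract_add contract_cmult sum.distrib cs
      subst1.simps contract2.simps contract.simps
    by (simp only: add_ac)
qed

lemma norm_\<gamma>_sum: "(\<Sum>l\<in>UNIV. of_real (\<epsilon> * \<gamma> $ l) * complex_of_real (\<epsilon> * \<gamma> $ l)) = of_real (\<epsilon>\<^sup>2 * (norm \<gamma>)\<^sup>2)"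
proof -
  have "(\<Sum>l\<in>UNIV. (\<epsilon> * \<gamma> $ l) * (\<epsilon> * \<gamma> $ l)) = \<epsilon>\<^sup>2 * (norm \<gamma>)\<^sup>2"
    unfolding power2_norm_eq_inner inner_vec_def sum_distrib_left
    by (intro sum.cong) (auto simp: power2_eq_square)
  then show ?thesis by (simp only: of_real_sum[symmetric] of_real_mult[symmetric])
qed

lemma adm_rpoly: "adm (\<lambda>t z. rpoly k (w t z))"
proof (induction k)
  case 0
  show ?case unfolding rpoly.simps by (intro adm_intros adm_w)
next
  case (Suc k)
  then show ?case unfolding rpoly.simps by (intro adm_intros adm_w)
qed

text \<open>Induction by the product rule with one more factor \<open>w\<close>: the rotation
  frequencies \<open>2 \<kappa>\<close> add up, and the first-order coefficients stay proportional
  to \<open>w^k (1 - w)^2\<close>.\<close>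

lemma ito_w_power:
  "ito (\<lambda>t z. w t z ^ Suc k)
    (\<lambda>t z. (- \<i> * of_real (2 * real (Suc k) * \<kappa>)) * w t z ^ Suc k
        + (of_nat (Suc k) * bt * of_real \<epsilon>) * (w t z ^ k * (1 - w t z)\<^sup>2 * lin a t z)
        + (bt\<^sup>2 * of_real (\<epsilon>\<^sup>2 * (norm \<gamma>)\<^sup>2)) * rpoly k (w t z))
    (\<lambda>l t z. (of_nat (Suc k) * bt * of_real (\<epsilon> * \<gamma> $ l)) * (w t z ^ k * (1 - w t z)\<^sup>2))"
proof (induction k)
  case 0
  show ?case by (rule ito_cong[OF ito_w]) (simp_all add: algebra_simps)
next
  case (Suc k)
  have alg: "x ^ Suc k * (- 2 * \<i> * \<kappa> * x + bt * \<epsilon> * V * (1 - x)\<^sup>2 - bt\<^sup>2 * g * (1 - x) ^ 3)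
      + x * ((- \<i> * of_real (2 * real (Suc k) * \<kappa>)) * x ^ Suc k
        + (of_nat (Suc k) * bt * of_real \<epsilon>) * (x ^ k * (1 - x)\<^sup>2 * V) + (bt\<^sup>2 * g) * P)
      + of_nat (Suc k) * bt\<^sup>2 * (x ^ k * (1 - x) ^ 4) * g
    = (- \<i> * of_real (2 * real (Suc (Suc k)) * \<kappa>)) * x ^ Suc (Suc k)
        + (of_nat (Suc (Suc k)) * bt * of_real \<epsilon>) * (x ^ Suc k * (1 - x)\<^sup>2 * V)
        + (bt\<^sup>2 * g) * (x ^ Suc k * (- ((1 - x) ^ 3)) + x * P + of_nat (Suc k) * (x ^ k * (1 - x) ^ 4))" for x V g P :: complex
  proof -
    define y where "y = (1 - x)"
    have "complex_of_real (2 * real (Suc k) * \<kappa>) = 2 * of_nat (Suc k) * of_real \<kappa>"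
      "complex_of_real (2 * real (Suc (Suc k)) * \<kappa>) = 2 * (of_nat (Suc k) + 1) * of_real \<kappa>"
      "complex_of_nat (Suc (Suc k)) = of_nat (Suc k) + 1" by (simp_all add: add_ac)
    then show ?thesis unfolding y_def[symmetric] power_Suc by (simp only:) (simp only: ring_distribs mult_minus_left mult_minus_right mult_ac add_ac mult_1_left mult_1_right diff_conv_add_uminus minus_add_distrib)
  qed
  show ?case
  proof (rule ito_cong[OF ito_mult[OF Suc ito_w adm_power[OF adm_w] adm_w]])
    fix t z
    let ?x = "w t z"
    show "?x ^ Suc k * ?x = ?x ^ Suc (Suc k)" by (simp only: power_Suc mult_ac)
    have "(\<Sum>l\<in>UNIV. (of_nat (Suc k) * bt * of_real (\<epsilon> * \<gamma> $ l)) * (?x ^ k * (1 - ?x)\<^sup>2) * (bt * of_real (\<epsilon> * \<gamma> $ l) * (1 - ?x)\<^sup>2))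
      = (\<Sum>l\<in>UNIV. (of_nat (Suc k) * bt\<^sup>2 * (?x ^ k * (1 - ?x) ^ 4)) * (of_real (\<epsilon> * \<gamma> $ l) * of_real (\<epsilon> * \<gamma> $ l)))"
    proof (rule sum.cong[OF refl])
      fix l
      have e4: "(1 - ?x) ^ 4 = (1 - ?x)\<^sup>2 * (1 - ?x)\<^sup>2" by (simp flip: power_add)
      show "(of_nat (Suc k) * bt * of_real (\<epsilon> * \<gamma> $ l)) * (?x ^ k * (1 - ?x)\<^sup>2) * (bt * of_real (\<epsilon> * \<gamma> $ l) * (1 - ?x)\<^sup>2)
        = (of_nat (Suc k) * bt\<^sup>2 * (?x ^ k * (1 - ?x) ^ 4)) * (of_real (\<epsilon> * \<gamma> $ l) * of_real (\<epsilon> * \<gamma> $ l))"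
        unfolding e4 power2_eq_square[of bt] by (simp only: mult_ac)
    qed
    then have S: "(\<Sum>l\<in>UNIV. (of_nat (Suc k) * bt * of_real (\<epsilon> * \<gamma> $ l)) * (?x ^ k * (1 - ?x)\<^sup>2) * (bt * of_real (\<epsilon> * \<gamma> $ l) * (1 - ?x)\<^sup>2))
      = of_nat (Suc k) * bt\<^sup>2 * (?x ^ k * (1 - ?x) ^ 4) * of_real (\<epsilon>\<^sup>2 * (norm \<gamma>)\<^sup>2)"
      by (simp only: sum_distrib_left[symmetric] norm_\<gamma>_sum)
    show "?x ^ Suc k * (- 2 * \<i> * \<kappa> * ?x + bt * \<epsilon> * lin a t z * (1 - ?x)\<^sup>2 - bt\<^sup>2 * (of_real (\<epsilon>\<^sup>2 * (norm \<gamma>)\<^sup>2)) * (1 - ?x) ^ 3)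
      + ?x * ((- \<i> * of_real (2 * real (Suc k) * \<kappa>)) * ?x ^ Suc k
        + (of_nat (Suc k) * bt * of_real \<epsilon>) * (?x ^ k * (1 - ?x)\<^sup>2 * lin a t z)
        + (bt\<^sup>2 * of_real (\<epsilon>\<^sup>2 * (norm \<gamma>)\<^sup>2)) * rpoly k ?x)
      + (\<Sum>l\<in>UNIV. (of_nat (Suc k) * bt * of_real (\<epsilon> * \<gamma> $ l)) * (?x ^ k * (1 - ?x)\<^sup>2) * (bt * of_real (\<epsilon> * \<gamma> $ l) * (1 - ?x)\<^sup>2))
      = (- \<i> * of_real (2 * real (Suc (Suc k)) * \<kappa>)) * ?x ^ Suc (Suc k)
        + (of_nat (Suc (Suc k)) * bt * of_real \<epsilon>) * (?x ^ Suc k * (1 - ?x)\<^sup>2 * lin a t z)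
        + (bt\<^sup>2 * of_real (\<epsilon>\<^sup>2 * (norm \<gamma>)\<^sup>2)) * rpoly (Suc k) ?x"
      unfolding S rpoly.simps by (rule alg)
    fix l
    have "of_nat (Suc (Suc k)) = of_nat (Suc k) + (1 :: complex)" by simp
    then show "?x ^ Suc k * (bt * of_real (\<epsilon> * \<gamma> $ l) * (1 - ?x)\<^sup>2)
       + ?x * ((of_nat (Suc k) * bt * of_real (\<epsilon> * \<gamma> $ l)) * (?x ^ k * (1 - ?x)\<^sup>2))
      = (of_nat (Suc (Suc k)) * bt * of_real (\<epsilon> * \<gamma> $ l)) * (?x ^ Suc k * (1 - ?x)\<^sup>2)"
      by (simp only: power_Suc distrib_left distrib_right mult_ac add_ac mult_1_left mult_1_right)
  qed
qed

abbreviation "mom k \<equiv> moment (\<lambda>t z. w t z ^ k)"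
abbreviation "smom k \<equiv> moment (\<lambda>t z. w t z ^ k * (1 - w t z)\<^sup>2)"

lemma smom: "smom k bs = mom k bs - 2 * mom (Suc k) bs + mom (Suc (Suc k)) bs"
proof -
  have "(\<lambda>t z. w t z ^ k * (1 - w t z)\<^sup>2) = (\<lambda>t z. w t z ^ k - 2 * w t z ^ Suc k + w t z ^ Suc (Suc k))"
    by (intro ext) (simp add: power2_eq_square algebra_simps)
  then show ?thesis
    by (simp only: moment_add moment_diff moment_cmult adm_diff adm_mult adm_const adm_power adm_w)
qed

text \<open>All terms that carry a factor \<epsilon>. Those of first order couple to moments with
  one functional more, through \<open>a\<close>, or one less, through \<gamma>.\<close>

definition noise_part :: "nat \<Rightarrow> (real^'d) list \<Rightarrow> complex" where
  "noise_part k bs = of_nat (Suc k) * bt * of_real \<epsilon> * (smom k (a # bs) + contract (\<lambda>c. \<gamma> \<bullet> TB c) (smom k) bs)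
    + bt\<^sup>2 * of_real (\<epsilon>\<^sup>2 * (norm \<gamma>)\<^sup>2) * moment (\<lambda>t z. rpoly k (w t z)) bs"

lemma mom_equation:
  "subst1 TA (mom (Suc k)) bs - \<i> * of_real (2 * real (Suc k) * \<kappa>) * mom (Suc k) bs
    + (contract2 (\<lambda>b c. TB b \<bullet> TB c) (mom (Suc k)) bs + noise_part k bs) = 0"
proof -
  let ?u = "of_nat (Suc k) * bt * of_real \<epsilon>" and ?s = "\<lambda>t z. w t z ^ k * (1 - w t z)\<^sup>2"
  have admx: "adm (\<lambda>t z. w t z ^ Suc k)" and adms: "adm ?s" by (intro adm_intros adm_w)+
  note adm_all = admx adms adm_rpoly
  let ?D1 = "\<lambda>t z. (- \<i> * of_real (2 * real (Suc k) * \<kappa>)) * w t z ^ Suc k"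
    and ?D2 = "\<lambda>t z. ?u * (?s t z * lin a t z)"
    and ?D3 = "\<lambda>t z. (bt\<^sup>2 * of_real (\<epsilon>\<^sup>2 * (norm \<gamma>)\<^sup>2)) * rpoly k (w t z)"
  have "moment (\<lambda>t z. ?D1 t z + ?D2 t z + ?D3 t z) bs = moment ?D1 bs + moment ?D2 bs + moment ?D3 bs"
    by (subst moment_add, intro adm_add adm_mult adm_const adm_all adm_lin, intro adm_mult adm_const adm_all,
        subst moment_add) (intro adm_mult adm_const adm_all adm_lin refl)+
  also have "\<dots> = (- \<i> * of_real (2 * real (Suc k) * \<kappa>)) * mom (Suc k) bs + ?u * smom k (a # bs)
     + (bt\<^sup>2 * of_real (\<epsilon>\<^sup>2 * (norm \<gamma>)\<^sup>2)) * moment (\<lambda>t z. rpoly k (w t z)) bs"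
    unfolding moment_Cons by (simp only: moment_cmult adm_mult adm_all adm_lin)
  finally have D: "moment (\<lambda>t z. ?D1 t z + ?D2 t z + ?D3 t z) bs = \<dots>" .
  have s: "moment (\<lambda>t z. (of_nat (Suc k) * bt * of_real (\<epsilon> * \<gamma> $ l)) * ?s t z) cs = (?u * of_real (\<gamma> $ l)) * smom k cs" for l cs
  proof -
    have "of_nat (Suc k) * bt * of_real (\<epsilon> * \<gamma> $ l) = ?u * of_real (\<gamma> $ l)" by (simp only: of_real_mult mult.assoc)
    then show ?thesis by (simp only: moment_cmult[OF adms])
  qed
  have "(\<Sum>l\<in>UNIV. contract (\<lambda>c. TB c $ l) (\<lambda>cs. (?u * of_real (\<gamma> $ l)) * smom k cs) bs)
    = ?u * (\<Sum>l\<in>UNIV. of_real (\<gamma> $ l) * contract (\<lambda>c. TB c $ l) (smom k) bs)"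
    by (simp only: contract_cmult sum_distrib_left mult.assoc)
  also have "(\<Sum>l\<in>UNIV. of_real (\<gamma> $ l) * contract (\<lambda>c. TB c $ l) (smom k) bs) = contract (\<lambda>c. \<gamma> \<bullet> TB c) (smom k) bs"
    by (subst contract_sum_left) (simp_all add: inner_vec_def)
  finally have S: "(\<Sum>l\<in>UNIV. contract (\<lambda>c. TB c $ l) (\<lambda>cs. (?u * of_real (\<gamma> $ l)) * smom k cs) bs)
    = ?u * contract (\<lambda>c. \<gamma> \<bullet> TB c) (smom k) bs" .
  have ext: "moment (\<lambda>t z. (of_nat (Suc k) * bt * of_real (\<epsilon> * \<gamma> $ l)) * ?s t z) = (\<lambda>cs. (?u * of_real (\<gamma> $ l)) * smom k cs)" for l
    by (rule ext) (rule s)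
  show ?thesis
    using moment_equation[OF ito_w_power admx, of bs] unfolding D ext S noise_part_def
    by (simp only: distrib_left mult_minus_left diff_conv_add_uminus add_ac)
qed

text \<open>Without \<open>w\<close> the hierarchy is that of the linear process \<open>v\<close>.
  It closes: apart from its own moments, each equation refers to moments with two functionals
  less.\<close>

lemma mom_0_equation:
  "subst1 TA (mom 0) bs + contract2 (\<lambda>b c. TB b \<bullet> TB c) (mom 0) bs = 0"
proof -
  have z: "moment (\<lambda>t z. 0) = (\<lambda>bs. 0)" by (rule ext) (simp add: moment_def mean_const)
  have "contract r (\<lambda>cs. 0) cs = 0" for r and cs :: "(real^'d) list" by (induction cs) auto
  then show ?thesis using moment_equation[OF ito_const[of 1] adm_const, of bs] z by simp
qed

lemma mom_0_Nil: "mom 0 [] = 1"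
  by (simp add: moment_Nil mean_const)

end

section \<open>Moment estimates\<close>

lemma integrable_half_line:
  fixes g :: "real \<Rightarrow> 'a::euclidean_space"
  assumes cont: "continuous_on {0..} g" and bound: "\<And>t. 0 \<le> t \<Longrightarrow> norm (g t) \<le> K * exp (- \<delta> * t)" and \<delta>: "0 < \<delta>"
  shows "g integrable_on {0..}"
proof (rule integrable_on_all_intervals_integrable_bound)
  show "(\<lambda>t. K * exp (- \<delta> * t)) integrable_on {0..}"
    by (intro integrable_on_mult_right integrable_on_exp_minus_to_infinity \<delta>)
  fix p q :: real
  have "g integrable_on {max 0 p..q}"
    by (rule integrable_continuous_interval[OF continuous_on_subset[OF cont]]) auto
  moreover have "{0..} \<inter> cbox p q = {max 0 p..q}" by auto
  ultimately show "(\<lambda>t. if t \<in> {0..} then g t else 0) integrable_on cbox p q"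
    by (simp only: integrable_restrict_Int)
qed (use bound in auto)

lemma mat_exp_bound:
  fixes A :: "real^'d^'d"
  assumes "stable_matrix A"
  obtains C \<delta> where "0 < C" "0 < \<delta>" "\<And>t. 0 \<le> t \<Longrightarrow> norm (mat_exp (t *\<^sub>R A)) \<le> C * exp (- \<delta> * t)"
proof -
  obtain C \<delta> where C: "C > 0" "\<delta> > 0" "\<And>t i j. t \<ge> 0 \<Longrightarrow> \<bar>mat_exp (t *\<^sub>R A) $ i $ j\<bar> \<le> C * exp (- \<delta> * t)"
    using stable_mat_exp_decay[OF assms] by blast
  have "norm (mat_exp (t *\<^sub>R A)) \<le> (real CARD('d) * (real CARD('d) * C)) * exp (- \<delta> * t)" if t: "0 \<le> t" for t
  proof -
    have "norm (mat_exp (t *\<^sub>R A)) \<le> (\<Sum>i\<in>UNIV. norm (mat_exp (t *\<^sub>R A) $ i))"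
      unfolding norm_vec_def by (rule L2_set_le_sum) simp
    also have "\<dots> \<le> (\<Sum>i\<in>(UNIV :: 'd set). \<Sum>j\<in>(UNIV :: 'd set). C * exp (- \<delta> * t))"
      by (rule sum_mono, rule order.trans[OF norm_le_l1_cart sum_mono]) (rule C(3)[OF t])
    finally show ?thesis by simp
  qed
  then show ?thesis using C by (intro that[of "real CARD('d) * (real CARD('d) * C)" \<delta>]) auto
qed

lemma bounded_bilinear_matrix_matrix_mult:
  "bounded_bilinear ((**) :: real^'n^'m \<Rightarrow> real^'k^'n \<Rightarrow> real^'k^'m)"
proof -
  have add_mult: "(X + Y) ** Z = X ** Z + Y ** Z" for X Y :: "real^'n^'m" and Z :: "real^'k^'n"
    by (simp add: matrix_matrix_mult_def vec_eq_iff sum.distrib distrib_right)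
  show ?thesis
    unfolding bilinear_conv_bounded_bilinear[symmetric] bilinear_def
  by (intro conjI allI linearI)
     (simp_all add: matrix_add_ldistrib add_mult scalar_matrix_assoc matrix_scalar_ac)
qed

text \<open>The definition integrates matrices. Exponential decay makes the integrand integrable,
  and a bounded linear functional may then be pulled under the integral.\<close>

lemma cos_transform_mv:
  fixes A :: "real^'d^'d"
  assumes "stable_matrix A"
  shows "((\<lambda>t. cos (\<omega> * t) * (a \<bullet> (mat_exp (t *\<^sub>R A) *v u))) has_integral pi * (a \<bullet> (cos_transform A \<omega> *v u))) {0..}"
proof -
  obtain C \<delta> where C: "0 < C" "0 < \<delta>" "\<And>t. 0 \<le> t \<Longrightarrow> norm (mat_exp (t *\<^sub>R A)) \<le> C * exp (- \<delta> * t)"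
    using mat_exp_bound[OF assms] by blast
  let ?g = "\<lambda>t. cos (\<omega> * t) *\<^sub>R mat_exp (t *\<^sub>R A)"
  have "?g integrable_on {0..}"
  proof (rule integrable_half_line[OF _ _ C(2)])
    show "continuous_on {0..} ?g" by (intro continuous_intros continuous_on_mat_exp)
    fix t :: real assume t: "0 \<le> t"
    have "norm (?g t) \<le> 1 * norm (mat_exp (t *\<^sub>R A))"
      unfolding norm_scaleR by (intro mult_right_mono) auto
    then show "norm (?g t) \<le> C * exp (- \<delta> * t)" using C(3)[OF t] by simp
  qed
  then have "(?g has_integral pi *\<^sub>R cos_transform A \<omega>) {0..}"
    by (simp add: cos_transform_def has_integral_integral)
  from has_integral_linear[OF this bounded_linear_compose[OF bounded_linear_inner_right
      bounded_bilinear.bounded_linear_left[OF bounded_bilinear_matrix_vector_mult]], of a u]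
  show ?thesis by (simp add: o_def scaleR_matrix_vector_assoc[symmetric])
qed

text \<open>The covariance in the weak form in which it will come out of the transport equation for
  two functionals.\<close>

lemma stationary_cov_integral:
  fixes A :: "real^'d^'d" and B :: "real^'m^'d"
  assumes "stable_matrix A"
  shows "((\<lambda>t. (transpose B *v Ev A t b) \<bullet> (transpose B *v Ev A t c)) has_integral b \<bullet> (stationary_cov A B *v c)) {0..}"
proof -
  obtain C \<delta> where C: "0 < C" "0 < \<delta>"
    "\<And>t x. t \<ge> 0 \<Longrightarrow> norm (mat_exp (t *\<^sub>R A) *v x) \<le> C * exp (- \<delta> * t) * norm x"
    "\<And>t x. t \<ge> 0 \<Longrightarrow> norm (transpose (mat_exp (t *\<^sub>R A)) *v x) \<le> C * exp (- \<delta> * t) * norm x"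
    using stable_decay_mv[OF assms] by metis
  let ?E = "\<lambda>t. mat_exp (t *\<^sub>R A)"
  let ?g = "\<lambda>t. ?E t ** B ** transpose B ** mat_exp (t *\<^sub>R transpose A)"
  have g: "x \<bullet> (?g t *v z) = (transpose B *v Ev A t x) \<bullet> (transpose B *v Ev A t z)" for t x z
  proof -
    have "x \<bullet> (?g t *v z) = x \<bullet> (?E t *v (B *v (transpose B *v (transpose (?E t) *v z))))"
      by (simp only: mat_exp_transpose matrix_vector_mul_assoc matrix_mul_assoc)
    also have "\<dots> = (transpose B *v (transpose (?E t) *v x)) \<bullet> (transpose B *v (transpose (?E t) *v z))"
      by (simp only: dot_lmul_matrix[symmetric] transpose_matrix_vector)
    finally show ?thesis by (simp only: Ev_def)
  qed
  obtain KB where KB: "KB \<ge> 0" "\<And>x. norm (transpose B *v x) \<le> norm x * KB"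
    using bounded_linear.nonneg_bounded[OF matrix_vector_mul_bounded_linear[of "transpose B"]] by blast
  have "?g integrable_on {0..}"
  proof (rule integrable_half_line)
    show "continuous_on {0..} ?g"
      by (intro bounded_bilinear.continuous_on[OF bounded_bilinear_matrix_matrix_mult]
          continuous_on_const continuous_on_mat_exp)
    show "0 < 2 * \<delta>" using C by simp
    fix t :: real assume t: "0 \<le> t"
    let ?q = "norm (transpose B *v (transpose (?E t) *v axis undefined 1))"
    have BE: "norm (transpose B *v Ev A t x) \<le> (C * KB) * exp (- \<delta> * t) * norm x" for x
    proof -
      have "norm (transpose B *v Ev A t x) \<le> norm (Ev A t x) * KB" by (rule KB)
      also have "\<dots> \<le> (C * exp (- \<delta> * t) * norm x) * KB"
        unfolding Ev_def by (intro mult_right_mono C(4) t KB)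
      finally show ?thesis by (simp add: mult_ac)
    qed
    have entry: "\<bar>?g t $ i $ j\<bar> \<le> (C * KB)\<^sup>2 * exp (- (2 * \<delta>) * t)" for i j
    proof -
      have "?g t $ i $ j = axis i 1 \<bullet> (?g t *v axis j 1)"
        by (simp add: inner_axis' matrix_vector_mult_basis column_def)
      also have "\<bar>\<dots>\<bar> \<le> norm (transpose B *v Ev A t (axis i 1)) * norm (transpose B *v Ev A t (axis j 1))"
        unfolding g by (rule Cauchy_Schwarz_ineq2)
      also have "\<dots> \<le> ((C * KB) * exp (- \<delta> * t) * 1) * ((C * KB) * exp (- \<delta> * t) * 1)"
        using BE[of "axis i 1"] BE[of "axis j 1"] C KB by (intro mult_mono) auto
      also have "\<dots> = (C * KB)\<^sup>2 * exp (- (2 * \<delta>) * t)"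
        by (simp add: power2_eq_square mult_ac flip: exp_add)
      finally show ?thesis .
    qed
    have "norm (?g t) \<le> (\<Sum>i\<in>UNIV. norm (?g t $ i))"
      unfolding norm_vec_def[of "?g t"] by (rule L2_set_le_sum) simp
    also have "\<dots> \<le> (\<Sum>i\<in>(UNIV :: 'd set). \<Sum>j\<in>(UNIV :: 'd set). (C * KB)\<^sup>2 * exp (- (2 * \<delta>) * t))"
      by (rule sum_mono, rule order.trans[OF norm_le_l1_cart sum_mono]) (rule entry)
    also have "\<dots> = (real CARD('d) * (real CARD('d) * (C * KB)\<^sup>2)) * exp (- (2 * \<delta>) * t)" by simp
    finally show "norm (?g t) \<le> (real CARD('d) * (real CARD('d) * (C * KB)\<^sup>2)) * exp (- (2 * \<delta>) * t)" .
  qed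
  then have "(?g has_integral stationary_cov A B) {0..}"
    by (simp add: stationary_cov_def has_integral_integral)
  from has_integral_linear[OF this bounded_linear_compose[OF bounded_linear_inner_right
      bounded_bilinear.bounded_linear_left[OF bounded_bilinear_matrix_vector_mult]], of b c]
  show ?thesis by (simp only: o_def g)
qed

text \<open>The single constant \<open>Q\<close> bounds everything on which the error terms may depend; this makes them
  uniform in the frequency, in \<open>\<epsilon>\<close> and in the probability space.\<close>

locale bounded_oscillator = stable_oscillator M F W A B a \<gamma> \<kappa> \<epsilon> v y r
  for M :: "'w measure" and F and W :: "real \<Rightarrow> 'w \<Rightarrow> real^'m" and A :: "real^'d^'d" and B a \<gamma> \<kappa> \<epsilon> v y r +
  fixes Q :: real
  assumes Q1: "1 \<le> Q" and Qa: "norm a \<le> Q" and Q\<gamma>: "norm \<gamma> \<le> Q"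
    and QB: "\<And>b. norm (transpose B *v b) \<le> Q * norm b"
    and QE: "\<And>t b. 0 \<le> t \<Longrightarrow> norm (Ev A t b) \<le> Q * exp (- (1 / Q) * t) * norm b"
    and Q\<kappa>: "1 / (2 * \<kappa>) \<le> Q"
    and Qv: "\<And>t. 0 \<le> t \<Longrightarrow> (\<integral>\<^sup>+z. ennreal (norm (v t z)) ^ 4 \<partial>M) \<le> ennreal (Q - 1)"
    and \<epsilon>: "0 \<le> \<epsilon>" "\<epsilon> \<le> 1"
begin

lemma norm_plin: "cmod (plin bs t z) \<le> nprod bs * norm (v t z) ^ length bs"
proof (induction bs)
  case Nil
  then show ?case by (simp add: plin_def)
next
  case (Cons b bs)
  have "cmod (lin b t z) \<le> norm b * norm (v t z)"
    unfolding lin_def norm_of_real by (rule Cauchy_Schwarz_ineq2)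
  then have "cmod (lin b t z) * cmod (plin bs t z) \<le> (norm b * norm (v t z)) * (nprod bs * norm (v t z) ^ length bs)"
    using Cons by (intro mult_mono) auto
  then show ?case by (simp add: plin_def norm_mult mult_ac)
qed

text \<open>For at most four functionals \<open>x^n \<le> 1 + x^4\<close>, which explains the fourth
  moment and the value \<open>Q - 1\<close> in the assumption on \<open>v\<close>: the sum is at
  most \<open>Q\<close>. This is the crude bound that cuts off the hierarchy.\<close>

lemma moment_bound:
  assumes q: "adm q" and c: "\<And>t z. 0 \<le> t \<Longrightarrow> z \<in> space M \<Longrightarrow> cmod (q t z) \<le> c" and len: "length bs \<le> 4"
  shows "cmod (moment q bs) \<le> (c * Q) * nprod bs"
  unfolding moment_def
proof (rule norm_mean)
  show adm: "adm (\<lambda>t z. q t z * plin bs t z)" by (intro adm_mult q adm_plin)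
  fix t :: real assume t: "0 \<le> t"
  obtain z0 where "z0 \<in> space M" using not_empty by blast
  then have c0: "0 \<le> c" using c[OF t] norm_ge_zero order.trans by blast
  have [measurable]: "v t \<in> borel_measurable M" using mbdd_measurable[OF mbdd_v] t by simp
  have pw: "x ^ length bs \<le> 1 + x ^ 4" if "0 \<le> x" for x :: real
  proof (cases "x \<le> 1")
    case True
    then have "x ^ length bs \<le> 1" using that by (intro power_le_one)
    then show ?thesis using that zero_le_power[of x 4] by linarith
  next
    case False
    then have "x ^ length bs \<le> x ^ 4" using len by (intro power_increasing) auto
    then show ?thesis by simp
  qed
  have "ennreal (cmod (expectation (\<lambda>z. q t z * plin bs t z))) \<le> (\<integral>\<^sup>+z. ennreal (cmod (q t z * plin bs t z)) \<partial>M)"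
    by (rule integral_norm_bound_ennreal[OF adm_integrable[OF adm t]])
  also have "\<dots> \<le> (\<integral>\<^sup>+z. ennreal (c * nprod bs) * (1 + ennreal (norm (v t z)) ^ 4) \<partial>M)"
  proof (rule nn_integral_mono)
    fix z assume z: "z \<in> space M"
    have "cmod (q t z * plin bs t z) \<le> c * (nprod bs * norm (v t z) ^ length bs)"
      unfolding norm_mult using c0 by (intro mult_mono c t z norm_plin) auto
    also have "\<dots> \<le> c * (nprod bs * (1 + norm (v t z) ^ 4))"
      using c0 by (intro mult_left_mono pw) auto
    finally have "ennreal (cmod (q t z * plin bs t z)) \<le> ennreal ((c * nprod bs) * (1 + norm (v t z) ^ 4))"
      by (intro ennreal_leI) (simp only: mult.assoc)
    also have "\<dots> = ennreal (c * nprod bs) * (1 + ennreal (norm (v t z)) ^ 4)"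
      using c0 by (simp add: ennreal_mult ennreal_power)
    finally show "ennreal (cmod (q t z * plin bs t z)) \<le> ennreal (c * nprod bs) * (1 + ennreal (norm (v t z)) ^ 4)" .
  qed
  also have "\<dots> = ennreal (c * nprod bs) * (1 + (\<integral>\<^sup>+z. ennreal (norm (v t z)) ^ 4 \<partial>M))"
    by (subst nn_integral_cmult, measurable, subst nn_integral_add) (auto simp: emeasure_space_1)
  also have "\<dots> \<le> ennreal (c * nprod bs) * (1 + ennreal (Q - 1))"
    by (intro mult_left_mono add_left_mono Qv t) simp
  also have "1 + ennreal (Q - 1) = ennreal Q" using Q1 by (simp flip: ennreal_1 ennreal_plus)
  also have "ennreal (c * nprod bs) * ennreal Q = ennreal ((c * Q) * nprod bs)"
    using c0 Q1 by (simp add: ennreal_mult'[symmetric] mult_ac)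
  finally show "cmod (expectation (\<lambda>z. q t z * plin bs t z)) \<le> (c * Q) * nprod bs"
    using c0 Q1 by (subst (asm) ennreal_le_iff) auto
qed

lemma mom_bound: "length bs \<le> 4 \<Longrightarrow> cmod (mom k bs) \<le> Q * nprod bs"
  using moment_bound[of "\<lambda>t z. w t z ^ k" 1 bs] by (simp add: adm_power adm_w norm_power norm_w)

lemma smom_bound: assumes "length bs \<le> 4" shows "cmod (smom k bs) \<le> (4 * Q) * nprod bs"
proof (rule moment_bound[OF _ _ assms])
  show "adm (\<lambda>t z. w t z ^ k * (1 - w t z)\<^sup>2)" by (intro adm_intros adm_w)
  show "cmod (w t z ^ k * (1 - w t z)\<^sup>2) \<le> 4" if "0 \<le> t" "z \<in> space M" for t z
    using norm_one_minus_power[OF norm_w[OF that(2,1)], of 2] norm_w[OF that(2,1)] by (simp add: norm_mult norm_power)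
qed

lemma rpoly_bound: assumes "length bs \<le> 4" "k \<le> 2"
  shows "cmod (moment (\<lambda>t z. rpoly k (w t z)) bs) \<le> (72 * Q) * nprod bs"
proof (rule moment_bound[OF adm_rpoly _ assms(1)])
  show "cmod (rpoly k (w t z)) \<le> 72" if "0 \<le> t" "z \<in> space M" for t z
  proof -
    \<comment> \<open>For \<open>k \<le> 2\<close> the general bound is at most
      \<open>8 + 16 + 48 = 72\<close>.\<close>
    have "8 * real k * (real k + 1) \<le> 8 * 2 * (2 + 1)" using assms(2) by (intro mult_mono) auto
    then show ?thesis using norm_rpoly[OF norm_w[OF that(2,1)], of k] assms(2) by simp
  qed
qed

lemma norm_bt: "cmod bt \<le> Q"
  using norm_beta[OF \<kappa>_pos] Q\<kappa> by simp

lemma noise_bound: "cmod (bt\<^sup>2 * of_real (\<epsilon>\<^sup>2 * (norm \<gamma>)\<^sup>2)) \<le> Q ^ 4 * \<epsilon>\<^sup>2"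
proof -
  have "cmod (bt\<^sup>2 * of_real (\<epsilon>\<^sup>2 * (norm \<gamma>)\<^sup>2)) = (cmod bt)\<^sup>2 * (norm \<gamma>)\<^sup>2 * \<epsilon>\<^sup>2"
    by (simp add: norm_mult norm_power)
  also have "\<dots> \<le> Q\<^sup>2 * Q\<^sup>2 * \<epsilon>\<^sup>2"
    using norm_bt Q\<gamma> by (intro mult_right_mono mult_mono power_mono) auto
  finally show ?thesis by (simp flip: power_add)
qed

lemma inner_\<gamma>_TB: "\<bar>\<gamma> \<bullet> TB b\<bar> \<le> (Q * Q) * norm b" and inner_TB: "\<bar>TB b \<bullet> TB c\<bar> \<le> (Q * Q) * (norm b * norm c)"
proof -
  have "norm \<gamma> * norm (TB b) \<le> Q * (Q * norm b)" using Q1 Q\<gamma> QB[of b] by (intro mult_mono) auto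
  then show "\<bar>\<gamma> \<bullet> TB b\<bar> \<le> (Q * Q) * norm b" using Cauchy_Schwarz_ineq2[of \<gamma> "TB b"] by (simp add: mult.assoc)
  have "norm (TB b) * norm (TB c) \<le> (Q * norm b) * (Q * norm c)" using Q1 QB by (intro mult_mono) auto
  then show "\<bar>TB b \<bullet> TB c\<bar> \<le> (Q * Q) * (norm b * norm c)" using Cauchy_Schwarz_ineq2[of "TB b" "TB c"] by (simp add: mult_ac)
qed

end

text \<open>For \<open>k \<ge> 1\<close> the moments of \<open>w\<^sup>k\<close> are bounded by \<open>K1 \<epsilon>\<close> with one linear functional of \<open>v\<close>, then by
  \<open>K2 \<epsilon>\<^sup>2\<close> with none, by \<open>K3 \<epsilon>\<close> with three and by \<open>K4 \<epsilon>\<^sup>2\<close> with two; each step uses the previous ones.\<close>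

definition est :: "real \<Rightarrow> real \<Rightarrow> real" where "est Q s = 3 * Q * ((Q + 3 * (Q * Q)) * s) + 72 * Q ^ 5"
definition K1 :: "real \<Rightarrow> real" where "K1 Q = est Q (4 * Q) * (Q ^ 1 * Q)"
definition K2 :: "real \<Rightarrow> real" where "K2 Q = Q * est Q (4 * K1 Q)"
definition K3 :: "real \<Rightarrow> real" where "K3 Q = (3 * (Q * Q) * K1 Q + est Q (4 * Q)) * (Q ^ 3 * Q)"
definition K4 :: "real \<Rightarrow> real" where "K4 Q = (Q * Q * K2 Q + est Q (4 * K3 Q + 4 * K1 Q)) * (Q ^ 2 * Q)"
text \<open>\<open>K5\<close> is the error constant at order \<epsilon>^3 in the forcing of the
  moment of \<open>w\<close> with one functional, and \<open>K6\<close> is the constant of the final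
  estimate.\<close>

definition K5 :: "real \<Rightarrow> real" where "K5 Q = Q * (3 * K4 Q * Q + Q * Q * (3 * K2 Q)) + Q ^ 4 * (7 * K1 Q)"
definition K6 :: "real \<Rightarrow> real" where "K6 Q = Q * (K5 Q * Q ^ 3) + Q ^ 4 / 2 * (3 * K2 Q)"

section \<open>Bounds of increasing order for the moments\<close>

context bounded_oscillator
begin

lemma est_nonneg: "0 \<le> s \<Longrightarrow> 0 \<le> est Q s"
  using Q1 by (simp add: est_def)

lemma K_nonneg: "0 \<le> K1 Q" "0 \<le> K2 Q" "0 \<le> K3 Q" "0 \<le> K4 Q"
proof -
  show 1: "0 \<le> K1 Q" using Q1 est_nonneg[of "4 * Q"] by (simp add: K1_def)
  show 2: "0 \<le> K2 Q" using Q1 1 est_nonneg[of "4 * K1 Q"] by (simp add: K2_def)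
  show 3: "0 \<le> K3 Q" using Q1 1 est_nonneg[of "4 * Q"] by (simp add: K3_def)
  show "0 \<le> K4 Q" using Q1 1 2 3 est_nonneg[of "4 * K3 Q + 4 * K1 Q"] by (simp add: K4_def)
qed

lemma \<epsilon>_square: "\<epsilon>\<^sup>2 \<le> \<epsilon>"
  using \<epsilon> mult_left_mono[of \<epsilon> 1 \<epsilon>] by (simp add: power2_eq_square)

text \<open>Origin of the constants: \<open>3\<close> bounds \<open>k + 1\<close> and the
  \<open>Q\<close> after it bounds \<open>bt\<close>; in the bracket, \<open>Q\<close> bounds
  \<open>a\<close>, and \<open>3 (Q Q)\<close> bounds at most three contractions with \<gamma>. In
  \<open>72 Q^5\<close> the bound \<open>72 Q\<close> for the correction polynomial meets the factor
  \<open>Q^4\<close>.\<close>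

lemma noise_part_bound:
  assumes k: "k \<le> 2" and n: "length bs = n" "n \<le> 3" and s: "0 \<le> s"
    and up: "\<And>cs. length cs = Suc n \<Longrightarrow> cmod (smom k cs) \<le> s * nprod cs"
    and down: "\<And>cs. Suc (length cs) = n \<Longrightarrow> cmod (smom k cs) \<le> s * nprod cs"
  shows "cmod (noise_part k bs) \<le> (3 * Q * ((Q + 3 * (Q * Q)) * s) * \<epsilon> + 72 * Q ^ 5 * \<epsilon>\<^sup>2) * nprod bs"
proof -
  have 1: "cmod (smom k (a # bs)) \<le> Q * s * nprod bs"
  proof -
    have "cmod (smom k (a # bs)) \<le> s * (norm a * nprod bs)" using up[of "a # bs"] n by simp
    also have "\<dots> \<le> s * (Q * nprod bs)" using s Qa by (intro mult_left_mono mult_right_mono) auto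
    finally show ?thesis by (simp only: mult_ac)
  qed
  have 2: "cmod (contract (\<lambda>c. \<gamma> \<bullet> TB c) (smom k) bs) \<le> 3 * (Q * Q * s) * nprod bs"
  proof (cases n)
    case 0
    then show ?thesis using n s by simp
  next
    case (Suc j)
    have "cmod (contract (\<lambda>c. \<gamma> \<bullet> TB c) (smom k) bs) \<le> real (Suc j) * (Q * Q * s) * nprod bs"
      by (rule contract_bound[OF inner_\<gamma>_TB _ s]) (use Suc n down in auto)
    also have "\<dots> \<le> 3 * (Q * Q * s) * nprod bs"
      using Suc n s by (intro mult_right_mono) auto
    finally show ?thesis .
  qed
  have 3: "cmod (of_nat (Suc k) * bt * of_real \<epsilon>) \<le> 3 * Q * \<epsilon>"
  proof -
    have "cmod (of_nat (Suc k) * bt * of_real \<epsilon>) = real (Suc k) * cmod bt * \<epsilon>"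
      unfolding norm_mult norm_of_nat norm_of_real using \<epsilon> by simp
    also have "\<dots> \<le> 3 * Q * \<epsilon>" using k \<epsilon> norm_bt by (intro mult_right_mono mult_mono) auto
    finally show ?thesis .
  qed
  have "cmod (noise_part k bs) \<le> (3 * Q * \<epsilon>) * (Q * s * nprod bs + 3 * (Q * Q * s) * nprod bs)
     + (Q ^ 4 * \<epsilon>\<^sup>2) * ((72 * Q) * nprod bs)"
    unfolding noise_part_def
  proof (rule norm_triangle_le[OF add_mono])
    show "cmod (of_nat (Suc k) * bt * of_real \<epsilon> * (smom k (a # bs) + contract (\<lambda>c. \<gamma> \<bullet> TB c) (smom k) bs))
      \<le> (3 * Q * \<epsilon>) * (Q * s * nprod bs + 3 * (Q * Q * s) * nprod bs)"
      unfolding norm_mult[of "_ * of_real \<epsilon>"]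
      using 3 \<epsilon> Q1 by (intro mult_mono norm_triangle_le add_mono 1 2) auto
    show "cmod (bt\<^sup>2 * of_real (\<epsilon>\<^sup>2 * (norm \<gamma>)\<^sup>2) * moment (\<lambda>t z. rpoly k (w t z)) bs) \<le> (Q ^ 4 * \<epsilon>\<^sup>2) * ((72 * Q) * nprod bs)"
      unfolding norm_mult[of "bt\<^sup>2 * _"]
      by (intro mult_mono noise_bound rpoly_bound) (use n k Q1 in auto)
  qed
  also have "\<dots> = (3 * Q * ((Q + 3 * (Q * Q)) * s) * \<epsilon> + 72 * Q ^ 5 * \<epsilon>\<^sup>2) * nprod bs"
    by (simp add: algebra_simps power_numeral_reduce)
  finally show ?thesis .
qed

lemma noise_part_trivial:
  assumes "k \<le> 2" "length bs \<le> 3"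
  shows "cmod (noise_part k bs) \<le> (est Q (4 * Q) * \<epsilon>) * nprod bs"
proof -
  have "cmod (noise_part k bs) \<le> (3 * Q * ((Q + 3 * (Q * Q)) * (4 * Q)) * \<epsilon> + 72 * Q ^ 5 * \<epsilon>\<^sup>2) * nprod bs"
    by (rule noise_part_bound[OF assms(1) refl assms(2)]) (use assms Q1 in \<open>auto intro!: smom_bound\<close>)
  also have "\<dots> \<le> (3 * Q * ((Q + 3 * (Q * Q)) * (4 * Q)) * \<epsilon> + 72 * Q ^ 5 * \<epsilon>) * nprod bs"
    using Q1 \<epsilon>_square by (intro mult_right_mono add_left_mono mult_left_mono) auto
  finally show ?thesis by (simp only: est_def distrib_right)
qed

text \<open>The gain of an order: if the neighbouring moments are already of order \<epsilon>, the
  coupling is of order \<epsilon>^2.\<close>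

lemma noise_part_small:
  assumes k: "k \<le> 2" and n: "length bs = n" "n \<le> 3" and s: "0 \<le> s"
    and up: "\<And>cs. length cs = Suc n \<Longrightarrow> cmod (smom k cs) \<le> s * \<epsilon> * nprod cs"
    and down: "\<And>cs. Suc (length cs) = n \<Longrightarrow> cmod (smom k cs) \<le> s * \<epsilon> * nprod cs"
  shows "cmod (noise_part k bs) \<le> (est Q s * \<epsilon>\<^sup>2) * nprod bs"
proof -
  have "cmod (noise_part k bs) \<le> (3 * Q * ((Q + 3 * (Q * Q)) * (s * \<epsilon>)) * \<epsilon> + 72 * Q ^ 5 * \<epsilon>\<^sup>2) * nprod bs"
    by (rule noise_part_bound[OF k n _ up down]) (use s \<epsilon> in auto)
  also have "(3 * Q * ((Q + 3 * (Q * Q)) * (s * \<epsilon>)) * \<epsilon> + 72 * Q ^ 5 * \<epsilon>\<^sup>2) = est Q s * \<epsilon>\<^sup>2"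
    by (simp only: est_def power2_eq_square distrib_right mult.assoc)
  finally show ?thesis .
qed

text \<open>\<open>smom 0\<close> contains \<open>mom 0\<close>, which is not small in general. It
  vanishes for one and for three functionals, so the gain is available next to those.\<close>

lemma smom_small:
  assumes "\<And>j. j \<le> 2 \<Longrightarrow> cmod (mom (Suc j) cs) \<le> c * nprod cs" "mom 0 cs = 0" "k \<le> 1" "0 \<le> c"
  shows "cmod (smom k cs) \<le> 4 * c * nprod cs"
proof -
  have m: "cmod (mom j cs) \<le> c * nprod cs" if "j \<le> 3" for j
    using assms(1)[of "j - 1"] assms(2,4) that by (cases j) auto
  have "cmod (smom k cs) \<le> c * nprod cs + 2 * (c * nprod cs) + c * nprod cs"
    unfolding smom
  proof (intro norm_triangle_le add_mono m order.trans[OF norm_triangle_ineq4])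
    show "cmod (2 * mom (Suc k) cs) \<le> 2 * (c * nprod cs)"
      using m[of "Suc k"] assms(3) by (simp add: norm_mult)
  qed (use assms(3) in auto)
  then show ?thesis by (simp add: algebra_simps)
qed

lemma adm_w_power: "adm (\<lambda>t z. w t z ^ k)"
  by (intro adm_power adm_w)

text \<open>With the decay constant \<open>Q\<close> and the rate \<open>1 / Q\<close>, transport
  costs the factor \<open>Q^n Q\<close>, whatever the frequency.\<close>

lemma mom_transport:
  assumes n: "0 < n" "n \<le> 4" "length bs = n"
    and G: "\<And>cs. length cs = n \<Longrightarrow>
      cmod (contract2 (\<lambda>b c. TB b \<bullet> TB c) (mom (Suc k)) cs + noise_part k cs) \<le> G * nprod cs"
  shows "cmod (mom (Suc k) bs) \<le> G * (Q ^ n * Q) * nprod bs"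
proof -
  have "cmod (mom (Suc k) bs) \<le> G * (Q ^ n / (1 / Q)) * nprod bs"
    by (rule transport_integral(2)[OF moment_multilinear[OF adm_w_power] n(1,3) _ QE mom_equation mom_bound G])
       (use n Q1 in auto)
  then show ?thesis by simp
qed

lemma mom_0_transport:
  assumes "0 < n" "n \<le> 4" "length bs = n"
    "\<And>cs. length cs = n \<Longrightarrow> contract2 (\<lambda>b c. TB b \<bullet> TB c) (mom 0) cs = 0"
  shows "mom 0 bs = 0"
proof -
  have eq: "subst1 TA (mom 0) cs - \<i> * of_real 0 * mom 0 cs + 0 = 0" if "length cs = n" for cs
    using mom_0_equation[of cs] assms(4)[OF that] by simp
  have "cmod (mom 0 bs) \<le> 0 * (Q ^ n / (1 / Q)) * nprod bs"
    by (rule transport_integral(2)[where g="\<lambda>_. 0" and \<mu>=0, OF moment_multilinear[OF adm_w_power] assms(1,3) _ QE eq mom_bound])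
       (use assms Q1 in auto)
  then show ?thesis by simp
qed

lemma mom_0_1: "mom 0 [b] = 0"
  by (rule mom_0_transport[where n=1]) (auto simp: length_Suc_conv)

lemma mom_0_3: "mom 0 [b, c, d] = 0"
  by (rule mom_0_transport[where n=3]) (auto simp: length_Suc_conv numeral_3_eq_3 mom_0_1[simplified])

text \<open>For two functionals the equation is the Lyapunov equation of the stationary covariance,
  so its solution by transport is that covariance, although \<open>v\<close> starts at zero.\<close>

lemma mom_0_2: "mom 0 [b, c] = of_real (b \<bullet> (stationary_cov A B *v c))"
proof -
  let ?g = "contract2 (\<lambda>b c. TB b \<bullet> TB c) (mom 0)"
  have g: "?g [b, c] = of_real (TB b \<bullet> TB c)" for b c by (simp add: mom_0_Nil[simplified])
  have "((\<lambda>t. exp (- \<i> * of_real (0 * t)) * ?g (map (Ev A t) [b, c])) has_integral mom 0 [b, c]) {0..}"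
  proof (rule transport_integral(1)[where \<mu>=0, OF moment_multilinear _ _ _ QE])
    show "adm (\<lambda>t z. w t z ^ 0)" by (intro adm_power adm_w)
    show "(0::nat) < 2" "length [b, c] = 2" "0 < 1 / Q" using Q1 by auto
    show "subst1 TA (mom 0) cs - \<i> * of_real 0 * mom 0 cs + ?g cs = 0" for cs
      using mom_0_equation[of cs] by simp
    show "cmod (mom 0 cs) \<le> Q * nprod cs" if "length cs = 2" for cs
      by (rule mom_bound) (use that in simp)
    show "cmod (?g cs) \<le> (Q * Q) * nprod cs" if len: "length cs = 2" for cs
    proof -
      obtain b c where cs: "cs = [b, c]" using len by (auto simp: length_Suc_conv numeral_2_eq_2)
      show ?thesis unfolding cs g norm_of_real using inner_TB[of b c] by (simp add: mult_ac)
    qed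
  qed
  then have "((\<lambda>t. complex_of_real (TB (Ev A t b) \<bullet> TB (Ev A t c))) has_integral mom 0 [b, c]) {0..}"
    unfolding list.map g by simp
  moreover have "((\<lambda>t. complex_of_real (TB (Ev A t b) \<bullet> TB (Ev A t c))) has_integral of_real (b \<bullet> (stationary_cov A B *v c))) {0..}"
    using has_integral_linear[OF stationary_cov_integral[OF stable] bounded_linear_of_real] by (simp add: o_def)
  ultimately show ?thesis by (rule has_integral_unique)
qed

text \<open>Powers up to \<open>w^3\<close> are included because \<open>smom 0\<close> and
  \<open>smom 1\<close>, which enter the equations for \<open>w\<close> and \<open>w^2\<close>,
  reach that far.\<close>

lemma mom_1: assumes "k \<le> 2" shows "cmod (mom (Suc k) [b]) \<le> K1 Q * \<epsilon> * norm b"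
proof -
  have "cmod (mom (Suc k) [b]) \<le> (est Q (4 * Q) * \<epsilon>) * (Q ^ 1 * Q) * nprod [b]"
  proof (rule mom_transport)
    fix cs :: "(real^'d) list" assume len: "length cs = 1"
    then obtain b where cs: "cs = [b]" by (auto simp: length_Suc_conv)
    then show "cmod (contract2 (\<lambda>b c. TB b \<bullet> TB c) (mom (Suc k)) cs + noise_part k cs) \<le> est Q (4 * Q) * \<epsilon> * nprod cs"
      using noise_part_trivial[OF assms, of "[b]"] by simp
  qed auto
  then show ?thesis by (simp add: K1_def mult_ac)
qed

lemma smom_1: assumes "k \<le> 1" "length cs = 1" shows "cmod (smom k cs) \<le> 4 * K1 Q * \<epsilon> * nprod cs"
proof -
  obtain b where cs: "cs = [b]" using assms(2) by (auto simp: length_Suc_conv)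
  have "cmod (smom k cs) \<le> 4 * (K1 Q * \<epsilon>) * nprod cs" unfolding cs
    by (rule smom_small) (use mom_1[of _ b] mom_0_1 assms K_nonneg \<epsilon> in auto)
  then show ?thesis by (simp only: mult.assoc)
qed

text \<open>With the empty list there is nothing to transport; the equation is inverted by dividing
  by the rotation frequency. This division requires \<kappa> to be bounded below, as does the bound
  on \<open>bt\<close>.\<close>

lemma mom_2: assumes k: "k \<le> 1" shows "cmod (mom (Suc k) []) \<le> K2 Q * \<epsilon>\<^sup>2"
proof -
  have "cmod (noise_part k []) \<le> (est Q (4 * K1 Q) * \<epsilon>\<^sup>2) * nprod ([] :: (real^'d) list)"
    by (rule noise_part_small[where n=0]) (use k K_nonneg smom_1 in auto)
  moreover have "\<i> * of_real (2 * real (Suc k) * \<kappa>) * mom (Suc k) [] = noise_part k []"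
    using mom_equation[of k "[]"] by (simp add: algebra_simps)
  then have "cmod (\<i> * of_real (2 * real (Suc k) * \<kappa>) * mom (Suc k) []) = cmod (noise_part k [])" by (simp only:)
  then have "2 * real (Suc k) * \<kappa> * cmod (mom (Suc k) []) = cmod (noise_part k [])"
    unfolding norm_mult norm_of_real using \<kappa>_pos by simp
  moreover have "(2 * \<kappa>) * cmod (mom (Suc k) []) \<le> 2 * real (Suc k) * \<kappa> * cmod (mom (Suc k) [])"
    using \<kappa>_pos by (intro mult_right_mono) auto
  ultimately have "(2 * \<kappa>) * cmod (mom (Suc k) []) \<le> est Q (4 * K1 Q) * \<epsilon>\<^sup>2" by simp
  then have "(1 / (2 * \<kappa>)) * ((2 * \<kappa>) * cmod (mom (Suc k) [])) \<le> Q * (est Q (4 * K1 Q) * \<epsilon>\<^sup>2)"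
    using \<kappa>_pos Q1 by (intro mult_mono[OF Q\<kappa>]) auto
  then show ?thesis using \<kappa>_pos by (simp add: K2_def mult.assoc)
qed

text \<open>Each of the three pairings leaves one functional, already of order \<epsilon>; the
  coupling to four and to two functionals is estimated crudely.\<close>

lemma mom_3: assumes k: "k \<le> 2" and len: "length bs = 3" shows "cmod (mom (Suc k) bs) \<le> K3 Q * \<epsilon> * nprod bs"
proof -
  have "cmod (mom (Suc k) bs) \<le> (3 * (Q * Q) * (K1 Q * \<epsilon>) + est Q (4 * Q) * \<epsilon>) * (Q ^ 3 * Q) * nprod bs"
  proof (rule mom_transport[OF _ _ len])
    fix cs :: "(real^'d) list" assume len: "length cs = 3"
    then obtain x y z where cs: "cs = [x, y, z]" by (auto simp: length_Suc_conv numeral_3_eq_3)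
    have p: "cmod (of_real (TB x \<bullet> TB y) * mom (Suc k) [z]) \<le> (Q * Q) * (K1 Q * \<epsilon>) * (norm x * (norm y * norm z))" for x y z
    proof -
      have "cmod (of_real (TB x \<bullet> TB y) * mom (Suc k) [z]) \<le> ((Q * Q) * (norm x * norm y)) * (K1 Q * \<epsilon> * norm z)"
        unfolding norm_mult norm_of_real using inner_TB[of x y] mom_1[OF k, of z] by (intro mult_mono) auto
      then show ?thesis by (simp only: mult_ac)
    qed
    have "contract2 (\<lambda>b c. TB b \<bullet> TB c) (mom (Suc k)) cs
      = of_real (TB x \<bullet> TB y) * mom (Suc k) [z] + of_real (TB x \<bullet> TB z) * mom (Suc k) [y] + of_real (TB y \<bullet> TB z) * mom (Suc k) [x]"
      by (simp add: cs)
    then have "cmod (contract2 (\<lambda>b c. TB b \<bullet> TB c) (mom (Suc k)) cs + noise_part k cs) \<le>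
      (Q * Q) * (K1 Q * \<epsilon>) * (norm x * (norm y * norm z)) + (Q * Q) * (K1 Q * \<epsilon>) * (norm x * (norm z * norm y))
        + (Q * Q) * (K1 Q * \<epsilon>) * (norm y * (norm z * norm x)) + est Q (4 * Q) * \<epsilon> * nprod cs"
      by (simp only:) (intro norm_triangle_le add_mono p noise_part_trivial k, simp add: len)
    also have "\<dots> = (3 * (Q * Q) * (K1 Q * \<epsilon>) + est Q (4 * Q) * \<epsilon>) * nprod cs"
      by (simp add: cs algebra_simps)
    finally show "cmod (contract2 (\<lambda>b c. TB b \<bullet> TB c) (mom (Suc k)) cs + noise_part k cs) \<le>
      (3 * (Q * Q) * (K1 Q * \<epsilon>) + est Q (4 * Q) * \<epsilon>) * nprod cs" .
  qed auto
  then show ?thesis by (simp only: K3_def distrib_right distrib_left mult_ac)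
qed

text \<open>All ingredients are of second order: the pairing leaves the moment without functionals,
  and the coupling, with its factor \<epsilon>, goes to three functionals and to one, both of order
  \<epsilon>.\<close>

lemma mom_4: assumes k: "k \<le> 1" shows "cmod (mom (Suc k) [b, c]) \<le> K4 Q * \<epsilon>\<^sup>2 * (norm b * norm c)"
proof -
  have k2: "k \<le> 2" using k by simp
  let ?s = "4 * K3 Q + 4 * K1 Q"
  have s: "0 \<le> ?s" "4 * K1 Q * \<epsilon> \<le> ?s * \<epsilon>" "4 * (K3 Q * \<epsilon>) \<le> ?s * \<epsilon>"
    using K_nonneg \<epsilon> by (auto simp: distrib_right)
  have "cmod (mom (Suc k) [b, c]) \<le> ((Q * Q) * (K2 Q * \<epsilon>\<^sup>2) + est Q ?s * \<epsilon>\<^sup>2) * (Q ^ 2 * Q) * nprod [b, c]"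
  proof (rule mom_transport)
    fix cs :: "(real^'d) list" assume len: "length cs = 2"
    then obtain x y where cs: "cs = [x, y]" by (auto simp: length_Suc_conv numeral_2_eq_2)
    have up: "cmod (smom k ds) \<le> ?s * \<epsilon> * nprod ds" if ds: "length ds = Suc 2" for ds
    proof -
      have ds3: "length ds = 3" using ds by simp
      obtain p q u where d: "ds = [p, q, u]" using ds by (auto simp: length_Suc_conv numeral_2_eq_2)
      have "cmod (smom k ds) \<le> 4 * (K3 Q * \<epsilon>) * nprod ds"
        by (rule smom_small[OF mom_3[OF _ ds3] _ k]) (use K_nonneg \<epsilon> mom_0_3 in \<open>auto simp: d\<close>)
      also have "\<dots> \<le> ?s * \<epsilon> * nprod ds" by (intro mult_right_mono s) simp
      finally show ?thesis .
    qed
    have down: "cmod (smom k ds) \<le> ?s * \<epsilon> * nprod ds" if "Suc (length ds) = 2" for ds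
      by (rule order.trans[OF smom_1[OF k]]) (use that in \<open>auto intro!: mult_right_mono s(2)\<close>)
    have "cmod (of_real (TB x \<bullet> TB y) * mom (Suc k) []) \<le> ((Q * Q) * (norm x * norm y)) * (K2 Q * \<epsilon>\<^sup>2)"
      unfolding norm_mult norm_of_real using inner_TB[of x y] mom_2[OF k] by (intro mult_mono) auto
    then have c2: "cmod (contract2 (\<lambda>b c. TB b \<bullet> TB c) (mom (Suc k)) cs) \<le> ((Q * Q) * (norm x * norm y)) * (K2 Q * \<epsilon>\<^sup>2)"
      by (simp add: cs)
    have "cmod (contract2 (\<lambda>b c. TB b \<bullet> TB c) (mom (Suc k)) cs + noise_part k cs) \<le>
      ((Q * Q) * (norm x * norm y)) * (K2 Q * \<epsilon>\<^sup>2) + est Q ?s * \<epsilon>\<^sup>2 * nprod cs"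
      by (intro norm_triangle_le add_mono c2 noise_part_small[OF k2 len _ s(1) up down]) auto
    also have "\<dots> = ((Q * Q) * (K2 Q * \<epsilon>\<^sup>2) + est Q ?s * \<epsilon>\<^sup>2) * nprod cs"
      by (simp add: cs algebra_simps)
    finally show "cmod (contract2 (\<lambda>b c. TB b \<bullet> TB c) (mom (Suc k)) cs + noise_part k cs) \<le>
      ((Q * Q) * (K2 Q * \<epsilon>\<^sup>2) + est Q ?s * \<epsilon>\<^sup>2) * nprod cs" .
  qed auto
  also have "((Q * Q) * (K2 Q * \<epsilon>\<^sup>2) + est Q ?s * \<epsilon>\<^sup>2) * (Q ^ 2 * Q) * nprod [b, c] = K4 Q * \<epsilon>\<^sup>2 * (norm b * norm c)"
    by (simp add: K4_def distrib_right distrib_left mult_ac)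
  finally show ?thesis .
qed

end

section \<open>The Lyapunov exponent\<close>

context bounded_oscillator
begin

text \<open>To leading order, the forcing of the moment of \<open>w\<close> with a functional
  \<open>b\<close> is \<open>bt \<epsilon>\<close> times the inner product of this vector with
  \<open>b\<close>. The first summand stems from the second moment of \<open>v\<close>, the other
  from the correlation between the noises driving \<open>v\<close> and the oscillator.\<close>

abbreviation "ua \<equiv> stationary_cov A B *v a + B *v \<gamma>"

text \<open>Solves the leading-order transport equation for the functional \<open>a\<close>, up to
  the factor \<open>bt \<epsilon>\<close>.\<close>

definition J :: complex where
  "J = integral {0..} (\<lambda>t. exp (- \<i> * of_real (2 * \<kappa> * t)) * of_real (ua \<bullet> Ev A t a))"

lemma Ev_cont: "continuous_on S (\<lambda>t. Ev A t b)"
  by (rule continuous_on_vector_derivative[OF Ev_deriv])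

lemma norm_exp_i: "cmod (exp (- \<i> * of_real x)) = 1"
  by (simp add: norm_exp_eq_Re)

lemma J_integral: "((\<lambda>t. exp (- \<i> * of_real (2 * \<kappa> * t)) * of_real (ua \<bullet> Ev A t a)) has_integral J) {0..}"
  unfolding J_def
proof (rule integrable_integral, rule integrable_half_line)
  show "continuous_on {0..} (\<lambda>t. exp (- \<i> * of_real (2 * \<kappa> * t)) * of_real (ua \<bullet> Ev A t a))"
    by (intro continuous_intros Ev_cont)
  show "0 < 1 / Q" using Q1 by simp
  fix t :: real assume t: "0 \<le> t"
  have "norm ua * norm (Ev A t a) \<le> norm ua * (Q * exp (- (1 / Q) * t) * norm a)"
    by (intro mult_left_mono QE t) simp
  then show "norm (exp (- \<i> * of_real (2 * \<kappa> * t)) * of_real (ua \<bullet> Ev A t a)) \<le> (norm ua * Q * norm a) * exp (- (1 / Q) * t)"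
    unfolding norm_mult norm_exp_i norm_of_real using Cauchy_Schwarz_ineq2[of ua "Ev A t a"] by (simp add: mult_ac)
qed

lemma Re_J: "Re J = pi * (a \<bullet> (cos_transform A (2 * \<kappa>) *v ua))"
proof -
  have R: "Re (exp (- \<i> * of_real (2 * \<kappa> * t)) * of_real (ua \<bullet> Ev A t a)) = cos (2 * \<kappa> * t) * (a \<bullet> (mat_exp (t *\<^sub>R A) *v ua))" for t
  proof -
    have "ua \<bullet> Ev A t a = a \<bullet> (mat_exp (t *\<^sub>R A) *v ua)"
      unfolding Ev_def inner_mv[of a] by (rule inner_commute)
    moreover have "Re (exp (- \<i> * of_real (2 * \<kappa> * t))) = cos (2 * \<kappa> * t)"
      by (simp add: Re_exp)
    ultimately show ?thesis by simp
  qed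
  have "((\<lambda>t. cos (2 * \<kappa> * t) * (a \<bullet> (mat_exp (t *\<^sub>R A) *v ua))) has_integral Re J) {0..}"
    using has_integral_linear[OF J_integral bounded_linear_Re] unfolding o_def R .
  then show ?thesis by (rule has_integral_unique[OF _ cos_transform_mv[OF stable]])
qed

text \<open>Expanding the cube gives \<open>3\<close>, \<open>3\<close> and \<open>1\<close> times
  moments of powers of \<open>w\<close>, while the constant term meets \<open>mom 0 [b] = 0\<close>;
  hence the factor \<open>7\<close>.\<close>

lemma cubic_bound: "cmod (moment (\<lambda>t z. rpoly 0 (w t z)) [b]) \<le> 7 * (K1 Q * \<epsilon>) * norm b"
proof -
  have "(\<lambda>t z. rpoly 0 (w t z)) = (\<lambda>t z. 3 * w t z ^ Suc 0 - 3 * w t z ^ Suc 1 + w t z ^ Suc 2 - w t z ^ 0)"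
    by (intro ext) (simp add: power2_eq_square power3_eq_cube algebra_simps)
  then have "moment (\<lambda>t z. rpoly 0 (w t z)) [b] = 3 * mom (Suc 0) [b] - 3 * mom (Suc 1) [b] + mom (Suc 2) [b] - mom 0 [b]"
    by (simp only: moment_add moment_diff moment_cmult adm_add adm_diff adm_mult adm_const adm_w_power)
  then have "moment (\<lambda>t z. rpoly 0 (w t z)) [b] = 3 * mom (Suc 0) [b] - 3 * mom (Suc 1) [b] + mom (Suc 2) [b]"
    by (simp only: mom_0_1 diff_0_right)
  also have "cmod (3 * mom (Suc 0) [b] - 3 * mom (Suc 1) [b] + mom (Suc 2) [b])
    \<le> 3 * (K1 Q * \<epsilon> * norm b) + 3 * (K1 Q * \<epsilon> * norm b) + K1 Q * \<epsilon> * norm b"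
    using mom_1[of 0 b] mom_1[of 1 b] mom_1[of 2 b]
    by (intro norm_triangle_le add_mono order.trans[OF norm_triangle_ineq4]) (auto simp: norm_mult)
  also have "\<dots> = 7 * (K1 Q * \<epsilon>) * norm b" by (simp add: algebra_simps)
  finally show ?thesis .
qed

text \<open>The summands free of \<open>w\<close> survive at first order. The others are \<epsilon>
  times moments of \<open>w\<close> and \<open>w^2\<close> of second order, or \<epsilon>^2 times
  the cubic correction, which is of first order.\<close>

lemma noise_part_0:
  "cmod (noise_part 0 [b] - bt * of_real \<epsilon> * of_real (ua \<bullet> b)) \<le> (K5 Q * \<epsilon> ^ 3) * norm b"
proof -
  let ?g = "complex_of_real (\<gamma> \<bullet> TB b)" and ?N = "bt\<^sup>2 * of_real (\<epsilon>\<^sup>2 * (norm \<gamma>)\<^sup>2)"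
  define p q where "p = mom (Suc 1) [a, b] - 2 * mom (Suc 0) [a, b]" and "q = mom (Suc 1) [] - 2 * mom (Suc 0) []"
  define R where "R = moment (\<lambda>t z. rpoly 0 (w t z)) [b]"
  \<comment> \<open>Commutativity of the product of functionals takes the place of symmetry of the
    covariance matrix.\<close>
  have "mom 0 [a, b] = mom 0 [b, a]"
    unfolding moment_Cons mult.assoc by (simp only: mult.commute)
  then have "mom 0 [a, b] + ?g = of_real (ua \<bullet> b)"
    unfolding mom_0_2[of b a] inner_add_left of_real_add inner_commute[of "B *v \<gamma>"] inner_mv[of b B]
    by (simp only: inner_commute)
  then have u: "of_real (ua \<bullet> b) = mom 0 [a, b] + ?g" ..
  have "noise_part 0 [b] = bt * of_real \<epsilon> * ((mom 0 [a, b] - 2 * mom (Suc 0) [a, b] + mom (Suc (Suc 0)) [a, b])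
    + ?g * (1 - 2 * mom (Suc 0) [] + mom (Suc (Suc 0)) [])) + ?N * R"
    unfolding noise_part_def contract.simps smom mom_0_Nil R_def by (simp only: of_nat_Suc of_nat_0 add_0_left add_0_right mult_1_left)
  then have "noise_part 0 [b] - bt * of_real \<epsilon> * of_real (ua \<bullet> b) = bt * of_real \<epsilon> * (p + ?g * q) + ?N * R"
    unfolding u p_def q_def One_nat_def by (simp only:) (simp only: algebra_simps mult_1_left mult_1_right)
  also have "cmod \<dots> \<le> (Q * \<epsilon>) * (3 * K4 Q * \<epsilon>\<^sup>2 * (Q * norm b) + (Q * Q * norm b) * (3 * K2 Q * \<epsilon>\<^sup>2)) + (Q ^ 4 * \<epsilon>\<^sup>2) * (7 * (K1 Q * \<epsilon>) * norm b)"
  proof (rule norm_triangle_le[OF add_mono])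
    have p: "cmod p \<le> 3 * K4 Q * \<epsilon>\<^sup>2 * (Q * norm b)"
    proof -
      have "cmod p \<le> K4 Q * \<epsilon>\<^sup>2 * (norm a * norm b) + 2 * (K4 Q * \<epsilon>\<^sup>2 * (norm a * norm b))"
        unfolding p_def using mom_4[of 1 a b] mom_4[of 0 a b]
        by (intro order.trans[OF norm_triangle_ineq4 add_mono]) (auto simp: norm_mult)
      also have "\<dots> = 3 * K4 Q * \<epsilon>\<^sup>2 * (norm a * norm b)" by (simp add: algebra_simps)
      also have "\<dots> \<le> 3 * K4 Q * \<epsilon>\<^sup>2 * (Q * norm b)"
        using K_nonneg Qa by (intro mult_left_mono mult_right_mono) auto
      finally show ?thesis .
    qed
    have q: "cmod q \<le> 3 * K2 Q * \<epsilon>\<^sup>2"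
    proof -
      have "cmod q \<le> K2 Q * \<epsilon>\<^sup>2 + 2 * (K2 Q * \<epsilon>\<^sup>2)"
        unfolding q_def using mom_2[of 1] mom_2[of 0]
        by (intro order.trans[OF norm_triangle_ineq4 add_mono]) (auto simp: norm_mult)
      then show ?thesis by simp
    qed
    have be: "cmod (bt * of_real \<epsilon>) \<le> Q * \<epsilon>"
      unfolding norm_mult norm_of_real using norm_bt \<epsilon> by (simp add: mult_right_mono)
    have gq: "cmod (?g * q) \<le> (Q * Q * norm b) * (3 * K2 Q * \<epsilon>\<^sup>2)"
      unfolding norm_mult norm_of_real using inner_\<gamma>_TB[of b] q Q1 by (intro mult_mono) auto
    show "cmod (bt * of_real \<epsilon> * (p + ?g * q)) \<le> (Q * \<epsilon>) * (3 * K4 Q * \<epsilon>\<^sup>2 * (Q * norm b) + (Q * Q * norm b) * (3 * K2 Q * \<epsilon>\<^sup>2))"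
      unfolding norm_mult[of "bt * _"] using Q1 \<epsilon> by (intro mult_mono be norm_triangle_le add_mono p gq) auto
    show "cmod (?N * R) \<le> (Q ^ 4 * \<epsilon>\<^sup>2) * (7 * (K1 Q * \<epsilon>) * norm b)"
      unfolding norm_mult[of ?N] R_def using Q1 by (intro mult_mono noise_bound cubic_bound) auto
  qed
  also have "\<dots> = (K5 Q * \<epsilon> ^ 3) * norm b"
    by (simp add: K5_def algebra_simps power2_eq_square power3_eq_cube)
  finally show ?thesis .
qed

lemma K5_nonneg: "0 \<le> K5 Q"
  using K_nonneg Q1 by (simp add: K5_def)

text \<open>The error of the forcing decays along the flow, so it can be integrated. The three
  factors \<open>Q\<close> are the decay constant, the bound for \<open>a\<close> and the inverse of
  the rate.\<close>

lemma mom_1_expansion: "cmod (mom (Suc 0) [a] - bt * of_real \<epsilon> * J) \<le> K5 Q * \<epsilon> ^ 3 * Q ^ 3"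
proof -
  let ?e = "\<lambda>t. exp (- \<i> * of_real (2 * \<kappa> * t))"
  let ?g = "\<lambda>cs. contract2 (\<lambda>b c. TB b \<bullet> TB c) (mom (Suc 0)) cs + noise_part 0 cs"
  have g: "?g [b] = noise_part 0 [b]" for b by simp
  have "((\<lambda>t. exp (- \<i> * of_real (2 * real (Suc 0) * \<kappa> * t)) * ?g (map (Ev A t) [a])) has_integral mom (Suc 0) [a]) {0..}"
  proof (rule transport_integral(1)[OF moment_multilinear[OF adm_w_power] _ _ _ QE mom_equation])
    show "(0::nat) < 1" "length [a] = 1" "0 < 1 / Q" using Q1 by auto
    show "cmod (mom (Suc 0) cs) \<le> Q * nprod cs" if "length cs = 1" for cs
      by (rule mom_bound) (use that in simp)
    show "cmod (?g cs) \<le> (est Q (4 * Q) * \<epsilon>) * nprod cs" if len: "length cs = 1" for cs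
    proof -
      obtain b where cs: "cs = [b]" using len by (auto simp: length_Suc_conv)
      show ?thesis unfolding cs g by (rule noise_part_trivial) auto
    qed
  qed
  then have I: "((\<lambda>t. ?e t * noise_part 0 [Ev A t a]) has_integral mom (Suc 0) [a]) {0..}"
    unfolding list.map g by simp
  have "((\<lambda>t. ?e t * noise_part 0 [Ev A t a] - (bt * of_real \<epsilon>) * (?e t * of_real (ua \<bullet> Ev A t a)))
     has_integral mom (Suc 0) [a] - (bt * of_real \<epsilon>) * J) {0..}"
    by (intro has_integral_diff I has_integral_mult_right J_integral)
  moreover have "?e t * noise_part 0 [Ev A t a] - (bt * of_real \<epsilon>) * (?e t * of_real (ua \<bullet> Ev A t a))
    = ?e t * (noise_part 0 [Ev A t a] - bt * of_real \<epsilon> * of_real (ua \<bullet> Ev A t a))" for t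
    by (simp only: right_diff_distrib mult_ac)
  ultimately have D: "((\<lambda>t. ?e t * (noise_part 0 [Ev A t a] - bt * of_real \<epsilon> * of_real (ua \<bullet> Ev A t a)))
     has_integral mom (Suc 0) [a] - (bt * of_real \<epsilon>) * J) {0..}" by (simp only:)
  let ?c = "K5 Q * \<epsilon> ^ 3 * (Q * norm a)"
  have Q0: "0 < 1 / Q" using Q1 by simp
  have h: "((\<lambda>t. ?c * exp (- (1 / Q) * t)) has_integral ?c * (exp (- (1 / Q) * 0) / (1 / Q))) {0..}"
    by (intro has_integral_mult_right has_integral_exp_minus_to_infinity Q0)
  have "cmod (mom (Suc 0) [a] - (bt * of_real \<epsilon>) * J) \<le> ?c * (exp (- (1 / Q) * 0) / (1 / Q))"
    unfolding integral_unique[OF D, symmetric] integral_unique[OF h, symmetric]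
  proof (rule integral_norm_bound_integral)
    show "(\<lambda>t. ?e t * (noise_part 0 [Ev A t a] - bt * of_real \<epsilon> * of_real (ua \<bullet> Ev A t a))) integrable_on {0..}"
      using D by blast
    show "(\<lambda>t. ?c * exp (- (1 / Q) * t)) integrable_on {0..}" using h by blast
    fix t :: real assume "t \<in> {0..}"
    then have t: "0 \<le> t" by simp
    have "cmod (noise_part 0 [Ev A t a] - bt * of_real \<epsilon> * of_real (ua \<bullet> Ev A t a)) \<le> (K5 Q * \<epsilon> ^ 3) * (Q * exp (- (1 / Q) * t) * norm a)"
      by (intro order.trans[OF noise_part_0] mult_left_mono QE t mult_nonneg_nonneg K5_nonneg zero_le_power \<epsilon>(1))
    then show "cmod (?e t * (noise_part 0 [Ev A t a] - bt * of_real \<epsilon> * of_real (ua \<bullet> Ev A t a))) \<le> ?c * exp (- (1 / Q) * t)"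
      unfolding norm_mult[of "?e t"] norm_exp_i by (simp only: mult_ac mult_1_left)
  qed
  also have "\<dots> = K5 Q * \<epsilon> ^ 3 * (Q * norm a * Q)" by simp
  also have "\<dots> \<le> K5 Q * \<epsilon> ^ 3 * (Q * Q * Q)"
    using K5_nonneg \<epsilon> Q1 Qa by (intro mult_left_mono mult_right_mono) auto
  finally show ?thesis by (simp only: power3_eq_cube)
qed

text \<open>The averaged drift of the logarithm contains \<open>- bt \<epsilon>\<close> times the
  moment of \<open>w\<close> with \<open>a\<close>, whose leading part is again proportional to
  \<open>bt \<epsilon>\<close>. Since \<open>bt^2 = - 1 / (4 \<kappa>^2)\<close>, this term and the
  Ito correction both acquire the factor \<open>1 / (4 \<kappa>^2)\<close>, which is
  \<open>1 / \<omega>^2\<close> at \<open>\<omega> = 2 \<kappa>\<close>; taking real parts turns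
  \<open>J\<close> into the cosine transform.\<close>

lemma lyapunov_expansion:
  assumes L: "is_lyapunov_exponent M F W A B a \<gamma> \<kappa>0 \<zeta> \<epsilon> L"
    and \<kappa>0: "\<kappa>0\<^sup>2 = \<kappa>\<^sup>2 + \<zeta>\<^sup>2" and \<zeta>: "0 < \<zeta>"
  shows "\<bar>L + \<zeta> - \<epsilon>\<^sup>2 * lambda2 A B a \<gamma> (2 * \<kappa>)\<bar> \<le> K6 Q * \<epsilon> ^ 4"
proof -
  let ?N = "bt\<^sup>2 * complex_of_real (\<epsilon>\<^sup>2 * (norm \<gamma>)\<^sup>2)"
  \<comment> \<open>Errors of the two moments that enter: \<open>d1\<close> is of order \<epsilon>^3
    and gets multiplied by \<epsilon>, \<open>d2\<close> is of order \<epsilon>^2 and gets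
    multiplied by \<epsilon>^2.\<close>
  define d1 d2 where "d1 = mom (Suc 0) [a] - bt * of_real \<epsilon> * J" and "d2 = mom (Suc 1) [] - 2 * mom (Suc 0) []"
  let ?X = "\<lambda>t z. bt * \<epsilon> * lin a t z * (1 - w t z) - ?N * (1 - w t z)\<^sup>2 / 2"
  have X: "?X = (\<lambda>t z. (bt * of_real \<epsilon>) * ((w t z ^ 0) * lin a t z) - (bt * of_real \<epsilon>) * (w t z ^ Suc 0 * lin a t z)
     - (?N / 2) * (w t z ^ 0 * (1 - w t z)\<^sup>2))"
    by (intro ext) (simp add: algebra_simps)
  have adms: "adm (\<lambda>t z. w t z ^ 0 * (1 - w t z)\<^sup>2)" by (intro adm_intros adm_w)
  have admX: "adm ?X" unfolding X by (intro adm_diff adm_mult adm_const adm_w_power adm_lin adms)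
  have "mean ?X = (bt * of_real \<epsilon>) * mom 0 [a] - (bt * of_real \<epsilon>) * mom (Suc 0) [a] - (?N / 2) * smom 0 []"
    unfolding X moment_Cons moment_Nil
    by (simp only: mean_diff mean_cmult adm_diff adm_mult adm_const adm_w_power adm_lin adms)
  also have "\<dots> = - (bt * of_real \<epsilon>) * mom (Suc 0) [a] - (?N / 2) * (1 + d2)"
    unfolding mom_0_1 smom mom_0_Nil d2_def One_nat_def by (simp add: algebra_simps)
  also have "\<dots> = (- (bt\<^sup>2 * (of_real (\<epsilon>\<^sup>2) * J)) - ?N / 2) + (- (bt * of_real \<epsilon>) * d1 - ?N / 2 * d2)"
    unfolding d1_def by (simp add: algebra_simps power2_eq_square)
  finally have mX: "mean ?X = (- (bt\<^sup>2 * (of_real (\<epsilon>\<^sup>2) * J)) - ?N / 2) + (- (bt * of_real \<epsilon>) * d1 - ?N / 2 * d2)" .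
  have "complex_of_real (L + \<zeta>) = of_real (Re (mean ?X))"
    using mean_lnphase[OF L \<kappa>0 \<zeta>] unfolding mean_Re[OF admX] by (rule sym)
  then have "L + \<zeta> = Re (mean ?X)" by (simp only: of_real_eq_iff)
  then have LX: "L + \<zeta> = Re (- (bt\<^sup>2 * (of_real (\<epsilon>\<^sup>2) * J)) - ?N / 2) + Re (- (bt * of_real \<epsilon>) * d1 - ?N / 2 * d2)"
    unfolding mX by (simp only: plus_complex.sel)
  have "Re (- (bt\<^sup>2 * (of_real (\<epsilon>\<^sup>2) * J)) - ?N / 2) = 1 / (4 * \<kappa>\<^sup>2) * (\<epsilon>\<^sup>2 * Re J) + 1 / (4 * \<kappa>\<^sup>2) * (\<epsilon>\<^sup>2 * (norm \<gamma>)\<^sup>2) / 2"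
    unfolding beta_square by simp
  also have "\<dots> = \<epsilon>\<^sup>2 * lambda2 A B a \<gamma> (2 * \<kappa>)"
    unfolding Re_J lambda2_def matrix_vector_right_distrib inner_add_right using \<kappa>_pos
    by (simp add: field_simps power2_eq_square)
  finally have main: "Re (- (bt\<^sup>2 * (of_real (\<epsilon>\<^sup>2) * J)) - ?N / 2) = \<epsilon>\<^sup>2 * lambda2 A B a \<gamma> (2 * \<kappa>)" .
  have "\<bar>L + \<zeta> - \<epsilon>\<^sup>2 * lambda2 A B a \<gamma> (2 * \<kappa>)\<bar> \<le> cmod (- (bt * of_real \<epsilon>) * d1 - ?N / 2 * d2)"
    unfolding LX main using abs_Re_le_cmod[of "- (bt * of_real \<epsilon>) * d1 - ?N / 2 * d2"] by simp
  also have "\<dots> \<le> (Q * \<epsilon>) * (K5 Q * \<epsilon> ^ 3 * Q ^ 3) + (Q ^ 4 * \<epsilon>\<^sup>2 / 2) * (3 * K2 Q * \<epsilon>\<^sup>2)"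
  proof (rule order.trans[OF norm_triangle_ineq4 add_mono])
    have be: "cmod (- (bt * of_real \<epsilon>)) \<le> Q * \<epsilon>"
      unfolding norm_minus_cancel norm_mult norm_of_real using norm_bt \<epsilon> by (simp add: mult_right_mono)
    show "cmod (- (bt * of_real \<epsilon>) * d1) \<le> (Q * \<epsilon>) * (K5 Q * \<epsilon> ^ 3 * Q ^ 3)"
      unfolding norm_mult[of "- (bt * of_real \<epsilon>)"] using be mom_1_expansion Q1 \<epsilon>
      unfolding d1_def by (intro mult_mono) auto
    have q: "cmod d2 \<le> 3 * K2 Q * \<epsilon>\<^sup>2"
    proof -
      have "cmod d2 \<le> K2 Q * \<epsilon>\<^sup>2 + 2 * (K2 Q * \<epsilon>\<^sup>2)"
        unfolding d2_def using mom_2[of 1] mom_2[of 0]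
        by (intro order.trans[OF norm_triangle_ineq4 add_mono]) (auto simp: norm_mult)
      then show ?thesis by simp
    qed
    have "cmod (?N / 2) \<le> Q ^ 4 * \<epsilon>\<^sup>2 / 2"
      unfolding norm_divide using noise_bound by simp
    then show "cmod (?N / 2 * d2) \<le> (Q ^ 4 * \<epsilon>\<^sup>2 / 2) * (3 * K2 Q * \<epsilon>\<^sup>2)"
      unfolding norm_mult[of "?N / 2"] using q Q1 by (intro mult_mono) auto
  qed
  also have "\<dots> = K6 Q * \<epsilon> ^ 4"
    by (simp add: K6_def algebra_simps power_numeral_reduce)
  finally show ?thesis .
qed

end

theorem theorem5p1:
  fixes A :: "real^'d^'d" and B :: "real^'m^'d" and a :: "real^'d" and \<gamma> :: "real^'m"
  assumes "stable_matrix A" and "controllable A B"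
  shows
    "(\<forall>(M :: 'w measure) F W \<kappa> \<zeta>\<^sub>2 lam.
        brownian_motion M F W \<and> 0 < \<kappa> \<and> 0 < \<zeta>\<^sub>2 \<and> \<zeta>\<^sub>2 < \<kappa> \<and>
        (\<forall>\<epsilon>>0. is_lyapunov_exponent M F W A B a \<gamma> \<kappa> \<zeta>\<^sub>2 \<epsilon> (lam \<epsilon>)) \<longrightarrow>
        (\<lambda>\<epsilon>. lam \<epsilon> - (- \<zeta>\<^sub>2 + \<epsilon>\<^sup>2 * lambda2 A B a \<gamma> (2 * sqrt (\<kappa>\<^sup>2 - \<zeta>\<^sub>2\<^sup>2))))
          \<in> O[at_right 0](\<lambda>\<epsilon>. \<epsilon> ^ 4)) \<and>
     (\<forall>c\<^sub>1 c\<^sub>2 :: real. 0 < c\<^sub>1 \<and> c\<^sub>1 < c\<^sub>2 \<longrightarrow>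
        (\<exists>K. \<forall>(M :: 'w measure) F W \<kappa> \<zeta>\<^sub>2 \<epsilon> L.
           brownian_motion M F W \<and> 0 < \<kappa> \<and> 0 < \<zeta>\<^sub>2 \<and> \<zeta>\<^sub>2 < \<kappa> \<and>
           0 < \<epsilon> \<and> \<epsilon> \<le> 1 \<and> c\<^sub>1 \<le> sqrt (\<kappa>\<^sup>2 - \<zeta>\<^sub>2\<^sup>2) \<and> sqrt (\<kappa>\<^sup>2 - \<zeta>\<^sub>2\<^sup>2) \<le> c\<^sub>2 \<and>
           is_lyapunov_exponent M F W A B a \<gamma> \<kappa> \<zeta>\<^sub>2 \<epsilon> L \<longrightarrow>
           \<bar>L + \<zeta>\<^sub>2 - \<epsilon>\<^sup>2 * lambda2 A B a \<gamma> (2 * sqrt (\<kappa>\<^sup>2 - \<zeta>\<^sub>2\<^sup>2))\<bar> \<le> K * \<epsilon> ^ 4))"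
proof (intro conjI)
  \<comment> \<open>Both claims are instances: the first with the fixed damped frequency as
    \<open>c\<close>, the second with the lower end of the interval. The constant is chosen before
    the probability space and before \<kappa>, \<zeta> and \<epsilon>.\<close>
  have key: "\<exists>K. \<forall>(M :: 'w measure) F W \<kappa> \<zeta> \<epsilon> L.
      brownian_motion M F W \<and> 0 < \<kappa> \<and> 0 < \<zeta> \<and> \<zeta> < \<kappa> \<and> 0 < \<epsilon> \<and> \<epsilon> \<le> 1 \<and> c \<le> sqrt (\<kappa>\<^sup>2 - \<zeta>\<^sup>2) \<and>
      is_lyapunov_exponent M F W A B a \<gamma> \<kappa> \<zeta> \<epsilon> L \<longrightarrow>
      \<bar>L + \<zeta> - \<epsilon>\<^sup>2 * lambda2 A B a \<gamma> (2 * sqrt (\<kappa>\<^sup>2 - \<zeta>\<^sup>2))\<bar> \<le> K * \<epsilon> ^ 4" if c: "0 < c" for c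
  proof -
    obtain C \<delta> where C: "C > 0" "\<delta> > 0"
      "\<And>t x. t \<ge> 0 \<Longrightarrow> norm (mat_exp (t *\<^sub>R A) *v x) \<le> C * exp (- \<delta> * t) * norm x"
      "\<And>t x. t \<ge> 0 \<Longrightarrow> norm (transpose (mat_exp (t *\<^sub>R A)) *v x) \<le> C * exp (- \<delta> * t) * norm x"
      using stable_decay_mv[OF assms(1)] by metis
    obtain KB where KB: "KB \<ge> 0" "\<And>x. norm (transpose B *v x) \<le> norm x * KB"
      using bounded_linear.nonneg_bounded[OF matrix_vector_mul_bounded_linear[of "transpose B"]] by blast
    obtain V where V0: "0 \<le> V" and V: "\<forall>(M::'w measure) F W a \<gamma> \<kappa> \<epsilon> v y r t. oscillator M F W A B a \<gamma> \<kappa> \<epsilon> v y r \<longrightarrow> 0 \<le> t \<longrightarrow>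
      (\<integral>\<^sup>+z. ennreal (norm (v t z)) ^ (2 ^ Suc 1) \<partial>M) \<le> ennreal V"
      using v_moment_uniform[OF assms(1), of B 1] by blast
    \<comment> \<open>A sum of nonnegative terms, so that it dominates each of them:
      \<open>1 + V\<close> serves the fourth moment of \<open>v\<close>, \<open>1 / \<delta>\<close>
      gives \<open>1 / Q \<le> \<delta>\<close> for the rate, and \<open>1 / (2 c)\<close> bounds
      \<open>bt\<close>.\<close>
    define Q where "Q = 1 + V + C + 1 / \<delta> + KB + norm a + norm \<gamma> + 1 / (2 * c)"
    have pos: "0 \<le> 1 / \<delta>" "0 \<le> 1 / (2 * c)" using C c by auto
    note all = V0 C(1) pos KB(1) norm_ge_zero[of a] norm_ge_zero[of \<gamma>]
    have Qs: "1 \<le> Q" "V \<le> Q - 1" "C \<le> Q" "1 / \<delta> \<le> Q" "KB \<le> Q" "norm a \<le> Q" "norm \<gamma> \<le> Q" "1 / (2 * c) \<le> Q"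
      using all unfolding Q_def by linarith+
    show ?thesis
    proof (intro exI[of _ "K6 Q"] allI impI, elim conjE)
      fix M :: "'w measure" and F W \<kappa> \<zeta> \<epsilon> L
      assume bm: "brownian_motion M F W" and \<kappa>: "0 < \<kappa>" and \<zeta>: "0 < \<zeta>" "\<zeta> < \<kappa>" and \<epsilon>: "0 < \<epsilon>" "\<epsilon> \<le> 1"
        and cs: "c \<le> sqrt (\<kappa>\<^sup>2 - \<zeta>\<^sup>2)" and L: "is_lyapunov_exponent M F W A B a \<gamma> \<kappa> \<zeta> \<epsilon> L"
      \<comment> \<open>The frequency of the undamped oscillator that is solved explicitly; the
        damping returns through the factor \<open>exp (- \<zeta> t)\<close>.\<close>
      define k where "k = sqrt (\<kappa>\<^sup>2 - \<zeta>\<^sup>2)"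
      have "\<zeta>\<^sup>2 \<le> \<kappa>\<^sup>2" using \<zeta> by (intro power_mono) auto
      then have k2: "\<kappa>\<^sup>2 = k\<^sup>2 + \<zeta>\<^sup>2" by (simp add: k_def)
      have ck: "c \<le> k" and k0: "0 < k" using cs c unfolding k_def by linarith+
      interpret brownian M F W using bm by unfold_locales
      obtain v y r where osc: "oscillator M F W A B a \<gamma> k \<epsilon> v y r"
        using exists_oscillator[OF k0] by blast
      interpret oscillator M F W A B a \<gamma> k \<epsilon> v y r by fact
      interpret bounded_oscillator M F W A B a \<gamma> k \<epsilon> v y r Q
      proof unfold_locales
        show "stable_matrix A" by (rule assms(1))
        show "norm (transpose B *v b) \<le> Q * norm b" for b
          using KB(2)[of b] mult_left_mono[OF Qs(5) norm_ge_zero[of b]] by (simp add: mult.commute)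
        show "norm (Ev A t b) \<le> Q * exp (- (1 / Q) * t) * norm b" if t: "0 \<le> t" for t b
        proof -
          have "1 \<le> Q * \<delta>" using Qs(4) C(2) by (simp add: pos_divide_le_eq)
          then have "1 / Q \<le> \<delta>" using Qs(1) by (simp add: pos_divide_le_eq mult.commute)
          then have "(1 / Q) * t \<le> \<delta> * t" using t by (rule mult_right_mono)
          then have "C * exp (- \<delta> * t) \<le> Q * exp (- (1 / Q) * t)"
            using Qs(1,3) by (intro mult_mono) auto
          then have "C * exp (- \<delta> * t) * norm b \<le> Q * exp (- (1 / Q) * t) * norm b"
            by (rule mult_right_mono) simp
          then show ?thesis unfolding Ev_def by (rule order.trans[OF C(4)[OF t]])
        qed
        have "1 / (2 * k) \<le> 1 / (2 * c)" using ck c by (intro frac_le) auto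
        then show "1 / (2 * k) \<le> Q" using Qs(8) by linarith
        show "(\<integral>\<^sup>+z. ennreal (norm (v t z)) ^ 4 \<partial>M) \<le> ennreal (Q - 1)" if t: "0 \<le> t" for t
        proof -
          have "(\<integral>\<^sup>+z. ennreal (norm (v t z)) ^ (2 ^ Suc 1) \<partial>M) \<le> ennreal V"
            using V osc t by blast
          then have "(\<integral>\<^sup>+z. ennreal (norm (v t z)) ^ 4 \<partial>M) \<le> ennreal V" by simp
          also have "\<dots> \<le> ennreal (Q - 1)" by (rule ennreal_leI[OF Qs(2)])
          finally show ?thesis .
        qed
      qed (use Qs \<epsilon> in auto)
      show "\<bar>L + \<zeta> - \<epsilon>\<^sup>2 * lambda2 A B a \<gamma> (2 * sqrt (\<kappa>\<^sup>2 - \<zeta>\<^sup>2))\<bar> \<le> K6 Q * \<epsilon> ^ 4"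
        unfolding k_def[symmetric] by (rule lyapunov_expansion[OF L k2 \<zeta>(1)])
    qed
  qed
  show "\<forall>c\<^sub>1 c\<^sub>2 :: real. 0 < c\<^sub>1 \<and> c\<^sub>1 < c\<^sub>2 \<longrightarrow>
        (\<exists>K. \<forall>(M :: 'w measure) F W \<kappa> \<zeta>\<^sub>2 \<epsilon> L.
           brownian_motion M F W \<and> 0 < \<kappa> \<and> 0 < \<zeta>\<^sub>2 \<and> \<zeta>\<^sub>2 < \<kappa> \<and>
           0 < \<epsilon> \<and> \<epsilon> \<le> 1 \<and> c\<^sub>1 \<le> sqrt (\<kappa>\<^sup>2 - \<zeta>\<^sub>2\<^sup>2) \<and> sqrt (\<kappa>\<^sup>2 - \<zeta>\<^sub>2\<^sup>2) \<le> c\<^sub>2 \<and>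
           is_lyapunov_exponent M F W A B a \<gamma> \<kappa> \<zeta>\<^sub>2 \<epsilon> L \<longrightarrow>
           \<bar>L + \<zeta>\<^sub>2 - \<epsilon>\<^sup>2 * lambda2 A B a \<gamma> (2 * sqrt (\<kappa>\<^sup>2 - \<zeta>\<^sub>2\<^sup>2))\<bar> \<le> K * \<epsilon> ^ 4)"
  proof (intro allI impI, elim conjE)
    fix c1 c2 :: real assume "0 < c1"
    from key[OF this] obtain K where K: "\<And>(M :: 'w measure) F W \<kappa> \<zeta> \<epsilon> L.
      brownian_motion M F W \<and> 0 < \<kappa> \<and> 0 < \<zeta> \<and> \<zeta> < \<kappa> \<and> 0 < \<epsilon> \<and> \<epsilon> \<le> 1 \<and> c1 \<le> sqrt (\<kappa>\<^sup>2 - \<zeta>\<^sup>2) \<and>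
      is_lyapunov_exponent M F W A B a \<gamma> \<kappa> \<zeta> \<epsilon> L \<Longrightarrow>
      \<bar>L + \<zeta> - \<epsilon>\<^sup>2 * lambda2 A B a \<gamma> (2 * sqrt (\<kappa>\<^sup>2 - \<zeta>\<^sup>2))\<bar> \<le> K * \<epsilon> ^ 4" by blast
    show "\<exists>K. \<forall>(M :: 'w measure) F W \<kappa> \<zeta>\<^sub>2 \<epsilon> L.
           brownian_motion M F W \<and> 0 < \<kappa> \<and> 0 < \<zeta>\<^sub>2 \<and> \<zeta>\<^sub>2 < \<kappa> \<and>
           0 < \<epsilon> \<and> \<epsilon> \<le> 1 \<and> c1 \<le> sqrt (\<kappa>\<^sup>2 - \<zeta>\<^sub>2\<^sup>2) \<and> sqrt (\<kappa>\<^sup>2 - \<zeta>\<^sub>2\<^sup>2) \<le> c2 \<and>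
           is_lyapunov_exponent M F W A B a \<gamma> \<kappa> \<zeta>\<^sub>2 \<epsilon> L \<longrightarrow>
           \<bar>L + \<zeta>\<^sub>2 - \<epsilon>\<^sup>2 * lambda2 A B a \<gamma> (2 * sqrt (\<kappa>\<^sup>2 - \<zeta>\<^sub>2\<^sup>2))\<bar> \<le> K * \<epsilon> ^ 4"
      by (intro exI[of _ K] allI impI) (rule K, blast)
  qed
  show "\<forall>(M :: 'w measure) F W \<kappa> \<zeta>\<^sub>2 lam.
        brownian_motion M F W \<and> 0 < \<kappa> \<and> 0 < \<zeta>\<^sub>2 \<and> \<zeta>\<^sub>2 < \<kappa> \<and>
        (\<forall>\<epsilon>>0. is_lyapunov_exponent M F W A B a \<gamma> \<kappa> \<zeta>\<^sub>2 \<epsilon> (lam \<epsilon>)) \<longrightarrow>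
        (\<lambda>\<epsilon>. lam \<epsilon> - (- \<zeta>\<^sub>2 + \<epsilon>\<^sup>2 * lambda2 A B a \<gamma> (2 * sqrt (\<kappa>\<^sup>2 - \<zeta>\<^sub>2\<^sup>2))))
          \<in> O[at_right 0](\<lambda>\<epsilon>. \<epsilon> ^ 4)"
  proof (intro allI impI, elim conjE)
    fix M :: "'w measure" and F W \<kappa> \<zeta> lam
    assume bm: "brownian_motion M F W" and \<kappa>: "0 < \<kappa>" and \<zeta>: "0 < \<zeta>" "\<zeta> < \<kappa>"
      and L: "\<forall>\<epsilon>>0. is_lyapunov_exponent M F W A B a \<gamma> \<kappa> \<zeta> \<epsilon> (lam \<epsilon>)"
    let ?k = "sqrt (\<kappa>\<^sup>2 - \<zeta>\<^sup>2)"
    have "\<zeta>\<^sup>2 < \<kappa>\<^sup>2" using \<zeta> by (intro power_strict_mono) auto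
    then have "0 < ?k" by simp
    from key[OF this] obtain K where K: "\<And>\<epsilon> L. 0 < \<epsilon> \<Longrightarrow> \<epsilon> \<le> 1 \<Longrightarrow> is_lyapunov_exponent M F W A B a \<gamma> \<kappa> \<zeta> \<epsilon> L \<Longrightarrow>
      \<bar>L + \<zeta> - \<epsilon>\<^sup>2 * lambda2 A B a \<gamma> (2 * ?k)\<bar> \<le> K * \<epsilon> ^ 4"
      using bm \<kappa> \<zeta> by blast
    show "(\<lambda>\<epsilon>. lam \<epsilon> - (- \<zeta> + \<epsilon>\<^sup>2 * lambda2 A B a \<gamma> (2 * ?k))) \<in> O[at_right 0](\<lambda>\<epsilon>. \<epsilon> ^ 4)"
    proof (rule bigoI)
      have "eventually (\<lambda>\<epsilon>::real. \<epsilon> \<in> {0<..<1}) (at_right 0)"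
        by (rule eventually_at_right_real) simp
      then show "eventually (\<lambda>\<epsilon>. norm (lam \<epsilon> - (- \<zeta> + \<epsilon>\<^sup>2 * lambda2 A B a \<gamma> (2 * ?k))) \<le> K * norm (\<epsilon> ^ 4)) (at_right 0)"
      proof eventually_elim
        case (elim \<epsilon>)
        have "lam \<epsilon> - (- \<zeta> + \<epsilon>\<^sup>2 * lambda2 A B a \<gamma> (2 * ?k)) = lam \<epsilon> + \<zeta> - \<epsilon>\<^sup>2 * lambda2 A B a \<gamma> (2 * ?k)" by simp
        moreover have "norm (\<epsilon> ^ 4) = \<epsilon> ^ 4" using elim by simp
        ultimately show ?case using K[of \<epsilon> "lam \<epsilon>"] L elim by simp
      qed
    qed
  qed
qed

end
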